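(* Let $\Bbbk$ be a field of characteristic $0$, and let $A$ and $B$ be reduced equidimensional $\mathbb{Z}_{\ge0}$-graded Noetherian rings with $A_0=B_0=\Bbbk$. Assume that $\dim A,\dim B>0$ and that $R:=A\otimes_{\Bbbk}B$ is reduced. Then the following are equivalent: (1) $R$ is nearly regular; (2) $R$ is regular; (3) $A$ and $B$ are regular.
   Context: $R=A\otimes_\Bbbk B$ carries the total grading, so $R_0=\Bbbk$. For a Noetherian $\mathbb{Z}_{\ge0}$-graded ring $S$ with $S_0=\Bbbk$ a field, let $\mathfrak m_S=\bigoplus_{i>0}S_i$; for an $S$-module $M$, $\operatorname{tr}_S(M)=\sum_{f\in\operatorname{Hom}_S(M,S)}f(M)$; $\Omega^i_{S/\Bbbk}=\bigwedge^i_S\Omega^1_{S/\Bbbk}$. $S$ is called nearly regular if $\operatorname{tr}_S(\Omega^{\dim S}_{S/\Bbbk})\supseteq\mathfrak m_S$. Equidimensional means $\dim S/\mathfrak q=\dim S$ for every minimal prime $\mathfrak q$. *)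

theory Defs
  imports "HOL-Algebra.Module" "HOL-Algebra.QuotRing" "HOL-Algebra.Ring_Divisibility"
    "HOL-Algebra.Generated_Groups" "HOL-Library.Extended_Nat"
begin

section \<open>Commutative rings: dimension, localization, regularity\<close>

definition reduced_ring :: "('a, 'r) ring_scheme \<Rightarrow> bool" where
  "reduced_ring R \<longleftrightarrow>
     (\<forall>x \<in> carrier R. \<forall>n::nat. x [^]\<^bsub>R\<^esub> n = \<zero>\<^bsub>R\<^esub> \<longrightarrow> x = \<zero>\<^bsub>R\<^esub>)"

text \<open>The supremum of the lengths \<open>n\<close> of chains of primes \<open>P 0 \<subset> \<dots> \<subset> P n\<close>. The zero ring, which
  has no primes, gets dimension \<open>0\<close>; no such ring occurs below.\<close>

definition krull_dim :: "('a, 'r) ring_scheme \<Rightarrow> enat" where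
  "krull_dim R = Sup {enat n | n. \<exists>P :: nat \<Rightarrow> 'a set.
     (\<forall>i\<le>n. primeideal (P i) R) \<and> (\<forall>i<n. P i \<subset> P (Suc i))}"

definition minimal_prime :: "'a set \<Rightarrow> ('a, 'r) ring_scheme \<Rightarrow> bool" where
  "minimal_prime Q R \<longleftrightarrow>
     primeideal Q R \<and> (\<forall>P. primeideal P R \<and> P \<subseteq> Q \<longrightarrow> P = Q)"

definition equidimensional :: "('a, 'r) ring_scheme \<Rightarrow> bool" where
  "equidimensional R \<longleftrightarrow>
     (\<forall>Q. minimal_prime Q R \<longrightarrow> krull_dim (R Quot Q) = krull_dim R)"

text \<open>Localization at a prime \<open>P\<close>: elements are classes of pairs \<open>(a, s)\<close>, standing for \<open>a / s\<close>.
  As with \<^const>\<open>rcoset_mult\<close>, each operation is a union over all representatives, all of which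
  contribute the same class.\<close>

definition frac_rel :: "('a, 'r) ring_scheme \<Rightarrow> 'a set \<Rightarrow> (('a \<times> 'a) \<times> ('a \<times> 'a)) set" where
  "frac_rel R P = {((a, s), (b, t)) | a s b t.
     a \<in> carrier R \<and> b \<in> carrier R \<and> s \<in> carrier R - P \<and> t \<in> carrier R - P \<and>
     (\<exists>u \<in> carrier R - P. u \<otimes>\<^bsub>R\<^esub> (t \<otimes>\<^bsub>R\<^esub> a) = u \<otimes>\<^bsub>R\<^esub> (s \<otimes>\<^bsub>R\<^esub> b))}"

definition fraction :: "('a, 'r) ring_scheme \<Rightarrow> 'a set \<Rightarrow> 'a \<Rightarrow> 'a \<Rightarrow> ('a \<times> 'a) set" where
  "fraction R P a s = frac_rel R P `` {(a, s)}"

definition localization :: "('a, 'r) ring_scheme \<Rightarrow> 'a set \<Rightarrow> ('a \<times> 'a) set ring" where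
  "localization R P =
     \<lparr>carrier = (carrier R \<times> (carrier R - P)) // frac_rel R P,
      monoid.mult = (\<lambda>U V. \<Union>{fraction R P (a \<otimes>\<^bsub>R\<^esub> b) (s \<otimes>\<^bsub>R\<^esub> t) | a s b t. (a, s) \<in> U \<and> (b, t) \<in> V}),
      one = fraction R P \<one>\<^bsub>R\<^esub> \<one>\<^bsub>R\<^esub>,
      zero = fraction R P \<zero>\<^bsub>R\<^esub> \<one>\<^bsub>R\<^esub>,
      add = (\<lambda>U V. \<Union>{fraction R P (t \<otimes>\<^bsub>R\<^esub> a \<oplus>\<^bsub>R\<^esub> s \<otimes>\<^bsub>R\<^esub> b) (s \<otimes>\<^bsub>R\<^esub> t) | a s b t.
               (a, s) \<in> U \<and> (b, t) \<in> V})\<rparr>"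

text \<open>A Noetherian local ring is regular if its maximal ideal can be generated by \<open>dim R\<close> elements;
  a Noetherian ring is regular if its localizations at all primes are.\<close>

definition regular_local_ring :: "('a, 'r) ring_scheme \<Rightarrow> bool" where
  "regular_local_ring R \<longleftrightarrow> cring R \<and> noetherian_ring R \<and>
     (\<exists>m. {I. maximalideal I R} = {m} \<and>
        (\<exists>T \<subseteq> carrier R. finite T \<and> enat (card T) = krull_dim R \<and> m = Idl\<^bsub>R\<^esub> T))"

definition regular_ring :: "('a, 'r) ring_scheme \<Rightarrow> bool" where
  "regular_ring R \<longleftrightarrow> cring R \<and> noetherian_ring R \<and>
     (\<forall>P. primeideal P R \<longrightarrow> regular_local_ring (localization R P))"


section \<open>Free modules, quotient modules, trace ideals\<close>

text \<open>Modules are records that extend rings; the \<^const>\<open>monoid.mult\<close> and \<^const>\<open>one\<close> fields of a mere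
  module carry no meaning and are left \<^const>\<open>undefined\<close>.\<close>

definition submodule_span ::
  "('a, 'r) ring_scheme \<Rightarrow> ('a, 'b, 'm) module_scheme \<Rightarrow> 'b set \<Rightarrow> 'b set" where
  "submodule_span R M T = \<Inter>{N. submodule N R M \<and> T \<subseteq> N}"

definition quotient_module :: "('a, 'b, 'm) module_scheme \<Rightarrow> 'b set \<Rightarrow> ('a, 'b set) module" where
  "quotient_module M N =
     \<lparr>carrier = a_rcosets\<^bsub>M\<^esub> N, monoid.mult = undefined, one = undefined,
      zero = N, add = set_add M,
      smult = (\<lambda>c U. \<Union>x \<in> U. N +>\<^bsub>M\<^esub> (c \<odot>\<^bsub>M\<^esub> x))\<rparr>"

text \<open>The free module on a set \<open>I\<close>: finitely supported functions on \<open>I\<close>, extended by zero outside \<open>I\<close>.\<close>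

definition free_module :: "('a, 'r) ring_scheme \<Rightarrow> 'x set \<Rightarrow> ('a, 'x \<Rightarrow> 'a) module" where
  "free_module R I =
     \<lparr>carrier = {f. f \<in> I \<rightarrow> carrier R \<and> (\<forall>x. x \<notin> I \<longrightarrow> f x = \<zero>\<^bsub>R\<^esub>) \<and> finite {x. f x \<noteq> \<zero>\<^bsub>R\<^esub>}},
      monoid.mult = undefined, one = undefined,
      zero = (\<lambda>_. \<zero>\<^bsub>R\<^esub>),
      add = (\<lambda>f g x. f x \<oplus>\<^bsub>R\<^esub> g x),
      smult = (\<lambda>c f x. c \<otimes>\<^bsub>R\<^esub> f x)\<rparr>"

definition free_gen :: "('a, 'r) ring_scheme \<Rightarrow> 'x \<Rightarrow> 'x \<Rightarrow> 'a" where
  "free_gen R x = (\<lambda>y. if y = x then \<one>\<^bsub>R\<^esub> else \<zero>\<^bsub>R\<^esub>)"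

definition module_dual :: "('a, 'r) ring_scheme \<Rightarrow> ('a, 'b, 'm) module_scheme \<Rightarrow> ('b \<Rightarrow> 'a) set" where
  "module_dual S M = {f \<in> carrier M \<rightarrow> carrier S.
     (\<forall>x \<in> carrier M. \<forall>y \<in> carrier M. f (x \<oplus>\<^bsub>M\<^esub> y) = f x \<oplus>\<^bsub>S\<^esub> f y) \<and>
     (\<forall>s \<in> carrier S. \<forall>x \<in> carrier M. f (s \<odot>\<^bsub>M\<^esub> x) = s \<otimes>\<^bsub>S\<^esub> f x)}"

text \<open>The sum of the ideals \<open>f(M)\<close> is the smallest ideal that contains all of them.\<close>

definition trace_ideal :: "('a, 'r) ring_scheme \<Rightarrow> ('a, 'b, 'm) module_scheme \<Rightarrow> 'a set" where
  "trace_ideal S M = Idl\<^bsub>S\<^esub> (\<Union>f \<in> module_dual S M. f ` carrier M)"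


section \<open>Kaehler differentials and exterior powers\<close>

text \<open>\<open>\<Omega>\<^sup>1\<close> of a \<open>K\<close>-algebra \<open>S\<close>, by generators \<open>d s = free_gen S s\<close> for \<open>s \<in> S\<close> and the relations
  \<open>d (s + t) = d s + d t\<close>, \<open>d (s t) = s d t + t d s\<close> and \<open>d (c 1) = 0\<close> for \<open>c \<in> K\<close>.\<close>

definition kaehler_relations ::
  "('k, 'r) ring_scheme \<Rightarrow> ('k, 's, 'm) module_scheme \<Rightarrow> ('s \<Rightarrow> 's) set" where
  "kaehler_relations K S =
    (let F = free_module S (carrier S); d = free_gen S in
       {d (s \<oplus>\<^bsub>S\<^esub> t) \<ominus>\<^bsub>F\<^esub> (d s \<oplus>\<^bsub>F\<^esub> d t) | s t. s \<in> carrier S \<and> t \<in> carrier S}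
     \<union> {d (s \<otimes>\<^bsub>S\<^esub> t) \<ominus>\<^bsub>F\<^esub> ((s \<odot>\<^bsub>F\<^esub> d t) \<oplus>\<^bsub>F\<^esub> (t \<odot>\<^bsub>F\<^esub> d s)) | s t.
          s \<in> carrier S \<and> t \<in> carrier S}
     \<union> {d (c \<odot>\<^bsub>S\<^esub> \<one>\<^bsub>S\<^esub>) | c. c \<in> carrier K})"

definition kaehler ::
  "('k, 'r) ring_scheme \<Rightarrow> ('k, 's, 'm) module_scheme \<Rightarrow> ('s, ('s \<Rightarrow> 's) set) module" where
  "kaehler K S =
    (let F = free_module S (carrier S)
     in quotient_module F (submodule_span S F (kaehler_relations K S)))"

text \<open>The \<open>i\<close>-th exterior power, by generators \<open>x\<^sub>1 \<and> \<dots> \<and> x\<^sub>i\<close>, one for each list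
  \<open>[x\<^sub>1, \<dots>, x\<^sub>i]\<close> over \<open>M\<close>, and the multilinear and alternating relations.
  For \<open>i = 0\<close> this is free of rank one.\<close>

definition tuples :: "nat \<Rightarrow> ('a, 'b, 'm) module_scheme \<Rightarrow> 'b list set" where
  "tuples i M = {xs. length xs = i \<and> set xs \<subseteq> carrier M}"

definition exterior_relations ::
  "('a, 'r) ring_scheme \<Rightarrow> nat \<Rightarrow> ('a, 'b, 'm) module_scheme \<Rightarrow> ('b list \<Rightarrow> 'a) set" where
  "exterior_relations S i M =
    (let F = free_module S (tuples i M); e = free_gen S in
       {e (xs[j := x \<oplus>\<^bsub>M\<^esub> y]) \<ominus>\<^bsub>F\<^esub> (e (xs[j := x]) \<oplus>\<^bsub>F\<^esub> e (xs[j := y])) | xs j x y.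
          xs \<in> tuples i M \<and> j < i \<and> x \<in> carrier M \<and> y \<in> carrier M}
     \<union> {e (xs[j := s \<odot>\<^bsub>M\<^esub> x]) \<ominus>\<^bsub>F\<^esub> (s \<odot>\<^bsub>F\<^esub> e (xs[j := x])) | xs j s x.
          xs \<in> tuples i M \<and> j < i \<and> s \<in> carrier S \<and> x \<in> carrier M}
     \<union> {e xs | xs j l. xs \<in> tuples i M \<and> j < l \<and> l < i \<and> xs ! j = xs ! l})"

definition exterior_power ::
  "('a, 'r) ring_scheme \<Rightarrow> nat \<Rightarrow> ('a, 'b, 'm) module_scheme \<Rightarrow> ('a, ('b list \<Rightarrow> 'a) set) module" where
  "exterior_power S i M =
    (let F = free_module S (tuples i M)
     in quotient_module F (submodule_span S F (exterior_relations S i M)))"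


section \<open>Graded algebras and near regularity\<close>

text \<open>A nonnegatively graded commutative ring \<open>S\<close> with components \<open>G i\<close> and \<open>G 0 = K\<close>: the
  identification of \<open>K\<close> with \<open>G 0\<close> is the structure map of \<open>S\<close> as a \<open>K\<close>-algebra.\<close>

locale connected_graded_algebra = algebra K S for K and S (structure) +
  fixes G :: "nat \<Rightarrow> 'c set"
  assumes component_subgroup: "\<And>i. additive_subgroup (G i) S"
    and component_mult: "\<And>i j x y. \<lbrakk>x \<in> G i; y \<in> G j\<rbrakk> \<Longrightarrow> x \<otimes> y \<in> G (i + j)"
    and component_decomp: "\<And>x. x \<in> carrier S \<Longrightarrow>
          \<exists>!f. (\<forall>i. f i \<in> G i) \<and> finite {i. f i \<noteq> \<zero>} \<and> x = (\<Oplus>i \<in> {i. f i \<noteq> \<zero>}. f i)"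
    and component_zero: "bij_betw (\<lambda>c. c \<odot> \<one>) (carrier K) (G 0)"

definition irrelevant_ideal :: "('a, 'r) ring_scheme \<Rightarrow> (nat \<Rightarrow> 'a set) \<Rightarrow> 'a set" where
  "irrelevant_ideal S G = generate (add_monoid S) (\<Union>i \<in> {0<..}. G i)"

text \<open>Only for \<open>S\<close> of finite Krull dimension, such as Noetherian connected graded algebras.\<close>

definition nearly_regular ::
  "('k, 'r) ring_scheme \<Rightarrow> ('k, 's, 'm) module_scheme \<Rightarrow> (nat \<Rightarrow> 's set) \<Rightarrow> bool" where
  "nearly_regular K S G \<longleftrightarrow>
     irrelevant_ideal S G \<subseteq>
       trace_ideal S (exterior_power S (the_enat (krull_dim S)) (kaehler K S))"


section \<open>Tensor products of algebras\<close>

text \<open>\<open>A \<otimes>\<^sub>K B\<close> is the free \<open>K\<close>-module on pairs modulo the bilinear relations. Its product is induced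
  by the product on the free module that extends \<open>(a, b) (a', b') = (a a', b b')\<close> bilinearly.\<close>

definition tensor_free ::
  "('k, 'r) ring_scheme \<Rightarrow> ('k, 'a, 'm) module_scheme \<Rightarrow> ('k, 'b, 'n) module_scheme
     \<Rightarrow> ('k, 'a \<times> 'b \<Rightarrow> 'k) module" where
  "tensor_free K A B = (free_module K (carrier A \<times> carrier B))
     \<lparr>monoid.mult := (\<lambda>f g z. \<Oplus>\<^bsub>K\<^esub>pq \<in> {(p, q). f p \<noteq> \<zero>\<^bsub>K\<^esub> \<and> g q \<noteq> \<zero>\<^bsub>K\<^esub> \<and>
                   z = (fst p \<otimes>\<^bsub>A\<^esub> fst q, snd p \<otimes>\<^bsub>B\<^esub> snd q)}. f (fst pq) \<otimes>\<^bsub>K\<^esub> g (snd pq)),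
      one := free_gen K (\<one>\<^bsub>A\<^esub>, \<one>\<^bsub>B\<^esub>)\<rparr>"

definition tensor_relations ::
  "('k, 'r) ring_scheme \<Rightarrow> ('k, 'a, 'm) module_scheme \<Rightarrow> ('k, 'b, 'n) module_scheme
     \<Rightarrow> ('a \<times> 'b \<Rightarrow> 'k) set" where
  "tensor_relations K A B =
    (let F = tensor_free K A B; e = (\<lambda>a b. free_gen K (a, b)) in
       {e (a \<oplus>\<^bsub>A\<^esub> a') b \<ominus>\<^bsub>F\<^esub> (e a b \<oplus>\<^bsub>F\<^esub> e a' b) | a a' b.
          a \<in> carrier A \<and> a' \<in> carrier A \<and> b \<in> carrier B}
     \<union> {e a (b \<oplus>\<^bsub>B\<^esub> b') \<ominus>\<^bsub>F\<^esub> (e a b \<oplus>\<^bsub>F\<^esub> e a b') | a b b'.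
          a \<in> carrier A \<and> b \<in> carrier B \<and> b' \<in> carrier B}
     \<union> {e (c \<odot>\<^bsub>A\<^esub> a) b \<ominus>\<^bsub>F\<^esub> (c \<odot>\<^bsub>F\<^esub> e a b) | c a b.
          c \<in> carrier K \<and> a \<in> carrier A \<and> b \<in> carrier B}
     \<union> {e a (c \<odot>\<^bsub>B\<^esub> b) \<ominus>\<^bsub>F\<^esub> (c \<odot>\<^bsub>F\<^esub> e a b) | c a b.
          c \<in> carrier K \<and> a \<in> carrier A \<and> b \<in> carrier B})"

definition tensor_null ::
  "('k, 'r) ring_scheme \<Rightarrow> ('k, 'a, 'm) module_scheme \<Rightarrow> ('k, 'b, 'n) module_scheme
     \<Rightarrow> ('a \<times> 'b \<Rightarrow> 'k) set" where
  "tensor_null K A B = submodule_span K (tensor_free K A B) (tensor_relations K A B)"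

definition pure_tensor ::
  "('k, 'r) ring_scheme \<Rightarrow> ('k, 'a, 'm) module_scheme \<Rightarrow> ('k, 'b, 'n) module_scheme
     \<Rightarrow> 'a \<Rightarrow> 'b \<Rightarrow> ('a \<times> 'b \<Rightarrow> 'k) set" where
  "pure_tensor K A B a b = tensor_null K A B +>\<^bsub>tensor_free K A B\<^esub> free_gen K (a, b)"

definition tensor_algebra ::
  "('k, 'r) ring_scheme \<Rightarrow> ('k, 'a, 'm) module_scheme \<Rightarrow> ('k, 'b, 'n) module_scheme
     \<Rightarrow> ('k, ('a \<times> 'b \<Rightarrow> 'k) set) module" where
  "tensor_algebra K A B = (quotient_module (tensor_free K A B) (tensor_null K A B))
     \<lparr>monoid.mult := rcoset_mult (tensor_free K A B) (tensor_null K A B),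
      one := pure_tensor K A B \<one>\<^bsub>A\<^esub> \<one>\<^bsub>B\<^esub>\<rparr>"

text \<open>The total grading: degree \<open>n\<close> is the sum of all \<open>A\<^sub>i \<otimes> B\<^sub>j\<close> with \<open>i + j = n\<close>.\<close>

definition total_grading ::
  "('k, 'r) ring_scheme \<Rightarrow> ('k, 'a, 'm) module_scheme \<Rightarrow> (nat \<Rightarrow> 'a set)
     \<Rightarrow> ('k, 'b, 'n) module_scheme \<Rightarrow> (nat \<Rightarrow> 'b set) \<Rightarrow> nat \<Rightarrow> ('a \<times> 'b \<Rightarrow> 'k) set set" where
  "total_grading K A GA B GB n = submodule_span K (tensor_algebra K A B)
     {pure_tensor K A B a b | a b i j. a \<in> GA i \<and> b \<in> GB j \<and> i + j = n}"

end

theory Submission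
  imports Defs "HOL-Algebra.Subrings" "HOL-Algebra.Ring_Divisibility" "HOL-Combinatorics.Permutations"
begin

text \<open>Call an algebra \<open>polynomial\<close> if it has algebraically independent generators. All three conditions turn out to
  be equivalent to \<open>A\<close> and \<open>B\<close> being polynomial. Polynomial algebras are regular, and so is their tensor
  product, which has dual derivations \<open>\<partial>\<^sub>1, \<dots>, \<partial>\<^sub>d\<close> whose determinant form has the value \<open>1\<close>. Conversely, if the
  localization at the irrelevant maximal ideal \<open>m\<close> is regular, then homogeneous generators that form a basis of
  \<open>m / m\<^sup>2\<close> are algebraically independent.

  If \<open>R\<close> is nearly regular and \<open>0 \<noteq> y \<in> B\<close> has positive degree, then \<open>1 \<otimes> y\<close> lies in the trace ideal but not in
  the kernel of \<open>R \<rightarrow> B\<close>. Hence there are a form \<open>f\<close> on \<open>\<Omega>\<^sup>d\<close>, where \<open>d = dim R\<close>, and elements \<open>r\<^sub>i\<close>, each homogeneous in \<open>A\<close>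
  or in \<open>B\<close>, such that \<open>g = f (d r\<^sub>1 \<and> \<dots> \<and> d r\<^sub>d)\<close> does not vanish in \<open>B\<close>. In characteristic \<open>0\<close> the \<open>r\<^sub>i\<close> are
  algebraically independent, and there is no room for a further independent element. Comparing with the Euler
  derivation of \<open>A\<close> shows that the \<open>r\<^sub>i\<close> in \<open>A\<close> generate \<open>A\<close>. By symmetry \<open>B\<close> is polynomial as well.\<close>

section \<open>Algebraic independence over subrings\<close>

text \<open>Polynomial rings, fraction fields and transcendence bases never occur as objects.
  Polynomials are coefficient lists evaluated inside the ring, and independence is tested modulo an
  ideal, so that one notion serves primes as well as annihilators. A prime chain of length
  \<open>n\<close> yields \<open>n\<close> elements independent modulo its bottom prime, and
  independent elements yield a chain; for finitely generated algebras the Krull dimension is thus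
  the maximal length of an independent list, with no normalization theorem.

  The obstacle is that \<open>R\<close> need not be a domain: \<open>g\<close> may vanish on some
  components and cannot be cancelled. Independence is therefore shown modulo the annihilator of
  \<open>g\<close>, and reducedness turns \<open>g g f = 0\<close> into \<open>g f = 0\<close>. That
  \<open>g\<close> survives in \<open>B\<close> gives control over degrees: a functional on
  \<open>B\<close> normalised at the image of \<open>g g\<close> turns an identity in
  \<open>R\<close> into one in \<open>A\<close> in which the interesting term is multiplied by an
  element with constant term \<open>1\<close>.\<close>

abbreviation (in ring) RR where "RR == carrier R"

abbreviation (in ring) mul (infixl "**" 70) where "x ** y == x \<otimes> y"

context ring
begin

text \<open>Adjoining a list proceeds from right to left: the head is adjoined last. Independence of a list modulo \<open>I\<close>
  demands that the coefficients vanish in \<open>R\<close>, not just modulo \<open>I\<close>; it is used only if \<open>D\<close> meets \<open>I\<close> in \<open>0\<close>.\<close>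

primrec pev :: "'a => 'a list => 'a" where
	"pev x [] = \<zero>"
| "pev x (d # ds) = d \<oplus> x ** pev x ds"

definition adj :: "'a set => 'a => 'a set" where
	"adj D x = {pev x ds | ds. set ds <= D}"

definition adjs :: "'a set => 'a list => 'a set" where
	"adjs D xs = foldr (%x E. adj E x) xs D"

definition transc :: "'a set => 'a set => 'a => bool" where
	"transc D I x \<longleftrightarrow> (ALL ds. set ds <= D & pev x ds : I --> set ds <= {\<zero>})"

primrec indep :: "'a set => 'a set => 'a list => bool" where
	"indep D I [] \<longleftrightarrow> True"
| "indep D I (x # xs) \<longleftrightarrow> indep D I xs & transc (adjs D xs) I x"

fun comb :: "'a list => 'a list => 'a" where
	"comb (c # cs) (v # vs) = c ** v \<oplus> comb cs vs"
| "comb _ _ = \<zero>"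

definition lin :: "'a set => 'a list => 'a set" where
	"lin D vs = {comb cs vs | cs. length cs = length vs & set cs <= D}"

text \<open>Subrings, ideals, spans and contracted ideals are all handled as
  \<open>D\<close>-modules inside the ring. Closure under negation is not part of the definition:
  for a subring \<open>D\<close> it follows from the scalar \<open>\<ominus> \<one>\<close>.\<close>

definition dmod :: "'a set => 'a set => bool" where
	"dmod D P \<longleftrightarrow> P <= RR & \<zero> : P & (ALL x:P. ALL y:P. x \<oplus> y : P) & (ALL d:D. ALL x:P. d ** x : P)"

lemma dmodD:
	assumes "dmod D P"
	shows "P <= RR" "\<zero> : P" "x : P ==> y : P ==> x \<oplus> y : P" "d : D ==> x : P ==> d ** x : P"
	using assms by (auto simp: dmod_def)

lemma dmod_uminus:
	assumes "dmod D P" "subring D R" "x : P"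
	shows "\<ominus> x : P"
proof -
	have "\<ominus> \<one> ** x : P" using assms dmodD(4)[OF assms(1)] subringE(3,5) by metis
	thus ?thesis using assms dmodD(1)[OF assms(1)] by (simp add: l_minus subset_iff)
qed

lemma ideal_dmod: "ideal I R ==> D <= RR ==> dmod D I"
	unfolding dmod_def
	by (auto simp: ideal.I_l_closed ideal.Icarr additive_subgroup.zero_closed additive_subgroup.a_closed ideal.axioms(1) subset_iff)

lemma adjs_Nil [simp]: "adjs D [] = D"
	and adjs_Cons [simp]: "adjs D (x # xs) = adj (adjs D xs) x"
	by (auto simp: adjs_def)

lemma adjs_append: "adjs D (xs @ ys) = adjs (adjs D ys) xs"
	by (simp add: adjs_def)

lemma indep_append: "indep D I (xs @ ys) \<longleftrightarrow> indep D I ys & indep (adjs D ys) I xs"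
	by (induction xs) (auto simp: adjs_append)

lemma pev_closed [simp, intro]: "x : RR ==> set ds <= RR ==> pev x ds : RR"
	by (induction ds) auto

lemma pev_zero [simp]: "x : RR ==> set ds <= {\<zero>} ==> pev x ds = \<zero>"
	by (induction ds) auto

lemma comb_closed [simp, intro]: "set cs <= RR ==> set vs <= RR ==> comb cs vs : RR"
	by (induction cs vs rule: comb.induct) auto

lemma pev_append:
	"x : RR ==> set ds <= RR ==> set es <= RR ==>
		pev x (ds @ es) = pev x ds \<oplus> x [^] length ds ** pev x es"
proof (induction ds)
	case (Cons d ds)
	have "x ** x [^] length ds = x [^] length (d # ds)"
		using Cons.prems by (metis length_Cons nat_pow_Suc2)
	moreover have "pev x ds : RR" "pev x es : RR" using Cons by auto
	ultimately show ?case using Cons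
		by (simp add: r_distr a_assoc m_assoc[symmetric] pev_closed)
qed auto

lemma lin_Nil [simp]: "lin D [] = {\<zero>}"
	by (auto simp: lin_def)

lemma lin_Cons: "lin D (v # vs) = {d ** v \<oplus> w | d w. d : D & w : lin D vs}"
proof -
	have "!!cs. length cs = length (v # vs) & set cs <= D \<longleftrightarrow>
		 (EX d cs'. cs = d # cs' & d : D & length cs' = length vs & set cs' <= D)"
		by (case_tac cs) auto
	thus ?thesis unfolding lin_def by (auto; metis comb.simps(1))
qed

lemma adjI: "set ds <= D ==> pev x ds : adj D x"
	by (auto simp: adj_def)

lemma adjE: assumes "f : adj D x" obtains ds where "set ds <= D" "f = pev x ds"
	using assms by (auto simp: adj_def)

lemma transcD: "transc D I x ==> set ds <= D ==> pev x ds : I ==> set ds <= {\<zero>}"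
	by (auto simp: transc_def)

end

context cring
begin

lemma subring_dmod: "subring D R ==> dmod D D"
	by (auto simp: dmod_def subringE)

text \<open>Coefficients range over a \<open>D\<close>-module \<open>M\<close>, so that polynomials
  with coefficients in an ideal of \<open>D\<close> are covered too. The exact length is recorded
  because pseudo-division needs the degree bound.\<close>

lemma pev_add_ex:
	assumes "dmod D M" "D <= RR" "x : RR" "set ds <= M" "set es <= M"
	shows "EX fs. set fs <= M & length fs = max (length ds) (length es) & pev x ds \<oplus> pev x es = pev x fs"
	using assms(4,5)
proof (induction ds arbitrary: es)
	case Nil
	thus ?case using assms dmodD(1)[OF assms(1)]
		by (intro exI[of _ es]) auto
next
	case (Cons d ds)
	have M: "M <= RR" using assms dmodD(1) by blast
	show ?case
	proof (cases es)
		case Nil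
		have "pev x (d # ds) : RR" using Cons.prems M assms(3) by (intro pev_closed) auto
		thus ?thesis using Nil Cons.prems by (intro exI[of _ "d # ds"]) auto
	next
		case (Cons e es')
		obtain fs where fs: "set fs <= M" "length fs = max (length ds) (length es')" "pev x ds \<oplus> pev x es' = pev x fs"
			using Cons.IH[of es'] Cons Cons.prems by auto
		have c: "d : RR" "e : RR" "pev x ds : RR" "pev x es' : RR"
			using M Cons Cons.prems assms by auto
		have "pev x (d # ds) \<oplus> pev x es = (d \<oplus> e) \<oplus> x ** (pev x ds \<oplus> pev x es')"
			using c assms(3) unfolding Cons by (simp, algebra)
		thus ?thesis using fs Cons Cons.prems dmodD(3)[OF assms(1)]
			by (intro exI[of _ "(d \<oplus> e) # fs"]) auto
	qed
qed

lemma pev_smult: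
	"x : RR ==> set ds <= RR ==> c : RR ==> c ** pev x ds = pev x (map ((\<otimes>) c) ds)"
proof (induction ds)
	case (Cons d ds)
	have "c ** (x ** pev x ds) = x ** (c ** pev x ds)" using Cons.prems by (simp add: m_lcomm pev_closed)
	thus ?case using Cons by (simp add: r_distr)
qed auto

lemma subring_adj:
	assumes D: "subring D R" and x: "x : RR"
	shows "subring (adj D x) R"
proof (rule subringI)
	have Dc: "D <= RR" using subringE(1)[OF D] .
	show "adj D x <= RR" using Dc x by (auto simp: adj_def)
	have "pev x [\<one>] = \<one>" using x by simp
	thus "\<one> : adj D x" using adjI[of "[\<one>]" D x] subringE(3)[OF D] by auto
	have sm: "c ** f : adj D x" if "c : D" "f : adj D x" for c f
	proof -
		obtain ds where "set ds <= D" "f = pev x ds" using \<open>f : adj D x\<close> by (auto simp: adj_def)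
		thus ?thesis using pev_smult[of x ds c] that x Dc subringE(6)[OF D]
			by (auto simp: subset_iff intro!: adjI)
	qed
	show "\<ominus> f : adj D x" if "f : adj D x" for f
	proof -
		have "f : RR" using that Dc x by (auto simp: adj_def)
		hence "\<ominus> f = (\<ominus> \<one>) ** f" by (simp add: l_minus)
		thus ?thesis using sm[of "\<ominus> \<one>" f] subringE(3,5)[OF D] that by simp
	qed
	show ad: "f \<oplus> g : adj D x" if "f : adj D x" "g : adj D x" for f g
	proof -
		obtain ds es where de: "set ds <= D" "f = pev x ds" "set es <= D" "g = pev x es"
			using \<open>f : adj D x\<close> \<open>g : adj D x\<close> by (auto simp: adj_def)
		obtain fs where "set fs <= D" "f \<oplus> g = pev x fs"
			using pev_add_ex[OF subring_dmod[OF D] Dc x de(1) de(3)] de by auto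
		thus ?thesis by (auto intro!: adjI)
	qed
	show "f ** g : adj D x" if "f : adj D x" "g : adj D x" for f g
	proof -
		obtain ds where "set ds <= D" and f: "f = pev x ds" using \<open>f : adj D x\<close> by (auto simp: adj_def)
		from \<open>set ds <= D\<close> have "pev x ds ** g : adj D x"
		proof (induction ds)
			case Nil
			have "g : RR" using that Dc x by (auto simp: adj_def)
			thus ?case using adjI[of "[]" D x] by auto
		next
			case (Cons d ds)
			have g: "g : RR" "d : RR" "pev x ds : RR" using that Cons Dc x by (auto simp: adj_def)
			have "pev x (d # ds) ** g = d ** g \<oplus> x ** (pev x ds ** g)"
				using g x by (simp add: l_distr m_assoc)
			moreover have "x ** (pev x ds ** g) : adj D x"
			proof -
				obtain es where es: "set es <= D" "pev x ds ** g = pev x es" using Cons by (auto elim: adjE)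
				have "pev x (\<zero> # es) = x ** (pev x ds ** g)" using es x Dc by (auto simp: subset_iff)
				thus ?thesis using adjI[of "\<zero> # es" D x] es subringE(2)[OF D] by auto
			qed
			ultimately show ?case using ad sm that Cons by auto
		qed
		thus ?thesis using f by simp
	qed
qed

lemma subring_adjs: "subring D R ==> set xs <= RR ==> subring (adjs D xs) R"
	by (induction xs) (auto simp: subring_adj)

lemma adj_incl: "D <= RR ==> x : RR ==> D <= adj D x"
	by (force simp: adj_def intro: exI[of _ "[_]"])

lemma adj_self: assumes "subring D R" "x : RR" shows "x : adj D x"
	using adjI[of "[\<zero>, \<one>]" D x] assms subringE(2,3)[OF assms(1)] by auto

lemma adjs_incl: "subring D R ==> set xs <= RR ==> D <= adjs D xs"
proof (induction xs)
	case (Cons x xs)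
	have "adjs D xs <= adj (adjs D xs) x"
		using Cons subringE(1)[OF subring_adjs] by (intro adj_incl) auto
	thus ?case using Cons by auto
qed auto

lemma adjs_self: "subring D R ==> set xs <= RR ==> set xs <= adjs D xs"
proof (induction xs)
	case (Cons x xs)
	have "adjs D xs <= adj (adjs D xs) x" "x : adj (adjs D xs) x"
		using Cons.prems subringE(1)[OF subring_adjs] by (auto intro!: adj_incl[THEN subsetD] adj_self subring_adjs)
	thus ?case using Cons by auto
qed auto

lemma pev_in_subring: "subring E R ==> x : E ==> set ds <= E ==> pev x ds : E"
	by (induction ds) (auto simp: subringE)

lemma adjs_least: "subring E R ==> D <= E ==> set xs <= E ==> adjs D xs <= E"
proof (induction xs)
	case (Cons x xs)
	thus ?case using pev_in_subring[of E x] by (auto simp: adj_def)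
qed auto

lemma adjs_cong_set:
	assumes "subring D R" "set xs <= RR" "set ys = set xs"
	shows "adjs D xs = adjs D ys"
	using assms adjs_least[of "adjs D ys" D xs] adjs_least[of "adjs D xs" D ys]
		adjs_incl adjs_self subring_adjs by (metis subset_antisym)

lemma indep_mono: "indep D I xs ==> J <= I ==> indep D J xs"
	by (induction xs) (auto simp: transc_def)

text \<open>An element of the generated algebra that lies in \<open>I\<close> is itself a polynomial
  relation for the element adjoined last.\<close>

lemma indep_inter:
	assumes "indep D I xs" "D \<inter> I <= {\<zero>}" "subring D R" "set xs <= RR"
	shows "adjs D xs \<inter> I <= {\<zero>}"
	using assms
proof (cases xs)
	case (Cons x ys)
	show ?thesis
	proof
		fix f assume f: "f : adjs D xs \<inter> I"
		then obtain ds where ds: "set ds <= adjs D ys" "f = pev x ds" using Cons by (auto elim: adjE)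
		hence "set ds <= {\<zero>}" using assms Cons f by (auto simp: transc_def)
		thus "f : {\<zero>}" using ds Cons assms by auto
	qed
qed auto

text \<open>A polynomial relation modulo \<open>P\<close> in an element of \<open>P' - P\<close> has its lowest coefficient in \<open>P'\<close>.\<close>

lemma transc_prime_step:
	assumes P: "primeideal P R" and P': "ideal P' R" and PP': "P <= P'" and x: "x : P'" "x ~: P"
		and D: "D <= RR" and DP: "D \<inter> P' <= {\<zero>}"
	shows "transc D P x"
	unfolding transc_def
proof (intro allI impI, elim conjE)
	interpret P: primeideal P R by fact
	interpret P': ideal P' R by fact
	fix ds assume "set ds <= D" "pev x ds : P"
	thus "set ds <= {\<zero>}"
	proof (induction ds)
		case (Cons d ds)
		have c: "x : RR" "d : RR" "pev x ds : RR"
			using x(1) D Cons.prems P'.Icarr by auto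
		have "d \<oplus> x ** pev x ds : P'" using Cons.prems(2) PP' by auto
		moreover have xp: "x ** pev x ds : P'" using x(1) c(3) P'.I_r_closed by blast
		ultimately have "(d \<oplus> x ** pev x ds) \<oplus> \<ominus> (x ** pev x ds) : P'"
			using P'.a_closed P'.a_inv_closed by blast
		moreover have "(d \<oplus> x ** pev x ds) \<oplus> \<ominus> (x ** pev x ds) = d" using c by algebra
		ultimately have d: "d = \<zero>" using DP Cons.prems(1) by auto
		\<comment> \<open>With the constant term gone, \<open>x\<close> can be cancelled modulo the prime
		  \<open>P\<close>, and the next coefficient becomes the lowest one.\<close>
		hence "x ** pev x ds : P" using Cons.prems(2) c by simp
		hence "pev x ds : P" using P.I_prime c x(2) by blast
		thus ?case using Cons.IH Cons.prems(1) d by auto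
	qed auto
qed

text \<open>One element is picked from each gap of the chain, starting at the top, where
  \<open>zs\<close> is already independent. The algebra built so far meets the larger prime of a gap
  only in \<open>\<zero>\<close>, so the new element is independent over it modulo the smaller
  prime. This bounds lengths of chains by lengths of independent lists.\<close>

lemma prime_chain_indep:
	assumes "!!i. i <= l ==> primeideal (P i) R" "!!i. i < l ==> P i \<subset> P (Suc i)"
		and D: "subring D R" and zs: "indep D (P l) zs" "set zs <= RR" "D \<inter> P l <= {\<zero>}"
	shows "EX xs. set xs <= RR & length xs = l & indep D (P 0) (xs @ zs) & D \<inter> P 0 <= {\<zero>}"
	using assms(1,2,4-)
proof (induction l arbitrary: P)
	case 0
	thus ?case by auto
next
	case (Suc l)
	obtain xs where xs: "set xs <= RR" "length xs = l" "indep D (P 1) (xs @ zs)" "D \<inter> P 1 <= {\<zero>}"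
		using Suc.IH[of "%i. P (Suc i)"] Suc.prems by auto
	have sub: "P 0 \<subset> P 1" using Suc.prems(2)[of 0] by auto
	then obtain x where x: "x : P 1" "x ~: P 0" by auto
	have pr: "primeideal (P 0) R" "primeideal (P 1) R" using Suc.prems(1)[of 0] Suc.prems(1)[of 1] by auto
	have i1: "ideal (P 1) R" using pr primeideal.axioms(1) by auto
	have "transc (adjs D (xs @ zs)) (P 0) x"
		using indep_inter[OF xs(3,4) D] xs(1) Suc.prems(4) x pr i1 subringE(1)[OF subring_adjs[OF D, of "xs @ zs"]]
		by (intro transc_prime_step[OF pr(1) i1 psubset_imp_subset[OF sub] x]) auto
	thus ?case using xs x sub indep_mono[OF xs(3), of "P 0"] ideal.Icarr[OF i1]
		by (intro exI[of _ "x # xs"]) auto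
qed

section \<open>Linear combinations over a subring and elimination\<close>

lemma comb_append:
	"length cs = length vs ==> set cs <= RR ==> set vs <= RR ==> set cs' <= RR ==> set vs' <= RR ==>
		 comb (cs @ cs') (vs @ vs') = comb cs vs \<oplus> comb cs' vs'"
	by (induction cs vs rule: list_induct2) (auto simp: a_assoc)

lemma comb_in_dmod:
	"dmod D P ==> set cs <= D ==> set vs <= P ==> comb cs vs : P"
	by (induction cs vs rule: comb.induct) (auto simp: dmodD)

lemma comb_smult:
	"a : RR ==> set cs <= RR ==> set vs <= RR ==>
		 comb (map ((\<otimes>) a) cs) vs = a ** comb cs vs"
	by (induction cs vs rule: comb.induct) (auto simp: r_distr m_assoc)

lemma lin_dmod:
	assumes D: "subring D R" and vs: "set vs <= RR"
	shows "dmod D (lin D vs)"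
	using vs
proof (induction vs)
	case Nil
	thus ?case using subringE(1)[OF D] by (auto simp: dmod_def)
next
	case (Cons v vs)
	note IH = dmodD[OF Cons.IH]
	have Dc: "D <= RR" using subringE(1)[OF D] .
	have v: "v : RR" "set vs <= RR" using Cons by auto
	have lc: "w : lin D vs ==> w : RR" for w using IH(1) v by auto
	show ?case unfolding dmod_def
	proof (intro conjI ballI)
		show "lin D (v # vs) <= RR" using v Dc lc by (auto simp: lin_Cons)
		have "\<zero> = \<zero> ** v \<oplus> \<zero>" using v by auto
		thus "\<zero> : lin D (v # vs)" using IH(2) v subringE(2)[OF D] unfolding lin_Cons by blast
	next
		fix x y assume "x : lin D (v # vs)" "y : lin D (v # vs)"
		then obtain a b w z where h: "a : D" "b : D" "w : lin D vs" "z : lin D vs" "x = a ** v \<oplus> w" "y = b ** v \<oplus> z"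
			unfolding lin_Cons by auto
		hence c: "a : RR" "b : RR" "w : RR" "z : RR" using Dc lc by auto
		have "x \<oplus> y = (a \<oplus> b) ** v \<oplus> (w \<oplus> z)" using h c v by algebra
		thus "x \<oplus> y : lin D (v # vs)" using h IH(3) v subringE(7)[OF D] unfolding lin_Cons by blast
	next
		fix d x assume d: "d : D" "x : lin D (v # vs)"
		then obtain a w where h: "a : D" "w : lin D vs" "x = a ** v \<oplus> w"
			unfolding lin_Cons by auto
		hence c: "a : RR" "w : RR" "d : RR" using d Dc lc by auto
		have "d ** x = (d ** a) ** v \<oplus> (d ** w)" using h c v by algebra
		thus "d ** x : lin D (v # vs)" using h d IH(4) v subringE(6)[OF D] unfolding lin_Cons by blast
	qed
qed

lemma lin_gen:
	assumes D: "subring D R" and vs: "set vs <= RR" and v: "v : set vs"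
	shows "v : lin D vs"
	using vs v
proof (induction vs)
	case (Cons u vs)
	have z: "\<zero> : lin D vs" using lin_dmod[OF D] Cons dmodD(2) by auto
	show ?case
	proof (cases "v = u")
		case True
		hence "v = \<one> ** u \<oplus> \<zero>" using Cons by auto
		thus ?thesis using z subringE(3)[OF D] unfolding lin_Cons by blast
	next
		case False
		hence "v : lin D vs" "v = \<zero> ** u \<oplus> v" using Cons by auto
		thus ?thesis using subringE(2)[OF D] unfolding lin_Cons by blast
	qed
qed auto

lemma lin_least:
	"dmod D M ==> set vs <= M ==> lin D vs <= M"
	by (auto simp: lin_def comb_in_dmod)

lemma comb_diff_map:
	"a0 : RR ==> v0 : RR ==> set cs <= RR ==> set vs <= RR ==>
	 (!!v. v : set vs ==> a v : RR) ==>
		 comb cs (map (%v. a0 ** v \<ominus> a v ** v0) vs) = a0 ** comb cs vs \<ominus> comb cs (map a vs) ** v0"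
proof (induction cs vs rule: comb.induct)
	case (1 c cs v vs)
	have cl: "comb cs vs : RR" "comb cs (map a vs) : RR" "c : RR" "v : RR" "a v : RR"
		using 1 by (auto intro!: comb_closed)
	have "c ** (a0 ** v \<ominus> a v ** v0) \<oplus> (a0 ** comb cs vs \<ominus> comb cs (map a vs) ** v0)
		 = a0 ** (c ** v \<oplus> comb cs vs) \<ominus> (c ** a v \<oplus> comb cs (map a vs)) ** v0"
		using cl 1(2,3) by algebra
	thus ?case using 1 by simp
qed (auto simp: minus_eq)

text \<open>Gaussian elimination over the domain \<open>D / N\<close>.\<close>

lemma nontrivial_relation:
	assumes D: "subring D R" and N: "\<one> ~: N" "!!a b. [|a : D; b : D; a ** b : N|] ==> a : N \<or> b : N"
		and P: "dmod D P" and NP: "!!n s. n : N ==> s : RR ==> n ** s : P"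
		and ws: "set ws <= RR"
		and vs: "!!v. v : set vs ==> EX w:lin D ws. EX p:P. v = w \<oplus> p" and len: "length ws < length vs"
	shows "EX cs. length cs = length vs & set cs <= D & \<not> set cs <= N & comb cs vs : P"
	using ws vs len
proof (induction ws arbitrary: vs)
	case Nil
	have "set vs <= P" using Nil dmodD(1)[OF P] by (auto simp: subset_iff)
	\<comment> \<open>With nothing left to span, every vector lies in \<open>P\<close>, and the
	  coefficients \<open>\<one>\<close> give a relation that is not in \<open>N\<close>.\<close>
	hence "comb (replicate (length vs) \<one>) vs : P"
		using subringE(3)[OF D] by (intro comb_in_dmod[OF P]) auto
	thus ?case using N Nil subringE(3)[OF D] by (intro exI[of _ "replicate (length vs) \<one>"]) auto
next
	case (Cons w ws)
	have Dc: "D <= RR" using subringE(1)[OF D] .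
	have Pc: "P <= RR" using dmodD(1)[OF P] .
	have w: "w : RR" "set ws <= RR" using Cons by auto
	have lc: "lin D ws <= RR" using lin_dmod[OF D w(2)] dmodD(1) by auto
	have "ALL v:set vs. EX a u p. a : D & u : lin D ws & p : P & v = a ** w \<oplus> u \<oplus> p"
		using Cons.prems(2) unfolding lin_Cons by fastforce
	then obtain a u p where aup: "!!v. v : set vs ==> a v : D & u v : lin D ws & p v : P & v = a v ** w \<oplus> u v \<oplus> p v"
		by metis
	have cl: "a v : RR" "u v : RR" "p v : RR" "v : RR" if "v : set vs" for v
	proof -
		show 1: "a v : RR" "u v : RR" "p v : RR" using aup[OF that] Dc Pc lc by auto
		show "v : RR" using 1 w aup[OF that] by (metis a_closed m_closed)
	qed
	show ?case
	proof (cases "ALL v:set vs. a v : N")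
		case True
		have "EX w:lin D ws. EX p:P. v = w \<oplus> p" if "v : set vs" for v
		proof -
			have "a v ** w \<oplus> p v : P" using True NP w aup[OF that] dmodD(3)[OF P] that by auto
			moreover have "a v ** w \<oplus> u v \<oplus> p v = u v \<oplus> (a v ** w \<oplus> p v)" using cl[OF that] w by algebra
			ultimately show ?thesis using aup[OF that] by metis
		qed
		thus ?thesis using Cons.IH[of vs] Cons.prems by auto
	next
		case False
		then obtain v0 where v0: "v0 : set vs" "a v0 ~: N" by auto
		then obtain vs1 vs2 where vs: "vs = vs1 @ v0 # vs2" by (meson split_list)
		\<comment> \<open>Cross-multiplication removes \<open>w\<close> without dividing: up to
		  \<open>P\<close>, each \<open>f v\<close> lies in the span of \<open>ws\<close> alone.\<close>
		define f where "f v = a v0 ** v \<ominus> a v ** v0" for v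
		have fv: "EX w:lin D ws. EX p:P. f v = w \<oplus> p" if v: "v : set vs" for v
		proof -
			note c = cl[OF v] cl[OF v0(1)] w(1)
			define u' where "u' = a v0 ** u v \<oplus> (\<ominus> a v) ** u v0"
			define p' where "p' = a v0 ** p v \<oplus> (\<ominus> a v) ** p v0"
			have "u' : lin D ws" unfolding u'_def
				using aup[OF v] aup[OF v0(1)] dmodD[OF lin_dmod[OF D w(2)]] subringE(5)[OF D] by auto
			moreover have "p' : P" unfolding p'_def
				using aup[OF v] aup[OF v0(1)] dmodD[OF P] subringE(5)[OF D] by auto
			moreover have "f v = u' \<oplus> p'"
			proof -
				have "f v = a v0 ** (a v ** w \<oplus> u v \<oplus> p v) \<ominus> a v ** (a v0 ** w \<oplus> u v0 \<oplus> p v0)"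
					unfolding f_def using aup[OF v] aup[OF v0(1)] by metis
				also have "\<dots> = u' \<oplus> p'" unfolding u'_def p'_def using c by algebra
				finally show ?thesis .
			qed
			ultimately show ?thesis by blast
		qed
		let ?vs = "vs1 @ vs2"
		have "EX cs. length cs = length (map f ?vs) & set cs <= D & \<not> set cs <= N & comb cs (map f ?vs) : P"
			using fv vs Cons.prems(3) by (intro Cons.IH[OF w(2)]) auto
		then obtain cs where cs: "length cs = length ?vs" "set cs <= D" "\<not> set cs <= N" "comb cs (map f ?vs) : P"
			unfolding length_map by blast
		define c1 where "c1 = take (length vs1) cs"
		define c2 where "c2 = drop (length vs1) cs"
		have c12: "cs = c1 @ c2" "length c1 = length vs1" "length c2 = length vs2" using cs by (auto simp: c1_def c2_def)
		\<comment> \<open>The relation between the \<open>f v\<close> is read as one between the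
		  \<open>vs\<close>; the terms subtracted in the \<open>f v\<close> add up to the coefficient of
		  \<open>v0\<close>.\<close>
		define c0 where "c0 = \<ominus> comb cs (map a ?vs)"
		let ?cs = "map ((\<otimes>) (a v0)) c1 @ c0 # map ((\<otimes>) (a v0)) c2"
		have sc: "set cs <= RR" "set c1 <= RR" "set c2 <= RR" "set vs1 <= RR" "set vs2 <= RR"
			using cs(2) Dc c12 cl vs by auto
		have "comb cs (map a ?vs) : D"
			using comb_in_dmod[OF subring_dmod[OF D] cs(2), of "map a ?vs"] aup vs by auto
		hence c0: "c0 : D" "comb cs (map a ?vs) : RR" unfolding c0_def using subringE(5)[OF D] Dc by auto
		note v0c = cl[OF v0(1)]
		have "comb ?cs vs = a v0 ** comb c1 vs1 \<oplus> (c0 ** v0 \<oplus> a v0 ** comb c2 vs2)"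
			unfolding vs using c12 sc v0c c0 Dc by (subst comb_append) (auto simp: comb_smult)
		also have "\<dots> = a v0 ** (comb c1 vs1 \<oplus> comb c2 vs2) \<ominus> comb cs (map a ?vs) ** v0"
		proof -
			have "comb c1 vs1 : RR" "comb c2 vs2 : RR" using sc by auto
			with v0c c0 show ?thesis unfolding c0_def by algebra
		qed
		also have "\<dots> = comb cs (map f ?vs)"
			unfolding f_def using v0c sc vs cl c12 by (subst comb_diff_map) (auto simp: comb_append)
		finally have "comb ?cs vs : P" using cs by simp
		moreover have "set ?cs <= D" using cs c0 aup[OF v0(1)] subringE(6)[OF D] c12 by auto
		moreover have "\<not> set ?cs <= N"
		proof -
			obtain c where "c : set cs" "c ~: N" using cs by auto
			hence "a v0 ** c ~: N" using N(2) v0 aup[OF v0(1)] cs by blast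
			thus ?thesis using \<open>c : set cs\<close> c12 by auto
		qed
		ultimately show ?thesis using c12 vs by (intro exI[of _ ?cs]) auto
	qed
qed

end

context cring
begin

lemma pev_smult_dmod:
	assumes "!!f. f : M1 ==> c ** f : M2" "x : RR" "M1 <= RR" "c : RR" "set ds <= M1"
	shows "EX fs. set fs <= M2 & length fs = length ds & c ** pev x ds = pev x fs"
proof -
	have "set ds <= RR" using assms(3,5) by auto
	thus ?thesis using assms(1,5) pev_smult[OF assms(2) _ assms(4)]
		by (intro exI[of _ "map ((\<otimes>) c) ds"]) auto
qed

lemma pev_mult_ex:
	assumes D: "subring D R" and M: "dmod D M1" "dmod D M2" "dmod D M3" "!!f g. f : M1 ==> g : M2 ==> f ** g : M3"
		and x: "x : RR" and gs: "set gs <= M2"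
	shows "set fs <= M1 ==>
		EX hs. set hs <= M3 & length hs <= length fs + length gs & pev x fs ** pev x gs = pev x hs"
proof (induction fs)
	case Nil
	have "pev x gs : RR" using gs x dmodD(1)[OF M(2)] by auto
	thus ?case by (intro exI[of _ "[]"]) auto
next
	case (Cons d fs)
	have c: "M1 <= RR" "M2 <= RR" "M3 <= RR" using M dmodD(1) by auto
	have cl: "d : RR" "pev x fs : RR" "pev x gs : RR" using c gs Cons.prems x by auto
	obtain hs where hs: "set hs <= M3" "length hs <= length fs + length gs" "pev x fs ** pev x gs = pev x hs"
		using Cons by auto
	obtain es where es: "set es <= M3" "length es = length gs" "d ** pev x gs = pev x es"
		using pev_smult_dmod[of M2 d M3 x gs] M(4)[of d] Cons.prems c cl x gs by auto
	have z: "set (\<zero> # hs) <= M3" using hs dmodD(2)[OF M(3)] by auto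
	obtain us where us: "set us <= M3" "length us = max (length es) (length (\<zero> # hs))" "pev x es \<oplus> pev x (\<zero> # hs) = pev x us"
		using pev_add_ex[OF M(3) subringE(1)[OF D] x es(1) z] by auto
	have "pev x hs : RR" using hs c x by auto
	hence "pev x (d # fs) ** pev x gs = pev x es \<oplus> pev x (\<zero> # hs)"
		using cl x es(3) hs(3) by (simp add: l_distr m_assoc)
	thus ?case using us hs es by (intro exI[of _ us]) auto
qed

context
	fixes D assumes D: "subring D R"
begin

lemma Dc: "D <= RR" using subringE(1)[OF D] .

lemma lin_mono_set:
	"set ws <= set vs ==> set vs <= RR ==> lin D ws <= lin D vs"
	using lin_least[OF lin_dmod[OF D]] lin_gen[OF D] by (meson subset_iff)

end

end

locale subfield_cring = cring R for R (structure) +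
	fixes k assumes subfield_k: "subfield k R"
begin

lemma k_subring: "subring k R"
	using subfield_k by (simp add: subfieldE(1) subringI subfield_def subdomain_def subcring_def)

lemma k_carrier: "k <= RR"
	using subringE(1)[OF k_subring] .

lemma one_not_zero: "\<one> ~= \<zero>"
	using subfieldE(6)[OF subfield_k] by auto

lemma k_inverse:
	assumes "c : k" "c ~= \<zero>"
	shows "EX c':k. c ** c' = \<one>"
	using subfield_m_inv[OF subfield_k] assms by blast

lemma k_inter_prime:
	assumes "primeideal P R"
	shows "k \<inter> P <= {\<zero>}"
proof -
	interpret primeideal P R by fact
	show ?thesis
	proof (rule ccontr)
		assume "\<not> k \<inter> P <= {\<zero>}"
		then obtain c where c: "c : k" "c : P" "c ~= \<zero>" by auto
		then obtain c' where "c' : k" "c ** c' = \<one>" using k_inverse by auto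
		hence "\<one> : P" using c k_carrier I_r_closed by (metis subset_iff)
		thus False using one_imp_carrier I_notcarr by auto
	qed
qed

end

section \<open>Primes avoiding a multiplicative set, and leading coefficients of products\<close>

context cring
begin

lemma ideal_extend:
	assumes Q: "ideal Q R" and a: "a : RR"
	shows "ideal {q \<oplus> a ** r | q r. q : Q & r : RR} R" (is "ideal ?J R")
		and "Q <= {q \<oplus> a ** r | q r. q : Q & r : RR}"
		and "a : {q \<oplus> a ** r | q r. q : Q & r : RR}"
proof -
	interpret Q: ideal Q R by fact
	have Qc: "Q <= RR" by (rule Q.a_subset)
	show "Q <= ?J"
	proof
		fix q assume q: "q : Q"
		hence "q = q \<oplus> a ** \<zero>" using a Qc by auto
		thus "q : ?J" using q by blast
	qed
	have "a = \<zero> \<oplus> a ** \<one>" using a by simp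
	thus "a : ?J" using Q.zero_closed by blast
	have add: "x \<oplus> y : ?J" if xy: "x : ?J" "y : ?J" for x y
	proof -
		obtain q r q' r' where h: "x = q \<oplus> a ** r" "y = q' \<oplus> a ** r'" "q : Q" "q' : Q" "r : RR" "r' : RR"
			using xy by auto
		moreover have "q : RR" "q' : RR" using h Qc by auto
		ultimately have "x \<oplus> y = (q \<oplus> q') \<oplus> a ** (r \<oplus> r')" using a by algebra
		thus ?thesis using h Q.a_closed by blast
	qed
	have mult: "s ** x : ?J" if sx: "s : RR" "x : ?J" for s x
	proof -
		obtain q r where h: "x = q \<oplus> a ** r" "q : Q" "r : RR" using sx by auto
		moreover have "q : RR" using h Qc by auto
		ultimately have "s ** x = s ** q \<oplus> a ** (s ** r)" using a sx by algebra
		thus ?thesis using h sx Q.I_l_closed by blast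
	qed
	show "ideal ?J R"
	proof (rule idealI)
		show "ring R" by (rule ring_axioms)
		have Jc: "?J <= RR" using a Qc by auto
		show "subgroup ?J (add_monoid R)"
		proof (rule add.subgroupI)
			show "?J <= RR" by (rule Jc)
			show "?J ~= {}" using \<open>Q <= ?J\<close> Q.zero_closed by blast
			show "\<ominus> x : ?J" if "x : ?J" for x
			proof -
				have "x : RR" using that Jc by blast
				hence "\<ominus> x = \<ominus> \<one> ** x" by (simp add: l_minus)
				thus ?thesis using mult[of "\<ominus> \<one>" x] that by simp
			qed
		qed (rule add)
		fix x s assume xs: "x : ?J" "s : RR"
		show "s ** x : ?J" by (rule mult[OF xs(2,1)])
		moreover have "x ** s = s ** x" using subsetD[OF Jc xs(1)] xs(2) by (rule m_comm)
		ultimately show "x ** s : ?J" by (rule ssubst[rotated])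
	qed
qed

text \<open>By Zorn there is an ideal \<open>Q\<close> maximal among those containing
  \<open>J\<close> and missing \<open>M\<close>. If neither \<open>a\<close> nor \<open>b\<close>
  lies in \<open>Q\<close>, both enlargements of \<open>Q\<close> meet \<open>M\<close>; the product
  of the two common elements lies in \<open>M\<close>, and it would lie in \<open>Q\<close> if
  \<open>a b\<close> did.\<close>

lemma primeideal_avoiding:
	assumes J: "ideal J R" and M: "M <= RR" "\<one> : M" "!!a b. a : M ==> b : M ==> a ** b : M"
		and JM: "J \<inter> M = {}"
	shows "EX Q. primeideal Q R & J <= Q & Q \<inter> M = {}"
proof -
	define \<A> where "\<A> = {I. ideal I R & J <= I & I \<inter> M = {}}"
	have "EX Q:\<A>. ALL X:\<A>. Q <= X --> X = Q"
	proof (rule subset_Zorn_nonempty)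
		show "\<A> ~= {}" using J JM by (auto simp: \<A>_def)
		fix \<C> assume c: "\<C> ~= {}" "subset.chain \<A> \<C>"
		hence sub: "\<C> <= \<A>" by (simp add: subset.chain_def)
		have "subset.chain {I. ideal I R} \<C>" using c by (auto simp: subset.chain_def \<A>_def)
		from chain_Union_is_ideal[OF this] have "ideal (\<Union>\<C>) R" using c(1) by simp
		thus "\<Union>\<C> \<in> \<A>" using sub c by (auto simp: \<A>_def)
	qed
	then obtain Q where Q: "Q : \<A>" and max: "!!X. X : \<A> ==> Q <= X ==> X = Q" by blast
	have Qi: "ideal Q R" "J <= Q" "Q \<inter> M = {}" using Q by (auto simp: \<A>_def)
	interpret Q: ideal Q R by fact
	have meet: "EX q r. q : Q & r : RR & q \<oplus> a ** r : M" if a: "a : RR" "a ~: Q" for a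
	proof (rule ccontr)
		assume n: "\<not> ?thesis"
		let ?X = "{q \<oplus> a ** r | q r. q : Q & r : RR}"
		have "?X \<inter> M = {}" using n by blast
		moreover have "J <= ?X" using ideal_extend(2)[OF Qi(1) a(1)] Qi(2) by (rule order_trans[rotated])
		ultimately have "?X : \<A>" using ideal_extend(1)[OF Qi(1) a(1)] unfolding \<A>_def by simp
		hence "?X = Q" using max ideal_extend(2)[OF Qi(1) a(1)] by blast
		thus False using ideal_extend(3)[OF Qi(1) a(1)] a by blast
	qed
	have "primeideal Q R"
	proof (rule primeidealI)
		show "RR ~= Q" using M Qi by auto
		fix a b assume ab: "a : RR" "b : RR" "a ** b : Q"
		show "a : Q \<or> b : Q"
		proof (rule ccontr)
			assume "\<not> (a : Q \<or> b : Q)"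
			then obtain q r q' r' where h: "q : Q" "r : RR" "q \<oplus> a ** r : M" "q' : Q" "r' : RR" "q' \<oplus> b ** r' : M"
				using meet[of a] meet[of b] ab by blast
			have qc: "q : RR" "q' : RR" using h Q.Icarr by auto
			have "(q \<oplus> a ** r) ** (q' \<oplus> b ** r') = (q' \<oplus> b ** r') ** q \<oplus> (a ** r) ** q' \<oplus> (r ** r') ** (a ** b)"
				using ab qc h by algebra
			moreover have "(q' \<oplus> b ** r') ** q : Q" "(a ** r) ** q' : Q" "(r ** r') ** (a ** b) : Q"
				using h(1,2,4,5) ab qc Q.I_l_closed by simp_all
			hence "(q' \<oplus> b ** r') ** q \<oplus> (a ** r) ** q' \<oplus> (r ** r') ** (a ** b) : Q" by blast
			ultimately show False using M(3)[OF h(3,6)] Qi by auto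
		qed
	qed (use Qi cring_axioms in auto)
	thus ?thesis using Qi by auto
qed

lemma pev_add_last:
	assumes D: "subring D R" and x: "x : RR" and c: "c : D"
	shows "set ds <= D ==> set es <= D ==> length es <= length ds ==>
		EX us. set us <= D & length us = length ds & pev x es \<oplus> pev x (ds @ [c]) = pev x (us @ [c])"
proof (induction es arbitrary: ds)
	case Nil
	have "set (ds @ [c]) <= RR" using Nil c subringE(1)[OF D] by auto
	thus ?case using Nil x by (intro exI[of _ ds]) auto
next
	case (Cons e es)
	then obtain d ds' where ds: "ds = d # ds'" by (cases ds) auto
	have "EX us. set us <= D & length us = length ds' & pev x es \<oplus> pev x (ds' @ [c]) = pev x (us @ [c])"
		using Cons.prems unfolding ds by (intro Cons.IH) auto
	then obtain us where us: "set us <= D" "length us = length ds'" "pev x es \<oplus> pev x (ds' @ [c]) = pev x (us @ [c])"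
		by blast
	have "set es <= RR" "set (ds' @ [c]) <= RR" "e : RR" "d : RR"
		using Cons.prems ds c subringE(1)[OF D] by auto
	hence "pev x es : RR" "pev x (ds' @ [c]) : RR" "e : RR" "d : RR" using x by auto
	hence "pev x (e # es) \<oplus> pev x (ds @ [c]) = (e \<oplus> d) \<oplus> x ** (pev x es \<oplus> pev x (ds' @ [c]))"
		unfolding ds using x by (simp, algebra)
	also have "\<dots> = pev x (((e \<oplus> d) # us) @ [c])" using us by simp
	finally show ?case using us Cons.prems ds subringE(7)[OF D] by (intro exI[of _ "(e \<oplus> d) # us"]) auto
qed

text \<open>Products are followed only through the entry at the top, which suffices to see that a
  product does not vanish. The top entries may be zero or zero divisors; the length of the product
  list is exact in any case.\<close>

lemma pev_mult_last:
	assumes D: "subring D R" and x: "x : RR" and c: "c : D" "c' : D" and bs: "set bs <= D"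
	shows "set as <= D ==>
		EX us. set us <= D & length us = length as + length bs &
			pev x (as @ [c]) ** pev x (bs @ [c']) = pev x (us @ [c ** c'])"
proof (induction as)
	case Nil
	have "set (bs @ [c']) <= RR" "c : RR" using bs c subringE(1)[OF D] by auto
	hence "pev x ([] @ [c]) ** pev x (bs @ [c']) = pev x (map ((\<otimes>) c) bs @ [c ** c'])"
		using pev_smult[OF x, of "bs @ [c']" c] x by simp
	thus ?case using bs c subringE(6)[OF D] by (intro exI[of _ "map ((\<otimes>) c) bs"]) auto
next
	case (Cons a as)
	then obtain us where us: "set us <= D" "length us = length as + length bs"
		"pev x (as @ [c]) ** pev x (bs @ [c']) = pev x (us @ [c ** c'])" by auto
	have cc: "c ** c' : D" using c subringE(6)[OF D] by auto
	have Dc: "D <= RR" using subringE(1)[OF D] .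
	have cl: "a : RR" "set (as @ [c]) <= RR" "set (bs @ [c']) <= RR" "set (us @ [c ** c']) <= RR"
		using Cons.prems bs c us cc Dc by auto
	hence cl': "pev x (as @ [c]) : RR" "pev x (bs @ [c']) : RR" "pev x (us @ [c ** c']) : RR"
		using x by auto
	have "EX ws. set ws <= D & length ws = length (\<zero> # us) &
		 pev x (map ((\<otimes>) a) (bs @ [c'])) \<oplus> pev x ((\<zero> # us) @ [c ** c']) = pev x (ws @ [c ** c'])"
		using us bs c Cons.prems subringE(2,6)[OF D] by (intro pev_add_last[OF D x cc]) auto
	then obtain ws where ws: "set ws <= D" "length ws = length (\<zero> # us)"
		"pev x (map ((\<otimes>) a) (bs @ [c'])) \<oplus> pev x ((\<zero> # us) @ [c ** c']) = pev x (ws @ [c ** c'])" by blast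
	have "pev x ((a # as) @ [c]) ** pev x (bs @ [c']) = a ** pev x (bs @ [c']) \<oplus> x ** (pev x (as @ [c]) ** pev x (bs @ [c']))"
		using cl cl' x by (simp add: l_distr m_assoc)
	also have "a ** pev x (bs @ [c']) = pev x (map ((\<otimes>) a) (bs @ [c']))"
		using pev_smult[OF x cl(3,1)] .
	also have "x ** (pev x (as @ [c]) ** pev x (bs @ [c'])) = pev x ((\<zero> # us) @ [c ** c'])"
		using us cl' x by simp
	finally show ?case using ws us by (intro exI[of _ ws]) auto
qed

text \<open>Coefficients in \<open>P\<close> at the top contribute only an element of
  \<open>P\<close>, so up to \<open>P\<close> the polynomial has a leading coefficient outside
  \<open>P\<close>.\<close>

lemma pev_strip:
	assumes P: "ideal P R" and x: "x : RR"
	shows "set ds <= RR ==> \<not> set ds <= P ==>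
		EX ds' l q rest. ds = ds' @ l # rest & set rest <= P & l ~: P & q : P & pev x ds = pev x (ds' @ [l]) \<oplus> q"
proof (induction ds rule: rev_induct)
	case (snoc a ds)
	interpret P: ideal P R by fact
	have c: "pev x ds : RR" "a : RR" "pev x (ds @ [a]) : RR" using snoc.prems x by auto
	show ?case
	proof (cases "a : P")
		case False
		thus ?thesis using c by (intro exI[of _ ds] exI[of _ a] exI[of _ \<zero>] exI[of _ "[]"]) auto
	next
		case True
		then obtain ds' l q rest where h: "ds = ds' @ l # rest" "set rest <= P" "l ~: P" "q : P" "pev x ds = pev x (ds' @ [l]) \<oplus> q"
			using snoc by auto
		let ?t = "x [^] length ds ** a"
		have t: "?t : P" using True x P.I_l_closed by auto
		have "pev x (ds @ [a]) = pev x ds \<oplus> ?t" using snoc.prems x c by (subst pev_append) auto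
		moreover have "pev x (ds' @ [l]) : RR" using snoc.prems x h(1) by auto
		ultimately have "pev x (ds @ [a]) = pev x (ds' @ [l]) \<oplus> (q \<oplus> ?t)"
			unfolding h(5) using t h(4) P.Icarr by (simp add: a_assoc)
		thus ?thesis using h t True by (intro exI[of _ ds'] exI[of _ l] exI[of _ "q \<oplus> ?t"] exI[of _ "rest @ [a]"]) auto
	qed
qed auto

lemma one_notin_prime: "primeideal Q R ==> \<one> ~: Q"
	using ideal.one_imp_carrier primeideal.I_notcarr primeideal.axioms(1) by metis

lemma pow_notin_prime:
	assumes "primeideal Q R" "c : RR" "c ~: Q"
	shows "c [^] (m::nat) ~: Q"
proof (induction m)
	interpret primeideal Q R by fact
	case 0
	thus ?case using one_notin_prime[OF assms(1)] by simp
next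
	interpret primeideal Q R by fact
	case (Suc m)
	thus ?case using I_prime[of "c [^] m" c] assms by auto
qed

text \<open>Converts between linear relations among powers of \<open>e\<close> and polynomial
  relations for \<open>e\<close>. The factor \<open>a\<close> carries a common denominator; the
  offset \<open>j\<close> serves the induction.\<close>

lemma pev_comb_pows:
	"e : RR ==> a : RR ==> set cs <= RR ==>
		comb cs (map (%i. a ** e [^] i) [j..<j + length cs]) = (a ** e [^] j) ** pev e cs"
proof (induction cs arbitrary: j)
	case (Cons c cs)
	have l: "[j..<j + length (c # cs)] = j # [Suc j..<Suc j + length cs]" by (simp add: upt_rec)
	have cl: "pev e cs : RR" "e [^] j : RR" "c : RR" using Cons.prems by auto
	have "comb (c # cs) (map (%i. a ** e [^] i) [j..<j + length (c # cs)]) = c ** (a ** e [^] j) \<oplus> (a ** (e [^] j ** e)) ** pev e cs"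
		unfolding l using Cons.IH[of "Suc j"] Cons.prems by (simp del: upt_Suc)
	also have "\<dots> = (a ** e [^] j) ** pev e (c # cs)" using cl Cons.prems(1,2) by (simp, algebra)
	finally show ?case .
qed auto

lemma subring_pow: "subring D R ==> c : D ==> c [^] (m::nat) : D"
	by (induction m) (auto simp: subringE)

section \<open>Algebraic dependence modulo a prime\<close>

text \<open>The preimage in the ring of the \<open>D\<close>-span of \<open>ws\<close> modulo
  \<open>P\<close>. Working with it replaces working in the quotient ring.\<close>

definition msp :: "'a set => 'a set => 'a list => 'a set" where
	"msp D P ws = {w \<oplus> p | w p. w : lin D ws & p : P}"

lemma msp_dmod:
	assumes D: "subring D R" and Q: "dmod D P" and ws: "set ws <= RR"
	shows "dmod D (msp D P ws)"
	unfolding dmod_def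
proof (intro conjI ballI)
	note L = lin_dmod[OF D ws] and Dc = subringE(1)[OF D]
	have c: "lin D ws <= RR" "P <= RR" using dmodD(1)[OF L] dmodD(1)[OF Q] by auto
	show "msp D P ws <= RR" using c by (auto simp: msp_def)
	show "\<zero> : msp D P ws" using dmodD(2)[OF L] dmodD(2)[OF Q] by (force simp: msp_def)
	fix x assume "x : msp D P ws"
	then obtain p q where x: "p : lin D ws" "q : P" "x = p \<oplus> q" by (auto simp: msp_def)
	hence xc: "p : RR" "q : RR" using c by auto
	show "x \<oplus> y : msp D P ws" if "y : msp D P ws" for y
	proof -
		from that obtain r s where y: "r : lin D ws" "s : P" "y = r \<oplus> s" by (auto simp: msp_def)
		hence yc: "r : RR" "s : RR" using c by auto
		have "x \<oplus> y = (p \<oplus> r) \<oplus> (q \<oplus> s)" using x(3) y(3) xc yc by (simp add: a_ac)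
		thus ?thesis using dmodD(3)[OF L x(1) y(1)] dmodD(3)[OF Q x(2) y(2)] unfolding msp_def by blast
	qed
	show "d ** x : msp D P ws" if d: "d : D" for d
	proof -
		have "d ** x = d ** p \<oplus> d ** q" using x(3) xc d Dc by (simp add: r_distr subset_iff)
		thus ?thesis using dmodD(4)[OF L d x(1)] dmodD(4)[OF Q d x(2)] unfolding msp_def by blast
	qed
qed

lemma msp_least:
	assumes "dmod D M" "set ws <= M" "P <= M"
	shows "msp D P ws <= M"
	using lin_least[OF assms(1,2)] assms(3) dmodD(3)[OF assms(1)] by (auto simp: msp_def)

lemma msp_gens:
	assumes D: "subring D R" and Q: "dmod D P" and ws: "set ws <= RR"
	shows "set ws <= msp D P ws" "P <= msp D P ws" "lin D ws <= msp D P ws"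
proof -
	note L = lin_dmod[OF D ws]
	have c: "lin D ws <= RR" "P <= RR" using dmodD(1)[OF L] dmodD(1)[OF Q] by auto
	show l: "lin D ws <= msp D P ws"
	proof
		fix w assume w: "w : lin D ws"
		hence "w = w \<oplus> \<zero>" using c by auto
		thus "w : msp D P ws" using w dmodD(2)[OF Q] unfolding msp_def by blast
	qed
	show "set ws <= msp D P ws" using l lin_gen[OF D ws] by blast
	show "P <= msp D P ws"
	proof
		fix p assume p: "p : P"
		hence "p = \<zero> \<oplus> p" using c by auto
		thus "p : msp D P ws" using p dmodD(2)[OF L] unfolding msp_def by blast
	qed
qed

lemma dmod_preimage:
	assumes V: "dmod D V" and D: "D <= RR" and c: "c : RR"
	shows "dmod D {z : RR. c ** z : V}"
	unfolding dmod_def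
proof (intro conjI ballI)
	show "\<zero> : {z : RR. c ** z : V}" using dmodD(2)[OF V] c by simp
	fix u assume u: "u : {z : RR. c ** z : V}"
	show "u \<oplus> w : {z : RR. c ** z : V}" if "w : {z : RR. c ** z : V}" for w
		using u that dmodD(3)[OF V, of "c ** u" "c ** w"] c by (simp add: r_distr)
	show "d ** u : {z : RR. c ** z : V}" if d: "d : D" for d
		using u dmodD(4)[OF V d, of "c ** u"] c d D by (auto simp: m_lcomm subset_iff)
qed auto

text \<open>Greedy choice of a family that is independent modulo \<open>N\<close>, where
  coefficients in \<open>Z\<close> count as zero. A rejected \<open>y\<close> satisfies a relation
  in which its own coefficient \<open>a\<close> is outside \<open>Z\<close>; the product
  \<open>e\<close> of all these \<open>a\<close> multiplies the whole of \<open>ys\<close> into the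
  span. In the applications \<open>Z\<close> is a prime ideal, or \<open>{\<zero>}\<close> over a
  field.\<close>

lemma free_subfamily:
	assumes D: "subring D R" and N: "dmod D N" and Z: "\<one> ~: Z" "!!a b. [|a : D; b : D; a ** b : Z|] ==> a : Z \<or> b : Z"
		and ZN: "!!z s. z : Z ==> s : RR ==> z ** s : N"
	shows "set ys <= RR ==> EX xs e. set xs <= set ys & e : D & e ~: Z &
		 (ALL cs. length cs = length xs --> set cs <= D --> comb cs xs : N --> set cs <= Z) & (ALL y:set ys. e ** y : msp D N xs)"
proof (induction ys)
	case Nil
	thus ?case using Z(1) subringE(3)[OF D] by (intro exI[of _ "[]"] exI[of _ \<one>]) auto
next
	case (Cons y ys)
	then obtain xs e where xs: "set xs <= set ys" "e : D" "e ~: Z"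
		"!!cs. length cs = length xs ==> set cs <= D ==> comb cs xs : N ==> set cs <= Z" "!!y. y : set ys ==> e ** y : msp D N xs" by auto
	note Dc = subringE(1)[OF D]
	have xsc: "set xs <= RR" and y: "y : RR" and yxc: "set (y # xs) <= RR" using xs(1) Cons.prems by auto
	have ec: "e : RR" using xs(2) Dc by auto
	note V = msp_dmod[OF D N xsc] and L = lin_dmod[OF D xsc]
	show ?case
	proof (cases "EX a cs. a : D & a ~: Z & length cs = length xs & set cs <= D & comb (a # cs) (y # xs) : N")
		case True
		then obtain a cs where a: "a : D" "a ~: Z" "length cs = length xs" "set cs <= D" "a ** y \<oplus> comb cs xs : N" by auto
		have ac: "a : RR" using a(1) Dc by auto
		have cl: "comb cs xs : lin D xs" using a by (auto simp: lin_def)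
		hence cc: "comb cs xs : RR" using dmodD(1)[OF L] by auto
		have "\<ominus> comb cs xs \<oplus> (a ** y \<oplus> comb cs xs) : msp D N xs"
			using dmod_uminus[OF L D cl] a(5) unfolding msp_def by blast
		moreover have "\<ominus> comb cs xs \<oplus> (a ** y \<oplus> comb cs xs) = a ** y" using cc ac y by (simp add: a_comm a_lcomm r_neg)
		ultimately have ay: "a ** y : msp D N xs" by simp
		have "(e ** a) ** z : msp D N xs" if z: "z : set (y # ys)" for z
		proof -
			have zc: "z : RR" using z Cons.prems by auto
			show ?thesis
			proof (cases "z = y")
				case True
				thus ?thesis using dmodD(4)[OF V xs(2) ay] ec ac y by (simp add: m_assoc)
			next
				case False
				hence "a ** (e ** z) : msp D N xs" using dmodD(4)[OF V a(1) xs(5)] z by auto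
				thus ?thesis using ec ac zc by (simp add: m_ac)
			qed
		qed
		thus ?thesis using xs Z(2)[OF xs(2) a(1)] a(1,2) subringE(6)[OF D xs(2) a(1)]
			by (intro exI[of _ xs] exI[of _ "e ** a"] conjI) auto
	next
		case False
		have "set cs <= Z" if cs: "length cs = length (y # xs)" "set cs <= D" "comb cs (y # xs) : N" for cs
		proof -
			obtain a ds where c: "cs = a # ds" using cs(1) by (cases cs) auto
			have aZ: "a : Z" using False cs c by auto
			have cc: "a : RR" "comb ds xs : RR" using cs c Dc comb_closed[OF _ xsc, of ds] by auto
			have "\<ominus> (a ** y) \<oplus> (a ** y \<oplus> comb ds xs) : N"
				using dmodD(3)[OF N dmod_uminus[OF N D ZN[OF aZ y]]] cs(3) c by simp
			hence "comb ds xs : N" using cc y by (simp add: a_assoc[symmetric] l_neg)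
			thus ?thesis using xs(4)[of ds] cs c aZ by auto
		qed
		moreover have "e ** z : msp D N (y # xs)" if z: "z : set (y # ys)" for z
		proof (cases "z = y")
			case True
			thus ?thesis using dmodD(4)[OF msp_dmod[OF D N yxc] xs(2)] msp_gens(1)[OF D N yxc] by auto
		next
			case False
			have "msp D N xs <= msp D N (y # xs)"
				using msp_gens[OF D N yxc] by (intro msp_least[OF msp_dmod[OF D N yxc]]) auto
			thus ?thesis using xs(5) z False by auto
		qed
		ultimately show ?thesis using xs(1-3) by (intro exI[of _ "y # xs"] exI[of _ e] conjI) auto
	qed
qed

text \<open>For a prime \<open>P\<close>, this says that the class of \<open>x\<close> is algebraic
  over the fraction field of the image of \<open>D\<close> modulo \<open>P\<close>. Only the leading
  coefficient must be nonzero modulo \<open>P\<close>.\<close>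

definition algb :: "'a set => 'a set => 'a => bool" where
	"algb D P x \<longleftrightarrow> (EX ds a. set ds <= D & a : D & a ~: P & pev x (ds @ [a]) : P)"

lemma algbI:
	assumes P: "ideal P R" and D: "subring D R" and x: "x : RR" and us: "set us <= D" "\<not> set us <= P" "pev x us : P"
	shows "algb D P x"
proof -
	interpret P: ideal P R by fact
	note Dc = subringE(1)[OF D]
	from pev_strip[OF P x subset_trans[OF us(1) Dc] us(2)]
	obtain ds l q rest where h: "us = ds @ l # rest" "l ~: P" "q : P" "pev x us = pev x (ds @ [l]) \<oplus> q" by blast
	have s: "set ds <= D" "l : D" using h(1) us(1) by auto
	have c: "pev x (ds @ [l]) : RR" "q : RR" using s Dc pev_closed[OF x, of "ds @ [l]"] P.Icarr[OF h(3)] by auto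
	have "pev x (ds @ [l]) = pev x us \<oplus> \<ominus> q" unfolding h(4) using c by (simp add: a_assoc r_neg)
	hence "pev x (ds @ [l]) : P" using P.a_closed[OF us(3) P.a_inv_closed[OF h(3)]] by simp
	thus ?thesis using s h(2) by (auto simp: algb_def)
qed

lemma algb_mono: "algb D P x ==> D <= E ==> algb E P x"
	unfolding algb_def by blast

lemma algb_self:
	assumes P: "primeideal P R" and D: "subring D R" and x: "x : D"
	shows "algb D P x"
proof -
	interpret P: primeideal P R by fact
	have "x : RR" using x subringE(1)[OF D] by auto
	hence "pev x ([\<ominus> x] @ [\<one>]) : P" using P.zero_closed by (simp add: l_neg)
	thus ?thesis using x one_notin_prime[OF P] subringE(3,5)[OF D] unfolding algb_def
		by (intro exI[of _ "[\<ominus> x]"] exI[of _ \<one>]) auto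
qed

lemma transc_not_algb:
	assumes "\<zero> : P" "transc D P x"
	shows "\<not> algb D P x"
proof
	assume "algb D P x"
	then obtain ds a where h: "set (ds @ [a]) <= D" "a ~: P" "pev x (ds @ [a]) : P" by (auto simp: algb_def)
	thus False using transcD[OF assms(2) h(1,3)] assms(1) by simp
qed

lemma power_raise:
	assumes V: "dmod D V" and c: "c : D" "c : RR" and z: "z : RR" "c [^] (N::nat) ** z : V" and NM: "N <= M"
	shows "c [^] M ** z : V"
	using NM
proof (induction M rule: dec_induct)
	case (step M)
	have "c ** (c [^] M ** z) : V" using dmodD(4)[OF V c(1) step.IH] .
	thus ?case using c z by (simp add: m_ac)
qed (use z in simp)

text \<open>The relation expresses \<open>a x^n\<close>, with \<open>n\<close> the length of
  \<open>ds\<close>, by lower powers of \<open>x\<close> modulo \<open>P\<close>. Hence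
  multiplication by \<open>a x\<close> maps the span \<open>V\<close> of the lower powers into
  itself, and a sufficiently high power of \<open>a\<close> brings any polynomial in
  \<open>x\<close> into \<open>V\<close>. The powers are written with a factor \<open>\<one>\<close>
  and an offset \<open>0\<close> to fit \<open>pev_comb_pows\<close>.\<close>

lemma algebraic_powers:
	assumes P: "primeideal P R" and E: "subring E R" and x: "x : RR"
		and a: "set ds <= E" "a : E" "a ~: P" "pev x (ds @ [a]) : P"
	defines "V \<equiv> msp E P (map (%i. \<one> ** x [^] i) [0..<0 + length ds])"
	shows "r : adj E x ==> EX N::nat. a [^] N ** r : V"
proof -
	interpret P: primeideal P R by fact
	note Ec = subringE(1)[OF E]
	let ?pw = "map (%i. \<one> ** x [^] i) [0..<0 + length ds]"
	have pwc: "set ?pw <= RR" using x by auto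
	have PE: "dmod E P" by (rule ideal_dmod[OF P.is_ideal Ec])
	have V: "dmod E V" unfolding V_def by (rule msp_dmod[OF E PE pwc])
	note G = msp_gens[OF E PE pwc, folded V_def]
	have dsc: "set ds <= RR" and ac: "a : RR" using a Ec by auto
	have top: "a ** x [^] length ds : V"
	proof -
		have "comb ds ?pw = pev x ds" using pev_comb_pows[OF x one_closed dsc, of 0] x dsc by simp
		hence "pev x ds : lin E ?pw" using a(1) by (auto simp: lin_def intro!: exI[of _ ds])
		hence l: "pev x ds : V" using G(3) by blast
		have "\<ominus> pev x ds \<oplus> pev x (ds @ [a]) : V" using dmodD(3)[OF V dmod_uminus[OF V E l]] a(4) G(2) by blast
		moreover have "pev x (ds @ [a]) = pev x ds \<oplus> x [^] length ds ** a"
			using pev_append[OF x dsc, of "[a]"] ac x by simp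
		ultimately show ?thesis using x dsc ac by (simp add: a_assoc[symmetric] l_neg m_comm)
	qed
	have shift: "a ** (x ** v) : V" if "v : V" for v
	proof -
		have M: "dmod E {v : RR. a ** (x ** v) : V}"
			using dmod_preimage[OF dmod_preimage[OF V Ec ac] Ec x] by (rule back_subst[of "dmod E"]) (use x in auto)
		have "V <= {v : RR. a ** (x ** v) : V}" unfolding V_def
		proof (rule msp_least[OF M[unfolded V_def]], goal_cases)
			case 1
			have "a ** (x ** (\<one> ** x [^] i)) : V" if i: "i < length ds" for i
			proof (cases "Suc i < length ds")
				case True
				hence "\<one> ** x [^] Suc i : V" using G(1) by force
				hence "a ** (\<one> ** x [^] Suc i) : V" by (rule dmodD(4)[OF V a(2)])
				thus ?thesis using x ac by (simp add: m_comm)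
			next
				case False
				hence "length ds = Suc i" using i by simp
				thus ?thesis using top x ac by (simp add: m_comm)
			qed
			thus ?case using x unfolding V_def by auto
		next
			case 2
			have "a ** (x ** p) : V" if "p : P" for p
				using P.I_l_closed[OF P.I_l_closed[OF that x] ac] G(2) by blast
			thus ?case using P.Icarr unfolding V_def by auto
		qed
		thus ?thesis using that by blast
	qed
	have one: "u : V" if u: "u : E" for u
	proof -
		have "ds ~= []" using a ac x by auto
		hence "\<one> ** x [^] (0::nat) : V" using G(1) by force
		hence "u ** (\<one> ** x [^] (0::nat)) : V" by (rule dmodD(4)[OF V u])
		thus ?thesis using u Ec by auto
	qed
	have "EX N::nat. a [^] N ** pev x us : V" if "set us <= E" for us
		using that
	proof (induction us)
		case Nil
		thus ?case using dmodD(2)[OF V] by (intro exI[of _ 0]) simp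
	next
		case (Cons u us)
		then obtain N :: nat where N: "a [^] N ** pev x us : V" by auto
		have uc: "u : RR" "u : E" "pev x us : RR" using Cons.prems Ec x by auto
		have "a [^] Suc N ** u : V" using dmodD(4)[OF V subring_pow[OF E a(2)] one[OF uc(2)]] .
		hence "a [^] Suc N ** u \<oplus> a ** (x ** (a [^] N ** pev x us)) : V" by (rule dmodD(3)[OF V _ shift[OF N]])
		moreover have "a [^] Suc N ** u \<oplus> a ** (x ** (a [^] N ** pev x us)) = a [^] Suc N ** pev x (u # us)"
			using uc ac x by (simp add: r_distr m_ac)
		ultimately show ?case by metis
	qed
	thus "r : adj E x ==> EX N::nat. a [^] N ** r : V" by (auto simp: adj_def)
qed

text \<open>Finite generation in a tower: if \<open>ws\<close> spans \<open>E\<close> over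
  \<open>D\<close> up to powers of \<open>c\<close>, the products of \<open>vs\<close> and
  \<open>ws\<close> span over \<open>D\<close> what \<open>vs\<close> spans over \<open>E\<close>,
  again up to powers of \<open>c\<close>.\<close>

lemma msp_tower:
	assumes P: "primeideal P R" and D: "subring D R" and E: "subring E R" and ws: "set ws <= RR" and c: "c : D"
		and span: "!!e. e : E ==> EX N::nat. c [^] N ** e : msp D P ws" and vs: "set vs <= RR" and z: "z : msp E P vs"
	shows "EX N::nat. c [^] N ** z : msp D P (concat (map (%v. map (%w. v ** w) ws) vs))"
proof -
	interpret P: primeideal P R by fact
	define pr where "pr = concat (map (%v. map (%w. v ** w) ws) vs)"
	note Dc = subringE(1)[OF D] and Ec = subringE(1)[OF E]
	have cc: "c : RR" using c Dc by auto
	have prc: "set pr <= RR" using ws vs by (auto simp: pr_def)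
	have PD: "dmod D P" by (rule ideal_dmod[OF P.is_ideal Dc])
	note V = msp_dmod[OF D PD prc] and W = msp_dmod[OF D PD ws] and G = msp_gens[OF D PD prc]
	have mult: "v ** w : msp D P pr" if v: "v : set vs" and w: "w : msp D P ws" for v w
	proof -
		have vc: "v : RR" using v vs by auto
		have "msp D P ws <= {w : RR. v ** w : msp D P pr}"
		proof (rule msp_least)
			show "dmod D {w : RR. v ** w : msp D P pr}" by (rule dmod_preimage[OF V Dc vc])
			show "set ws <= {w : RR. v ** w : msp D P pr}" using G(1) v ws by (force simp: pr_def)
			show "P <= {w : RR. v ** w : msp D P pr}" using P.I_l_closed[OF _ vc] P.Icarr G(2) by blast
		qed
		thus ?thesis using w by blast
	qed
	have "EX N::nat. c [^] N ** comb es us : msp D P pr" if "set es <= E" "set us <= set vs" for es us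
		using that
	proof (induction es us rule: comb.induct)
		case (1 e es u us)
		then obtain N :: nat where N: "c [^] N ** comb es us : msp D P pr" by auto
		obtain M :: nat where M: "c [^] M ** e : msp D P ws" using span[of e] 1(2) by auto
		have cl: "e : RR" "u : RR" "comb es us : RR"
			using 1(2,3) Ec vs by (auto intro!: comb_closed)
		have "u ** (c [^] M ** e) : msp D P pr" using mult[OF _ M] 1(3) by auto
		hence M': "c [^] M ** (e ** u) : msp D P pr" using cl cc by (simp add: m_ac)
		let ?K = "max M N"
		have "c [^] ?K ** (e ** u) \<oplus> c [^] ?K ** comb es us : msp D P pr"
			using cl by (intro dmodD(3)[OF V] power_raise[OF V c cc _ M'] power_raise[OF V c cc _ N]) auto
		moreover have "c [^] ?K ** (e ** u) \<oplus> c [^] ?K ** comb es us = c [^] ?K ** comb (e # es) (u # us)"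
			using cl cc by (simp add: r_distr)
		ultimately show ?case by metis
	qed (use dmodD(2)[OF V] in \<open>auto intro!: exI[of _ 0]\<close>)
	moreover obtain es p where h: "set es <= E" "p : P" "z = comb es vs \<oplus> p" using z by (auto simp: msp_def lin_def)
	ultimately obtain N :: nat where N: "c [^] N ** comb es vs : msp D P pr" by blast
	have hc: "comb es vs : RR" "p : RR" using h vs Ec P.Icarr by (auto intro!: comb_closed)
	have "c [^] N ** comb es vs \<oplus> c [^] N ** p : msp D P pr"
		using dmodD(3)[OF V N] P.I_l_closed[OF h(2), of "c [^] N"] G(2) cc by blast
	hence "c [^] N ** z : msp D P pr" using h(3) hc cc by (simp add: r_distr)
	thus ?thesis unfolding pr_def by blast
qed

text \<open>Transitivity by counting. Modulo \<open>P\<close> and up to denominators, all powers of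
  \<open>r\<close> lie in the \<open>D\<close>-span of the finite family \<open>pr\<close> of
  products of powers of \<open>x\<close> and \<open>r\<close>. One common denominator
  \<open>u\<close> is found for \<open>Suc (length pr)\<close> consecutive powers; being one more
  than the members of \<open>pr\<close>, they satisfy a nontrivial linear relation over
  \<open>D\<close>, from which \<open>u\<close> can be cancelled since it lies outside
  \<open>P\<close>.\<close>

lemma algb_trans:
	assumes P: "primeideal P R" and D: "subring D R" and x: "x : RR" "algb D P x" and r: "r : RR" "algb (adj D x) P r"
	shows "algb D P r"
proof -
	interpret P: primeideal P R by fact
	define E where "E = adj D x"
	have E: "subring E R" unfolding E_def by (rule subring_adj[OF D x(1)])
	note Dc = subringE(1)[OF D] and Ec = subringE(1)[OF E]
	have PD: "dmod D P" and PE: "dmod E P" using ideal_dmod[OF P.is_ideal] Dc Ec by auto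
	obtain ds a where a: "set ds <= D" "a : D" "a ~: P" "pev x (ds @ [a]) : P" using x(2) by (auto simp: algb_def)
	obtain es b where b: "set es <= E" "b : E" "b ~: P" "pev r (es @ [b]) : P" using r(2) by (auto simp: algb_def E_def)
	define ws where "ws = map (%i. \<one> ** x [^] i) [0..<0 + length ds]"
	define vs where "vs = map (%i. \<one> ** r [^] i) [0..<0 + length es]"
	define pr where "pr = concat (map (%v. map (%w. v ** w) ws) vs)"
	have wc: "set ws <= RR" and vc: "set vs <= RR" using x r by (auto simp: ws_def vs_def)
	have prc: "set pr <= RR" using wc vc by (auto simp: pr_def)
	have ac: "a : RR" and bc: "b : RR" using a b Dc Ec by auto
	have rE: "r [^] i : adj E r" for i :: nat by (rule subring_pow[OF subring_adj[OF E r(1)] adj_self[OF E r(1)]])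
	note VE = msp_dmod[OF E PE vc] and V = msp_dmod[OF D PD prc]
	have "EX K::nat. ALL i<n. b [^] K ** r [^] i : msp E P vs" for n :: nat
	proof (induction n)
		case (Suc n)
		then obtain K :: nat where K: "ALL i<n. b [^] K ** r [^] i : msp E P vs" by blast
		obtain N :: nat where N: "b [^] N ** r [^] n : msp E P vs"
			using algebraic_powers[OF P E r(1) b rE[of n]] unfolding vs_def by blast
		have "b [^] max K N ** r [^] i : msp E P vs" if "i < Suc n" for i
			using that K N r(1) power_raise[OF VE b(2) bc, of "r [^] i" K "max K N"] power_raise[OF VE b(2) bc, of "r [^] i" N "max K N"]
			by (cases "i = n") auto
		thus ?case by blast
	qed auto
	then obtain K :: nat where K: "ALL i<Suc (length pr). b [^] K ** r [^] i : msp E P vs" by blast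
	have "EX M::nat. ALL i<n. a [^] M ** (b [^] K ** r [^] i) : msp D P pr" if "n <= Suc (length pr)" for n
		using that
	proof (induction n)
		case (Suc n)
		then obtain M :: nat where M: "ALL i<n. a [^] M ** (b [^] K ** r [^] i) : msp D P pr" by auto
		have span: "EX N::nat. a [^] N ** e : msp D P ws" if "e : E" for e
			using algebraic_powers[OF P D x(1) a] that unfolding ws_def E_def by blast
		obtain N :: nat where N: "a [^] N ** (b [^] K ** r [^] n) : msp D P pr"
			using msp_tower[OF P D E wc a(2) span vc, of "b [^] K ** r [^] n"] K Suc.prems unfolding pr_def by auto
		have c: "b [^] K ** r [^] i : RR" for i :: nat using bc r(1) by simp
		have "a [^] max M N ** (b [^] K ** r [^] i) : msp D P pr" if "i < Suc n" for i
			using that M N power_raise[OF V a(2) ac c[of i], of M "max M N"] power_raise[OF V a(2) ac c[of i], of N "max M N"]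
			by (cases "i = n") auto
		thus ?case by blast
	qed auto
	from this[OF order_refl] obtain M :: nat where M: "ALL i<Suc (length pr). a [^] M ** (b [^] K ** r [^] i) : msp D P pr" by blast
	define u where "u = a [^] M ** b [^] K"
	have uc: "u : RR" using ac bc by (simp add: u_def)
	have uP: "u ~: P"
		using P.I_prime[of "a [^] M" "b [^] K"] pow_notin_prime[OF P ac a(3)] pow_notin_prime[OF P bc b(3)] ac bc by (auto simp: u_def)
	let ?vs = "map (%i. u ** r [^] i) [0..<0 + Suc (length pr)]"
	have "EX cs. length cs = length ?vs & set cs <= D & \<not> set cs <= P & comb cs ?vs : P"
	proof (rule nontrivial_relation[OF D one_notin_prime[OF P] _ PD _ prc])
		show "a : P \<or> b : P" if "a : D" "b : D" "a ** b : P" for a b using P.I_prime[of a b] that Dc by auto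
		show "EX w:lin D pr. EX p:P. v = w \<oplus> p" if v: "v : set ?vs" for v
		proof -
			obtain i where i: "i < Suc (length pr)" "v = u ** r [^] i" using v by (auto simp del: upt_Suc)
			hence "v : msp D P pr" using M ac bc r by (auto simp: u_def m_assoc)
			thus ?thesis by (auto simp: msp_def)
		qed
	qed (use P.I_r_closed in auto)
	then obtain cs where cs: "length cs = Suc (length pr)" "set cs <= D" "\<not> set cs <= P" "comb cs ?vs : P" by auto
	have "(u ** r [^] (0::nat)) ** pev r cs : P"
		using pev_comb_pows[OF r(1) uc, of cs 0] cs Dc by auto
	hence "u ** pev r cs : P" using uc by simp
	moreover have "pev r cs : RR" using cs Dc r by auto
	ultimately have "pev r cs : P" using P.I_prime[OF uc] uP by blast
	thus ?thesis by (rule algbI[OF P.is_ideal D r(1) cs(2,3)])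
qed

text \<open>Rewriting a polynomial in \<open>y\<close> over \<open>E[x]\<close> as a polynomial in \<open>x\<close> over \<open>E[y]\<close>.\<close>

lemma pev_swap:
	assumes P: "ideal P R" and E: "subring E R" and x: "x : RR" and y: "y : RR"
	shows "set us <= adj E x ==> EX ess. (ALL e:set ess. set e <= E) & pev y us = pev x (map (pev y) ess) &
		(\<not> set us <= P --> (EX e:set ess. \<not> set e <= P))"
proof (induction us)
	case Nil
	thus ?case by (intro exI[of _ "[]"]) auto
next
	case (Cons u us)
	interpret P: ideal P R by fact
	note Ec = subringE(1)[OF E]
	obtain ess where ess: "ALL e:set ess. set e <= E" "pev y us = pev x (map (pev y) ess)"
		"\<not> set us <= P --> (EX e:set ess. \<not> set e <= P)" using Cons by auto
	obtain cs where cs: "set cs <= E" "u = pev x cs" using Cons.prems by (auto simp: adj_def)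
	have cl: "pev y e : RR" if "set e <= E" for e using that Ec y by (intro pev_closed) auto
	have cls: "pev x (map (pev y) es) : RR" if "ALL e:set es. set e <= E" for es
		using that cl x by (intro pev_closed) auto
	\<comment> \<open>Multiplication by \<open>y\<close> shifts each coefficient polynomial by one
	  place, and the entries of \<open>cs\<close> become the new constant terms. Nothing cancels, so a
	  coefficient outside \<open>P\<close> remains visible.\<close>
	have merge: "EX fss. (ALL e:set fss. set e <= E) & pev x cs \<oplus> y ** pev x (map (pev y) ess) = pev x (map (pev y) fss) &
		 ((EX e:set ess. \<not> set e <= P) --> (EX e:set fss. \<not> set e <= P)) & (\<not> set cs <= P --> (EX e:set fss. \<not> set e <= P))"
		if "set cs <= E" "ALL e:set ess. set e <= E" for cs ess
		using that
	proof (induction cs arbitrary: ess)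
		case Nil
		have "y ** pev x (map (pev y) es) = pev x (map (pev y) (map ((#) \<zero>) es))" if "ALL e:set es. set e <= E" for es
			using that
		proof (induction es)
			case (Cons e es)
			have "pev y e : RR" "pev x (map (pev y) es) : RR" using Cons.prems cl[of e] cls[of es] by auto
			thus ?case using Cons x y by (simp add: r_distr m_lcomm)
		qed (use y in simp)
		from this[OF Nil(2)] show ?case using Nil subringE(2)[OF E] m_closed[OF y cls[OF Nil(2)]]
			by (intro exI[of _ "map ((#) \<zero>) ess"]) auto
	next
		case (Cons c cs)
		define e where "e = (case ess of [] => [] | e # _ => e)"
		define es where "es = tl ess"
		have eE: "set e <= E" "ALL e:set es. set e <= E" using Cons.prems(2) by (cases ess; simp add: e_def es_def)+
		have en: "(EX e:set ess. \<not> set e <= P) ==> \<not> set e <= P \<or> (EX e:set es. \<not> set e <= P)" by (cases ess) (auto simp: e_def es_def)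
		obtain fss where f: "ALL e:set fss. set e <= E" "pev x cs \<oplus> y ** pev x (map (pev y) es) = pev x (map (pev y) fss)"
			"(EX e:set es. \<not> set e <= P) --> (EX e:set fss. \<not> set e <= P)" "\<not> set cs <= P --> (EX e:set fss. \<not> set e <= P)"
			using Cons.IH[OF _ eE(2)] Cons.prems(1) by auto
		have cc: "c : RR" "set cs <= RR" "set e <= RR" "c : E" using Cons.prems(1) eE(1) Ec by auto
		have pc: "pev y e : RR" "pev x (map (pev y) es) : RR" "pev x cs : RR"
			using cc cl[OF eE(1)] cls[OF eE(2)] x by auto
		have h: "pev x (map (pev y) ess) = pev y e \<oplus> x ** pev x (map (pev y) es)"
			using pc x by (cases ess) (auto simp: e_def es_def)
		have "pev x (c # cs) \<oplus> y ** pev x (map (pev y) ess) = (c \<oplus> y ** pev y e) \<oplus> x ** (pev x cs \<oplus> y ** pev x (map (pev y) es))"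
			unfolding h using pc cc x y by (simp add: r_distr m_lcomm a_ac)
		hence "pev x (c # cs) \<oplus> y ** pev x (map (pev y) ess) = pev x (map (pev y) ((c # e) # fss))" using f(2) by simp
		thus ?case using f(1,3,4) en eE(1) cc(4) by (intro exI[of _ "(c # e) # fss"]) auto
	qed
	have "\<not> set cs <= P" if "u ~: P"
	proof
		assume "set cs <= P"
		hence "pev x cs : P" by (induction cs) (auto simp: x P.I_l_closed)
		thus False using that cs(2) by simp
	qed
	moreover obtain fss where f: "ALL e:set fss. set e <= E" "pev x cs \<oplus> y ** pev x (map (pev y) ess) = pev x (map (pev y) fss)"
		"(EX e:set ess. \<not> set e <= P) --> (EX e:set fss. \<not> set e <= P)" "\<not> set cs <= P --> (EX e:set fss. \<not> set e <= P)"
		using merge[OF cs(1) ess(1)] by blast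
	ultimately have "\<not> set (u # us) <= P --> (EX e:set fss. \<not> set e <= P)" using ess(3) by auto
	thus ?case using f(1,2) ess(2) cs(2) by (intro exI[of _ fss]) simp
qed

text \<open>The relation for \<open>y\<close> over \<open>E[x]\<close> is read as a polynomial in
  \<open>x\<close> over \<open>E[y]\<close>. One of its coefficients is a polynomial in
  \<open>y\<close> that is nonzero modulo \<open>P\<close>; its value is outside \<open>P\<close>,
  as otherwise \<open>y\<close> would be algebraic over \<open>E\<close>.\<close>

lemma algb_exchange:
	assumes P: "ideal P R" and E: "subring E R" and x: "x : RR" and y: "y : RR"
		and n: "\<not> algb E P y" and a: "algb (adj E x) P y"
	shows "algb (adj E y) P x"
proof -
	obtain ds b where b: "set ds <= adj E x" "b : adj E x" "b ~: P" "pev y (ds @ [b]) : P" using a by (auto simp: algb_def)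
	have "set (ds @ [b]) <= adj E x" using b by auto
	from pev_swap[OF P E x y this] obtain ess where ess: "ALL e:set ess. set e <= E" "pev y (ds @ [b]) = pev x (map (pev y) ess)"
		"EX e:set ess. \<not> set e <= P" using b(3) by auto
	obtain e where "e : set ess" "\<not> set e <= P" using ess(3) by blast
	hence "\<not> set (map (pev y) ess) <= P" using ess(1) algbI[OF P E y, of e] n by auto
	moreover have "set (map (pev y) ess) <= adj E y" using ess(1) by (auto simp: adj_def)
	ultimately show ?thesis using ess(2) b(4) by (intro algbI[OF P subring_adj[OF E y] x]) auto
qed

text \<open>Generic finiteness: a product \<open>c\<close> of leading coefficients of relations for
  the \<open>xs\<close> is a denominator that makes the whole algebra a finite
  \<open>D\<close>-module modulo \<open>P\<close>.\<close>

lemma generic_span: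
	assumes P: "primeideal P R" and D: "subring D R"
	shows "set xs <= RR ==> (!!x. x : set xs ==> algb D P x) ==>
		EX c ws. c : D & c ~: P & set ws <= RR & (ALL r:adjs D xs. EX N::nat. c [^] N ** r : msp D P ws)"
proof (induction xs)
	case Nil
	interpret P: primeideal P R by fact
	note Dc = subringE(1)[OF D]
	have PD: "dmod D P" by (rule ideal_dmod[OF P.is_ideal Dc])
	have "r : msp D P [\<one>]" if "r : D" for r
		using dmodD(4)[OF msp_dmod[OF D PD] that, of "[\<one>]" \<one>] msp_gens(1)[OF D PD, of "[\<one>]"] that Dc by auto
	hence "ALL r:adjs D []. EX N::nat. \<one> [^] N ** r : msp D P [\<one>]" using Dc by (auto intro!: exI[of _ 0])
	thus ?case using one_notin_prime[OF P] subringE(3)[OF D] by (intro exI[of _ \<one>] exI[of _ "[\<one>]"]) auto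
next
	case (Cons x xs)
	interpret P: primeideal P R by fact
	note Dc = subringE(1)[OF D]
	have x: "x : RR" and xs: "set xs <= RR" using Cons.prems by auto
	obtain c ws where c: "c : D" "c ~: P" "set ws <= RR" "!!r. r : adjs D xs ==> EX N::nat. c [^] N ** r : msp D P ws"
		using Cons by auto
	obtain ds a where a: "set ds <= D" "a : D" "a ~: P" "pev x (ds @ [a]) : P" using Cons.prems(2)[of x] by (auto simp: algb_def)
	note E = subring_adjs[OF D xs] and DE = adjs_incl[OF D xs]
	have cc: "c : RR" "a : RR" using c a Dc by auto
	define vs where "vs = map (%i. \<one> ** x [^] i) [0..<0 + length ds]"
	define pr where "pr = concat (map (%v. map (%w. v ** w) ws) vs)"
	have vc: "set vs <= RR" using x by (auto simp: vs_def)
	have prc: "set pr <= RR" using c(3) vc by (auto simp: pr_def)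
	note V = msp_dmod[OF D ideal_dmod[OF P.is_ideal Dc] prc]
	have "EX N::nat. (c ** a) [^] N ** r : msp D P pr" if r: "r : adj (adjs D xs) x" for r
	proof -
		have rc: "r : RR" using r subringE(1)[OF subring_adj[OF E x]] by blast
		have "set ds <= adjs D xs" "a : adjs D xs" using a DE by auto
		from algebraic_powers[OF P E x this a(3,4) r] obtain N :: nat where N: "a [^] N ** r : msp (adjs D xs) P vs"
			unfolding vs_def by blast
		from msp_tower[OF P D E c(3,1,4) vc N] obtain M :: nat where M: "c [^] M ** (a [^] N ** r) : msp D P pr"
			unfolding pr_def by blast
		have "a [^] M ** (c [^] N ** (c [^] M ** (a [^] N ** r))) : msp D P pr"
			using dmodD(4)[OF V] subring_pow[OF D c(1)] subring_pow[OF D a(2)] M by blast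
		moreover have "a [^] M ** (c [^] N ** (c [^] M ** (a [^] N ** r))) = (c ** a) [^] (M + N) ** r"
			using cc rc by (simp add: nat_pow_distrib nat_pow_mult[symmetric] m_ac)
		ultimately show ?thesis by metis
	qed
	moreover have "c ** a : D" "c ** a ~: P" using subringE(6)[OF D c(1) a(2)] P.I_prime[OF cc] c(2) a(3) by auto
	ultimately show ?case using prc by (intro exI[of _ "c ** a"] exI[of _ pr]) auto
qed

text \<open>Clearing denominators in a relation \<open>h = f r\<close> with respect to a generic basis.\<close>

lemma generic_division:
	assumes P: "primeideal P R" and D: "subring D R" "D \<inter> P <= {\<zero>}" and xs: "set xs <= RR" "adjs D xs = RR"
		and alg: "!!x. x : set xs ==> algb D P x"
	obtains c where "c : D" "c ~: P"
		"!!h f r. h : D ==> f : D ==> r : RR ==> h \<ominus> f ** r : P ==> EX m::nat. EX s:D. c [^] m ** h = f ** s"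
proof -
	interpret P: primeideal P R by fact
	note Dc = subringE(1)[OF D(1)]
	have PD: "dmod D P" by (rule ideal_dmod[OF P.is_ideal Dc])
	obtain c ws where c: "c : D" "c ~: P" "set ws <= RR" "!!r. r : RR ==> EX N::nat. c [^] N ** r : msp D P ws"
		using generic_span[OF P D(1) xs(1) alg] unfolding xs(2) by blast
	have Dp: "a : P \<or> b : P" if "a : D" "b : D" "a ** b : P" for a b using P.I_prime[of a b] that Dc by auto
	obtain vs e where e: "set vs <= set ws" "e : D" "e ~: P"
		 "!!cs. length cs = length vs ==> set cs <= D ==> comb cs vs : P ==> set cs <= P" "!!w. w : set ws ==> e ** w : msp D P vs"
		using free_subfamily[OF D(1) PD one_notin_prime[OF P] Dp P.I_r_closed c(3)] by blast
	have vc: "set vs <= RR" using e(1) c(3) by blast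
	note V = msp_dmod[OF D(1) PD vc]
	have cc: "c : RR" "e : RR" using c e Dc by auto
	define d where "d = c ** e"
	have d: "d : D" "d : RR" "d ~: P" using subringE(6)[OF D(1) c(1) e(2)] cc Dp[OF c(1) e(2)] c(2) e(3) by (auto simp: d_def)
	have eV: "e ** z : msp D P vs" if "z : msp D P ws" for z
	proof -
		have "msp D P ws <= {z : RR. e ** z : msp D P vs}"
		proof (rule msp_least)
			show "dmod D {z : RR. e ** z : msp D P vs}" by (rule dmod_preimage[OF V Dc cc(2)])
			show "set ws <= {z : RR. e ** z : msp D P vs}" using e(5) c(3) by blast
			show "P <= {z : RR. e ** z : msp D P vs}"
				using P.I_l_closed[OF _ cc(2)] P.Icarr msp_gens(2)[OF D(1) PD vc] by blast
		qed
		thus ?thesis using that by blast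
	qed
	have gen: "EX N::nat. d [^] N ** r : msp D P vs" if r: "r : RR" for r
	proof -
		obtain N :: nat where "c [^] N ** r : msp D P ws" using c(4)[OF r] by blast
		hence "c ** (e [^] N ** (e ** (c [^] N ** r))) : msp D P vs"
			using dmodD(4)[OF V] eV subring_pow[OF D(1) e(2)] c(1) by blast
		moreover have "c ** (e [^] N ** (e ** (c [^] N ** r))) = d [^] Suc N ** r"
			using cc r by (simp add: d_def nat_pow_distrib m_ac)
		ultimately show ?thesis by metis
	qed
	show ?thesis
	proof (rule that[OF d(1,3)])
		fix h f r assume h: "h : D" and f: "f : D" and r: "r : RR" and hf: "h \<ominus> f ** r : P"
		have hc: "h : RR" "f : RR" using h f Dc by auto
		have "vs ~= []"
		proof
			assume "vs = []"
			then obtain N :: nat where "d [^] N ** \<one> : P" using gen[OF one_closed] P.Icarr by (auto simp: msp_def)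
			thus False using pow_notin_prime[OF P d(2,3), of N] d(2) by simp
		qed
		\<comment> \<open>Any single basis element \<open>v\<close> will do. Expanding \<open>r v\<close>
		  and comparing the coefficients at \<open>v\<close> in \<open>h v\<close> and
		  \<open>f r v\<close> gives \<open>d^m h = f b\<close> modulo \<open>P\<close>, and both sides
		  lie in \<open>D\<close>, which meets \<open>P\<close> only in \<open>\<zero>\<close>.\<close>
		then obtain v us where vs: "vs = v # us" by (cases vs) auto
		have v: "v : RR" "set us <= RR" using vc vs by auto
		obtain m :: nat where m: "d [^] m ** (r ** v) : msp D P vs" using gen[of "r ** v"] r v by auto
		then obtain cs q where q: "length cs = length vs" "set cs <= D" "q : P" "d [^] m ** (r ** v) = comb cs vs \<oplus> q"
			by (auto simp: msp_def lin_def)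
		obtain b bs where cs: "cs = b # bs" "length bs = length us" using q(1) vs by (cases cs) auto
		have b: "b : D" "set bs <= D" "b : RR" "set bs <= RR" using q(2) cs Dc by auto
		have cb: "comb bs us : RR" using b v by auto
		have qc: "q : RR" using q(3) P.Icarr by auto
		define t where "t = d [^] m ** h \<ominus> f ** b"
		have dm: "d [^] m : D" "d [^] m : RR" using subring_pow[OF D(1) d(1)] d(2) by auto
		have tD: "t : D" unfolding t_def minus_eq using subringE(5,6,7)[OF D(1)] dm(1) h f b(1) by auto
		have "comb (t # map ((\<otimes>) (\<ominus> f)) bs) vs = (d [^] m ** v) ** (h \<ominus> f ** r) \<oplus> f ** q"
		proof -
			have "comb (t # map ((\<otimes>) (\<ominus> f)) bs) vs = t ** v \<ominus> f ** comb bs us"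
				unfolding vs using comb_smult[OF _ b(4) v(2), of "\<ominus> f"] hc cb by (simp add: minus_eq l_minus)
			also have "\<dots> = d [^] m ** h ** v \<ominus> f ** (b ** v \<oplus> comb bs us)"
				unfolding t_def using dm hc b v cb by algebra
			also have "b ** v \<oplus> comb bs us = d [^] m ** (r ** v) \<ominus> q"
				using q(4) cs vs qc cb b v by (simp add: minus_eq a_assoc r_neg)
			also have "d [^] m ** h ** v \<ominus> f ** (d [^] m ** (r ** v) \<ominus> q) = (d [^] m ** v) ** (h \<ominus> f ** r) \<oplus> f ** q"
				using dm hc v r qc by algebra
			finally show ?thesis .
		qed
		hence "comb (t # map ((\<otimes>) (\<ominus> f)) bs) vs : P"
			using P.a_closed[OF P.I_l_closed[OF hf] P.I_l_closed[OF q(3) hc(2)]] dm v by simp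
		moreover have "set (t # map ((\<otimes>) (\<ominus> f)) bs) <= D" using tD b(2) subringE(5,6)[OF D(1)] f by auto
		ultimately have "t : P" using e(4)[of "t # map ((\<otimes>) (\<ominus> f)) bs"] cs vs by auto
		hence "t = \<zero>" using tD D(2) by blast
		hence "d [^] m ** h = f ** b" using dm hc b unfolding t_def by simp
		thus "EX m::nat. EX s:D. d [^] m ** h = f ** s" using b(1) by blast
	qed
qed

end

section \<open>Dimension of finitely generated algebras\<close>

lemma krull_dim_ge_chain:
	"[|!!i. i <= n ==> primeideal (P i) R; !!i. i < n ==> P i \<subset> P (Suc i)|] ==> enat n <= krull_dim R"
	unfolding krull_dim_def by (rule Sup_upper) blast

lemma krull_dim_le:
	assumes "!!n P. [|!!i. i <= n ==> primeideal (P i) R; !!i. i < n ==> P i \<subset> P (Suc i)|] ==> n <= m"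
	shows "krull_dim R <= enat m"
	unfolding krull_dim_def
proof (rule Sup_least)
	fix x assume "x : {enat n | n. EX P :: nat => 'a set. (ALL i<=n. primeideal (P i) R) & (ALL i<n. P i \<subset> P (Suc i))}"
	then obtain n and P :: "nat => 'a set" where "x = enat n" "ALL i<=n. primeideal (P i) R" "ALL i<n. P i \<subset> P (Suc i)" by blast
	thus "x <= enat m" using assms[of n P] by simp
qed

context cring
begin

lemma zero_ideal: "ideal {\<zero>} R"
	by (rule zeroideal)

text \<open>Only the intersection of the ideal with the generated algebra matters: if it is zero, a
  polynomial value in \<open>J\<close> is \<open>\<zero>\<close> and hence also lies in
  \<open>I\<close>.\<close>

lemma indep_transfer:
	assumes "indep D I ys" "\<zero> : I" "adjs D ys \<inter> J <= {\<zero>}" "subring D R" "set ys <= RR"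
	shows "indep D J ys"
	using assms(1,3,5)
proof (induction ys)
	case (Cons y ys)
	have E: "subring (adjs D ys) R" using subring_adjs[OF assms(4)] Cons.prems by auto
	have "adjs D ys <= adjs D (y # ys)" using adj_incl[OF subringE(1)[OF E]] Cons.prems by auto
	hence "indep D J ys" using Cons by auto
	moreover have "transc (adjs D ys) J y" unfolding transc_def
	proof (intro allI impI, elim conjE)
		fix ds assume ds: "set ds <= adjs D ys" "pev y ds : J"
		hence "pev y ds = \<zero>" using Cons.prems(2) by (auto intro!: adjI)
		thus "set ds <= {\<zero>}" using Cons.prems(1) assms(2) ds by (auto simp: transc_def)
	qed
	ultimately show ?case by simp
qed auto

lemma adj_domain:
	assumes E: "subring E R" and dom: "!!a b. a : E ==> b : E ==> a ** b = \<zero> ==> a = \<zero> \<or> b = \<zero>"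
		and t: "transc E {\<zero>} y" and y: "y : RR"
		and ab: "a : adj E y" "b : adj E y" "a ** b = \<zero>"
	shows "a = \<zero> \<or> b = \<zero>"
proof (rule ccontr)
	assume n: "\<not> (a = \<zero> \<or> b = \<zero>)"
	have Ec: "E <= RR" using subringE(1)[OF E] .
	have *: "EX as a'. set as <= E & a' : E & a' ~= \<zero> & a = pev y (as @ [a'])" if a: "a : adj E y" "a ~= \<zero>" for a
	proof -
		obtain us where us: "set us <= E" "a = pev y us" using a by (auto simp: adj_def)
		hence "\<not> set us <= {\<zero>}" using a y by auto
		from pev_strip[OF zero_ideal y subset_trans[OF us(1) Ec] this]
		obtain ds' l q rest where h: "us = ds' @ l # rest" "l ~= \<zero>" "q : {\<zero>}" "pev y us = pev y (ds' @ [l]) \<oplus> q" by blast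
		have "set (ds' @ [l]) <= RR" using h(1) us Ec by auto
		hence "a = pev y (ds' @ [l])" using h us y by simp
		thus ?thesis using h us by (intro exI[of _ ds'] exI[of _ l]) auto
	qed
	obtain as a' bs b' where h: "set as <= E" "a' : E" "a' ~= \<zero>" "a = pev y (as @ [a'])"
		 "set bs <= E" "b' : E" "b' ~= \<zero>" "b = pev y (bs @ [b'])"
		using *[OF ab(1)] *[OF ab(2)] n by blast
	obtain us where us: "set us <= E" "a ** b = pev y (us @ [a' ** b'])"
		using pev_mult_last[OF E y h(2,6,5,1)] h(4,8) by auto
	have "set (us @ [a' ** b']) <= {\<zero>}"
		using us ab(3) h(2,6) subringE(6)[OF E] by (intro transcD[OF t]) auto
	thus False using dom[of a' b'] h by auto
qed

end

context subfield_cring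
begin

lemma adjs_domain:
	"set ys <= RR ==> indep k {\<zero>} ys ==> a : adjs k ys ==> b : adjs k ys ==> a ** b = \<zero> ==> a = \<zero> \<or> b = \<zero>"
proof (induction ys arbitrary: a b)
	case Nil
	thus ?case using subfieldE(5)[OF subfield_k] by auto
next
	case (Cons y ys)
	show ?case
		by (rule adj_domain[of "adjs k ys" y]) (use Cons subring_adjs[OF k_subring, of ys] in auto)
qed

text \<open>One step up a prime chain at the cost of one independent element. With
  \<open>D0 = k[y, ys]\<close> and a generic denominator \<open>c\<close> for the ring over
  \<open>D0\<close>, the element \<open>f = 1 + y c\<close> is added to \<open>Q\<close>. It has
  positive degree in \<open>y\<close>, so its multiples in \<open>D0\<close> avoid the nonzero
  elements of \<open>B = k[ys]\<close>; being coprime to \<open>c\<close>, it still avoids them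
  after denominators are cleared. A prime over \<open>Q\<close> and \<open>f\<close> that avoids
  \<open>B - {\<zero>}\<close> then exists.\<close>

lemma indep_extend_prime_algebraic:
	assumes gens: "set gens <= RR" "adjs k gens = RR"
		and Q: "primeideal Q R" and ys: "set (y # ys) <= RR" "indep k Q (y # ys)"
		and alg: "!!x. x : set gens ==> algb (adjs k (y # ys)) Q x"
	shows "EX Q'. primeideal Q' R & Q \<subset> Q' & indep k Q' ys"
proof -
	interpret Q: primeideal Q R by fact
	define B where "B = adjs k ys"
	define D0 where "D0 = adj B y"
	have y: "y : RR" "set ys <= RR" using ys by auto
	have B: "subring B R" unfolding B_def by (rule subring_adjs[OF k_subring y(2)])
	have D0: "subring D0 R" unfolding D0_def by (rule subring_adj[OF B y(1)])
	have D0e: "D0 = adjs k (y # ys)" by (simp add: D0_def B_def)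
	have Bc: "B <= RR" and D0c: "D0 <= RR" using B D0 subringE(1) by auto
	have BD: "B <= D0" unfolding D0_def by (rule adj_incl[OF Bc y(1)])
	have yD: "y : D0" unfolding D0_def by (rule adj_self[OF B y(1)])
	have t: "transc B Q y" using ys by (simp add: B_def)
	have D0Q: "D0 \<inter> Q <= {\<zero>}" unfolding D0e using indep_inter[OF ys(2) k_inter_prime[OF Q] k_subring ys(1)] .
	have full: "adjs D0 gens = RR"
	proof
		show "adjs D0 gens <= RR" using subringE(1)[OF subring_adjs[OF D0 gens(1)]] .
		have "k <= D0" unfolding D0e by (rule adjs_incl[OF k_subring ys(1)])
		thus "RR <= adjs D0 gens"
			using adjs_least[OF subring_adjs[OF D0 gens(1)], of k gens] adjs_incl[OF D0 gens(1)] adjs_self[OF D0 gens(1)] gens(2)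
			by auto
	qed
	obtain c where c: "c : D0" "c ~: Q"
		"!!h f r. h : D0 ==> f : D0 ==> r : RR ==> h \<ominus> f ** r : Q ==> EX m::nat. EX s:D0. c [^] m ** h = f ** s"
		using generic_division[OF Q D0 D0Q gens(1) full] alg unfolding D0e by metis
	obtain cs where cs: "set cs <= B" "c = pev y cs" using c(1) by (auto simp: D0_def adj_def)
	define f where "f = \<one> \<oplus> y ** c"
	have f: "f = pev y (\<one> # cs)" using cs by (simp add: f_def)
	have oneB: "\<one> : B" using subringE(3)[OF B] .
	have fD: "f : D0" unfolding f D0_def using cs oneB by (intro adjI) auto
	have cc: "c : RR" "f : RR" using c fD D0c by auto
	have fQ: "f ~: Q"
	proof
		assume "f : Q"
		hence "set (\<one> # cs) <= {\<zero>}" using cs oneB f by (intro transcD[OF t]) auto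
		thus False using one_not_zero by simp
	qed
	have strip: "EX as a'. set as <= B & a' : B & a' ~= \<zero> & pev y us = pev y (as @ [a']) & length as < length us"
		if us: "set us <= B" "\<not> set us <= {\<zero>}" for us
	proof -
		from pev_strip[OF zero_ideal y(1) subset_trans[OF us(1) Bc] us(2)]
		obtain ds' l q rest where h: "us = ds' @ l # rest" "l ~= \<zero>" "q : {\<zero>}" "pev y us = pev y (ds' @ [l]) \<oplus> q" by blast
		have "set (ds' @ [l]) <= RR" using h(1) us Bc by auto
		hence "pev y us = pev y (ds' @ [l])" using h y by simp
		thus ?thesis using h us by (intro exI[of _ ds'] exI[of _ l]) auto
	qed
	let ?J = "{q \<oplus> f ** r | q r. q : Q & r : RR}"
	have disj: "?J \<inter> (B - {\<zero>}) = {}"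
	proof (rule ccontr)
		assume "\<not> ?thesis"
		then obtain h q r where h: "h : B" "h ~= \<zero>" "h = q \<oplus> f ** r" "q : Q" "r : RR" by blast
		have hD: "h : D0" and hc: "h : RR" using h BD Bc by auto
		have qc: "q : RR" using h Q.Icarr by auto
		have "h \<ominus> f ** r = q" unfolding h(3) using qc cc h(5) by algebra
		then obtain m :: nat where "EX s:D0. c [^] m ** h = f ** s" using c(3)[OF hD fD h(5)] h(4) by blast
		\<comment> \<open>Since \<open>f - y c = 1\<close>, the factors \<open>c\<close> can be removed
		  one by one, each time at the cost of a new cofactor \<open>s\<close>.\<close>
		hence "EX s:D0. h = f ** s"
		proof (induction m)
			case 0
			thus ?case using hc by auto
		next
			case (Suc m)
			then obtain s where s: "s : D0" "c [^] Suc m ** h = f ** s" by auto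
			have sc: "s : RR" "c [^] m : RR" using s D0c cc by auto
			have cm: "c [^] m ** h : D0" using subring_pow[OF D0 c(1)] hD subringE(6)[OF D0] by auto
			have "c [^] m ** h = (f \<ominus> y ** c) ** (c [^] m ** h)" unfolding f_def using cc sc y hc by algebra
			also have "\<dots> = f ** (c [^] m ** h) \<ominus> y ** (c [^] Suc m ** h)" using cc sc y hc by (simp, algebra)
			also have "\<dots> = f ** (c [^] m ** h \<ominus> y ** s)" unfolding s(2) using cc sc y hc by algebra
			finally have "EX s:D0. c [^] m ** h = f ** s" using cm yD s subringE[OF D0] by (intro bexI[of _ "c [^] m ** h \<ominus> y ** s"]) (auto simp: minus_eq)
			thus ?case by (rule Suc.IH)
		qed
		then obtain s ss where s: "s : D0" "h = f ** s" "set ss <= B" "s = pev y ss" by (auto simp: D0_def adj_def)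
		have "\<not> set ss <= {\<zero>}" using s h y cc by auto
		then obtain ds l where dl: "set ds <= B" "l : B" "l ~= \<zero>" "pev y ss = pev y (ds @ [l])" using strip[OF s(3)] by blast
		have "\<not> set cs <= {\<zero>}" using cs c(2) y Q.zero_closed by auto
		then obtain as a where a: "set as <= B" "a : B" "a ~= \<zero>" "pev y cs = pev y (as @ [a])" using strip[OF cs(1)] by blast
		have f2: "f = pev y ((\<one> # as) @ [a])" using f a(4) by simp
		have "set (\<one> # as) <= B" using a oneB by auto
		from pev_mult_last[OF B y(1) a(2) dl(2) dl(1) this]
		obtain us where us: "set us <= B" "length us = Suc (length as) + length ds" "h = pev y (us @ [a ** l])"
			using s dl f2 by auto
		\<comment> \<open>The list is nonempty because \<open>f\<close> has degree at least one in
		  \<open>y\<close>. Subtracting \<open>h\<close> from the constant term therefore leaves the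
		  leading coefficient \<open>a l\<close> in place, and transcendence of \<open>y\<close> forces it
		  to vanish.\<close>
		obtain u us' where u: "us = u # us'" using us by (cases us) auto
		have uc: "u : RR" "set (us' @ [a ** l]) <= RR" using us u a dl Bc subringE(6)[OF B] by auto
		have "pev y ((u \<ominus> h) # us' @ [a ** l]) = h \<ominus> h"
		proof -
			have pc: "pev y (us' @ [a ** l]) : RR" using uc y by auto
			have "h = u \<oplus> y ** pev y (us' @ [a ** l])" using us u by simp
			thus ?thesis using pc uc y hc by (simp, algebra)
		qed
		hence "pev y ((u \<ominus> h) # us' @ [a ** l]) : Q" using hc Q.zero_closed by (simp add: minus_eq r_neg)
		moreover have "set ((u \<ominus> h) # us' @ [a ** l]) <= B" using us u h a dl subringE[OF B] by (auto simp: minus_eq)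
		ultimately have "a ** l = \<zero>" using transcD[OF t, of "(u \<ominus> h) # us' @ [a ** l]"] by auto
		hence "a : Q \<or> l : Q" using Q.I_prime[of a l] a dl Bc Q.zero_closed by auto
		thus False using a dl BD D0Q by blast
	qed
	have "EX Q'. primeideal Q' R & ?J <= Q' & Q' \<inter> (B - {\<zero>}) = {}"
	proof (rule primeideal_avoiding[OF ideal_extend(1)[OF Q.is_ideal cc(2)] _ _ _ disj])
		show "a ** b : B - {\<zero>}" if "a : B - {\<zero>}" "b : B - {\<zero>}" for a b
		proof -
			have "a : Q \<or> b : Q" if "a ** b = \<zero>"
				using Q.I_prime[of a b] \<open>a : B - {\<zero>}\<close> \<open>b : B - {\<zero>}\<close> that Bc Q.zero_closed by auto
			thus ?thesis using that BD D0Q subringE(6)[OF B] by blast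
		qed
	qed (use Bc oneB one_not_zero in auto)
	then obtain Q' where Q': "primeideal Q' R" "?J <= Q'" "Q' \<inter> (B - {\<zero>}) = {}" by blast
	have "Q <= Q'" "f : Q'" using Q'(2) ideal_extend(2,3)[OF Q.is_ideal cc(2)] by (blast, blast)
	moreover have "indep k Q' ys"
	proof (rule indep_transfer[of _ Q])
		show "indep k Q ys" using ys by simp
		show "adjs k ys \<inter> Q' <= {\<zero>}" using Q'(3) by (auto simp: B_def)
	qed (use k_subring y Q.zero_closed in auto)
	ultimately show ?thesis using Q'(1) fQ by blast
qed

text \<open>Completing \<open>y # ys\<close> by some of the generators to a transcendence basis
  modulo \<open>Q\<close> makes the ring algebraic over the generated algebra. The previous lemma
  then sacrifices the head of the completed list, and \<open>ys\<close> stays independent whether or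
  not that head is \<open>y\<close>.\<close>

lemma indep_extend_prime:
	assumes gens: "set gens <= RR" "adjs k gens = RR"
		and Q: "primeideal Q R" and ys: "set (y # ys) <= RR" "indep k Q (y # ys)"
	shows "EX Q'. primeideal Q' R & Q \<subset> Q' & indep k Q' ys"
proof -
	interpret Q: primeideal Q R by fact
	have "EX zs. set zs <= RR & indep k Q (zs @ y # ys) & (ALL x:set xs. algb (adjs k (zs @ y # ys)) Q x)"
		if "set xs <= RR" for xs
		using that
	proof (induction xs)
		case Nil
		thus ?case using ys by (intro exI[of _ "[]"]) auto
	next
		case (Cons x xs)
		then obtain zs where zs: "set zs <= RR" "indep k Q (zs @ y # ys)" "ALL x:set xs. algb (adjs k (zs @ y # ys)) Q x" by auto
		have c: "set (zs @ y # ys) <= RR" "x : RR" using zs(1) ys(1) Cons.prems by auto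
		note D = subring_adjs[OF k_subring c(1)]
		show ?case
		proof (cases "transc (adjs k (zs @ y # ys)) Q x")
			case True
			have "algb (adjs k ((x # zs) @ y # ys)) Q z" if "z : set (x # xs)" for z
				using that zs(3) algb_mono[OF _ adj_incl[OF subringE(1)[OF D] c(2)]]
					algb_self[OF Q subring_adj[OF D c(2)] adj_self[OF D c(2)]] by auto
			thus ?thesis using zs(1,2) c(2) True by (intro exI[of _ "x # zs"]) auto
		next
			case False
			then obtain us where us: "set us <= adjs k (zs @ y # ys)" "pev x us : Q" "\<not> set us <= {\<zero>}" by (auto simp: transc_def)
			have "adjs k (zs @ y # ys) \<inter> Q <= {\<zero>}" by (rule indep_inter[OF zs(2) k_inter_prime[OF Q] k_subring c(1)])
			hence "\<not> set us <= Q" using us by blast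
			from algbI[OF Q.is_ideal D c(2) us(1) this us(2)] show ?thesis using zs by (intro exI[of _ zs]) auto
		qed
	qed
	from this[OF gens(1)] obtain zs where zs: "set zs <= RR" "indep k Q (zs @ y # ys)"
		"!!x. x : set gens ==> algb (adjs k (zs @ y # ys)) Q x" by blast
	show ?thesis
	proof (cases zs)
		case Nil
		thus ?thesis using indep_extend_prime_algebraic[OF gens Q ys] zs(3) by simp
	next
		case (Cons z zs')
		then obtain Q' where "primeideal Q' R" "Q \<subset> Q'" "indep k Q' (zs' @ y # ys)"
			using indep_extend_prime_algebraic[OF gens Q, of z "zs' @ y # ys"] zs ys(1) by auto
		thus ?thesis by (auto simp: indep_append)
	qed
qed

lemma indep_prime_chain:
	assumes gens: "set gens <= RR" "adjs k gens = RR"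
	shows "primeideal Q R ==> set ys <= RR ==> indep k Q ys ==>
		EX P. P 0 = Q & (ALL i<=length ys. primeideal (P i) R) & (ALL i<length ys. P i \<subset> P (Suc i))"
proof (induction ys arbitrary: Q)
	case Nil
	thus ?case by (intro exI[of _ "%_. Q"]) auto
next
	case (Cons y ys)
	obtain Q' where Q': "primeideal Q' R" "Q \<subset> Q'" "indep k Q' ys"
		using indep_extend_prime[OF gens Cons.prems] by blast
	obtain P where P: "P 0 = Q'" "!!i. i <= length ys ==> primeideal (P i) R" "!!i. i < length ys ==> P i \<subset> P (Suc i)"
		using Cons.IH[OF Q'(1) _ Q'(3)] Cons.prems by auto
	show ?case
	proof (intro exI[of _ "case_nat Q P"] conjI allI impI)
		show "primeideal (case_nat Q P i) R" if "i <= length (y # ys)" for i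
			using that P Cons.prems by (cases i) auto
		show "case_nat Q P i \<subset> case_nat Q P (Suc i)" if "i < length (y # ys)" for i
			using that P Q' by (cases i) auto
	qed auto
qed

text \<open>The algebra generated by \<open>ys\<close> is a domain, so some prime avoids its nonzero
  elements. Modulo this prime \<open>ys\<close> is still independent, and the chain is grown from
  there. The ambient ring may have zero divisors.\<close>

lemma krull_dim_ge_indep:
	assumes gens: "set gens <= RR" "adjs k gens = RR"
		and ys: "set ys <= RR" "indep k {\<zero>} ys"
	shows "enat (length ys) <= krull_dim R"
proof -
	have A: "subring (adjs k ys) R" by (rule subring_adjs[OF k_subring ys(1)])
	have "EX Q. primeideal Q R & {\<zero>} <= Q & Q \<inter> (adjs k ys - {\<zero>}) = {}"
	proof (rule primeideal_avoiding[OF zero_ideal])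
		show "a ** b : adjs k ys - {\<zero>}" if "a : adjs k ys - {\<zero>}" "b : adjs k ys - {\<zero>}" for a b
			using adjs_domain[OF ys, of a b] subringE(6)[OF A, of a b] that by blast
	qed (use subringE(1,3)[OF A] one_not_zero in auto)
	then obtain Q where Q: "primeideal Q R" "Q \<inter> (adjs k ys - {\<zero>}) = {}" by blast
	have "indep k Q ys" by (rule indep_transfer[OF ys(2)]) (use Q k_subring ys in auto)
	from indep_prime_chain[OF gens Q(1) ys(1) this] show ?thesis
		using krull_dim_ge_chain by blast
qed

text \<open>Steinitz exchange for algebraic dependence modulo a prime.\<close>

lemma exchange_length:
	assumes P: "primeideal P R"
	shows "set ys <= RR ==> set xs <= RR ==> set zs <= RR ==> indep k P (ys @ zs) ==>
		(!!r. r : RR ==> algb (adjs k (xs @ zs)) P r) ==> length ys <= length xs"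
proof (induction ys arbitrary: xs zs rule: rev_induct)
	case (snoc y ys)
	interpret P: primeideal P R by fact
	have y: "y : RR" using snoc.prems by auto
	have sub: "subring (adjs k vs) R" if "set vs <= RR" for vs by (rule subring_adjs[OF k_subring that])
	have mono: "adjs k us <= adjs k vs" if "set us <= set vs" "set vs <= RR" for us vs
		using that adjs_incl[OF k_subring that(2)] adjs_self[OF k_subring that(2)] by (intro adjs_least[OF sub]) auto
	have "indep k P (y # zs)" using snoc.prems(4) by (simp add: indep_append)
	hence n: "\<not> algb (adjs k zs) P y" using transc_not_algb[OF P.zero_closed] by simp
	\<comment> \<open>Elements of \<open>xs\<close> are adjoined from the right until \<open>y\<close>
	  becomes algebraic; \<open>x\<close> is the element at which this happens, and by exchange
	  \<open>y\<close> can take its place.\<close>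
	have "EX us x vs. xs = us @ x # vs & \<not> algb (adjs k (vs @ zs)) P y & algb (adjs k (x # vs @ zs)) P y"
		if "algb (adjs k (xs @ zs)) P y" for xs
		using that
	proof (induction xs)
		case (Cons x xs)
		show ?case
		proof (cases "algb (adjs k (xs @ zs)) P y")
			case True
			then obtain us x' vs where "xs = us @ x' # vs & \<not> algb (adjs k (vs @ zs)) P y & algb (adjs k (x' # vs @ zs)) P y"
				using Cons.IH by blast
			thus ?thesis by (intro exI[of _ "x # us"]) auto
		next
			case False
			thus ?thesis using Cons.prems by (intro exI[of _ "[]"]) auto
		qed
	qed (use n in simp)
	then obtain us x vs where h: "xs = us @ x # vs" "\<not> algb (adjs k (vs @ zs)) P y" "algb (adjs k (x # vs @ zs)) P y"
		using snoc.prems(5)[OF y] by blast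
	have c: "x : RR" "set us <= RR" "set vs <= RR" "set (vs @ zs) <= RR" "set ((us @ vs) @ y # zs) <= RR"
		"set (x # (us @ vs) @ y # zs) <= RR"
		using snoc.prems(2,3) h(1) y by auto
	have "algb (adjs k (y # vs @ zs)) P x"
		using algb_exchange[OF P.is_ideal sub[OF c(4)] c(1) y h(2)] h(3) by simp
	hence x: "algb (adjs k ((us @ vs) @ y # zs)) P x" by (rule algb_mono) (rule mono[OF _ c(5)], auto)
	have "algb (adjs k ((us @ vs) @ y # zs)) P r" if r: "r : RR" for r
	proof (rule algb_trans[OF P sub[OF c(5)] c(1) x r])
		have "adjs k (xs @ zs) <= adjs k (x # (us @ vs) @ y # zs)" by (rule mono[OF _ c(6)]) (use h(1) in auto)
		thus "algb (adj (adjs k ((us @ vs) @ y # zs)) x) P r" using algb_mono[OF snoc.prems(5)[OF r]] by simp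
	qed
	hence "length ys <= length (us @ vs)"
		using snoc.prems c y by (intro snoc.IH[of "us @ vs" "y # zs"]) auto
	thus ?case using h(1) by simp
qed simp

lemma indep_length_le_gens:
	assumes gens: "set gens <= RR" "adjs k gens = RR"
		and P: "primeideal P R" and ys: "set ys <= RR" "indep k P ys"
	shows "length ys <= length gens"
	using exchange_length[OF P ys(1) gens(1), of "[]"] ys(2) gens(2) algb_self[OF P carrier_is_subring] by simp

text \<open>A chain of primes gives as many elements independent modulo its bottom prime, and
  exchange bounds their number by that of the generators.\<close>

lemma krull_dim_le_gens:
	assumes gens: "set gens <= RR" "adjs k gens = RR"
	shows "krull_dim R <= enat (length gens)"
proof (rule krull_dim_le)
	fix n P assume P: "!!i. i <= n ==> primeideal (P i) R" "!!i. i < n ==> P i \<subset> P (Suc i)"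
	have "EX xs. set xs <= RR & length xs = n & indep k (P 0) (xs @ []) & k \<inter> P 0 <= {\<zero>}"
		using k_inter_prime[OF P(1), of n] by (intro prime_chain_indep[of n P, OF P k_subring]) auto
	then obtain xs where "set xs <= RR" "length xs = n" "indep k (P 0) xs" by auto
	thus "n <= length gens" using indep_length_le_gens[OF gens P(1), of 0 xs] by auto
qed

text \<open>A proper relation between the generators lowers the transcendence degree.\<close>

lemma indep_gens:
	assumes gens: "set gens <= RR" "adjs k gens = RR"
		and P: "primeideal P R" and ys: "set ys <= RR" "indep k P ys" and len: "length gens <= length ys"
	shows "indep k P gens"
proof (rule ccontr)
	interpret P: primeideal P R by fact
	assume n: "\<not> indep k P gens"
	have "EX us z zs. gens = us @ z # zs & indep k P zs & \<not> transc (adjs k zs) P z"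
		if "\<not> indep k P gens" for gens using that
	proof (induction gens)
		case (Cons g gens)
		show ?case
		proof (cases "indep k P gens")
			case True
			thus ?thesis using Cons.prems by (intro exI[of _ "[]"]) auto
		next
			case False
			then obtain us z zs where "gens = us @ z # zs & indep k P zs & \<not> transc (adjs k zs) P z" using Cons by blast
			thus ?thesis by (intro exI[of _ "g # us"]) auto
		qed
	qed auto
	then obtain us z zs where h: "gens = us @ z # zs" "indep k P zs" "\<not> transc (adjs k zs) P z" using n by blast
	have c: "z : RR" "set zs <= RR" "set us <= RR" using gens h by auto
	have A: "subring (adjs k zs) R" by (rule subring_adjs[OF k_subring c(2)])
	have AP: "adjs k zs \<inter> P <= {\<zero>}" by (rule indep_inter[OF h(2) k_inter_prime[OF P] k_subring c(2)])
	obtain ds where ds: "set ds <= adjs k zs" "pev z ds : P" "\<not> set ds <= {\<zero>}" using h(3) by (auto simp: transc_def)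
	from pev_strip[OF zero_ideal c(1) subset_trans[OF ds(1) subringE(1)[OF A]] ds(3)]
	obtain ds' l q rest where l: "ds = ds' @ l # rest" "l ~= \<zero>" "q : {\<zero>}" "pev z ds = pev z (ds' @ [l]) \<oplus> q" by blast
	have lc: "set (ds' @ [l]) <= RR" "l : adjs k zs" "set ds' <= adjs k zs" using l ds subringE(1)[OF A] by auto
	have rel: "pev z (ds' @ [l]) : P" using l ds lc c by simp
	have sub: "adjs k zs <= adjs k (us @ zs)"
	proof -
		have "subring (adjs k (us @ zs)) R" using c by (intro subring_adjs[OF k_subring]) auto
		thus ?thesis using adjs_least[of "adjs k (us @ zs)" k zs] adjs_incl[OF k_subring, of "us @ zs"] adjs_self[OF k_subring, of "us @ zs"] c
			by auto
	qed
	have U: "set (us @ zs) <= RR" using c by auto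
	have z: "algb (adjs k (us @ zs)) P z"
		using rel lc l sub AP unfolding algb_def by (intro exI[of _ ds'] exI[of _ l]) auto
	have "length ys <= length (us @ zs)"
	proof (rule exchange_length[OF P ys(1) U, of "[]"])
		fix r assume r: "r : RR"
		have "adjs k (z # us @ zs) = adjs k gens" using c h by (intro adjs_cong_set[OF k_subring]) auto
		hence "algb (adj (adjs k (us @ zs)) z) P r" using gens(2) algb_self[OF P carrier_is_subring r] by simp
		from algb_trans[OF P subring_adjs[OF k_subring U] c(1) z r this]
		show "algb (adjs k ((us @ zs) @ [])) P r" by simp
	qed (use ys in auto)
	thus False using len h by simp
qed

end

section \<open>Hilbert's basis theorem for subrings\<close>

context cring
begin

definition noeth :: "'a set => bool" where
	"noeth D \<longleftrightarrow> (ALL I. dmod D I & I <= D --> (EX vs. set vs <= I & I <= lin D vs))"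

lemma pev_add_same:
	assumes D: "subring D R" and x: "x : RR" and c: "c : D" "c' : D"
	shows "length ds = length es ==> set ds <= D ==> set es <= D ==>
		EX us. set us <= D & length us = length ds & pev x (ds @ [c]) \<oplus> pev x (es @ [c']) = pev x (us @ [c \<oplus> c'])"
proof (induction ds es rule: list_induct2)
	case Nil
	have "c : RR" "c' : RR" using c subringE(1)[OF D] by auto
	thus ?case using x by (intro exI[of _ "[]"]) auto
next
	case (Cons d ds e es)
	then obtain us where us: "set us <= D" "length us = length ds" "pev x (ds @ [c]) \<oplus> pev x (es @ [c']) = pev x (us @ [c \<oplus> c'])" by auto
	have "set (ds @ [c]) <= RR" "set (es @ [c']) <= RR" "d : RR" "e : RR"
		using Cons.prems c subringE(1)[OF D] by auto
	hence "pev x (ds @ [c]) : RR" "pev x (es @ [c']) : RR" "d : RR" "e : RR"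
		using x by auto
	hence "pev x ((d # ds) @ [c]) \<oplus> pev x ((e # es) @ [c']) = (d \<oplus> e) \<oplus> x ** (pev x (ds @ [c]) \<oplus> pev x (es @ [c']))"
		using x by (simp, algebra)
	thus ?case using us Cons.prems subringE(7)[OF D] by (intro exI[of _ "(d \<oplus> e) # us"]) auto
qed

lemma pev_replicate_zero:
	"x : RR ==> set ds <= RR ==> pev x (replicate n \<zero> @ ds) = x [^] n ** pev x ds"
proof (induction n)
	case (Suc n)
	have "pev x ds : RR" "x [^] n : RR" using Suc.prems by auto
	hence "x ** (x [^] n ** pev x ds) = (x [^] n ** x) ** pev x ds" using Suc.prems by algebra
	thus ?case using Suc by simp
qed auto

text \<open>If all \<open>F w\<close> have the same formal degree \<open>n\<close>, a combination of
  the leading coefficients \<open>w\<close> lifts to the same combination of the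
  polynomials.\<close>

lemma lin_lift_leading:
	assumes D: "subring D R" and x: "x : RR" and E: "E = adj D x"
		and F: "!!w. w : set W ==> F w : RR & (EX us. set us <= D & length us = n & F w = pev x (us @ [w]))"
		and W: "set W <= D" and d: "d : lin D W"
	shows "EX us. set us <= D & length us = n & pev x (us @ [d]) : lin E (map F W)"
	using F W d
proof (induction W arbitrary: d)
	case Nil
	have "pev x (replicate n \<zero> @ [\<zero>]) = \<zero>" using x by (intro pev_zero) auto
	thus ?case using Nil subringE(2)[OF D] by (intro exI[of _ "replicate n \<zero>"]) auto
next
	case (Cons w W)
	have Dc: "D <= RR" using subringE(1)[OF D] .
	obtain c d' where d: "c : D" "d' : lin D W" "d = c ** w \<oplus> d'" using Cons.prems unfolding lin_Cons by auto
	obtain us where us: "set us <= D" "length us = n" "pev x (us @ [d']) : lin E (map F W)"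
		using Cons.IH[OF _ _ d(2)] Cons.prems(1,2) unfolding list.set insert_subset by blast
	obtain vs where vs: "set vs <= D" "length vs = n" "F w = pev x (vs @ [w])" using Cons.prems(1)[of w] by auto
	have c: "c : RR" "w : D" using d Dc Cons.prems by auto
	have d'D: "d' : D" using lin_least[OF subring_dmod[OF D], of W] Cons.prems d(2) by auto
	have "set (vs @ [w]) <= RR" using vs c Dc by auto
	hence s: "c ** F w = pev x (map ((\<otimes>) c) vs @ [c ** w])" using vs pev_smult[OF x, of "vs @ [w]" c] c by simp
	have cD: "set (map ((\<otimes>) c) vs) <= D" "c ** w : D" using vs d(1) c subringE(6)[OF D] by auto
	obtain ws where ws: "set ws <= D" "length ws = n" "c ** F w \<oplus> pev x (us @ [d']) = pev x (ws @ [d])"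
		using pev_add_same[OF D x cD(2) d'D _ cD(1) us(1)] us vs unfolding s d(3) by auto
	have "c : E" using d(1) adj_incl[OF Dc x] E by auto
	hence "c ** F w \<oplus> pev x (us @ [d']) : lin E (map F (w # W))" using us(3) by (auto simp: lin_Cons)
	thus ?case using ws by (intro exI[of _ ws]) auto
qed

text \<open>Hilbert's argument with the ideals \<open>L n\<close> of leading coefficients in degree
  \<open>n\<close>, which increase by multiplication with \<open>x\<close>. Degrees and leading
  coefficients belong to the lists, not to the elements: \<open>x\<close> may be algebraic over
  \<open>D\<close>, and an element may have many lists.\<close>

lemma noeth_adj:
	assumes D: "subring D R" and N: "noeth D" and x: "x : RR"
	shows "noeth (adj D x)"
	unfolding noeth_def
proof (intro allI impI, elim conjE)
	fix I assume I: "dmod (adj D x) I" "I <= adj D x"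
	define E where "E = adj D x"
	have E: "subring E R" unfolding E_def by (rule subring_adj[OF D x])
	have Dc: "D <= RR" using subringE(1)[OF D] .
	have DE: "D <= E" unfolding E_def by (rule adj_incl[OF Dc x])
	have xE: "x : E" unfolding E_def by (rule adj_self[OF D x])
	have Id: "dmod E I" using I(1) by (simp add: E_def)
	note I' = dmodD[OF Id]
	define L where "L n = {d : D. EX ds. set ds <= D & length ds = n & pev x (ds @ [d]) : I}" for n
	have Ld: "dmod D (L n)" for n
		unfolding dmod_def
	proof (intro conjI ballI)
		show "L n <= RR" using Dc by (auto simp: L_def)
		have "pev x (replicate n \<zero> @ [\<zero>]) = \<zero>" using x by (intro pev_zero) auto
		thus "\<zero> : L n" unfolding L_def using I'(2) subringE(2)[OF D]
			by (auto intro!: exI[of _ "replicate n \<zero>"])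
	next
		fix d e assume "d : L n" "e : L n"
		then obtain ds es where h: "set ds <= D" "length ds = n" "pev x (ds @ [d]) : I" "d : D"
			 "set es <= D" "length es = n" "pev x (es @ [e]) : I" "e : D" by (auto simp: L_def)
		then obtain us where "set us <= D" "length us = n" "pev x (ds @ [d]) \<oplus> pev x (es @ [e]) = pev x (us @ [d \<oplus> e])"
			using pev_add_same[OF D x h(4,8) _ h(1,5)] by auto
		thus "d \<oplus> e : L n" using I'(3)[OF h(3,7)] h subringE(7)[OF D] by (auto simp: L_def)
	next
		fix c d assume c: "c : D" "d : L n"
		then obtain ds where h: "set ds <= D" "length ds = n" "pev x (ds @ [d]) : I" "d : D" by (auto simp: L_def)
		have "set (ds @ [d]) <= RR" "c : RR" using h c Dc by auto
		note eq = pev_smult[OF x this]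
		have "c ** pev x (ds @ [d]) : I" using I'(4)[OF _ h(3)] c DE by auto
		hence "pev x (map ((\<otimes>) c) ds @ [c ** d]) : I" unfolding eq by simp
		moreover have "set (map ((\<otimes>) c) ds) <= D" using h(1) c(1) subringE(6)[OF D] by auto
		moreover have "c ** d : D" "length (map ((\<otimes>) c) ds) = n" using h(2,4) c(1) subringE(6)[OF D] by auto
		ultimately show "c ** d : L n" unfolding L_def by blast
	qed
	have L_shift: "L n <= L (n + j)" for n j
	proof
		fix d assume "d : L n"
		then obtain ds where h: "set ds <= D" "length ds = n" "pev x (ds @ [d]) : I" "d : D" by (auto simp: L_def)
		have c: "set (ds @ [d]) <= RR" using h Dc by auto
		have "x [^] j ** pev x (ds @ [d]) : I" using I'(4)[OF subring_pow[OF E xE] h(3)] .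
		hence "pev x ((replicate j \<zero> @ ds) @ [d]) : I" using pev_replicate_zero[OF x c] by simp
		thus "d : L (n + j)" unfolding L_def using h subringE(2)[OF D]
			by (auto intro!: exI[of _ "replicate j \<zero> @ ds"])
	qed
	have LD: "L n <= D" for n by (auto simp: L_def)
	define Li where "Li = (\<Union>n. L n)"
	have "dmod D Li" unfolding dmod_def
	proof (intro conjI ballI)
		show "Li <= RR" using LD Dc by (auto simp: Li_def)
		show "\<zero> : Li" using dmodD(2)[OF Ld] by (auto simp: Li_def)
		fix d e assume "d : Li" "e : Li"
		then obtain n m where "d : L n" "e : L m" by (auto simp: Li_def)
		hence "d : L (n + m)" "e : L (n + m)" using L_shift[of n m] L_shift[of m n] by (auto simp: add.commute)
		thus "d \<oplus> e : Li" using dmodD(3)[OF Ld] by (auto simp: Li_def)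
	qed (use dmodD(4)[OF Ld] in \<open>auto simp: Li_def\<close>)
	moreover have "Li <= D" using LD by (auto simp: Li_def)
	ultimately obtain vs where vs: "set vs <= Li" "Li <= lin D vs" using N by (auto simp: noeth_def)
	have "EX N. set ws <= L N" if "set ws <= Li" for ws using that
	proof (induction ws)
		case (Cons w ws)
		then obtain N m where "set ws <= L N" "w : L m" by (auto simp: Li_def)
		hence "set (w # ws) <= L (N + m)" using L_shift[of N m] L_shift[of m N] by (auto simp: add.commute)
		thus ?case by blast
	qed auto
	then obtain M where M: "set vs <= L M" using vs by blast
	have "ALL n. EX V. set V <= L n & L n <= lin D V" using N Ld LD by (auto simp: noeth_def)
	then obtain V0 where V0: "!!n. set (V0 n) <= L n & L n <= lin D (V0 n)" by metis
	\<comment> \<open>In degree \<open>M\<close> the generators have to be those of the union of all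
	  \<open>L n\<close>, since they serve every higher degree as well.\<close>
	define V where "V n = (if n = M then vs else V0 n)" for n
	have "L M <= lin D vs" using vs(2) unfolding Li_def by blast
	hence V: "set (V n) <= L n" "L n <= lin D (V n)" for n
		using V0 M by (simp_all add: V_def)
	have "ALL n w. w : L n --> (EX f:I. EX us. set us <= D & length us = n & f = pev x (us @ [w]))"
		by (auto simp: L_def)
	then obtain F where F: "!!n w. w : L n ==> F n w : I & (EX us. set us <= D & length us = n & F n w = pev x (us @ [w]))"
		by metis
	define Fs where "Fs = concat (map (%n. map (F n) (V n)) [0..<Suc M])"
	have FsI: "set Fs <= I" using F V by (fastforce simp: Fs_def)
	have Fsc: "set Fs <= RR" using FsI I'(1) by auto
	note lE = dmodD[OF lin_dmod[OF E Fsc]]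
	have "ALL ds. set ds <= D & length ds = n & pev x ds : I --> pev x ds : lin E Fs" for n
	proof (induction n)
		case 0
		thus ?case using lE(2) by auto
	next
		case (Suc n)
		show ?case
		proof (intro allI impI, elim conjE)
			fix ds assume ds: "set ds <= D" "length ds = Suc n" "pev x ds : I"
			then obtain es d where e: "ds = es @ [d]" by (cases ds rule: rev_cases) auto
			have es: "set es <= D" "d : D" "length es = n" using ds e by auto
			have dL: "d : L n" using ds e es by (auto simp: L_def)
			\<comment> \<open>A list of length \<open>Suc n\<close> has degree \<open>n\<close>. Above degree
			  \<open>M\<close> the polynomials of degree \<open>M\<close> are used, multiplied by a power of
			  \<open>x\<close>.\<close>
			define n' where "n' = min n M"
			have "d : lin D (V n')"
			proof (cases "n <= M")
				case True
				thus ?thesis using dL V(2)[of n] by (auto simp: n'_def)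
			next
				case False
				have "d : lin D vs" using dL vs(2) unfolding Li_def by blast
				thus ?thesis using False by (simp add: n'_def V_def)
			qed
			moreover have "!!w. w : set (V n') ==> F n' w : RR & (EX us. set us <= D & length us = n' & F n' w = pev x (us @ [w]))"
				using F V(1) I'(1) by blast
			moreover have "set (V n') <= D" using V(1) LD by blast
			ultimately obtain us where us: "set us <= D" "length us = n'" "pev x (us @ [d]) : lin E (map (F n') (V n'))"
				using lin_lift_leading[OF D x E_def, of "V n'" "F n'" n' d] by blast
			have "n' < Suc M" by (simp add: n'_def)
			hence "set (map (F n') (V n')) <= set Fs" unfolding Fs_def by (auto simp del: upt_Suc)
			from lin_mono_set[OF E this Fsc] have uF: "pev x (us @ [d]) : lin E Fs" using us by auto
			define us' where "us' = replicate (n - n') \<zero> @ us"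
			have us': "set us' <= D" "length us' = n" using us subringE(2)[OF D] by (auto simp: us'_def n'_def)
			have uc: "set (us @ [d]) <= RR" "set (us' @ [d]) <= RR" "set (es @ [d]) <= RR" using us us' es Dc by auto
			have "pev x (us' @ [d]) = x [^] (n - n') ** pev x (us @ [d])"
				using pev_replicate_zero[OF x uc(1)] by (simp add: us'_def)
			hence uF': "pev x (us' @ [d]) : lin E Fs" using lE(4)[OF subring_pow[OF E xE] uF] by simp
			have lI: "lin E Fs <= I" by (rule lin_least[OF Id FsI])
			have m1: "\<ominus> \<one> : D" using subringE(3,5)[OF D] by auto
			let ?vs = "map ((\<otimes>) (\<ominus> \<one>)) us'"
			have vs': "set ?vs <= D" "length es = length ?vs" using us' es m1 subringE(6)[OF D] by auto
			have md: "\<ominus> \<one> ** d : D" using m1 es subringE(6)[OF D] by auto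
			obtain ws where ws: "set ws <= D" "length ws = n"
				"pev x (es @ [d]) \<oplus> pev x (?vs @ [\<ominus> \<one> ** d]) = pev x (ws @ [d \<oplus> \<ominus> \<one> ** d])"
				using pev_add_same[OF D x es(2) md vs'(2) es(1) vs'(1)] es by auto
			have dc: "d : RR" using es Dc by auto
			have pm: "pev x (?vs @ [\<ominus> \<one> ** d]) = \<ominus> \<one> ** pev x (us' @ [d])" using pev_smult[OF x uc(2), of "\<ominus> \<one>"] by simp
			have wz: "d \<oplus> \<ominus> \<one> ** d = \<zero>" using dc by algebra
			have wsc: "set ws <= RR" using ws Dc by auto
			have eq: "pev x (es @ [d]) \<oplus> \<ominus> \<one> ** pev x (us' @ [d]) = pev x ws"
				using ws(3) wsc x unfolding pm wz by (simp add: pev_append)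
			have m1E: "\<ominus> \<one> : E" using m1 DE by auto
			have "pev x ws : I" unfolding eq[symmetric] using ds(3) e lI uF' I'(3,4) m1E by blast
			hence "pev x ws : lin E Fs" using Suc ws by blast
			hence "pev x ws \<oplus> pev x (us' @ [d]) : lin E Fs" using uF' lE(3) by blast
			moreover have "pev x ws \<oplus> pev x (us' @ [d]) = pev x (es @ [d])"
			proof -
				have "pev x (us' @ [d]) : RR" "pev x (es @ [d]) : RR" using uc x by auto
				thus ?thesis unfolding eq[symmetric] by algebra
			qed
			ultimately show "pev x ds : lin E Fs" using e by simp
		qed
	qed
	hence "I <= lin E Fs" using I(2) by (force simp: adj_def)
	thus "EX vs. set vs <= I & I <= lin (adj D x) vs" using FsI E_def by blast
qed

lemma noeth_adjs: "subring D R ==> noeth D ==> set xs <= RR ==> noeth (adjs D xs)"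
	by (induction xs) (auto intro!: noeth_adj subring_adjs)

lemma ideal_genideal_lin:
	assumes "ideal I R" "set vs <= I" "I <= lin (RR) vs"
	shows "I = Idl (set vs)"
proof
	interpret ideal I R by fact
	have vc: "set vs <= RR" using assms(2) a_subset by auto
	show "Idl (set vs) <= I" using genideal_minimal[OF assms(1,2)] .
	have i: "ideal (Idl (set vs)) R" using genideal_ideal[OF vc] .
	have "lin (RR) vs <= Idl (set vs)"
		using genideal_self[OF vc] by (intro lin_least ideal_dmod[OF i]) auto
	thus "I <= Idl (set vs)" using assms(3) by auto
qed

end

context subfield_cring
begin

lemma noeth_k: "noeth k"
	unfolding noeth_def
proof (intro allI impI, elim conjE)
	fix I assume I: "dmod k I" "I <= k"
	show "EX vs. set vs <= I & I <= lin k vs"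
	proof (cases "I <= {\<zero>}")
		case True
		thus ?thesis by (intro exI[of _ "[]"]) auto
	next
		case False
		then obtain c where c: "c : I" "c ~= \<zero>" by auto
		then obtain c' where c': "c' : k" "c ** c' = \<one>" using k_inverse I by blast
		have "d : lin k [c]" if d: "d : I" for d
		proof -
			have cl: "d : RR" "c : RR" "c' : RR" using d c c' I k_carrier by auto
			have "d ** (c ** c') = (d ** c') ** c \<oplus> \<zero>" using cl by algebra
			hence "d = (d ** c') ** c \<oplus> \<zero>" using c' cl by simp
			moreover have "d ** c' : k" using d I c' subringE(6)[OF k_subring] by auto
			ultimately show ?thesis unfolding lin_Cons by auto
		qed
		thus ?thesis using c by (intro exI[of _ "[c]"]) auto
	qed
qed

lemma noetherian_ring_gens:
	assumes gens: "set gens <= RR" "adjs k gens = RR"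
	shows "noetherian_ring R"
proof (rule noetherian_ringI)
	fix I assume I: "ideal I R"
	have "noeth (RR)" using noeth_adjs[OF k_subring noeth_k gens(1)] gens(2) by simp
	moreover have "dmod (RR) I" by (rule ideal_dmod[OF I]) simp
	moreover have "I <= RR" using additive_subgroup.a_subset[OF ideal.axioms(1)[OF I]] .
	ultimately obtain vs where "set vs <= I" "I <= lin (RR) vs" by (auto simp: noeth_def)
	thus "EX A<=RR. finite A & I = Idl A"
		using ideal_genideal_lin[OF I] \<open>I <= RR\<close> by (intro exI[of _ "set vs"]) auto
qed

end

context cring
begin

section \<open>Primes of polynomial rings\<close>

text \<open>Prime ideals of a subring \<open>D\<close>, as subsets of the ambient ring.\<close>

definition dprime :: "'a set => 'a set => bool" where
	"dprime D p \<longleftrightarrow> dmod D p & p <= D & \<one> ~: p & (ALL a:D. ALL b:D. a ** b : p --> a : p \<or> b : p)"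

lemma dprime_primeideal: "dprime (RR) P \<longleftrightarrow> primeideal P R"
proof
	assume P: "dprime (RR) P"
	have d: "dmod (RR) P" using P by (simp add: dprime_def)
	show "primeideal P R"
	proof (rule primeidealI)
		show "ideal P R"
		proof (rule idealI)
			show "ring R" by (rule ring_axioms)
			show "subgroup P (add_monoid R)"
				by (rule add.subgroupI)
					(use dmodD[OF d] dmod_uminus[OF d carrier_is_subring] in auto)
			show "x ** a : P" if "a : P" "x : RR" for a x using dmodD(4)[OF d] that by blast
			show "a ** x : P" if "a : P" "x : RR" for a x
				using dmodD(1)[OF d] dmodD(4)[OF d that(2,1)] that m_comm[of a x] by auto
		qed
		show "RR ~= P" using P by (auto simp: dprime_def)
	qed (use P cring_axioms in \<open>auto simp: dprime_def\<close>)
next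
	assume P: "primeideal P R"
	interpret primeideal P R by fact
	show "dprime (RR) P"
		unfolding dprime_def using ideal_dmod[OF is_ideal] a_subset one_notin_prime[OF P] I_prime by blast
qed

lemma dprime_inter:
	assumes E: "dprime E p" and D: "subring D R" "D <= E"
	shows "dprime D (p \<inter> D)"
proof -
	have p: "dmod E p" "\<one> ~: p" "!!a b. a : E ==> b : E ==> a ** b : p ==> a : p \<or> b : p" using E by (auto simp: dprime_def)
	note p1 = dmodD[OF p(1)]
	have "dmod D (p \<inter> D)" unfolding dmod_def
	proof (intro conjI ballI)
		show "p \<inter> D <= RR" using p1(1) by auto
		show "\<zero> : p \<inter> D" using p1(2) subringE(2)[OF D(1)] by simp
		show "x \<oplus> y : p \<inter> D" if "x : p \<inter> D" "y : p \<inter> D" for x y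
			using that p1(3) subringE(7)[OF D(1)] by simp
		show "d ** x : p \<inter> D" if "d : D" "x : p \<inter> D" for d x
			using that p1(4)[of d x] subringE(6)[OF D(1), of d x] D(2) by auto
	qed
	thus ?thesis unfolding dprime_def using p(2,3) D(2) subringE(6)[OF D(1)] by blast
qed

text \<open>The extension \<open>q[z]\<close> of an ideal \<open>q\<close> of \<open>D\<close> to
  \<open>D[z]\<close>: \<open>adj\<close> applied to an ideal gives the polynomials with all
  coefficients in \<open>q\<close>.\<close>

definition pext :: "'a => 'a set => 'a set" where
	"pext z q = adj q z"

text \<open>At a transcendental element, lists with equal values agree up to zeros at the end, which
  explains the hypothesis that \<open>q\<close> contains \<open>\<zero>\<close>.\<close>

lemma pev_eq_transc:
	assumes D: "subring D R" and z: "z : RR" and t: "transc D {\<zero>} z" and q: "\<zero> : q"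
	shows "set ds <= D ==> set es <= D ==> set es <= q ==> pev z ds = pev z es ==> set ds <= q"
proof (induction ds arbitrary: es)
	case (Cons d ds)
	have Dc: "D <= RR" using subringE(1)[OF D] .
	show ?case
	proof (cases es)
		case Nil
		hence "set (d # ds) <= {\<zero>}" using Cons.prems by (intro transcD[OF t]) auto
		thus ?thesis using q by auto
	next
		case (Cons e es')
		have A: "subring (adj D z) R" by (rule subring_adj[OF D z])
		have "pev z ds : adj D z" "pev z es' : adj D z" using Cons.prems Cons by (auto intro!: adjI)
		hence "pev z ds \<ominus> pev z es' : adj D z" using subringE[OF A] by (auto simp: minus_eq)
		then obtain fs where fs: "set fs <= D" "pev z ds \<ominus> pev z es' = pev z fs" by (auto simp: adj_def)
		have c: "d : D" "e : D" "d : RR" "e : RR" "pev z ds : RR" "pev z es' : RR"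
			using Cons.prems Cons Dc z by (auto intro!: pev_closed)
		have "pev z ((d \<ominus> e) # fs) = (d \<oplus> z ** pev z ds) \<ominus> (e \<oplus> z ** pev z es')"
			using c z fs(2)[symmetric] by (simp, algebra)
		also have "\<dots> = \<zero>" using Cons.prems(4) Cons c z by (simp add: minus_eq r_neg)
		finally have "pev z ((d \<ominus> e) # fs) = \<zero>" .
		moreover have "set ((d \<ominus> e) # fs) <= D" using c fs subringE[OF D] by (auto simp: minus_eq)
		ultimately have zz: "set ((d \<ominus> e) # fs) <= {\<zero>}" using transcD[OF t] by blast
		hence "d = e" using c by simp
		moreover have "pev z ds = pev z es'" using zz fs c z by simp
		hence "set ds <= q" using Cons.IH[of es'] Cons.prems Cons by auto
		ultimately show ?thesis using Cons.prems Cons by auto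
	qed
qed auto

lemma pext_iff:
	assumes D: "subring D R" and z: "z : RR" and t: "transc D {\<zero>} z" and q: "\<zero> : q" "q <= D"
		and ds: "set ds <= D"
	shows "pev z ds : pext z q \<longleftrightarrow> set ds <= q"
proof
	assume "pev z ds : pext z q"
	then obtain es where "set es <= q" "pev z ds = pev z es" by (auto simp: pext_def adj_def)
	thus "set ds <= q" using pev_eq_transc[OF D z t q(1) ds] q by blast
qed (auto simp: pext_def intro: adjI)

lemma dmod_pext:
	assumes D: "subring D R" and z: "z : RR" and q: "dmod D q"
	shows "dmod (adj D z) (pext z q)"
proof -
	have Dc: "D <= RR" using subringE(1)[OF D] .
	have qc: "q <= RR" using dmodD(1)[OF q] .
	show ?thesis unfolding dmod_def pext_def
	proof (intro conjI ballI)
		show "adj q z <= RR" using qc z by (auto simp: adj_def)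
		show "\<zero> : adj q z" using adjI[of "[]" q z] by simp
	next
		fix f g assume "f : adj q z" "g : adj q z"
		then obtain ds es where "set ds <= q" "set es <= q" "f = pev z ds" "g = pev z es" by (auto simp: adj_def)
		thus "f \<oplus> g : adj q z" using pev_add_ex[OF q Dc z, of ds es] by (auto intro!: adjI)
	next
		fix f g assume "f : adj D z" "g : adj q z"
		then obtain ds es where h: "set ds <= D" "set es <= q" "f = pev z ds" "g = pev z es" by (auto simp: adj_def)
		have "EX hs. set hs <= q & length hs <= length ds + length es & pev z ds ** pev z es = pev z hs"
			using dmodD(4)[OF q] by (intro pev_mult_ex[OF D subring_dmod[OF D] q q _ z h(2,1)]) auto
		thus "f ** g : adj q z" using h by (auto intro!: adjI)
	qed
qed

lemma pev_strip_dmod: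
	assumes E: "dmod E p" and z: "z : E" and E': "subring E R" and q: "q <= p"
	shows "set ds <= RR ==> \<not> set ds <= q ==>
		EX ds' l r rest. ds = ds' @ l # rest & l ~: q & r : p & pev z ds = pev z (ds' @ [l]) \<oplus> r"
proof (induction ds rule: rev_induct)
	case (snoc a ds)
	have zc: "z : RR" using z subringE(1)[OF E'] by auto
	note p = dmodD[OF E]
	have c: "a : RR" "set ds <= RR" using snoc.prems by auto
	hence c': "pev z ds : RR" "pev z (ds @ [a]) : RR" using zc by (auto intro!: pev_closed)
	show ?case
	proof (cases "a : q")
		case False
		thus ?thesis using c' p(2) by (intro exI[of _ ds] exI[of _ a] exI[of _ \<zero>] exI[of _ "[]"]) auto
	next
		case True
		hence "\<not> set ds <= q" using snoc.prems by auto
		then obtain ds' l r rest where h: "ds = ds' @ l # rest" "l ~: q" "r : p" "pev z ds = pev z (ds' @ [l]) \<oplus> r"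
			using snoc.IH c by blast
		let ?t = "z [^] length ds ** a"
		have t: "?t : p" using True q p(4)[OF subring_pow[OF E' z]] by auto
		have "pev z (ds @ [a]) = pev z ds \<oplus> ?t" using zc c by (subst pev_append) auto
		moreover have "pev z (ds' @ [l]) : RR" using c zc h(1) by (intro pev_closed) auto
		ultimately have "pev z (ds @ [a]) = pev z (ds' @ [l]) \<oplus> (r \<oplus> ?t)"
			unfolding h(4) using t h(3) p(1) by (simp add: a_assoc subset_iff)
		thus ?thesis using h t p(3) by (intro exI[of _ ds'] exI[of _ l] exI[of _ "r \<oplus> ?t"] exI[of _ "rest @ [a]"]) auto
	qed
qed auto

text \<open>After removal of top terms with coefficients in \<open>q\<close>, two factors outside
  \<open>q[z]\<close> have leading coefficients outside \<open>q\<close>. The product of these is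
  the leading coefficient of the product, and it is outside the prime \<open>q\<close>.\<close>

lemma dprime_pext:
	assumes D: "subring D R" and z: "z : RR" and t: "transc D {\<zero>} z" and q: "dprime D q"
	shows "dprime (adj D z) (pext z q)"
proof -
	have Dc: "D <= RR" using subringE(1)[OF D] .
	have E: "subring (adj D z) R" by (rule subring_adj[OF D z])
	have zE: "z : adj D z" by (rule adj_self[OF D z])
	have qd: "dmod D q" and qD: "q <= D" and q1: "\<one> ~: q" using q by (auto simp: dprime_def)
	have q0: "\<zero> : q" using dmodD(2)[OF qd] .
	have pd: "dmod (adj D z) (pext z q)" by (rule dmod_pext[OF D z qd])
	note p = dmodD[OF pd]
	note iff = pext_iff[OF D z t q0 qD]
	have qp: "q <= pext z q"
		using adj_incl[of q z] qD Dc z by (simp add: pext_def)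
	show ?thesis unfolding dprime_def
	proof (intro conjI ballI impI)
		show "dmod (adj D z) (pext z q)" by fact
		show "pext z q <= adj D z" using qD by (auto simp: pext_def adj_def)
		show "\<one> ~: pext z q" using iff[of "[\<one>]"] q1 z subringE(3)[OF D] by simp
	next
		fix a b assume ab: "a : adj D z" "b : adj D z" "a ** b : pext z q"
		show "a : pext z q \<or> b : pext z q"
		proof (rule ccontr)
			assume n: "\<not> (a : pext z q \<or> b : pext z q)"
			have *: "EX ds l r. set ds <= D & l : D & l ~: q & r : pext z q & a = pev z (ds @ [l]) \<oplus> r"
				if a: "a : adj D z" "a ~: pext z q" for a
			proof -
				obtain us where us: "set us <= D" "a = pev z us" using a by (auto simp: adj_def)
				hence "\<not> set us <= q" using iff a by auto
				from pev_strip_dmod[OF pd zE E qp subset_trans[OF us(1) Dc] this]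
				obtain ds' l r rest where "us = ds' @ l # rest" "l ~: q" "r : pext z q" "pev z us = pev z (ds' @ [l]) \<oplus> r" by blast
				thus ?thesis using us by (intro exI[of _ ds'] exI[of _ l] exI[of _ r]) auto
			qed
			obtain as l r bs l' r' where h: "set as <= D" "l : D" "l ~: q" "r : pext z q" "a = pev z (as @ [l]) \<oplus> r"
				"set bs <= D" "l' : D" "l' ~: q" "r' : pext z q" "b = pev z (bs @ [l']) \<oplus> r'"
				using *[OF ab(1)] *[OF ab(2)] n by blast
			have asE: "pev z (as @ [l]) : adj D z" "pev z (bs @ [l']) : adj D z" using h by (auto intro!: adjI)
			have c: "pev z (as @ [l]) : RR" "pev z (bs @ [l']) : RR" "r : RR" "r' : RR"
				using asE subringE(1)[OF E] h(4,9) p(1) by auto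
			have "pev z (as @ [l]) ** pev z (bs @ [l']) = a ** b \<oplus> \<ominus> \<one> ** (pev z (as @ [l]) ** r' \<oplus> b ** r)"
				unfolding h(5,10) using c by algebra
			also have "\<dots> : pext z q"
			proof -
				have "\<ominus> \<one> : adj D z" using subringE(3,5)[OF E] by auto
				moreover have "b ** r : pext z q" "pev z (as @ [l]) ** r' : pext z q" using p(4) ab h(4,9) asE by simp_all
				ultimately show ?thesis using p(3,4) ab(3) by simp
			qed
			finally have in1: "pev z (as @ [l]) ** pev z (bs @ [l']) : pext z q" .
			obtain us where us: "set us <= D" "pev z (as @ [l]) ** pev z (bs @ [l']) = pev z (us @ [l ** l'])"
				using pev_mult_last[OF D z h(2,7,6,1)] by auto
			have "set (us @ [l ** l']) <= D" using us h subringE(6)[OF D] by auto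
			from iff[OF this] have "l ** l' : q" using in1 us by auto
			thus False using q h by (auto simp: dprime_def)
		qed
	qed
qed

lemma common_multiplier:
	assumes D: "subring D R" and p: "dprime D p" and ts: "set ts <= RR"
		and gen: "!!f. f : p ==> EX u:D - p. u ** f : lin D ts"
	shows "set fs <= p ==> EX u:D - p. ALL f:set fs. u ** f : lin D ts"
proof (induction fs)
	case Nil
	have "\<one> : D - p" using subringE(3)[OF D] p by (auto simp: dprime_def)
	thus ?case by auto
next
	case (Cons f fs)
	then obtain u where u: "u : D - p" "ALL f:set fs. u ** f : lin D ts" by auto
	obtain v where v: "v : D - p" "v ** f : lin D ts" using gen Cons.prems by auto
	have Dc: "D <= RR" "p <= D" using subringE(1)[OF D] p by (auto simp: dprime_def)
	note l = dmodD(4)[OF lin_dmod[OF D ts]]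
	have "v ** u : D - p" using u v p subringE(6)[OF D] by (auto simp: dprime_def)
	moreover have "(v ** u) ** g : lin D ts" if g: "g : set (f # fs)" for g
	proof -
		have c: "v : RR" "u : RR" "g : RR" using u v g Cons.prems Dc by auto
		show ?thesis
		proof (cases "g = f")
			case True
			have "u ** (v ** f) : lin D ts" using l u v by auto
			thus ?thesis using c True by (metis m_assoc m_comm)
		next
			case False
			hence "v ** (u ** g) : lin D ts" using l u v g by auto
			thus ?thesis using c by (metis m_assoc)
		qed
	qed
	ultimately show ?case by blast
qed

text \<open>Division with remainder in which each cancellation costs one factor \<open>g\<close>
  instead of an inverse. The divisor has degree \<open>length ds0\<close>, so a remainder list of
  that length already has smaller degree.\<close>

lemma pseudo_division:
	assumes D: "subring D R" and z: "z : RR" and g: "g : D" "set ds0 <= D"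
	shows "set ss <= D ==> EX m::nat. EX q:adj D z. EX rs. set rs <= D & length rs <= length ds0 &
		g [^] m ** pev z ss = q ** pev z (ds0 @ [g]) \<oplus> pev z rs"
proof (induction ss)
	case Nil
	have "pev z (ds0 @ [g]) : RR" using g subringE(1)[OF D] z by (intro pev_closed) auto
	thus ?case using g subringE(2)[OF subring_adj[OF D z]]
		by (intro exI[of _ 0] bexI[of _ \<zero>] exI[of _ "[]"]) auto
next
	case (Cons s ss)
	have Dc: "D <= RR" using subringE(1)[OF D] .
	have E: "subring (adj D z) R" by (rule subring_adj[OF D z])
	have DE: "D <= adj D z" "z : adj D z" using adj_incl[OF Dc z] adj_self[OF D z] by auto
	obtain m :: nat and q rs where h: "q : adj D z" "set rs <= D" "length rs <= length ds0"
		"g [^] m ** pev z ss = q ** pev z (ds0 @ [g]) \<oplus> pev z rs" using Cons by auto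
	have gm: "g [^] m : D" by (rule subring_pow[OF D g(1)])
	have c: "s : D" "s : RR" "g [^] m : RR" "q : RR" "g : RR" "set ds0 <= RR"
		"set rs <= RR" "set ss <= RR"
		using Cons.prems h g gm Dc subringE(1)[OF E] by auto
	have c': "pev z ss : RR" "pev z rs : RR" "pev z (ds0 @ [g]) : RR"
		using c z by (auto intro!: pev_closed)
	let ?rs = "(g [^] m ** s) # rs"
	have rD: "set ?rs <= D" using gm c h subringE(6)[OF D] by auto
	have rc: "set ?rs <= RR" using rD Dc by auto
	have e1: "g [^] m ** pev z (s # ss) = (z ** q) ** pev z (ds0 @ [g]) \<oplus> pev z ?rs"
	proof -
		have "g [^] m ** pev z (s # ss) = g [^] m ** s \<oplus> z ** (g [^] m ** pev z ss)" using c c' z by (simp, algebra)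
		also have "\<dots> = (z ** q) ** pev z (ds0 @ [g]) \<oplus> pev z ?rs" unfolding h(4) using c c' z by (simp, algebra)
		finally show ?thesis .
	qed
	show ?case
	proof (cases "length rs = length ds0")
		case False
		thus ?thesis using e1 rD h DE subringE(6)[OF E]
			by (intro exI[of _ m] bexI[of _ "z ** q"] exI[of _ ?rs]) auto
	next
		\<comment> \<open>The new coefficient made the remainder one term too long. Another factor
		  \<open>g\<close> cancels its top term against \<open>w\<close> times the divisor.\<close>
		case True
		obtain vs w where vw: "?rs = vs @ [w]" "length vs = length ds0"
			using that True append_butlast_last_id[of ?rs] length_butlast[of ?rs]
			by (metis diff_Suc_1 length_Cons list.distinct(1))
		have w: "w : D" "set vs <= D" "w : RR" "set vs <= RR" using rD Dc unfolding vw by auto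
		let ?u1 = "map ((\<otimes>) g) vs" and ?u2 = "map ((\<otimes>) (\<ominus> w)) ds0"
		have u: "set ?u1 <= D" "set ?u2 <= D" using w g subringE(5,6)[OF D] by auto
		obtain us where us: "set us <= D" "length us = max (length ?u1) (length ?u2)" "pev z ?u1 \<oplus> pev z ?u2 = pev z us"
			using pev_add_ex[OF subring_dmod[OF D] Dc z u] by auto
		have e1': "pev z ?u1 = g ** pev z vs" using pev_smult[OF z w(4) c(5)] by simp
		have e2: "pev z ?u2 = \<ominus> w ** pev z ds0" using pev_smult[OF z c(6), of "\<ominus> w"] w by simp
		have pv: "pev z ?rs = pev z vs \<oplus> z [^] length ds0 ** w" unfolding vw(1) using w z vw by (subst pev_append) auto
		have pd: "pev z (ds0 @ [g]) = pev z ds0 \<oplus> z [^] length ds0 ** g" using c z by (subst pev_append) auto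
		have cc: "pev z vs : RR" "pev z ds0 : RR" "z [^] length ds0 : RR" using w c z by auto
		have e3: "g ** pev z ?rs = w ** pev z (ds0 @ [g]) \<oplus> pev z us"
			unfolding us(3)[symmetric] e1' e2 pv pd using cc w c by algebra
		have pc: "pev z ?rs : RR" "pev z us : RR" "pev z (s # ss) : RR"
			using rc us Dc z c Cons.prems by (auto intro!: pev_closed)
		have "g [^] Suc m ** pev z (s # ss) = g ** (g [^] m ** pev z (s # ss))" using c pc by (simp add: m_ac)
		also have "\<dots> = g ** ((z ** q) ** pev z (ds0 @ [g])) \<oplus> g ** pev z ?rs"
			unfolding e1 using c c' z pc by (simp add: r_distr)
		also have "\<dots> = (g ** (z ** q) \<oplus> w) ** pev z (ds0 @ [g]) \<oplus> pev z us"
			unfolding e3 using c c' z pc w by algebra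
		finally have "g [^] Suc m ** pev z (s # ss) = (g ** (z ** q) \<oplus> w) ** pev z (ds0 @ [g]) \<oplus> pev z us" .
		moreover have "g ** (z ** q) \<oplus> w : adj D z"
			by (intro subringE(6,7)[OF E] subsetD[OF DE(1) g(1)] subsetD[OF DE(1) w(1)] DE(2) h(1))
		moreover have "length us <= length ds0" using us vw by simp
		ultimately show ?thesis using us(1) by blast
	qed
qed

lemma lin_transfer:
	assumes "D <= E" "subring E R" "set ts <= set ts'" "set ts' <= RR"
	shows "lin D ts <= lin E ts'"
proof -
	have "lin D ts <= lin E ts" using assms(1) by (auto simp: lin_def)
	thus ?thesis using lin_mono_set[OF assms(2-4)] by auto
qed

end

context subfield_cring
begin

text \<open>All that regularity at \<open>p\<close> requires, in one induction on the variables. The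
  list \<open>ts\<close> generates \<open>p\<close> up to multipliers outside \<open>p\<close>,
  hence after localization; the chain \<open>C\<close> shows that the height is at least
  \<open>length ts\<close>; and \<open>ws\<close>, which is independent modulo \<open>p\<close>,
  will bound it from above, because the two lengths add up to the number of variables.\<close>

lemma polynomial_prime_structure:
	"set zs <= RR ==> indep k {\<zero>} zs ==> dprime (adjs k zs) p ==>
		EX ts ws C. set ts <= p & distinct ts & (ALL f:p. EX u:adjs k zs - p. u ** f : lin (adjs k zs) ts) &
			(ALL i<=length ts. dprime (adjs k zs) (C i)) & (ALL i<length ts. C i \<subset> C (Suc i)) & C (length ts) = p &
			set ws <= adjs k zs & length ws + length ts = length zs & indep k p ws"
proof (induction zs arbitrary: p)
	case Nil
	have p: "dmod k p" "p <= k" "\<one> ~: p" using Nil by (auto simp: dprime_def)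
	have "p <= {\<zero>}"
	proof
		fix c assume c: "c : p"
		show "c : {\<zero>}"
		proof (rule ccontr)
			assume "c ~: {\<zero>}"
			then obtain c' where c': "c' : k" "c ** c' = \<one>" using k_inverse c p by auto
			have "c' ** c : p" using dmodD(4)[OF p(1)] c c' by auto
			thus False using c' c p k_carrier by (metis m_comm subsetD)
		qed
	qed
	hence "ALL f:p. EX u:k - p. u ** f : lin k []"
		using p(3) subringE(3)[OF k_subring] by (intro ballI bexI[of _ \<one>]) auto
	thus ?case using Nil by (intro exI[of _ "[]"] exI[of _ "%_. p"]) auto
next
	case (Cons z zs)
	define D where "D = adjs k zs"
	define E where "E = adj D z"
	have z: "z : RR" "set zs <= RR" "indep k {\<zero>} zs" and t: "transc D {\<zero>} z"
		using Cons.prems by (auto simp: D_def)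
	have D: "subring D R" unfolding D_def by (rule subring_adjs[OF k_subring z(2)])
	have E: "subring E R" unfolding E_def by (rule subring_adj[OF D z(1)])
	have Dc: "D <= RR" and Ec: "E <= RR" using D E subringE(1) by auto
	have DE: "D <= E" unfolding E_def by (rule adj_incl[OF Dc z(1)])
	have zE: "z : E" unfolding E_def by (rule adj_self[OF D z(1)])
	have p: "dprime E p" using Cons.prems by (simp add: D_def E_def)
	have pd: "dmod E p" and pE: "p <= E" using p by (auto simp: dprime_def)
	note p' = dmodD[OF pd]
	have pprime: "!!a b. a : E ==> b : E ==> a ** b : p ==> a : p \<or> b : p" using p by (auto simp: dprime_def)
	define q where "q = p \<inter> D"
	have q: "dprime D q" unfolding q_def by (rule dprime_inter[OF p D DE])
	have qd: "dmod D q" and qD: "q <= D" using q by (auto simp: dprime_def)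
	have q0: "\<zero> : q" using dmodD(2)[OF qd] .
	note ext_iff = pext_iff[OF D z(1) t q0 qD]
	obtain ts ws C where IH: "set ts <= q" "distinct ts" "!!f. f : q ==> EX u:D - q. u ** f : lin D ts"
			"!!i. i <= length ts ==> dprime D (C i)" "!!i. i < length ts ==> C i \<subset> C (Suc i)" "C (length ts) = q"
			"set ws <= D" "length ws + length ts = length zs" "indep k q ws"
		using Cons.IH[OF z(2,3), folded D_def, OF q] by blast
	have tsc: "set ts <= RR" using IH(1) qD Dc by auto
	have wsc: "set ws <= RR" using IH(7) Dc by auto
	have kD: "k <= D" unfolding D_def by (rule adjs_incl[OF k_subring z(2)])
	have wsD: "adjs k ws <= D" by (rule adjs_least[OF D kD IH(7)])
	have kq: "k \<inter> q <= {\<zero>}"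
	proof
		fix c assume c: "c : k \<inter> q"
		show "c : {\<zero>}"
		proof (rule ccontr)
			assume "c ~: {\<zero>}"
			then obtain c' where c': "c' : k" "c ** c' = \<one>" using k_inverse c by auto
			have "c' ** c : q" using dmodD(4)[OF qd] c c' kD by auto
			moreover have "\<one> ~: q" using q by (simp add: dprime_def)
			ultimately show False using c' c k_carrier by (metis IntD1 m_comm subsetD)
		qed
	qed
	have wsq: "adjs k ws \<inter> q <= {\<zero>}" by (rule indep_inter[OF IH(9) kq k_subring wsc])
	have wsp: "indep k p ws"
		by (rule indep_transfer[OF IH(9) q0 _ k_subring wsc]) (use wsq wsD in \<open>auto simp: q_def\<close>)
	have ext_sub: "pext z q <= p"
	proof
		fix f assume "f : pext z q"
		then obtain ds where ds: "set ds <= q" "f = pev z ds" by (auto simp: pext_def adj_def)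
		have "pev z ds : p" if "set ds <= q" for ds using that
		proof (induction ds)
			case (Cons d ds)
			thus ?case using p'(3,4) zE by (auto simp: q_def)
		qed (use p'(2) in auto)
		thus "f : p" using ds by simp
	qed
	have Cext: "dprime E (pext z (C i))" if "i <= length ts" for i
		unfolding E_def by (rule dprime_pext[OF D z(1) t IH(4)[OF that]])
	have Cext_strict: "pext z (C i) \<subset> pext z (C (Suc i))" if i: "i < length ts" for i
	proof -
		have d: "dprime D (C i)" "dprime D (C (Suc i))" using IH(4) i by auto
		obtain x where x: "x : C (Suc i)" "x ~: C i" using IH(5)[OF i] by auto
		have sub: "pext z (C i) <= pext z (C (Suc i))" using IH(5)[OF i] by (force simp: pext_def adj_def)
		have xD: "x : D" using x d by (auto simp: dprime_def)
		have "\<zero> : C i" "C i <= D" "\<zero> : C (Suc i)" "C (Suc i) <= D" using d by (auto simp: dprime_def dmod_def)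
		hence "pev z [x] ~: pext z (C i)" "pev z [x] : pext z (C (Suc i))"
			using pext_iff[OF D z(1) t, of _ "[x]"] x xD by auto
		thus ?thesis using sub by blast
	qed
	have genE: "EX u:E - p. u ** f : lin E ts" if f: "f : pext z q" for f
	proof -
		obtain ds where ds: "set ds <= q" "f = pev z ds" using f by (auto simp: pext_def adj_def)
		obtain u where u: "u : D - q" "ALL d:set ds. u ** d : lin D ts"
			using common_multiplier[OF D q tsc IH(3) ds(1)] by blast
		have uc: "u : RR" "set ds <= RR" using u ds Dc qD by auto
		have e: "u ** f = pev z (map ((\<otimes>) u) ds)" unfolding ds(2) by (rule pev_smult[OF z(1) uc(2,1)])
		have "pev z es : lin E ts" if "set es <= lin D ts" for es using that
		proof (induction es)
			case (Cons d es)
			thus ?case using dmodD(3,4)[OF lin_dmod[OF E tsc]] zE lin_transfer[OF DE E, of ts ts] tsc by auto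
		qed (use dmodD(2)[OF lin_dmod[OF E tsc]] in auto)
		moreover have "set (map ((\<otimes>) u) ds) <= lin D ts" using u(2) by auto
		ultimately have "u ** f : lin E ts" unfolding e by blast
		moreover have "u : E - p" using u DE by (auto simp: q_def)
		ultimately show ?thesis by blast
	qed
	show ?case
	\<comment> \<open>If every polynomial in \<open>p\<close> has its coefficients in \<open>q\<close>,
	  then \<open>p = q[z]\<close> and \<open>z\<close> joins \<open>ws\<close>. Otherwise
	  \<open>p\<close> is strictly larger than \<open>q[z]\<close>: one more generator is needed, and
	  the chain gains one step.\<close>
	proof (cases "ALL ds. set ds <= D & pev z ds : p --> set ds <= q")
		case True
		have pq: "p = pext z q"
		proof
			show "p <= pext z q"
			proof
				fix f assume f: "f : p"
				then obtain ds where ds: "set ds <= D" "f = pev z ds" using pE by (auto simp: E_def adj_def)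
				thus "f : pext z q" using True f ext_iff by blast
			qed
		qed (rule ext_sub)
		have "transc (adjs k ws) p z" unfolding transc_def
		proof (intro allI impI, elim conjE)
			fix ds assume "set ds <= adjs k ws" "pev z ds : p"
			hence "set ds <= q" using True wsD by (meson subset_trans)
			thus "set ds <= {\<zero>}" using wsq \<open>set ds <= adjs k ws\<close> by blast
		qed
		hence ind: "indep k p (z # ws)" using wsp by simp
		show ?thesis unfolding adjs_Cons D_def[symmetric] E_def[symmetric]
		proof (rule exI[of _ ts], rule exI[of _ "z # ws"], rule exI[of _ "%i. pext z (C i)"], intro conjI)
			show "set ts <= p" using IH(1) by (auto simp: q_def)
			show "ALL f:p. EX u:E - p. u ** f : lin E ts" using genE pq by blast
			show "pext z (C (length ts)) = p" using IH(6) pq by simp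
			show "set (z # ws) <= E" using IH(7) DE zE by auto
		qed (use IH(2,8) Cext Cext_strict ind in auto)
	next
		case False
		\<comment> \<open>A shortest polynomial of \<open>p\<close> outside \<open>q[z]\<close> is chosen.
		  Once its top terms with coefficients in \<open>q\<close> are dropped, its leading coefficient
		  \<open>g\<close> lies outside \<open>p\<close>, as needed for pseudo-division.\<close>
		define rl where "rl ds \<longleftrightarrow> set ds <= D & pev z ds : p & \<not> set ds <= q" for ds
		obtain ds where ds: "rl ds" and min: "!!es. rl es ==> length ds <= length es"
		proof -
			obtain ds where "rl ds" using False by (auto simp: rl_def)
			thus ?thesis using that ex_has_least_nat[of rl ds length] by blast
		qed
		have dsD: "set ds <= D" "pev z ds : p" "\<not> set ds <= q" using ds by (auto simp: rl_def)
		have qp: "q <= p" by (auto simp: q_def)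
		from pev_strip_dmod[OF pd zE E qp subset_trans[OF dsD(1) Dc] dsD(3)]
		obtain ds0 g r rest where h: "ds = ds0 @ g # rest" "g ~: q" "r : p" "pev z ds = pev z (ds0 @ [g]) \<oplus> r"
			by blast
		define f0 where "f0 = pev z (ds0 @ [g])"
		have gD: "g : D" "set ds0 <= D" using dsD h by auto
		have f0c: "f0 : RR" using gD Dc z unfolding f0_def by (intro pev_closed) auto
		have rc: "r : RR" using h p'(1) by auto
		have f0p: "f0 : p"
		proof -
			have "f0 = pev z ds \<oplus> \<ominus> r" unfolding h(4) f0_def[symmetric] using f0c rc by algebra
			thus ?thesis using dsD(2) dmod_uminus[OF pd E h(3)] p'(3) by auto
		qed
		have gp: "g : E - p" using gD DE h(2) by (auto simp: q_def)
		have minp: "set es <= q" if es: "set es <= D" "pev z es : p" "length es <= length ds0" for es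
			using min[of es] es h(1) by (force simp: rl_def)
		have f0q: "f0 ~: pext z q"
		proof -
			have "set (ds0 @ [g]) <= D" using gD by auto
			from ext_iff[OF this] show ?thesis using h(2) by (simp add: f0_def)
		qed
		have gen0: "EX u:E - p. u ** f : lin E (f0 # ts)" if f: "f : p" for f
		proof -
			obtain ss where ss: "set ss <= D" "f = pev z ss" using f pE by (auto simp: E_def adj_def)
			obtain m :: nat and qq rs where d: "qq : E" "set rs <= D" "length rs <= length ds0"
					"g [^] m ** f = qq ** f0 \<oplus> pev z rs"
				using pseudo_division[OF D z(1) gD ss(1)] unfolding ss(2) f0_def E_def by blast
			have gm: "g [^] m : E" using subring_pow[OF E] gp by blast
			have c: "qq : RR" "pev z rs : RR" "f : RR" "g [^] m : RR"
				using d(1,2) Dc Ec z(1) f p'(1) gm by (auto intro!: pev_closed)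
			have "pev z rs = g [^] m ** f \<oplus> \<ominus> (qq ** f0)" unfolding d(4) using c f0c by algebra
			also have "\<dots> : p" using f gm f0p d(1) p'(3,4) dmod_uminus[OF pd E] by blast
			\<comment> \<open>The remainder lies in \<open>p\<close> and is too short to have a coefficient
			  outside \<open>q\<close>.\<close>
			finally have "set rs <= q" using minp d by blast
			hence "pev z rs : pext z q" using ext_iff d by blast
			then obtain u where u: "u : E - p" "u ** pev z rs : lin E ts" using genE by blast
			have f0ts: "set (f0 # ts) <= RR" using f0c tsc by auto
			note l = dmodD[OF lin_dmod[OF E f0ts]]
			have "f0 : lin E (f0 # ts)" using lin_gen[OF E f0ts] by auto
			moreover have "u ** qq : E" using u d subringE(6)[OF E] by auto
			moreover have "u ** pev z rs : lin E (f0 # ts)" using u lin_transfer[of E E ts "f0 # ts"] E f0ts by auto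
			ultimately have "(u ** qq) ** f0 \<oplus> u ** pev z rs : lin E (f0 # ts)" using l by blast
			moreover have "(u ** qq) ** f0 \<oplus> u ** pev z rs = (u ** g [^] m) ** f"
			proof -
				have uc: "u : RR" using u Ec by auto
				have "(u ** g [^] m) ** f = u ** (qq ** f0 \<oplus> pev z rs)" using uc c d(4) by (simp add: m_assoc)
				thus ?thesis using uc c f0c by algebra
			qed
			moreover have "u ** g [^] m : E - p"
			proof -
				have "g [^] m ~: p"
				proof (induction m)
					case 0
					thus ?case using p by (simp add: dprime_def)
				next
					case (Suc m)
					thus ?case using pprime[of "g [^] m" g] subring_pow[OF E] gp by auto
				qed
				thus ?thesis using u gm pprime[of u "g [^] m"] subringE(6)[OF E] by auto
			qed
			ultimately show ?thesis by auto
		qed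
		define C' where "C' i = (if i <= length ts then pext z (C i) else p)" for i
		have ch: "C' i \<subset> C' (Suc i)" if "i < length (f0 # ts)" for i
		proof (cases "i < length ts")
			case True
			thus ?thesis using Cext_strict by (auto simp: C'_def)
		next
			case False
			hence "i = length ts" using that by simp
			thus ?thesis using ext_sub f0p f0q IH(6) by (auto simp: C'_def)
		qed
		have "f0 ~: set ts"
		proof
			assume "f0 : set ts"
			hence "f0 : q" using IH by auto
			hence "f0 = pev z [f0]" "set [f0] <= D" "set [f0] <= q" using f0c z qD by auto
			thus False using f0q ext_iff by metis
		qed
		hence dist: "distinct (f0 # ts)" using IH(2) by simp
		show ?thesis unfolding adjs_Cons D_def[symmetric] E_def[symmetric]
		proof (rule exI[of _ "f0 # ts"], rule exI[of _ ws], rule exI[of _ C'], intro conjI)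
			show "set (f0 # ts) <= p" using IH(1) f0p by (auto simp: q_def)
			show "ALL f:p. EX u:E - p. u ** f : lin E (f0 # ts)" using gen0 by blast
			show "ALL i<=length (f0 # ts). dprime E (C' i)" using Cext p by (auto simp: C'_def)
			show "set ws <= E" using IH(7) DE by auto
		qed (use dist ch IH(8) wsp in \<open>auto simp: C'_def\<close>)
	qed
qed

end

section \<open>Regular local rings\<close>

locale prime_localization = cring R for R (structure) +
	fixes P assumes prime_P: "primeideal P R"
begin

abbreviation "S \<equiv> RR - P"
abbreviation "fr \<equiv> fraction R P"
abbreviation "L \<equiv> localization R P"

lemma P_ideal: "ideal P R"
	using prime_P primeideal.axioms(1) by auto

lemma P_carrier: "P <= RR"
	using additive_subgroup.a_subset[OF ideal.axioms(1)[OF P_ideal]] .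

lemma S_one: "\<one> : S"
	using one_notin_prime[OF prime_P] by simp

lemma S_mult: "s : S ==> t : S ==> s ** t : S"
	using primeideal.I_prime[OF prime_P, of s t] by auto

lemma frac_relD: "((a, s), (b, t)) : frac_rel R P \<longleftrightarrow>
	a : RR & b : RR & s : S & t : S & (EX u:S. u ** (t ** a) = u ** (s ** b))"
	by (auto simp: frac_rel_def)

lemma frac_rel_equiv: "equiv (RR \<times> S) (frac_rel R P)"
proof (rule equivI)
	show "frac_rel R P <= (RR \<times> S) \<times> (RR \<times> S)" by (auto simp: frac_rel_def)
	show "refl_on (RR \<times> S) (frac_rel R P)"
		unfolding refl_on_def using S_one by (auto simp: frac_relD)
	show "sym (frac_rel R P)"
	proof (rule symI)
		fix x y assume xy: "(x, y) : frac_rel R P"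
		obtain a s b t where e: "x = (a, s)" "y = (b, t)" by (metis surj_pair)
		show "(y, x) : frac_rel R P" using xy unfolding e frac_relD by metis
	qed
	show "trans (frac_rel R P)"
	proof (rule transI)
		fix x y z assume xy: "(x, y) : frac_rel R P" and yz: "(y, z) : frac_rel R P"
		obtain a s b t c r where e: "x = (a, s)" "y = (b, t)" "z = (c, r)" by (metis surj_pair)
		obtain u v where h: "a : RR" "b : RR" "c : RR" "s : S" "t : S" "r : S" "u : S" "v : S"
			"u ** (t ** a) = u ** (s ** b)" "v ** (r ** b) = v ** (t ** c)"
			using xy yz unfolding e frac_relD by blast
		have c: "s : RR" "t : RR" "r : RR" "u : RR" "v : RR" using h by auto
		have "(u ** v ** t) ** (r ** a) = (v ** r) ** (u ** (t ** a))" using c h(1-3) by algebra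
		also have "\<dots> = (u ** s) ** (v ** (r ** b))" unfolding h(9) using c h(1-3) by algebra
		also have "\<dots> = (u ** v ** t) ** (s ** c)" unfolding h(10) using c h(1-3) by algebra
		finally show "(x, z) : frac_rel R P" unfolding e frac_relD using h S_mult by blast
	qed
qed

lemma fr_eq: "a : RR ==> b : RR ==> s : S ==> t : S ==>
	fr a s = fr b t \<longleftrightarrow> (EX u:S. u ** (t ** a) = u ** (s ** b))"
	unfolding fraction_def
	using eq_equiv_class_iff[OF frac_rel_equiv, of "(a, s)" "(b, t)"] by (auto simp: frac_relD)

lemma fr_eqI:
	assumes "a : RR" "b : RR" "s : S" "t : S" "t ** a = s ** b"
	shows "fr a s = fr b t"
	using fr_eq[OF assms(1-4)] assms S_one by metis

lemma mem_fr: "(a, s) : fr b t \<longleftrightarrow> ((b, t), (a, s)) : frac_rel R P"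
	by (simp add: fraction_def)

lemma mem_fr_eq: "a : RR ==> s : S ==> b : RR ==> t : S ==> (a, s) : fr b t \<longleftrightarrow> fr a s = fr b t"
	unfolding mem_fr fraction_def
	using eq_equiv_class_iff[OF frac_rel_equiv, of "(b, t)" "(a, s)"] by auto

lemma L_carrier: "carrier L = {fr a s | a s. a : RR & s : S}"
	by (auto simp: localization_def quotient_def fraction_def)

lemma fr_closed [simp]: "a : RR ==> s : S ==> fr a s : carrier L"
	by (auto simp: L_carrier)

lemma L_cases: assumes "x : carrier L" obtains a s where "a : RR" "s : S" "x = fr a s"
	using assms by (auto simp: L_carrier)

lemma Union_const: "X ~= {} ==> (!!x. x : X ==> x = c) ==> \<Union>X = c"
	by blast

lemma L_one: "\<one>\<^bsub>L\<^esub> = fr \<one> \<one>" and L_zero: "\<zero>\<^bsub>L\<^esub> = fr \<zero> \<one>"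
	by (simp_all add: localization_def)

lemma L_mult:
	assumes a: "a : RR" "s : S" and b: "b : RR" "t : S"
	shows "fr a s \<otimes>\<^bsub>L\<^esub> fr b t = fr (a ** b) (s ** t)"
proof -
	have "\<Union>{fr (a' ** b') (s' ** t') | a' s' b' t'. (a', s') : fr a s & (b', t') : fr b t} = fr (a ** b) (s ** t)"
	proof (rule Union_const)
		have "(a, s) : fr a s" "(b, t) : fr b t" using mem_fr_eq a b by auto
		thus "{fr (a' ** b') (s' ** t') | a' s' b' t'. (a', s') : fr a s & (b', t') : fr b t} ~= {}" by blast
		fix x assume "x : {fr (a' ** b') (s' ** t') | a' s' b' t'. (a', s') : fr a s & (b', t') : fr b t}"
		then obtain a' b' s' t' where x: "x = fr (a' ** b') (s' ** t')" "((a, s), (a', s')) : frac_rel R P" "((b, t), (b', t')) : frac_rel R P"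
			unfolding mem_fr by blast
		then obtain u v where h: "a' : RR" "b' : RR" "s' : S" "t' : S" "u : S" "v : S"
			"u ** (s' ** a) = u ** (s ** a')" "v ** (t' ** b) = v ** (t ** b')" unfolding frac_relD by blast
		have c: "s : RR" "t : RR" "s' : RR" "t' : RR" "u : RR" "v : RR"
			using h a b by auto
		have "(u ** v) ** ((s ** t) ** (a' ** b')) = (u ** (s ** a')) ** (v ** (t ** b'))" using c h(1,2) by algebra
		also have "\<dots> = (u ** v) ** ((s' ** t') ** (a ** b))" unfolding h(7,8)[symmetric] using c a b by algebra
		finally have "(u ** v) ** ((s ** t) ** (a' ** b')) = (u ** v) ** ((s' ** t') ** (a ** b))" .
		moreover have "u ** v : S" by (rule S_mult[OF h(5,6)])
		ultimately have "EX w:S. w ** ((s ** t) ** (a' ** b')) = w ** ((s' ** t') ** (a ** b))" by blast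
		thus "x = fr (a ** b) (s ** t)" unfolding x(1)
			using fr_eq[of "a' ** b'" "a ** b" "s' ** t'" "s ** t"] h a b S_mult by auto
	qed
	thus ?thesis by (simp add: localization_def)
qed

lemma L_add:
	assumes a: "a : RR" "s : S" and b: "b : RR" "t : S"
	shows "fr a s \<oplus>\<^bsub>L\<^esub> fr b t = fr (t ** a \<oplus> s ** b) (s ** t)"
proof -
	have "\<Union>{fr (t' ** a' \<oplus> s' ** b') (s' ** t') | a' s' b' t'. (a', s') : fr a s & (b', t') : fr b t} = fr (t ** a \<oplus> s ** b) (s ** t)"
	proof (rule Union_const)
		have "(a, s) : fr a s" "(b, t) : fr b t" using mem_fr_eq a b by auto
		thus "{fr (t' ** a' \<oplus> s' ** b') (s' ** t') | a' s' b' t'. (a', s') : fr a s & (b', t') : fr b t} ~= {}" by blast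
		fix x assume "x : {fr (t' ** a' \<oplus> s' ** b') (s' ** t') | a' s' b' t'. (a', s') : fr a s & (b', t') : fr b t}"
		then obtain a' b' s' t' where x: "x = fr (t' ** a' \<oplus> s' ** b') (s' ** t')" "((a, s), (a', s')) : frac_rel R P" "((b, t), (b', t')) : frac_rel R P"
			unfolding mem_fr by blast
		then obtain u v where h: "a' : RR" "b' : RR" "s' : S" "t' : S" "u : S" "v : S"
			"u ** (s' ** a) = u ** (s ** a')" "v ** (t' ** b) = v ** (t ** b')" unfolding frac_relD by blast
		have c: "s : RR" "t : RR" "s' : RR" "t' : RR" "u : RR" "v : RR"
			using h a b by auto
		have "(u ** v) ** ((s ** t) ** (t' ** a' \<oplus> s' ** b'))
			 = (v ** t ** t') ** (u ** (s ** a')) \<oplus> (u ** s ** s') ** (v ** (t ** b'))" using c h(1,2) by algebra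
		also have "\<dots> = (u ** v) ** ((s' ** t') ** (t ** a \<oplus> s ** b))" unfolding h(7,8)[symmetric] using c a b by algebra
		finally have "(u ** v) ** ((s ** t) ** (t' ** a' \<oplus> s' ** b')) = (u ** v) ** ((s' ** t') ** (t ** a \<oplus> s ** b))" .
		moreover have "u ** v : S" by (rule S_mult[OF h(5,6)])
		ultimately have "EX w:S. w ** ((s ** t) ** (t' ** a' \<oplus> s' ** b')) = w ** ((s' ** t') ** (t ** a \<oplus> s ** b))" by blast
		thus "x = fr (t ** a \<oplus> s ** b) (s ** t)" unfolding x(1)
			using fr_eq[of "t' ** a' \<oplus> s' ** b'" "t ** a \<oplus> s ** b" "s' ** t'" "s ** t"] h(1-4) a b c S_mult by simp
	qed
	thus ?thesis by (simp add: localization_def)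
qed

lemma L_cring: "cring L"
proof (rule cringI)
	show "abelian_group L"
	proof (rule abelian_groupI)
		show "x \<oplus>\<^bsub>L\<^esub> y : carrier L" if xy: "x : carrier L" "y : carrier L" for x y
		proof -
			obtain a s b t where h: "a : RR" "s : S" "x = fr a s" "b : RR" "t : S" "y = fr b t"
				using xy by (meson L_cases)
			thus ?thesis using S_mult[of s t] by (simp add: L_add)
		qed
		show "\<zero>\<^bsub>L\<^esub> : carrier L" using S_one by (simp add: L_zero)
		show "x \<oplus>\<^bsub>L\<^esub> y \<oplus>\<^bsub>L\<^esub> z = x \<oplus>\<^bsub>L\<^esub> (y \<oplus>\<^bsub>L\<^esub> z)" if xyz: "x : carrier L" "y : carrier L" "z : carrier L" for x y z
		proof -
			obtain a s b t c r where h: "a : RR" "s : S" "x = fr a s" "b : RR" "t : S" "y = fr b t"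
				"c : RR" "r : S" "z = fr c r"
				using xyz by (meson L_cases)
			hence c: "s : RR" "t : RR" "r : RR" by auto
			have S: "s ** t : S" "t ** r : S" "s ** t ** r : S" "s ** (t ** r) : S" using h S_mult by auto
			have "r ** (t ** a \<oplus> s ** b) \<oplus> s ** t ** c = t ** r ** a \<oplus> s ** (r ** b \<oplus> t ** c)"
				using h(1,4,7) c by algebra
			moreover have "s ** t ** r = s ** (t ** r)" using c by algebra
			ultimately show ?thesis using h c S by (simp add: L_add)
		qed
		show "x \<oplus>\<^bsub>L\<^esub> y = y \<oplus>\<^bsub>L\<^esub> x" if xy: "x : carrier L" "y : carrier L" for x y
		proof -
			obtain a s b t where h: "a : RR" "s : S" "x = fr a s" "b : RR" "t : S" "y = fr b t"
				using xy by (meson L_cases)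
			thus ?thesis by (simp add: L_add a_comm m_comm)
		qed
		show "\<zero>\<^bsub>L\<^esub> \<oplus>\<^bsub>L\<^esub> x = x" if x: "x : carrier L" for x
		proof -
			obtain a s where h: "a : RR" "s : S" "x = fr a s" using x by (meson L_cases)
			thus ?thesis using S_one by (simp add: L_zero L_add)
		qed
		show "EX y:carrier L. y \<oplus>\<^bsub>L\<^esub> x = \<zero>\<^bsub>L\<^esub>" if x: "x : carrier L" for x
		proof -
			obtain a s where h: "a : RR" "s : S" "x = fr a s" using x by (meson L_cases)
			have "s ** \<ominus> a \<oplus> s ** a = \<zero>" using h(1,2) by (simp add: r_distr[symmetric] l_neg)
			moreover have "fr \<zero> (s ** s) = fr \<zero> \<one>" using h S_mult[of s s] S_one by (intro fr_eqI) auto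
			ultimately have "fr (\<ominus> a) s \<oplus>\<^bsub>L\<^esub> x = \<zero>\<^bsub>L\<^esub>" using h by (simp add: L_add L_zero)
			thus ?thesis using h by (intro bexI[of _ "fr (\<ominus> a) s"]) auto
		qed
	qed
	show "comm_monoid L"
	proof (rule comm_monoidI)
		show "x \<otimes>\<^bsub>L\<^esub> y : carrier L" if xy: "x : carrier L" "y : carrier L" for x y
		proof -
			obtain a s b t where h: "a : RR" "s : S" "x = fr a s" "b : RR" "t : S" "y = fr b t"
				using xy by (meson L_cases)
			thus ?thesis using S_mult[of s t] by (simp add: L_mult)
		qed
		show "\<one>\<^bsub>L\<^esub> : carrier L" using S_one by (simp add: L_one)
		show "x \<otimes>\<^bsub>L\<^esub> y \<otimes>\<^bsub>L\<^esub> z = x \<otimes>\<^bsub>L\<^esub> (y \<otimes>\<^bsub>L\<^esub> z)" if xyz: "x : carrier L" "y : carrier L" "z : carrier L" for x y z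
		proof -
			obtain a s b t c r where h: "a : RR" "s : S" "x = fr a s" "b : RR" "t : S" "y = fr b t"
				"c : RR" "r : S" "z = fr c r"
				using xyz by (meson L_cases)
			thus ?thesis using S_mult by (simp add: L_mult m_assoc)
		qed
		show "x \<otimes>\<^bsub>L\<^esub> y = y \<otimes>\<^bsub>L\<^esub> x" if xy: "x : carrier L" "y : carrier L" for x y
		proof -
			obtain a s b t where h: "a : RR" "s : S" "x = fr a s" "b : RR" "t : S" "y = fr b t"
				using xy by (meson L_cases)
			thus ?thesis by (simp add: L_mult m_comm)
		qed
		show "\<one>\<^bsub>L\<^esub> \<otimes>\<^bsub>L\<^esub> x = x" if x: "x : carrier L" for x
		proof -
			obtain a s where h: "a : RR" "s : S" "x = fr a s" using x by (meson L_cases)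
			thus ?thesis using S_one by (simp add: L_one L_mult)
		qed
	qed
	show "(x \<oplus>\<^bsub>L\<^esub> y) \<otimes>\<^bsub>L\<^esub> z = x \<otimes>\<^bsub>L\<^esub> z \<oplus>\<^bsub>L\<^esub> y \<otimes>\<^bsub>L\<^esub> z" if xyz: "x : carrier L" "y : carrier L" "z : carrier L" for x y z
	proof -
		obtain a s b t c r where h: "a : RR" "s : S" "x = fr a s" "b : RR" "t : S" "y = fr b t"
			"c : RR" "r : S" "z = fr c r"
			using xyz by (meson L_cases)
		hence c: "s : RR" "t : RR" "r : RR" by auto
		have S: "s ** t : S" "t ** r : S" "s ** r : S" "s ** t ** r : S" "s ** r ** (t ** r) : S" using h S_mult by auto
		have "fr ((t ** a \<oplus> s ** b) ** c) (s ** t ** r) = fr (t ** r ** (a ** c) \<oplus> s ** r ** (b ** c)) (s ** r ** (t ** r))"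
			by (rule fr_eqI) (use h S c in \<open>simp_all, algebra\<close>)
		thus ?thesis using h c S by (simp add: L_add L_mult)
	qed
qed

interpretation L: cring L by (rule L_cring)

lemma L_uminus: "a : RR ==> s : S ==> \<ominus>\<^bsub>L\<^esub> fr a s = fr (\<ominus> a) s"
proof (rule L.minus_equality)
	assume h: "a : RR" "s : S"
	have "s ** \<ominus> a \<oplus> s ** a = \<zero>" using h(1,2) by (simp add: r_distr[symmetric] l_neg)
	moreover have "fr \<zero> (s ** s) = fr \<zero> \<one>" using h S_mult[of s s] S_one by (intro fr_eqI) auto
	ultimately show "fr (\<ominus> a) s \<oplus>\<^bsub>L\<^esub> fr a s = \<zero>\<^bsub>L\<^esub>" using h by (simp add: L_add L_zero)
qed auto

lemma fr_split: "a : RR ==> s : S ==> fr a s = fr \<one> s \<otimes>\<^bsub>L\<^esub> fr a \<one>"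
	using S_one by (simp add: L_mult)

definition cont :: "('a \<times> 'a) set set => 'a set" where
	"cont J = {a : RR. fr a \<one> : J}"

definition ext :: "'a set => ('a \<times> 'a) set set" where
	"ext Q = {fr a s | a s. a : Q & s : S}"

lemma cont_fr:
	assumes J: "ideal J L" and a: "a : RR" "s : S"
	shows "fr a s : J \<longleftrightarrow> a : cont J"
proof
	interpret J: ideal J L by fact
	assume h: "fr a s : J"
	have "fr s \<one> \<otimes>\<^bsub>L\<^esub> fr a s : J" using J.I_l_closed[OF h, of "fr s \<one>"] a S_one by auto
	moreover have "fr (s ** a) s = fr a \<one>" using a S_one by (intro fr_eqI) (auto simp: m_comm)
	ultimately show "a : cont J" using a S_one by (simp add: cont_def L_mult)
next
	interpret J: ideal J L by fact
	assume "a : cont J"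
	hence "fr a \<one> : J" by (simp add: cont_def)
	thus "fr a s : J" using J.I_l_closed[of "fr a \<one>" "fr \<one> s"] fr_split[OF a] a by simp
qed

lemma cont_ideal:
	assumes J: "ideal J L"
	shows "ideal (cont J) R"
proof -
	interpret J: ideal J L by fact
	show ?thesis
	proof (rule idealI)
		show "ring R" by (rule ring_axioms)
		show "subgroup (cont J) (add_monoid R)"
		proof (rule add.subgroupI)
			have "fr \<zero> \<one> : J" using J.zero_closed by (simp add: L_zero)
			thus "cont J ~= {}" by (auto simp: cont_def)
			show "\<ominus> a : cont J" if "a : cont J" for a
			proof -
				have a: "a : RR" "fr a \<one> : J" using that by (auto simp: cont_def)
				from J.a_inv_closed[OF a(2)] have "fr (\<ominus> a) \<one> : J" unfolding L_uminus[OF a(1) S_one] .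
				thus ?thesis using a by (simp add: cont_def)
			qed
			show "a \<oplus> b : cont J" if "a : cont J" "b : cont J" for a b
			proof -
				have h: "a : RR" "fr a \<one> : J" "b : RR" "fr b \<one> : J" using that by (auto simp: cont_def)
				have eq: "fr a \<one> \<oplus>\<^bsub>L\<^esub> fr b \<one> = fr (a \<oplus> b) \<one>" using h S_one by (simp add: L_add)
				from J.a_closed[OF h(2,4)] have "fr (a \<oplus> b) \<one> : J" unfolding eq .
				thus ?thesis using h by (simp add: cont_def)
			qed
		qed (auto simp: cont_def)
		show "x ** a : cont J" if "a : cont J" "x : RR" for a x
			using that J.I_l_closed[of "fr a \<one>" "fr x \<one>"] S_one by (auto simp: cont_def L_mult)
		show "a ** x : cont J" if "a : cont J" "x : RR" for a x
			using that J.I_r_closed[of "fr a \<one>" "fr x \<one>"] S_one by (auto simp: cont_def L_mult)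
	qed
qed

lemma cont_proper:
	assumes J: "ideal J L" "J ~= carrier L"
	shows "cont J <= P"
proof
	interpret J: ideal J L by fact
	fix a assume a: "a : cont J"
	show "a : P"
	proof (rule ccontr)
		assume "a ~: P"
		hence aS: "a : S" "fr a \<one> : J" using a by (auto simp: cont_def)
		hence "fr \<one> a \<otimes>\<^bsub>L\<^esub> fr a \<one> : J" using J.I_l_closed by auto
		moreover have "fr a a = fr \<one> \<one>" using aS S_one by (intro fr_eqI) auto
		ultimately have "\<one>\<^bsub>L\<^esub> : J" using aS S_one by (simp add: L_mult L_one)
		thus False using J.one_imp_carrier J(2) by simp
	qed
qed

lemma cont_prime:
	assumes J: "primeideal J L"
	shows "primeideal (cont J) R" "cont J <= P"
proof -
	interpret J: primeideal J L by fact
	show sub: "cont J <= P" using cont_proper[OF J.is_ideal] J.I_notcarr by auto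
	show "primeideal (cont J) R"
	proof (rule primeidealI)
		show "RR ~= cont J" using sub S_one by auto
		fix a b assume "a : RR" "b : RR" "a ** b : cont J"
		thus "a : cont J \<or> b : cont J"
			using J.I_prime[of "fr a \<one>" "fr b \<one>"] S_one by (auto simp: cont_def L_mult)
	qed (use cont_ideal[OF J.is_ideal] cring_axioms in auto)
qed

lemma cont_strict:
	assumes "ideal J L" "ideal J' L" "J \<subset> J'"
	shows "cont J \<subset> cont J'"
proof -
	have "cont J <= cont J'" using assms by (auto simp: cont_def)
	moreover obtain x where x: "x : J'" "x ~: J" using assms by auto
	hence "x : carrier L" using ideal.Icarr[OF assms(2)] by auto
	then obtain a s where a: "a : RR" "s : S" "x = fr a s" by (meson L_cases)
	hence "a : cont J'" "a ~: cont J" using cont_fr assms x by auto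
	ultimately show ?thesis by blast
qed

lemma ext_fr:
	assumes Q: "primeideal Q R" "Q <= P" and a: "a : RR" "s : S"
	shows "fr a s : ext Q \<longleftrightarrow> a : Q"
proof
	interpret Q: primeideal Q R by fact
	assume "fr a s : ext Q"
	then obtain b t where b: "b : Q" "t : S" "fr a s = fr b t" by (auto simp: ext_def)
	have bc: "b : RR" using b Q.Icarr by auto
	obtain u where u: "u : S" "u ** (t ** a) = u ** (s ** b)" using fr_eq[OF a(1) bc a(2) b(2)] b by auto
	have "u ** (s ** b) : Q" using b a u Q.I_l_closed by auto
	hence "(u ** t) ** a : Q" using u a b by (simp add: m_assoc)
	moreover have "u ** t : S" using u b S_mult by auto
	ultimately show "a : Q" using Q.I_prime[of "u ** t" a] a Q(2) by auto
qed (use a in \<open>auto simp: ext_def\<close>)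

lemma ext_prime:
	assumes Q: "primeideal Q R" "Q <= P"
	shows "primeideal (ext Q) L"
proof -
	interpret Q: primeideal Q R by fact
	note e = ext_fr[OF Q]
	have sub: "ext Q <= carrier L" using Q.a_subset by (auto simp: ext_def)
	show ?thesis
	proof (rule primeidealI)
		show "ideal (ext Q) L"
		proof (rule idealI)
			show "ring L" by (rule L.ring_axioms)
			show "subgroup (ext Q) (add_monoid L)"
			proof (rule L.add.subgroupI)
				show "ext Q ~= {}" using e[of \<zero> \<one>] S_one Q.zero_closed by auto
				show "\<ominus>\<^bsub>L\<^esub> x : ext Q" if "x : ext Q" for x
				proof -
					obtain a s where "a : RR" "s : S" "x = fr a s" using \<open>x : ext Q\<close> sub by (meson L_cases subsetD)
					thus ?thesis using that e by (simp add: L_uminus Q.a_inv_closed)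
				qed
				show "x \<oplus>\<^bsub>L\<^esub> y : ext Q" if xy: "x : ext Q" "y : ext Q" for x y
				proof -
					obtain a s b t where h: "a : RR" "s : S" "x = fr a s" "b : RR" "t : S" "y = fr b t"
						using xy sub by (meson L_cases subsetD)
					hence "a : Q" "b : Q" using xy e by auto
					hence "t ** a \<oplus> s ** b : Q" using h by (auto intro: Q.I_l_closed)
					thus ?thesis using h S_mult[of s t] e[of "t ** a \<oplus> s ** b" "s ** t"] by (simp add: L_add)
				qed
			qed (use sub in auto)
			show lc: "x \<otimes>\<^bsub>L\<^esub> y : ext Q" if xy: "y : ext Q" "x : carrier L" for x y
			proof -
				obtain a s b t where h: "a : RR" "s : S" "x = fr a s" "b : RR" "t : S" "y = fr b t"
					using xy sub by (meson L_cases subsetD)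
				hence "a ** b : Q" using xy e by (auto intro: Q.I_l_closed)
				thus ?thesis using h S_mult[of s t] e[of "a ** b" "s ** t"] by (simp add: L_mult)
			qed
			show "y \<otimes>\<^bsub>L\<^esub> x : ext Q" if xy: "y : ext Q" "x : carrier L" for x y
				using lc[OF xy] L.m_comm[of x y] xy sub by auto
		qed
		show "carrier L ~= ext Q"
		proof -
			have "fr \<one> \<one> ~: ext Q" using e[of \<one> \<one>] S_one Q(2) by auto
			moreover have "fr \<one> \<one> : carrier L" using S_one by (intro fr_closed) auto
			ultimately show ?thesis by metis
		qed
		fix x y assume xy: "x : carrier L" "y : carrier L" "x \<otimes>\<^bsub>L\<^esub> y : ext Q"
		obtain a s b t where h: "a : RR" "s : S" "x = fr a s" "b : RR" "t : S" "y = fr b t"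
			using xy by (meson L_cases)
		hence "a ** b : Q" using xy e[of "a ** b" "s ** t"] S_mult by (simp add: L_mult)
		thus "x : ext Q \<or> y : ext Q" using h e Q.I_prime[of a b] by auto
	qed (rule L_cring)
qed

lemma ext_strict:
	assumes "primeideal Q R" "primeideal Q' R" "Q' <= P" "Q \<subset> Q'"
	shows "ext Q \<subset> ext Q'"
proof -
	have "ext Q <= ext Q'" using assms by (auto simp: ext_def)
	moreover obtain a where a: "a : Q'" "a ~: Q" using assms by auto
	hence "a : RR" using ideal.Icarr[OF primeideal.axioms(1)[OF assms(2)]] by auto
	hence "fr a \<one> : ext Q'" "fr a \<one> ~: ext Q" using ext_fr a assms S_one by auto
	ultimately show ?thesis by blast
qed

lemma L_maximalideals: "{I. maximalideal I L} = {ext P}"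
proof -
	have eP: "primeideal (ext P) L" using ext_prime[OF prime_P] by simp
	interpret E: primeideal "ext P" L by (rule eP)
	have top: "J <= ext P" if J: "ideal J L" "J ~= carrier L" for J
	proof
		fix x assume x: "x : J"
		then obtain a s where h: "a : RR" "s : S" "x = fr a s" using ideal.Icarr[OF J(1)] by (meson L_cases)
		hence "a : P" using cont_fr[OF J(1)] cont_proper[OF J] x by blast
		thus "x : ext P" using h unfolding ext_def by blast
	qed
	have "maximalideal (ext P) L"
	proof (rule maximalidealI)
		show "ideal (ext P) L" by (rule E.is_ideal)
		show "carrier L ~= ext P" by (rule E.I_notcarr)
		show "J = ext P \<or> J = carrier L" if "ideal J L" "ext P <= J" "J <= carrier L" for J
			using top[OF that(1)] that by auto
	qed
	moreover have "I = ext P" if I: "maximalideal I L" for I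
	proof -
		interpret I: maximalideal I L by fact
		have "I <= ext P" using top[OF I.is_ideal] I.I_notcarr by metis
		thus ?thesis using I.I_maximal[OF E.is_ideal _ E.a_subset] E.I_notcarr by metis
	qed
	ultimately show ?thesis by blast
qed

lemma L_noetherian:
	assumes "noetherian_ring R"
	shows "noetherian_ring L"
proof (rule L.noetherian_ringI)
	fix J assume J: "ideal J L"
	interpret J: ideal J L by fact
	interpret N: noetherian_ring R by fact
	obtain A where A: "A <= RR" "finite A" "cont J = Idl A" using N.finetely_gen[OF cont_ideal[OF J]] by auto
	have AJ: "A <= cont J" using genideal_self[OF A(1)] A(3) by simp
	let ?B = "(%a. fr a \<one>) ` A"
	have B: "?B <= carrier L" using A S_one by auto
	interpret I: ideal "Idl\<^bsub>L\<^esub> ?B" L by (rule L.genideal_ideal[OF B])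
	have "J = Idl\<^bsub>L\<^esub> ?B"
	proof
		show "Idl\<^bsub>L\<^esub> ?B <= J" using AJ by (intro L.genideal_minimal[OF J]) (auto simp: cont_def)
		have "A <= cont (Idl\<^bsub>L\<^esub> ?B)" using L.genideal_self[OF B] A(1) by (auto simp: cont_def)
		hence "cont J <= cont (Idl\<^bsub>L\<^esub> ?B)" unfolding A(3) by (rule genideal_minimal[OF cont_ideal[OF I.is_ideal]])
		thus "J <= Idl\<^bsub>L\<^esub> ?B"
		proof (intro subsetI)
			fix x assume "cont J <= cont (Idl\<^bsub>L\<^esub> ?B)" and x: "x : J"
			then obtain a s where h: "a : RR" "s : S" "x = fr a s" using J.Icarr by (meson L_cases)
			thus "x : Idl\<^bsub>L\<^esub> ?B" using cont_fr[OF J] cont_fr[OF I.is_ideal] x \<open>cont J <= _\<close> by auto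
		qed
	qed
	thus "EX A<=carrier L. finite A & J = Idl\<^bsub>L\<^esub> A" using B A(2) by blast
qed

text \<open>The chain \<open>C\<close> and the bound on chains below \<open>P\<close> make the
  dimension of the localization equal to \<open>length ts\<close>. The ring is a domain, so distinct
  \<open>ts\<close> stay distinct as fractions, and the generating set has exactly as many elements
  as the definition demands.\<close>

lemma regular_local_ringI:
	assumes N: "noetherian_ring R" and dom: "!!a b. a : RR ==> b : RR ==> a ** b = \<zero> ==> a = \<zero> \<or> b = \<zero>"
		and ts: "set ts <= P" "distinct ts" "!!f. f : P ==> EX u:S. u ** f : lin (RR) ts"
		and C: "!!i. i <= length ts ==> primeideal (C i) R" "!!i. i < length ts ==> C i \<subset> C (Suc i)" "C (length ts) <= P"
		and bound: "!!n C. [|!!i. i <= n ==> primeideal (C i) R; !!i. i < n ==> C i \<subset> C (Suc i); C n <= P|] ==> n <= length ts"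
	shows "regular_local_ring L"
proof -
	have tsc: "set ts <= RR" using ts P_carrier by auto
	let ?T = "(%a. fr a \<one>) ` set ts"
	have inj: "inj_on (%a. fr a \<one>) (RR)"
	proof (rule inj_onI)
		fix a b assume ab: "a : RR" "b : RR" "fr a \<one> = fr b \<one>"
		then obtain u where u: "u : S" "u ** (\<one> ** a) = u ** (\<one> ** b)" using fr_eq[OF ab(1,2) S_one S_one] by auto
		hence uc: "u : RR" by auto
		have "u ** (a \<ominus> b) = u ** (\<one> ** a) \<ominus> u ** (\<one> ** b)" using uc ab by algebra
		hence "u ** (a \<ominus> b) = \<zero>" unfolding u(2) using uc ab by (simp add: minus_eq r_neg)
		moreover have "u ~= \<zero>" using u additive_subgroup.zero_closed[OF ideal.axioms(1)[OF P_ideal]] by auto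
		ultimately have "a \<ominus> b = \<zero>" using dom[of u "a \<ominus> b"] uc ab by auto
		thus "a = b" using ab by simp
	qed
	have card: "card ?T = length ts"
		using card_image[OF inj_on_subset[OF inj tsc]] distinct_card[OF ts(2)] by simp
	have T: "?T <= carrier L" using tsc S_one by auto
	have Cs: "C i <= P" if "i <= length ts" for i
		using that
	proof (induction "length ts - i" arbitrary: i)
		case 0
		thus ?case using C(3) by auto
	next
		case (Suc n)
		hence "C (Suc i) <= P" by (intro Suc.hyps(1)) auto
		moreover have "C i \<subset> C (Suc i)" using Suc.hyps(2) by (intro C(2)) simp
		ultimately show ?case by blast
	qed
	have "enat (length ts) <= krull_dim L"
		by (rule krull_dim_ge_chain[of _ "%i. ext (C i)"])
			(use ext_prime ext_strict C Cs in \<open>auto simp: Suc_le_eq\<close>)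
	moreover have "krull_dim L <= enat (length ts)"
	proof (rule krull_dim_le)
		fix n J assume J: "!!i. i <= n ==> primeideal (J i) L" "!!i. i < n ==> J i \<subset> J (Suc i)"
		show "n <= length ts"
		proof (rule bound[of n "%i. cont (J i)"])
			show "cont (J i) \<subset> cont (J (Suc i))" if "i < n" for i
				using that J by (intro cont_strict primeideal.axioms(1)) auto
		qed (use cont_prime J in auto)
	qed
	ultimately have dim: "krull_dim L = enat (length ts)" by simp
	have gen: "ext P = Idl\<^bsub>L\<^esub> ?T"
	proof
		interpret I: ideal "Idl\<^bsub>L\<^esub> ?T" L by (rule L.genideal_ideal[OF T])
		have eP: "ideal (ext P) L" using ext_prime[OF prime_P] primeideal.axioms(1) by auto
		show "Idl\<^bsub>L\<^esub> ?T <= ext P" using ts(1) S_one by (intro L.genideal_minimal[OF eP]) (auto simp: ext_def)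
		show "ext P <= Idl\<^bsub>L\<^esub> ?T"
		proof
			fix x assume "x : ext P"
			then obtain a s where a: "a : P" "s : S" "x = fr a s" by (auto simp: ext_def)
			obtain u where u: "u : S" "u ** a : lin (RR) ts" using ts(3)[OF a(1)] by auto
			have ac: "a : RR" using a P_carrier by auto
			have "set ts <= cont (Idl\<^bsub>L\<^esub> ?T)" using L.genideal_self[OF T] tsc by (auto simp: cont_def)
			hence "lin (RR) ts <= cont (Idl\<^bsub>L\<^esub> ?T)"
				by (intro lin_least ideal_dmod[OF cont_ideal[OF I.is_ideal]]) auto
			hence "fr (u ** a) (u ** s) : Idl\<^bsub>L\<^esub> ?T" using u ac a S_mult by (subst cont_fr[OF I.is_ideal]) auto
			moreover have "fr (u ** a) (u ** s) = x" unfolding a(3)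
				using u a ac S_mult by (intro fr_eqI) (auto simp: m_ac)
			ultimately show "x : Idl\<^bsub>L\<^esub> ?T" by simp
		qed
	qed
	show ?thesis unfolding regular_local_ring_def
	proof (intro conjI, goal_cases)
		case 3
		show ?case
		proof (rule exI[of _ "ext P"], intro conjI, goal_cases)
			case 2
			show ?case by (rule exI[of _ ?T]) (use T card dim gen in auto)
		qed (rule L_maximalideals)
	qed (use L_cring L_noetherian[OF N] in auto)
qed

text \<open>The numerators of generators of the maximal ideal generate \<open>P\<close> up to
  multipliers outside \<open>P\<close>. Passing from the generating set to a list of numerators may
  identify elements, but the length still equals the dimension.\<close>

lemma regular_local_ringE:
	assumes reg: "regular_local_ring L"
	obtains as C where "set as <= P" "!!f. f : P ==> EX u:S. u ** f : lin (RR) as"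
		"!!i. i <= length as ==> primeideal (C i) R" "!!i. i < length as ==> C i \<subset> C (Suc i)"
proof -
	obtain T where T: "T <= carrier L" "finite T" "enat (card T) = krull_dim L" "ext P = Idl\<^bsub>L\<^esub> T"
		using reg unfolding regular_local_ring_def L_maximalideals by auto
	have eP: "ideal (ext P) L" using ext_prime[OF prime_P] primeideal.axioms(1) by auto
	have "T <= ext P" using L.genideal_self[OF T(1)] T(4) by simp
	hence "ALL x:T. EX a s. a : P & s : S & x = fr a s" by (auto simp: ext_def)
	then obtain num den where nd: "!!x. x : T ==> num x : P & den x : S & x = fr (num x) (den x)" by metis
	obtain xs where xs: "set xs = T" "length xs = card T" using finite_distinct_list[OF T(2)] distinct_card by metis
	define as where "as = map num xs"
	have asP: "set as <= P" using nd xs by (auto simp: as_def)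
	have asc: "set as <= RR" using asP P_carrier by auto
	define W where "W = {fr a s | a s. a : lin (RR) as & s : S}"
	note l = dmodD[OF lin_dmod[OF carrier_is_subring asc]]
	have WI: "ideal W L"
	proof (rule idealI)
		have Wc: "W <= carrier L" using l(1) by (auto simp: W_def)
		show "ring L" by (rule L.ring_axioms)
		show "subgroup W (add_monoid L)"
		proof (rule L.add.subgroupI)
			show "W ~= {}" using l(2) S_one by (auto simp: W_def)
			show "\<ominus>\<^bsub>L\<^esub> x : W" if xW: "x : W" for x
			proof -
				obtain a s where "a : lin (RR) as" "s : S" "x = fr a s" using xW by (auto simp: W_def)
				moreover from this have "\<ominus> a : lin (RR) as" "a : RR"
					using dmod_uminus[OF lin_dmod[OF carrier_is_subring asc] carrier_is_subring] l(1) by auto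
				ultimately show ?thesis by (auto simp: W_def L_uminus)
			qed
			show "x \<oplus>\<^bsub>L\<^esub> y : W" if xy: "x : W" "y : W" for x y
			proof -
				obtain a s b t where h: "a : lin (RR) as" "s : S" "x = fr a s" "b : lin (RR) as" "t : S" "y = fr b t"
					using xy by (auto simp: W_def)
				have c: "a : RR" "b : RR" using h l(1) by auto
				have "t ** a \<oplus> s ** b : lin (RR) as" using h l(3,4) by auto
				thus ?thesis using h c S_mult[of s t] by (auto simp: W_def L_add)
			qed
		qed (use Wc in auto)
		show lc: "x \<otimes>\<^bsub>L\<^esub> y : W" if xy: "y : W" "x : carrier L" for x y
		proof -
			obtain b t where h: "b : lin (RR) as" "t : S" "y = fr b t" using xy by (auto simp: W_def)
			obtain a s where h': "a : RR" "s : S" "x = fr a s" using xy by (meson L_cases)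
			have c: "b : RR" using h l(1) by auto
			have "a ** b : lin (RR) as" using h h' l(4) by auto
			thus ?thesis using h h' c S_mult[of s t] by (auto simp: W_def L_mult)
		qed
		show "y \<otimes>\<^bsub>L\<^esub> x : W" if xy: "y : W" "x : carrier L" for x y
			using lc[OF xy] L.m_comm[of x y] xy Wc by auto
	qed
	have "T <= W"
	proof
		fix x assume x: "x : T"
		hence "num x : lin (RR) as" using xs by (intro lin_gen[OF carrier_is_subring asc]) (auto simp: as_def)
		thus "x : W" using nd[OF x] by (auto simp: W_def)
	qed
	hence sub: "ext P <= W" unfolding T(4) by (rule L.genideal_minimal[OF WI])
	have gen: "EX u:S. u ** f : lin (RR) as" if f: "f : P" for f
	proof -
		have fc: "f : RR" using f P_carrier by auto
		have "fr f \<one> : W" using f sub S_one by (auto simp: ext_def)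
		then obtain a s where a: "a : lin (RR) as" "s : S" "fr f \<one> = fr a s" by (auto simp: W_def)
		have ac: "a : RR" using a l(1) by auto
		obtain u where u: "u : S" "u ** (s ** f) = u ** (\<one> ** a)" using fr_eq[OF fc ac S_one a(2)] a(3) by auto
		have "u ** a : lin (RR) as" using u a l(4) by auto
		hence "(u ** s) ** f : lin (RR) as" using u a fc ac by (simp add: m_assoc)
		thus ?thesis using u a S_mult by blast
	qed
	define h where "h = card T"
	have lh: "length as = h" using xs by (simp add: as_def h_def)
	\<comment> \<open>The dimension is a supremum and has to be attained. If no chain had length
	  \<open>h\<close>, all chains would have length at most \<open>h - 1\<close>; here
	  \<open>h\<close> is positive, since the maximal ideal alone is a chain of length
	  \<open>0\<close>.\<close>
	have "EX J. (ALL i<=h. primeideal (J i) L) & (ALL i<h. J i \<subset> J (Suc i))"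
	proof (rule ccontr)
		assume no: "\<not> ?thesis"
		have "krull_dim L <= enat (h - 1) & h \<ge> 1"
		proof
			have "primeideal (ext P) L" using ext_prime[OF prime_P] by simp
			thus "h \<ge> 1" using no by (cases h) auto
			show "krull_dim L <= enat (h - 1)"
			proof (rule krull_dim_le)
				fix n J assume J: "!!i. i <= n ==> primeideal (J i) L" "!!i. i < n ==> J i \<subset> J (Suc i)"
				have "\<not> h <= n"
				proof
					assume "h <= n"
					hence "(ALL i<=h. primeideal (J i) L) & (ALL i<h. J i \<subset> J (Suc i))" using J by auto
					thus False using no by blast
				qed
				thus "n <= h - 1" by simp
			qed
		qed
		moreover have "krull_dim L = enat h" using T(3) by (simp add: h_def)
		ultimately have "h <= h - 1" "h \<ge> 1" by (metis enat_ord_simps(1), blast)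
		thus False by simp
	qed
	then obtain J where J: "!!i. i <= h ==> primeideal (J i) L" "!!i. i < h ==> J i \<subset> J (Suc i)" by blast
	show thesis
	proof (rule that[of as "%i. cont (J i)", OF asP gen])
		show "primeideal (cont (J i)) R" if "i <= length as" for i using that J cont_prime lh by auto
		show "cont (J i) \<subset> cont (J (Suc i))" if "i < length as" for i
			using that J lh by (intro cont_strict primeideal.axioms(1)) auto
	qed
qed

end

context subfield_cring
begin

theorem regular_ring_polynomial:
	assumes zs: "set zs <= RR" "adjs k zs = RR" "indep k {\<zero>} zs"
	shows "regular_ring R"
	unfolding regular_ring_def
proof (intro conjI allI impI)
	show "cring R" by (rule cring_axioms)
	show N: "noetherian_ring R" by (rule noetherian_ring_gens[OF zs(1,2)])
	fix P assume P: "primeideal P R"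
	interpret loc: prime_localization R P by (rule prime_localization.intro[OF cring_axioms prime_localization_axioms.intro[OF P]])
	obtain ts ws C where h: "set ts <= P" "distinct ts" "ALL f:P. EX u:RR - P. u ** f : lin (RR) ts"
		"ALL i<=length ts. dprime (RR) (C i)" "ALL i<length ts. C i \<subset> C (Suc i)" "C (length ts) = P"
		"set ws <= RR" "length ws + length ts = length zs" "indep k P ws"
		using polynomial_prime_structure[OF zs(1,3), of P] unfolding zs(2) dprime_primeideal using P by blast
	show "regular_local_ring (localization R P)"
	proof (rule loc.regular_local_ringI[OF N _ h(1,2)])
		show "a = \<zero> \<or> b = \<zero>" if "a : RR" "b : RR" "a ** b = \<zero>" for a b
			using adjs_domain[OF zs(1,3)] zs(2) that by auto
		show "primeideal (C i) R" if "i <= length ts" for i using h(4) that by (simp add: dprime_primeideal)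
		fix n and Q assume Q: "!!i. i <= n ==> primeideal (Q i) R" "!!i. i < n ==> Q i \<subset> Q (Suc i)" "Q n <= P"
		\<comment> \<open>The elements picked from a chain below \<open>P\<close> are independent over
		  those of \<open>ws\<close>, so \<open>n\<close> plus the length of \<open>ws\<close> is at most
		  the number of variables.\<close>
		have "EX xs. set xs <= RR & length xs = n & indep k (Q 0) (xs @ ws) & k \<inter> Q 0 <= {\<zero>}"
			using k_inter_prime[OF Q(1), of n] h(7) indep_mono[OF h(9) Q(3)]
			by (intro prime_chain_indep[of n Q, OF Q(1,2) k_subring]) auto
		then obtain xs where xs: "set xs <= RR" "length xs = n" "indep k (Q 0) (xs @ ws)" by auto
		have "length (xs @ ws) <= length zs"
			using indep_length_le_gens[OF zs(1,2) Q(1)[of 0] _ xs(3)] xs(1) h(7) by auto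
		thus "n <= length ts" using xs(2) h(8) by simp
	qed (use h in auto)
qed

text \<open>The product ideal \<open>m m\<close>. Since \<open>comb\<close> stops at the end of the
  shorter list, the two lists may have different lengths.\<close>

definition ideal_square :: "'a set => 'a set" where
	"ideal_square m = {comb as bs | as bs. set as <= m & set bs <= m}"

lemma ideal_square_dmod:
	assumes m: "ideal m R"
	shows "dmod (RR) (ideal_square m)"
proof -
	interpret m: ideal m R by fact
	have mc: "m <= RR" by (rule m.a_subset)
	have tr: "EX as' bs'. set as' <= m & set bs' <= m & length as' = length bs' & comb as bs = comb as' bs'"
		if "set as <= m" "set bs <= m" for as bs
		using that
	proof (induction as bs rule: comb.induct)
		case (1 c cs v vs)
		then obtain as' bs' where "set as' <= m" "set bs' <= m" "length as' = length bs'" "comb cs vs = comb as' bs'" by auto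
		thus ?case using 1 by (intro exI[of _ "c # as'"] exI[of _ "v # bs'"]) auto
	qed (auto intro!: exI[of _ "[]"])
	show ?thesis unfolding dmod_def
	proof (intro conjI ballI)
		show "ideal_square m <= RR" using mc by (force simp: ideal_square_def)
		show "\<zero> : ideal_square m" unfolding ideal_square_def by (intro CollectI exI[of _ "[]"]) auto
	next
		fix x y assume "x : ideal_square m" "y : ideal_square m"
		then obtain as bs cs ds where "x = comb as bs" "y = comb cs ds" and
			s: "set as <= m" "set bs <= m" "set cs <= m" "set ds <= m" by (auto simp: ideal_square_def)
		moreover obtain as' bs' where h: "set as' <= m" "set bs' <= m" "length as' = length bs'" "comb as bs = comb as' bs'"
			using tr[OF s(1,2)] by blast
		ultimately have "x \<oplus> y = comb (as' @ cs) (bs' @ ds)" using mc by (subst comb_append) auto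
		thus "x \<oplus> y : ideal_square m" unfolding ideal_square_def using h s
			by (intro CollectI exI[of _ "as' @ cs"] exI[of _ "bs' @ ds"]) auto
	next
		fix d x assume d: "d : RR" "x : ideal_square m"
		then obtain as bs where s: "x = comb as bs" "set as <= m" "set bs <= m" by (auto simp: ideal_square_def)
		have "set as <= RR" "set bs <= RR" using s mc by auto
		hence "d ** x = comb (map ((\<otimes>) d) as) bs" using d s by (simp add: comb_smult)
		thus "d ** x : ideal_square m" unfolding ideal_square_def using s d
			by (intro CollectI exI[of _ "map ((\<otimes>) d) as"] exI[of _ bs]) (auto intro: m.I_l_closed)
	qed
qed

lemma comb_in_ideal_square: "set as <= m ==> set bs <= m ==> comb as bs : ideal_square m"
	by (auto simp: ideal_square_def)

lemma comb_add_left: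
	"length as = length bs ==> set as <= RR ==> set bs <= RR ==> set vs <= RR ==> length vs = length as ==>
		comb (map2 (\<oplus>) as bs) vs = comb as vs \<oplus> comb bs vs"
proof (induction as bs arbitrary: vs rule: list_induct2)
	case (Cons a as b bs)
	then obtain v vs' where v: "vs = v # vs'" by (cases vs) auto
	have c: "comb as vs' : RR" "comb bs vs' : RR" using Cons.prems v by auto
	have "(a \<oplus> b) ** v \<oplus> (comb as vs' \<oplus> comb bs vs') = (a ** v \<oplus> comb as vs') \<oplus> (b ** v \<oplus> comb bs vs')"
		using c Cons.prems v by (simp, algebra)
	thus ?case using Cons v by simp
qed auto

text \<open>Regularity gives a list \<open>as\<close> that generates \<open>m\<close> locally,
  together with a chain of length \<open>length as\<close>. The residue field is \<open>k\<close>,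
  so \<open>as\<close> spans \<open>m\<close> modulo the square over \<open>k\<close>, and the
  linearly independent \<open>zs\<close> are no more numerous than \<open>as\<close>. The chain
  yields \<open>length as\<close> independent elements, and a generating list that is no longer than
  an independent list is independent itself.\<close>

theorem regular_local_indep:
	assumes m: "primeideal m R" and aug: "!!f. f : RR ==> EX c:k. f \<ominus> c : m"
		and zs: "set zs <= m" "adjs k zs = RR"
		and li: "!!cs. length cs = length zs ==> set cs <= k ==> comb cs zs : ideal_square m ==> set cs <= {\<zero>}"
		and reg: "regular_local_ring (localization R m)"
	shows "indep k {\<zero>} zs"
proof -
	interpret loc: prime_localization R m by (rule prime_localization.intro[OF cring_axioms prime_localization_axioms.intro[OF m]])
	interpret m: primeideal m R by fact
	have mc: "m <= RR" by (rule m.a_subset)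
	have zsc: "set zs <= RR" using zs mc by auto
	obtain as C where h: "set as <= m" "!!f. f : m ==> EX u:RR - m. u ** f : lin (RR) as"
		"!!i. i <= length as ==> primeideal (C i) R" "!!i. i < length as ==> C i \<subset> C (Suc i)"
		using loc.regular_local_ringE[OF reg] by metis
	have asc: "set as <= RR" using h mc by auto
	have sd: "dmod (RR) (ideal_square m)" by (rule ideal_square_dmod[OF m.is_ideal])
	note sq = dmodD[OF sd]
	have sqk: "dmod k (ideal_square m)" using sd k_carrier by (auto simp: dmod_def)
	have two: "a ** b : ideal_square m" if ab: "a : m" "b : m" for a b
	proof -
		have "a ** b = comb [a] [b]" using ab mc by auto
		thus ?thesis using comb_in_ideal_square[of "[a]" m "[b]"] ab by simp
	qed
	\<comment> \<open>A multiplier \<open>u\<close> outside \<open>m\<close> has an invertible constant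
	  part \<open>c\<close>, and each coefficient is a constant plus an element of \<open>m\<close>.
	  Everything but the constants ends up in the square of \<open>m\<close>.\<close>
	have spl: "EX w:lin k as. EX p:ideal_square m. v = w \<oplus> p" if v: "v : m" for v
	proof -
		obtain u where u: "u : RR - m" "u ** v : lin (RR) as" using h(2)[OF v] by auto
		obtain rs where rs: "length rs = length as" "set rs <= RR" "u ** v = comb rs as" using u by (auto simp: lin_def)
		obtain c where c: "c : k" "u \<ominus> c : m" using aug u by auto
		have cc: "c : RR" "u : RR" "v : RR" using c u v k_carrier mc by auto
		have "c ~= \<zero>"
		proof
			assume "c = \<zero>"
			hence "u : m" using c cc by (simp add: minus_eq)
			thus False using u by simp
		qed
		then obtain c' where c': "c' : k" "c ** c' = \<one>" using k_inverse c by auto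
		have "ALL r:RR. EX c:k. r \<ominus> c : m" using aug by auto
		then obtain \<rho> where \<rho>: "!!r. r : RR ==> \<rho> r : k & r \<ominus> \<rho> r : m" by metis
		let ?rs1 = "map \<rho> rs" and ?rs2 = "map (%r. r \<ominus> \<rho> r) rs"
		have r1: "set ?rs1 <= k" "set ?rs1 <= RR" "set ?rs2 <= m" "set ?rs2 <= RR"
			using \<rho> rs k_carrier mc by auto
		have "rs = map2 (\<oplus>) ?rs1 ?rs2"
		proof (rule nth_equalityI)
			fix i assume i: "i < length rs"
			have ri: "rs ! i : RR" using i rs(2) nth_mem by auto
			moreover have "\<rho> (rs ! i) : RR" using \<rho>[OF ri] k_carrier by auto
			ultimately have "rs ! i : RR" "\<rho> (rs ! i) : RR" .
			hence "rs ! i = \<rho> (rs ! i) \<oplus> (rs ! i \<ominus> \<rho> (rs ! i))" by algebra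
			thus "rs ! i = map2 (\<oplus>) ?rs1 ?rs2 ! i" using i by simp
		qed simp
		from arg_cong[OF this, of "%x. comb x as"]
		have "u ** v = comb (map2 (\<oplus>) ?rs1 ?rs2) as" using rs(3) by (rule trans[rotated])
		also have "\<dots> = comb ?rs1 as \<oplus> comb ?rs2 as"
			by (rule comb_add_left) (use r1 asc rs(1) in auto)
		finally have e: "u ** v = comb ?rs1 as \<oplus> comb ?rs2 as" .
		have cl: "comb ?rs1 as : RR" "comb ?rs2 as : RR" "c' : RR" using r1 asc c' k_carrier by auto
		have "v = (c ** c') ** v" using c' cc by simp
		also have "\<dots> = c' ** (u ** v) \<oplus> (\<ominus> c') ** ((u \<ominus> c) ** v)" using cc cl(3) by algebra
		also have "\<dots> = c' ** comb ?rs1 as \<oplus> (c' ** comb ?rs2 as \<oplus> (\<ominus> c') ** ((u \<ominus> c) ** v))"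
			unfolding e using cc cl by (simp add: r_distr a_assoc)
		finally have "v = c' ** comb ?rs1 as \<oplus> (c' ** comb ?rs2 as \<oplus> (\<ominus> c') ** ((u \<ominus> c) ** v))" .
		moreover have "c' ** comb ?rs1 as : lin k as"
		proof (rule dmodD(4)[OF lin_dmod[OF k_subring asc] c'(1)])
			show "comb ?rs1 as : lin k as" unfolding lin_def using r1(1) rs(1) by (intro CollectI exI[of _ ?rs1]) auto
		qed
		moreover have "c' ** comb ?rs2 as \<oplus> (\<ominus> c') ** ((u \<ominus> c) ** v) : ideal_square m"
			using comb_in_ideal_square[OF r1(3) h(1)] two[OF c(2) v] cl sq(3,4) by simp
		ultimately show ?thesis by blast
	qed
	have le: "length zs <= length as"
	proof (rule ccontr)
		assume "\<not> length zs <= length as"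
		hence len: "length as < length zs" by simp
		have "EX cs. length cs = length zs & set cs <= k & \<not> set cs <= {\<zero>} & comb cs zs : ideal_square m"
		proof (rule nontrivial_relation[OF k_subring _ _ sqk _ asc _ len])
			show "\<one> ~: {\<zero>}" using one_not_zero by simp
			show "a : {\<zero>} \<or> b : {\<zero>}" if "a : k" "b : k" "a ** b : {\<zero>}" for a b
				using that subfieldE(5)[OF subfield_k] by auto
			show "n ** s : ideal_square m" if "n : {\<zero>}" "s : RR" for n s using that sq(2) by auto
		qed (use spl zs in auto)
		thus False using li by blast
	qed
	have "EX xs. set xs <= RR & length xs = length as & indep k (C 0) (xs @ []) & k \<inter> C 0 <= {\<zero>}"
		using k_inter_prime[OF h(3), of "length as"] by (intro prime_chain_indep[of "length as" C, OF h(3,4) k_subring]) auto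
	then obtain xs where xs: "set xs <= RR" "length xs = length as" "indep k (C 0) xs" by auto
	have pC: "primeideal (C 0) R" using h(3)[of 0] by simp
	have "indep k (C 0) zs" using indep_gens[OF zsc zs(2) pC xs(1,3)] le xs(2) by simp
	moreover have "{\<zero>} <= C 0" using additive_subgroup.zero_closed[OF ideal.axioms(1)[OF primeideal.axioms(1)[OF pC]]] by simp
	ultimately show ?thesis by (rule indep_mono)
qed

end

context ring
begin

section \<open>Derivations\<close>

definition derivation_on :: "'a set => 'a set => ('a => 'a) => bool" where
	"derivation_on k D \<delta> \<longleftrightarrow> (ALL x:D. \<delta> x : RR) & (ALL x:D. ALL y:D. \<delta> (x \<oplus> y) = \<delta> x \<oplus> \<delta> y) &
		 (ALL x:D. ALL y:D. \<delta> (x ** y) = x ** \<delta> y \<oplus> y ** \<delta> x) & (ALL c:k. \<delta> c = \<zero>)"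

lemma derivation_onD:
	assumes "derivation_on k D \<delta>"
	shows "x : D ==> \<delta> x : RR" "x : D ==> y : D ==> \<delta> (x \<oplus> y) = \<delta> x \<oplus> \<delta> y"
		"x : D ==> y : D ==> \<delta> (x ** y) = x ** \<delta> y \<oplus> y ** \<delta> x" "c : k ==> \<delta> c = \<zero>"
	using assms by (auto simp: derivation_on_def)

primrec nmul :: "nat => 'a => 'a" where
	"nmul 0 x = \<zero>"
| "nmul (Suc n) x = nmul n x \<oplus> x"

text \<open>Applied with \<open>n = 1\<close> to the tail of a list, this is the coefficient list of
  the formal derivative, one entry shorter than the original list.\<close>

primrec scale_coeffs :: "nat => 'a list => 'a list" where
	"scale_coeffs n [] = []"
| "scale_coeffs n (d # ds) = nmul n d # scale_coeffs (Suc n) ds"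

text \<open>The value of the formal derivative, obtained from the product rule for Horner's
  form.\<close>

primrec pevd :: "'a => 'a list => 'a" where
	"pevd x [] = \<zero>"
| "pevd x (d # ds) = pev x ds \<oplus> x ** pevd x ds"

fun padd :: "'a list => 'a list => 'a list" where
	"padd [] es = es"
| "padd ds [] = ds"
| "padd (d # ds) (e # es) = (d \<oplus> e) # padd ds es"

primrec pmul :: "'a list => 'a list => 'a list" where
	"pmul [] es = []"
| "pmul (d # ds) es = padd (map ((\<otimes>) d) es) (\<zero> # pmul ds es)"

end

context cring
begin

lemma nmul_closed [simp]: "x : RR ==> nmul n x : RR"
	by (induction n) auto

lemma nmul_one: "x : RR ==> nmul n x = nmul n \<one> ** x"
	by (induction n) (auto simp: l_distr)

lemma nmul_add_pow: "x : RR ==> nmul n x = [n] \<cdot> x"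
	by (induction n) auto

lemma nmul_subring: "subring D R ==> x : D ==> nmul n x : D"
	by (induction n) (auto simp: subringE)

lemma length_scale_coeffs [simp]: "length (scale_coeffs n ds) = length ds"
	by (induction ds arbitrary: n) auto

lemma scale_coeffs_subring: "subring D R ==> set ds <= D ==> set (scale_coeffs n ds) <= D"
	by (induction ds arbitrary: n) (auto simp: nmul_subring)

lemma pev_scale_coeffs_Suc:
	"y : RR ==> set ds <= RR ==> pev y (scale_coeffs (Suc n) ds) = pev y (scale_coeffs n ds) \<oplus> pev y ds"
proof (induction ds arbitrary: n)
	case (Cons d ds)
	have c: "set (scale_coeffs (Suc n) ds) <= RR"
		using scale_coeffs_subring[OF carrier_is_subring] Cons.prems by auto
	hence "pev y (scale_coeffs (Suc n) ds) : RR" "pev y ds : RR" "nmul n d : RR" "d : RR"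
		using Cons.prems by auto
	hence "(nmul n d \<oplus> d) \<oplus> y ** (pev y (scale_coeffs (Suc n) ds) \<oplus> pev y ds) =
			(nmul n d \<oplus> y ** pev y (scale_coeffs (Suc n) ds)) \<oplus> (d \<oplus> y ** pev y ds)"
		using Cons.prems(1) by algebra
	moreover have "pev y (scale_coeffs (Suc (Suc n)) ds) = pev y (scale_coeffs (Suc n) ds) \<oplus> pev y ds"
		using Cons by auto
	ultimately show ?case by simp
qed auto

lemma pevd_closed: "y : RR ==> set ds <= RR ==> pevd y ds : RR"
	by (induction ds) auto

lemma pevd_scale_coeffs:
	"y : RR ==> set (d # ds) <= RR ==> pevd y (d # ds) = pev y (scale_coeffs 1 ds)"
proof (induction ds arbitrary: d)
	case (Cons e ds)
	have c: "set (scale_coeffs (Suc 0) ds) <= RR"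
		using scale_coeffs_subring[OF carrier_is_subring] Cons.prems by auto
	have p: "pev y (scale_coeffs (Suc 0) ds) : RR" "pev y (e # ds) : RR"
		using c Cons.prems by (auto simp del: pev.simps)
	have "pevd y (d # e # ds) = pev y (e # ds) \<oplus> y ** pev y (scale_coeffs 1 ds)"
		using Cons.IH[of e] Cons.prems by simp
	also have "\<dots> = pev y (scale_coeffs 0 (e # ds)) \<oplus> pev y (e # ds)"
		using p Cons.prems by (simp add: a_comm del: pev.simps(2)) (simp add: a_ac)
	also have "\<dots> = pev y (scale_coeffs 1 (e # ds))"
		using pev_scale_coeffs_Suc[of y "e # ds" 0] Cons.prems by simp
	finally show ?case .
qed auto

lemma derivation_zero: "derivation_on k (RR) \<delta> ==> \<delta> \<zero> = \<zero>"
proof -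
	assume d: "derivation_on k (RR) \<delta>"
	have "\<delta> \<zero> = \<delta> \<zero> \<oplus> \<delta> \<zero>" using derivation_onD(2)[OF d, of \<zero> \<zero>] by simp
	moreover have "\<delta> \<zero> : RR" using derivation_onD(1)[OF d] by simp
	ultimately show ?thesis using add.l_cancel_one[of "\<delta> \<zero>" "\<delta> \<zero>"] by simp
qed

lemma derivation_pev:
	assumes d: "derivation_on k (RR) \<delta>" and y: "y : RR"
	shows "set ds <= RR ==> (!!d. d : set ds ==> \<delta> d = \<zero>) ==> \<delta> (pev y ds) = \<delta> y ** pevd y ds"
proof (induction ds)
	case Nil
	thus ?case using derivation_zero[OF d] derivation_onD(1)[OF d y] by simp
next
	case (Cons a ds)
	have c: "pev y ds : RR" "a : RR" "pevd y ds : RR" "\<delta> y : RR"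
		using Cons.prems y derivation_onD(1)[OF d] by (auto intro!: pevd_closed)
	have "\<delta> (pev y (a # ds)) = \<delta> a \<oplus> (y ** \<delta> (pev y ds) \<oplus> pev y ds ** \<delta> y)"
		using derivation_onD(2,3)[OF d] c y by simp
	also have "\<dots> = \<delta> y ** pevd y (a # ds)"
		using Cons c y by (simp, algebra)
	finally show ?case .
qed

lemma derivation_kernel_adjs:
	assumes d: "derivation_on k (RR) \<delta>" and k: "subring k R"
	shows "set ys <= RR ==> (!!y. y : set ys ==> \<delta> y = \<zero>) ==> f : adjs k ys ==> \<delta> f = \<zero>"
proof (induction ys arbitrary: f)
	case Nil
	thus ?case using derivation_onD(4)[OF d] by simp
next
	case (Cons y ys)
	obtain ds where ds: "set ds <= adjs k ys" "f = pev y ds" using Cons.prems by (auto simp: adj_def)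
	have dsc: "set ds <= RR" using ds subringE(1)[OF subring_adjs[OF k, of ys]] Cons.prems by auto
	have "\<delta> f = \<delta> y ** pevd y ds" unfolding ds(2)
		using Cons ds dsc by (intro derivation_pev[OF d]) auto
	thus ?case using Cons.prems dsc by (simp add: pevd_closed)
qed

section \<open>Extending a derivation to a transcendental element\<close>

lemma padd_props:
	assumes D: "subring D R"
	shows "set ds <= D ==> set es <= D ==> set (padd ds es) <= D"
	by (induction ds es rule: padd.induct) (auto simp: subringE(7)[OF D])

lemma pmul_props:
	assumes D: "subring D R"
	shows "set ds <= D ==> set es <= D ==> set (pmul ds es) <= D"
proof (induction ds)
	case (Cons d ds)
	have "set (map ((\<otimes>) d) es) <= D" using Cons.prems subringE(6)[OF D] by auto
	moreover have "set (\<zero> # pmul ds es) <= D" using Cons subringE(2)[OF D] by auto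
	ultimately show ?case using padd_props[OF D] by simp
qed auto

text \<open>The value that any extension of \<open>\<delta>\<close> with \<open>z\<close> sent to
  \<open>w\<close> must take on the polynomial \<open>ds\<close>: \<open>\<delta>\<close> on the
  coefficients plus \<open>w\<close> times the formal derivative.\<close>

definition dlift :: "'a => 'a => ('a => 'a) => 'a list => 'a" where
	"dlift z w \<delta> ds = pev z (map \<delta> ds) \<oplus> w ** pevd z ds"

context
	fixes k D \<delta> z w
	assumes D: "subring D R" and kD: "k <= D" and d: "derivation_on k D \<delta>" and z: "z : RR" and w: "w : RR"
		and \<delta>0: "\<delta> \<zero> = \<zero>"
begin

lemma dlift_closed: "set ds <= D ==> dlift z w \<delta> ds : RR"
proof -
	assume "set ds <= D"
	hence "set (map \<delta> ds) <= RR" "set ds <= RR"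
		using derivation_onD(1)[OF d] subringE(1)[OF D] by auto
	thus ?thesis using z w pevd_closed unfolding dlift_def by auto
qed

lemma dlift_Cons:
	assumes "set (a # ds) <= D"
	shows "dlift z w \<delta> (a # ds) = \<delta> a \<oplus> z ** dlift z w \<delta> ds \<oplus> w ** pev z ds"
proof -
	have "set (map \<delta> ds) <= RR" "set ds <= RR" "\<delta> a : RR"
		using derivation_onD(1)[OF d] subringE(1)[OF D] assms by auto
	hence "pev z (map \<delta> ds) : RR" "pevd z ds : RR" "pev z ds : RR" "\<delta> a : RR"
		using z by (auto intro: pevd_closed)
	thus ?thesis unfolding dlift_def using z w by (simp, algebra)
qed

lemma dlift_Nil: "dlift z w \<delta> [] = \<zero>"
	using w by (simp add: dlift_def)

lemma pev_padd:
	"set ds <= D ==> set es <= D ==>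
		pev z (padd ds es) = pev z ds \<oplus> pev z es & dlift z w \<delta> (padd ds es) = dlift z w \<delta> ds \<oplus> dlift z w \<delta> es"
proof (induction ds es rule: padd.induct)
	case (1 es)
	have "set es <= RR" using 1 subringE(1)[OF D] by auto
	thus ?case using 1 dlift_closed[of es] z by (simp add: dlift_Nil)
next
	case (2 v va)
	have "set (v # va) <= RR" using 2 subringE(1)[OF D] by auto
	hence "pev z (v # va) : RR" using z by (intro pev_closed) auto
	thus ?case using 2 dlift_closed[of "v # va"] z by (simp add: dlift_Nil)
next
	case (3 a ds b es)
	have s: "set ds <= D" "set es <= D" "a : D" "b : D" "set (padd ds es) <= D" "a \<oplus> b : D"
		using 3 padd_props[OF D] subringE(7)[OF D] by auto
	hence c: "pev z ds : RR" "pev z es : RR" "a : RR" "b : RR" "\<delta> a : RR" "\<delta> b : RR"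
		 "dlift z w \<delta> ds : RR" "dlift z w \<delta> es : RR"
		using subringE(1)[OF D] z derivation_onD(1)[OF d] dlift_closed by (auto intro!: pev_closed)
	have IH: "pev z (padd ds es) = pev z ds \<oplus> pev z es" "dlift z w \<delta> (padd ds es) = dlift z w \<delta> ds \<oplus> dlift z w \<delta> es"
		using 3 by auto
	have "pev z (padd (a # ds) (b # es)) = pev z (a # ds) \<oplus> pev z (b # es)" using IH c z by (simp, algebra)
	moreover have "dlift z w \<delta> (padd (a # ds) (b # es)) = dlift z w \<delta> (a # ds) \<oplus> dlift z w \<delta> (b # es)"
	proof -
		have "dlift z w \<delta> (padd (a # ds) (b # es)) = \<delta> (a \<oplus> b) \<oplus> z ** dlift z w \<delta> (padd ds es) \<oplus> w ** pev z (padd ds es)"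
			using s by (simp add: dlift_Cons)
		also have "\<dots> = dlift z w \<delta> (a # ds) \<oplus> dlift z w \<delta> (b # es)"
			using c z w derivation_onD(2)[OF d s(3,4)] s unfolding IH by (simp add: dlift_Cons, algebra)
		finally show ?thesis .
	qed
	ultimately show ?case by simp
qed

lemma dlift_smult:
	"a : D ==> set es <= D ==> dlift z w \<delta> (map ((\<otimes>) a) es) = a ** dlift z w \<delta> es \<oplus> \<delta> a ** pev z es"
proof (induction es)
	case Nil
	thus ?case using derivation_onD(1)[OF d] subringE(1)[OF D] by (auto simp: dlift_Nil)
next
	case (Cons e es)
	have s: "set es <= D" "e : D" "a ** e : D" "set (map ((\<otimes>) a) es) <= D" using Cons.prems subringE(6)[OF D] by auto
	have c: "pev z es : RR" "a : RR" "e : RR" "\<delta> a : RR" "\<delta> e : RR" "dlift z w \<delta> es : RR"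
		"set es <= RR"
		using Cons.prems s subringE(1)[OF D] z derivation_onD(1)[OF d] dlift_closed by (auto intro!: pev_closed)
	have "dlift z w \<delta> (map ((\<otimes>) a) (e # es)) = \<delta> (a ** e) \<oplus> z ** dlift z w \<delta> (map ((\<otimes>) a) es) \<oplus> w ** (a ** pev z es)"
		using s pev_smult[OF z c(7,2)] by (simp add: dlift_Cons)
	also have "\<dots> = a ** dlift z w \<delta> (e # es) \<oplus> \<delta> a ** pev z (e # es)"
		using c z w derivation_onD(3)[OF d Cons.prems(1) s(2)] s Cons by (simp add: dlift_Cons, algebra)
	finally show ?case .
qed

lemma pev_pmul:
	"set ds <= D ==> set es <= D ==> pev z (pmul ds es) = pev z ds ** pev z es &
		dlift z w \<delta> (pmul ds es) = pev z ds ** dlift z w \<delta> es \<oplus> pev z es ** dlift z w \<delta> ds"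
proof (induction ds)
	case Nil
	have "set es <= RR" using Nil subringE(1)[OF D] by auto
	thus ?case using Nil z dlift_closed[of es] by (simp add: dlift_Nil)
next
	case (Cons a ds)
	have s: "set ds <= D" "a : D" "set (map ((\<otimes>) a) es) <= D" "set (pmul ds es) <= D" "set (\<zero> # pmul ds es) <= D"
		using Cons.prems subringE(2,6)[OF D] pmul_props[OF D] by auto
	have c: "pev z es : RR" "pev z ds : RR" "a : RR" "\<delta> a : RR" "dlift z w \<delta> es : RR"
		"dlift z w \<delta> ds : RR" "set es <= RR"
		using Cons.prems s subringE(1)[OF D] z derivation_onD(1)[OF d] dlift_closed by (auto intro!: pev_closed)
	have IH: "pev z (pmul ds es) = pev z ds ** pev z es"
		"dlift z w \<delta> (pmul ds es) = pev z ds ** dlift z w \<delta> es \<oplus> pev z es ** dlift z w \<delta> ds" using Cons by auto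
	note pa = pev_padd[OF s(3,5)]
	have "pev z (pmul (a # ds) es) = pev z (map ((\<otimes>) a) es) \<oplus> pev z (\<zero> # pmul ds es)" using pa by simp
	also have "pev z (map ((\<otimes>) a) es) = a ** pev z es" using pev_smult[OF z c(7,3)] by simp
	also have "a ** pev z es \<oplus> pev z (\<zero> # pmul ds es) = pev z (a # ds) ** pev z es"
		using IH c z by (simp, algebra)
	finally have 1: "pev z (pmul (a # ds) es) = pev z (a # ds) ** pev z es" .
	have "dlift z w \<delta> (pmul (a # ds) es) = dlift z w \<delta> (map ((\<otimes>) a) es) \<oplus> dlift z w \<delta> (\<zero> # pmul ds es)" using pa by simp
	also have "\<dots> = (a ** dlift z w \<delta> es \<oplus> \<delta> a ** pev z es) \<oplus> (\<delta> \<zero> \<oplus> z ** dlift z w \<delta> (pmul ds es) \<oplus> w ** pev z (pmul ds es))"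
		using dlift_smult[OF s(2) Cons.prems(2)] dlift_Cons[OF s(5)] by simp
	also have "\<dots> = pev z (a # ds) ** dlift z w \<delta> es \<oplus> pev z es ** dlift z w \<delta> (a # ds)"
		unfolding IH \<delta>0 using c z w dlift_Cons[OF Cons.prems(1)] by (simp, algebra)
	finally show ?case using 1 by simp
qed

text \<open>For transcendental \<open>z\<close> two lists with the same value differ only by zeros
  at the end, and these do not affect \<open>dlift\<close>. Hence \<open>dlift\<close> depends on
  the element only.\<close>

lemma dlift_unique:
	assumes t: "transc D {\<zero>} z"
	shows "set ds <= D ==> set es <= D ==> pev z ds = pev z es ==> dlift z w \<delta> ds = dlift z w \<delta> es"
proof -
	have zl: "dlift z w \<delta> ds = \<zero>" if "set ds <= {\<zero>}" for ds
		using that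
	proof (induction ds)
		case (Cons a ds)
		hence "set (a # ds) <= D" using subringE(2)[OF D] by auto
		from dlift_Cons[OF this] show ?case using Cons \<delta>0 z w by simp
	qed (rule dlift_Nil)
	show "set ds <= D ==> set es <= D ==> pev z ds = pev z es ==> dlift z w \<delta> ds = dlift z w \<delta> es"
	proof (induction ds arbitrary: es)
		case Nil
		hence "set es <= {\<zero>}" by (intro transcD[OF t]) auto
		thus ?case using zl by (simp add: dlift_Nil)
	next
		case (Cons a ds)
		have Dc: "D <= RR" using subringE(1)[OF D] .
		show ?case
		proof (cases es)
			case Nil
			hence "set (a # ds) <= {\<zero>}" using Cons.prems by (intro transcD[OF t]) auto
			from zl[OF this] show ?thesis using Nil by (simp add: dlift_Nil)
		next
			case e: (Cons b es')
			have A: "subring (adj D z) R" by (rule subring_adj[OF D z])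
			have "pev z ds : adj D z" "pev z es' : adj D z" using Cons.prems e by (auto intro!: adjI)
			hence "pev z ds \<ominus> pev z es' : adj D z" using subringE[OF A] by (auto simp: minus_eq)
			then obtain fs where fs: "set fs <= D" "pev z ds \<ominus> pev z es' = pev z fs" by (auto simp: adj_def)
			have c: "a : D" "b : D" "a : RR" "b : RR" "pev z ds : RR" "pev z es' : RR"
				using Cons.prems e Dc z by (auto intro!: pev_closed)
			have "pev z ((a \<ominus> b) # fs) = (a \<oplus> z ** pev z ds) \<ominus> (b \<oplus> z ** pev z es')"
				using c z fs(2)[symmetric] by (simp, algebra)
			also have "\<dots> = \<zero>" using Cons.prems(3) e c z by (simp add: minus_eq r_neg)
			finally have "pev z ((a \<ominus> b) # fs) = \<zero>" .
			moreover have "set ((a \<ominus> b) # fs) <= D" using c fs subringE[OF D] by (auto simp: minus_eq)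
			ultimately have zz: "set ((a \<ominus> b) # fs) <= {\<zero>}" using transcD[OF t] by blast
			hence "a = b" using c by simp
			moreover have "pev z ds = pev z es'" using zz fs c z by simp
			hence "dlift z w \<delta> ds = dlift z w \<delta> es'" using Cons.IH[of es'] Cons.prems e by auto
			ultimately show ?thesis using Cons.prems e \<open>pev z ds = pev z es'\<close> by (simp add: dlift_Cons)
		qed
	qed
qed

lemma derivation_extend:
	assumes t: "transc D {\<zero>} z"
	shows "EX \<delta>'. derivation_on k (adj D z) \<delta>' & (ALL x:D. \<delta>' x = \<delta> x) & \<delta>' z = w"
proof -
	define \<delta>' where "\<delta>' f = dlift z w \<delta> (SOME ds. set ds <= D & pev z ds = f)" for f
	have eq: "\<delta>' (pev z ds) = dlift z w \<delta> ds" if "set ds <= D" for ds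
	proof -
		have "set (SOME ds'. set ds' <= D & pev z ds' = pev z ds) <= D &
			 pev z (SOME ds'. set ds' <= D & pev z ds' = pev z ds) = pev z ds"
			by (rule someI[of _ ds]) (use that in auto)
		thus ?thesis unfolding \<delta>'_def using dlift_unique[OF t _ that] by blast
	qed
	have Dc: "D <= RR" using subringE(1)[OF D] .
	have onD: "\<delta>' x = \<delta> x" if x: "x : D" for x
	proof -
		have "x = pev z [x]" "\<delta> x : RR" using x Dc z derivation_onD(1)[OF d] by auto
		thus ?thesis using eq[of "[x]"] x dlift_Cons[of x "[]"] z w by (simp add: dlift_Nil)
	qed
	have one0: "\<delta> \<one> = \<zero>"
	proof -
		have "\<one> : D" "\<delta> \<one> : RR" using subringE(3)[OF D] derivation_onD(1)[OF d] by auto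
		hence "\<delta> \<one> = \<delta> \<one> \<oplus> \<delta> \<one>" using derivation_onD(3)[OF d, of \<one> \<one>] by simp
		thus ?thesis using \<open>\<delta> \<one> : RR\<close> add.l_cancel_one[of "\<delta> \<one>" "\<delta> \<one>"] by simp
	qed
	have "set [\<zero>, \<one>] <= D" using subringE(2,3)[OF D] by auto
	from eq[OF this] have "\<delta>' z = w"
		using z w dlift_Cons[of \<zero> "[\<one>]"] dlift_Cons[of \<one> "[]"] subringE(2,3)[OF D] \<delta>0 one0 by (simp add: dlift_Nil)
	moreover have "derivation_on k (adj D z) \<delta>'"
		unfolding derivation_on_def
	proof (intro conjI ballI)
		show "\<delta>' x : RR" if "x : adj D z" for x
			using that eq dlift_closed by (auto simp: adj_def)
		show "\<delta>' c = \<zero>" if "c : k" for c using that onD kD derivation_onD(4)[OF d] by auto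
		fix x y assume "x : adj D z" "y : adj D z"
		then obtain ds es where h: "set ds <= D" "set es <= D" "x = pev z ds" "y = pev z es" by (auto simp: adj_def)
		show "\<delta>' (x \<oplus> y) = \<delta>' x \<oplus> \<delta>' y"
			using eq[OF padd_props[OF D h(1,2)]] pev_padd[OF h(1,2)] eq[OF h(1)] eq[OF h(2)] h(3,4) by simp
		show "\<delta>' (x ** y) = x ** \<delta>' y \<oplus> y ** \<delta>' x"
			using eq[OF pmul_props[OF D h(1,2)]] pev_pmul[OF h(1,2)] eq[OF h(1)] eq[OF h(2)] h(3,4) by simp
	qed
	ultimately show ?thesis using onD by blast
qed

end

lemma derivation_exists:
	assumes k: "subring k R"
	shows "set zs <= RR ==> indep k {\<zero>} zs ==> distinct zs ==> (!!z. v z : RR) ==>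
		EX \<delta>. derivation_on k (adjs k zs) \<delta> & (ALL z:set zs. \<delta> z = v z)"
proof (induction zs)
	case Nil
	have "derivation_on k k (%_. \<zero>)" using subringE(1)[OF k] by (auto simp: derivation_on_def subset_iff)
	thus ?case by auto
next
	case (Cons z zs)
	then obtain \<delta> where \<delta>: "derivation_on k (adjs k zs) \<delta>" "ALL z:set zs. \<delta> z = v z" by auto
	have zc: "set zs <= RR" "z : RR" "transc (adjs k zs) {\<zero>} z" using Cons by auto
	have "\<delta> \<zero> = \<zero>" using derivation_onD(4)[OF \<delta>(1)] subringE(2)[OF k] by auto
	from derivation_extend[OF subring_adjs[OF k zc(1)] adjs_incl[OF k zc(1)] \<delta>(1) zc(2) Cons.prems(4)[of z] this zc(3)]
	obtain \<delta>' where \<delta>': "derivation_on k (adj (adjs k zs) z) \<delta>'" "ALL x:adjs k zs. \<delta>' x = \<delta> x" "\<delta>' z = v z" by blast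
	have "ALL x:set zs. \<delta>' x = v x" using \<delta>'(2) \<delta>(2) adjs_self[OF k zc(1)] by auto
	thus ?case using \<delta>' by auto
qed

end

section \<open>The Jacobian criterion in characteristic 0\<close>

locale char0_algebra = subfield_cring +
	assumes char0: "nmul n \<one> = \<zero> ==> n = 0"
begin

lemma nmul_inverse:
	assumes "n > 0"
	shows "EX c:k. c ** nmul n \<one> = \<one>"
proof -
	have "nmul n \<one> : k" using nmul_subring[OF k_subring subringE(3)[OF k_subring]] .
	moreover have "nmul n \<one> ~= \<zero>" using char0 assms by auto
	ultimately obtain c where "c : k" "nmul n \<one> ** c = \<one>" using k_inverse by blast
	thus ?thesis using k_carrier by (metis m_comm nmul_closed one_closed subsetD)
qed

lemma nmul_eq_zero:
	assumes "x : RR" "nmul n x = \<zero>" "n > 0"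
	shows "x = \<zero>"
proof -
	obtain c where c: "c : k" "c ** nmul n \<one> = \<one>" using nmul_inverse[OF assms(3)] by blast
	have cc: "c : RR" using c k_carrier by auto
	have "x = (c ** nmul n \<one>) ** x" using c assms by simp
	also have "\<dots> = c ** nmul n x" using cc assms nmul_one[OF assms(1), of n] by (simp add: m_assoc)
	finally show ?thesis using assms cc by simp
qed

lemma scale_coeffs_zero:
	"set ds <= RR ==> n > 0 ==> set (scale_coeffs n ds) <= {\<zero>} ==> set ds <= {\<zero>}"
	by (induction ds arbitrary: n) (auto intro: nmul_eq_zero)

text \<open>The Jacobian criterion for algebraic independence: a relation \<open>g f = 0\<close> of minimal degree can be
	differentiated.\<close>

lemma triangular_derivations_indep:
	assumes red: "reduced_ring R" and g: "g : RR" "g ~= \<zero>"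
	shows "set ys <= RR ==> length \<delta>s = length ys ==> (!!\<delta>. \<delta> : set \<delta>s ==> derivation_on k (RR) \<delta>) ==>
		 (!!i j. i < j ==> j < length ys ==> (\<delta>s ! i) (ys ! j) = \<zero>) ==>
		 (!!i f. i < length ys ==> f : RR ==> (g ** f) ** (\<delta>s ! i) (ys ! i) = \<zero> ==> g ** f = \<zero>) ==>
		 indep k {f : RR. g ** f = \<zero>} ys"
proof (induction ys arbitrary: \<delta>s)
	case (Cons y ys)
	define I where "I = {f : RR. g ** f = \<zero>}"
	obtain \<delta> \<delta>s' where d: "\<delta>s = \<delta> # \<delta>s'" using Cons.prems(2) by (cases \<delta>s) auto
	have IH: "indep k I ys" unfolding I_def
	proof (rule Cons.IH[of \<delta>s'])
		show "(\<delta>s' ! i) (ys ! j) = \<zero>" if "i < j" "j < length ys" for i j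
			using Cons.prems(4)[of "Suc i" "Suc j"] that d by auto
		show "g ** f = \<zero>" if "i < length ys" "f : RR" "(g ** f) ** (\<delta>s' ! i) (ys ! i) = \<zero>" for i f
			using Cons.prems(5)[of "Suc i" f] that d by auto
	qed (use Cons.prems d in auto)
	have y: "y : RR" "set ys <= RR" using Cons.prems by auto
	have der: "derivation_on k (RR) \<delta>" using Cons.prems d by auto
	have A: "subring (adjs k ys) R" by (rule subring_adjs[OF k_subring y(2)])
	have Ac: "adjs k ys <= RR" using subringE(1)[OF A] .
	have "\<delta> u = \<zero>" if u: "u : set ys" for u
	proof -
		obtain j where "j < length ys" "ys ! j = u" using u by (auto simp: in_set_conv_nth)
		thus ?thesis using Cons.prems(4)[of 0 "Suc j"] d by auto
	qed
	\<comment> \<open>By triangularity the derivation belonging to the head kills all later elements,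
	  hence every coefficient that a relation for \<open>y\<close> can have.\<close>
	hence ker: "!!f. f : adjs k ys ==> \<delta> f = \<zero>" using derivation_kernel_adjs[OF der k_subring y(2)] by blast
	have kI: "k \<inter> I <= {\<zero>}"
	proof
		fix c assume c: "c : k \<inter> I"
		show "c : {\<zero>}"
		proof (rule ccontr)
			assume "c ~: {\<zero>}"
			then obtain c' where c': "c' : k" "c ** c' = \<one>" using k_inverse c by auto
			have cc: "c : RR" "c' : RR" using c c' k_carrier by auto
			have "g = (g ** c) ** c'" using c' cc g by (simp add: m_assoc)
			also have "\<dots> = \<zero>" using c cc by (simp add: I_def)
			finally show False using g by simp
		qed
	qed
	have AI: "adjs k ys \<inter> I <= {\<zero>}" by (rule indep_inter[OF IH kI k_subring y(2)])
	have "set ds <= {\<zero>}" if "set ds <= adjs k ys" "pev y ds : I" for ds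
		using that
	proof (induction "length ds" arbitrary: ds)
		case 0
		thus ?case by simp
	next
		case (Suc n)
		obtain a es where ds: "ds = a # es" using Suc.hyps(2) by (cases ds) auto
		let ?f = "pev y ds" and ?f' = "pev y (scale_coeffs 1 es)"
		have sc: "set (scale_coeffs 1 es) <= adjs k ys" using scale_coeffs_subring[OF A] Suc.prems ds by auto
		have dsc: "set ds <= RR" "set (a # es) <= RR" using Suc.prems Ac ds by auto
		have c: "?f : RR" "?f' : RR" "\<delta> y : RR" "\<delta> g : RR"
			using dsc sc Ac y g derivation_onD(1)[OF der] by (auto simp del: pev.simps intro!: pev_closed)
		have gf: "g ** ?f = \<zero>" using Suc.prems by (simp add: I_def)
		have df: "\<delta> ?f = \<delta> y ** ?f'"
			using derivation_pev[OF der y(1) dsc(1)] ker Suc.prems(1) pevd_scale_coeffs[OF y(1) dsc(2)] ds by auto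
		\<comment> \<open>Differentiating \<open>g f = 0\<close> also produces a term with the derivative
		  of \<open>g\<close>. One more factor \<open>g\<close> kills it.\<close>
		have "g ** \<delta> ?f \<oplus> ?f ** \<delta> g = \<zero>"
			using derivation_onD(3)[OF der g(1) c(1)] gf derivation_zero[OF der] by simp
		hence "\<zero> = g ** (g ** (\<delta> y ** ?f') \<oplus> ?f ** \<delta> g)" using g df by simp
		also have "\<dots> = (g ** (g ** ?f')) ** \<delta> y \<oplus> (g ** ?f) ** \<delta> g" using g c by algebra
		also have "\<dots> = (g ** (g ** ?f')) ** \<delta> y" unfolding gf using g c by simp
		finally have "g ** (g ** ?f') = \<zero>" using Cons.prems(5)[of 0 "g ** ?f'"] d g c by auto
		\<comment> \<open>Here reducedness stands in for cancelling \<open>g\<close>.\<close>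
		hence "(g ** ?f') [^] (2::nat) = \<zero>"
		proof -
			assume h: "g ** (g ** ?f') = \<zero>"
			have "(g ** ?f') [^] (2::nat) = ?f' ** (g ** (g ** ?f'))" using g c by (simp add: numeral_2_eq_2 m_ac)
			thus ?thesis using h c by simp
		qed
		hence "g ** ?f' = \<zero>" using red g c unfolding reduced_ring_def by blast
		hence "?f' : I" using c by (simp add: I_def)
		hence "set (scale_coeffs 1 es) <= {\<zero>}" using Suc.hyps ds sc by (intro Suc.hyps(1)) auto
		\<comment> \<open>The coefficients of the derivative are positive integer multiples of those of
		  the relation, so characteristic 0 recovers the latter.\<close>
		hence es: "set es <= {\<zero>}" using scale_coeffs_zero[of es 1] dsc by auto
		hence "?f = a" using ds dsc y by simp
		hence "a : adjs k ys \<inter> I" using Suc.prems ds by auto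
		thus ?case using es AI ds by auto
	qed
	hence "transc (adjs k ys) I y" unfolding transc_def by blast
	thus ?case using IH by (simp add: I_def)
qed auto

end

section \<open>Determinants by the Leibniz formula\<close>

context cring
begin

definition detsum :: "nat => (nat => nat => 'a) => 'a" where
	"detsum n h = (\<Oplus>\<sigma>\<in>{\<sigma>. \<sigma> permutes {..<n}}. (if evenperm \<sigma> then \<one> else \<ominus> \<one>) ** (\<Otimes>j\<in>{..<n}. h (\<sigma> j) j))"

lemma detsum_closed: "(!!i j. h i j : RR) ==> detsum n h : RR"
	unfolding detsum_def by (intro finsum_closed) auto

lemma detsum_identity:
	"detsum n (%i j. if i = j then \<one> else \<zero>) = \<one>"
proof -
	let ?h = "%i j. if i = j then \<one> else \<zero>" and ?A = "{\<sigma>. \<sigma> permutes {..<n}}"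
	have fin: "finite ?A" by (rule finite_permutations) simp
	have z: "(\<Otimes>j\<in>{..<n}. ?h (\<sigma> j) j) = \<zero>" if s: "\<sigma> permutes {..<n}" "\<sigma> ~= id" for \<sigma>
	proof -
		obtain j where j: "\<sigma> j ~= j" using s(2) by (metis eq_id_iff)
		hence "j : {..<n}" using s(1) by (meson permutes_not_in)
		hence "(\<Otimes>j\<in>{..<n}. ?h (\<sigma> j) j) = ?h (\<sigma> j) j ** (\<Otimes>j\<in>{..<n} - {j}. ?h (\<sigma> j) j)"
			by (subst finprod_insert[symmetric]) (auto simp: insert_absorb)
		moreover have "(\<Otimes>j\<in>{..<n} - {j}. ?h (\<sigma> j) j) : RR" by (intro finprod_closed) auto
		ultimately show ?thesis using j by simp
	qed
	have "detsum n ?h = (\<Oplus>\<sigma>\<in>?A. if id = \<sigma> then \<one> else \<zero>)"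
		unfolding detsum_def
	proof (rule finsum_cong')
		fix \<sigma> assume s: "\<sigma> : ?A"
		show "(if evenperm \<sigma> then \<one> else \<ominus> \<one>) ** (\<Otimes>j\<in>{..<n}. ?h (\<sigma> j) j) = (if id = \<sigma> then \<one> else \<zero>)"
		proof (cases "\<sigma> = id")
			case True
			thus ?thesis by (simp add: evenperm_id finprod_one_eqI)
		next
			case False
			have "(\<Otimes>j\<in>{..<n}. ?h (\<sigma> j) j) = \<zero>" using s False by (intro z) auto
			thus ?thesis using False by auto
		qed
	qed auto
	also have "\<dots> = \<one>"
		using add.finprod_singleton[of id ?A "%_. \<one>"] fin permutes_id[of "{..<n}"] by simp
	finally show ?thesis .
qed

lemma detsum_term_column:
	fixes \<sigma> :: "nat => nat" and l n :: nat
	assumes h: "!!i j. h i j : RR" and l: "l < n"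
	shows "(\<Otimes>j\<in>{..<n}. h (\<sigma> j) j) = h (\<sigma> l) l ** (\<Otimes>j\<in>{..<n} - {l}. h (\<sigma> j) j)"
	by (subst finprod_insert[symmetric]) (use h l in \<open>auto simp: insert_absorb\<close>)

lemma detsum_add:
	assumes h: "!!i j. h i j : RR" and h1: "!!i j. h1 i j : RR" and h2: "!!i j. h2 i j : RR"
		and l: "l < n" and eq: "!!i j. j ~= l ==> h1 i j = h i j" "!!i j. j ~= l ==> h2 i j = h i j"
		and s: "!!i. h i l = h1 i l \<oplus> h2 i l"
	shows "detsum n h = detsum n h1 \<oplus> detsum n h2"
proof -
	have "detsum n h = (\<Oplus>\<sigma>\<in>{\<sigma>. \<sigma> permutes {..<n}}.
			(if evenperm \<sigma> then \<one> else \<ominus> \<one>) ** (\<Otimes>j\<in>{..<n}. h1 (\<sigma> j) j) \<oplus> (if evenperm \<sigma> then \<one> else \<ominus> \<one>) ** (\<Otimes>j\<in>{..<n}. h2 (\<sigma> j) j))"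
		unfolding detsum_def
	proof (rule finsum_cong')
		fix \<sigma> :: "nat => nat"
		let ?P = "%h. \<Otimes>j\<in>{..<n} - {l}. h (\<sigma> j) j"
		have p: "?P h1 = ?P h" "?P h2 = ?P h" using eq h h1 h2 by (auto intro!: finprod_cong')
		have c: "?P h : RR" using h by (auto intro!: finprod_closed)
		show "(if evenperm \<sigma> then \<one> else \<ominus> \<one>) ** (\<Otimes>j\<in>{..<n}. h (\<sigma> j) j) =
			(if evenperm \<sigma> then \<one> else \<ominus> \<one>) ** (\<Otimes>j\<in>{..<n}. h1 (\<sigma> j) j) \<oplus> (if evenperm \<sigma> then \<one> else \<ominus> \<one>) ** (\<Otimes>j\<in>{..<n}. h2 (\<sigma> j) j)"
			unfolding detsum_term_column[of h, OF h l] detsum_term_column[of h1, OF h1 l] detsum_term_column[of h2, OF h2 l] p s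
			using c h1 h2 by (simp add: l_distr r_distr)
	qed (use h1 h2 in auto)
	also have "\<dots> = detsum n h1 \<oplus> detsum n h2"
		unfolding detsum_def using h1 h2 by (intro finsum_addf) auto
	finally show ?thesis .
qed

lemma detsum_smult:
	assumes h: "!!i j. h i j : RR" and h1: "!!i j. h1 i j : RR" and a: "a : RR"
		and l: "l < n" and eq: "!!i j. j ~= l ==> h1 i j = h i j"
		and s: "!!i. h i l = a ** h1 i l"
	shows "detsum n h = a ** detsum n h1"
proof -
	have "detsum n h = (\<Oplus>\<sigma>\<in>{\<sigma>. \<sigma> permutes {..<n}}. a ** ((if evenperm \<sigma> then \<one> else \<ominus> \<one>) ** (\<Otimes>j\<in>{..<n}. h1 (\<sigma> j) j)))"
		unfolding detsum_def
	proof (rule finsum_cong')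
		fix \<sigma> :: "nat => nat"
		let ?P = "%h. \<Otimes>j\<in>{..<n} - {l}. h (\<sigma> j) j"
		have p: "?P h1 = ?P h" using eq h h1 by (auto intro!: finprod_cong')
		have c: "?P h : RR" using h by (auto intro!: finprod_closed)
		show "(if evenperm \<sigma> then \<one> else \<ominus> \<one>) ** (\<Otimes>j\<in>{..<n}. h (\<sigma> j) j) =
			a ** ((if evenperm \<sigma> then \<one> else \<ominus> \<one>) ** (\<Otimes>j\<in>{..<n}. h1 (\<sigma> j) j))"
			unfolding detsum_term_column[of h, OF h l] detsum_term_column[of h1, OF h1 l] p s
			using c h1 a by (simp add: m_lcomm m_assoc)
	qed (use h1 a in auto)
	also have "\<dots> = a ** detsum n h1"
		unfolding detsum_def using h1 a by (intro finsum_rdistr[symmetric]) (auto simp: finite_permutations)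
	finally show ?thesis .
qed

text \<open>Composing every permutation with the transposition of \<open>a\<close> and
  \<open>b\<close> reverses each sign and, as the two columns agree, leaves each product unchanged.
  In characteristic 0 the determinant is therefore zero.\<close>

lemma detsum_swap:
	assumes h: "!!i j. h i j : RR" and ab: "a < n" "b < n" "a ~= b"
		and eq: "!!i. h i a = h i b"
	shows "detsum n h = \<ominus> detsum n h"
proof -
	let ?A = "{\<sigma>. \<sigma> permutes {..<n}}" and ?t = "Transposition.transpose a b"
	let ?f = "%\<sigma>. (if evenperm \<sigma> then \<one> else \<ominus> \<one>) ** (\<Otimes>j\<in>{..<n}. h (\<sigma> j) j)"
	have fin: "finite ?A" by (rule finite_permutations) simp
	have tp: "?t permutes {..<n}" using ab by (intro permutes_swap_id) auto
	have inj: "inj_on (%\<sigma>. \<sigma> \<circ> ?t) ?A"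
		by (rule inj_onI) (metis comp_assoc comp_id transpose_comp_involutory)
	have im: "(%\<sigma>. \<sigma> \<circ> ?t) ` ?A = ?A"
	proof
		show "(%\<sigma>. \<sigma> \<circ> ?t) ` ?A <= ?A" using tp by (auto intro: permutes_compose)
		show "?A <= (%\<sigma>. \<sigma> \<circ> ?t) ` ?A"
		proof
			fix \<sigma> assume "\<sigma> : ?A"
			hence "\<sigma> \<circ> ?t : ?A" "\<sigma> = (\<sigma> \<circ> ?t) \<circ> ?t"
				using permutes_compose[OF tp] by (auto simp: comp_assoc)
			thus "\<sigma> : (%\<sigma>. \<sigma> \<circ> ?t) ` ?A" by blast
		qed
	qed
	have fc: "?f : X \<rightarrow> RR" for X using h by auto
	have "detsum n h = finsum R ?f ((%\<sigma>. \<sigma> \<circ> ?t) ` ?A)" unfolding im detsum_def ..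
	also have "\<dots> = finsum R (%\<sigma>. ?f (\<sigma> \<circ> ?t)) ?A"
		by (rule finsum_reindex[OF fc inj])
	also have "\<dots> = finsum R (%\<sigma>. \<ominus> \<one> ** ?f \<sigma>) ?A"
	proof (rule finsum_cong')
		fix \<sigma> assume s: "\<sigma> : ?A"
		have "evenperm (\<sigma> \<circ> ?t) \<longleftrightarrow> \<not> evenperm \<sigma>"
		proof -
			have "permutation \<sigma>" using s permutation_permutes[of \<sigma>] by blast
			thus ?thesis
				using evenperm_comp[OF _ permutation_swap_id[of a b], of \<sigma>] ab by (simp add: evenperm_swap)
		qed
		moreover have "(\<Otimes>j\<in>{..<n}. h ((\<sigma> \<circ> ?t) j) j) = (\<Otimes>j\<in>{..<n}. h (\<sigma> j) j)"
		proof -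
			have im': "?t ` {..<n} = {..<n}" using permutes_image[OF tp] .
			have "(\<Otimes>j\<in>{..<n}. h (\<sigma> j) j) = (\<Otimes>j\<in>?t ` {..<n}. h (\<sigma> j) j)" unfolding im' ..
			also have "\<dots> = (\<Otimes>j\<in>{..<n}. h (\<sigma> (?t j)) (?t j))"
				using h permutes_inj[OF tp] by (intro finprod_reindex) (auto intro: inj_on_subset)
			also have "\<dots> = (\<Otimes>j\<in>{..<n}. h ((\<sigma> \<circ> ?t) j) j)"
			proof (rule finprod_cong')
				fix j
				show "h (\<sigma> (?t j)) (?t j) = h ((\<sigma> \<circ> ?t) j) j"
					using eq by (auto simp: transpose_def)
			qed (use h in auto)
			finally show ?thesis by simp
		qed
		moreover have "(\<Otimes>j\<in>{..<n}. h (\<sigma> j) j) : RR" using h by (auto intro!: finprod_closed)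
		ultimately show "?f (\<sigma> \<circ> ?t) = \<ominus> \<one> ** ?f \<sigma>" by (auto simp: l_minus)
	qed (use h in auto)
	also have "\<dots> = \<ominus> \<one> ** detsum n h"
		unfolding detsum_def using h by (intro finsum_rdistr[symmetric, OF fin]) auto
	also have "\<dots> = \<ominus> detsum n h" using detsum_closed[of h] h by (simp add: l_minus)
	finally show ?thesis .
qed

end

lemma (in char0_algebra) detsum_alternating:
	assumes h: "!!i j. h i j : RR" and ab: "a < n" "b < n" "a ~= b" and eq: "!!i. h i a = h i b"
	shows "detsum n h = \<zero>"
proof -
	have c: "detsum n h : RR" using detsum_closed[OF h] .
	have "nmul 2 (detsum n h) = \<zero>"
	proof -
		have "detsum n h \<oplus> detsum n h = \<ominus> detsum n h \<oplus> detsum n h"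
			using detsum_swap[of h a n b] h ab eq by (intro arg_cong2[of _ _ _ _ "(\<oplus>)"]) auto
		thus ?thesis using c by (simp add: numeral_2_eq_2 l_neg)
	qed
	thus ?thesis using nmul_eq_zero[OF c] by simp
qed

lemma abelian_group_cong:
	assumes "abelian_group M" "carrier M' = carrier M" "add M' = add M" "zero M' = zero M"
	shows "abelian_group M'"
proof -
	interpret abelian_group M by fact
	show ?thesis
	proof (rule abelian_groupI)
		show "EX y:carrier M'. y \<oplus>\<^bsub>M'\<^esub> x = \<zero>\<^bsub>M'\<^esub>" if "x : carrier M'" for x
			using that assms(2-4) l_neg by (intro bexI[of _ "\<ominus>\<^bsub>M\<^esub> x"]) auto
	qed (use assms(2-4) in \<open>auto simp: a_assoc intro: a_comm\<close>)
qed

text \<open>Maps on quotients and free modules are first built as additive maps only. Linearity is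
  checked afterwards on generators, which lets targets over different rings share one
  construction.\<close>

locale additive_map = M: abelian_group M + X: abelian_group X for M (structure) and X (structure) and f +
	assumes map_closed: "x : carrier M ==> f x : carrier X"
		and map_add: "x : carrier M ==> y : carrier M ==> f (x \<oplus>\<^bsub>M\<^esub> y) = f x \<oplus>\<^bsub>X\<^esub> f y"
begin

lemma map_zero: "f \<zero>\<^bsub>M\<^esub> = \<zero>\<^bsub>X\<^esub>"
proof -
	have "f \<zero>\<^bsub>M\<^esub> = f \<zero>\<^bsub>M\<^esub> \<oplus>\<^bsub>X\<^esub> f \<zero>\<^bsub>M\<^esub>" using map_add[of "\<zero>\<^bsub>M\<^esub>" "\<zero>\<^bsub>M\<^esub>"] by simp
	thus ?thesis using X.add.l_cancel_one[of "f \<zero>\<^bsub>M\<^esub>" "f \<zero>\<^bsub>M\<^esub>"] map_closed by simp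
qed

lemma map_uminus: "x : carrier M ==> f (\<ominus>\<^bsub>M\<^esub> x) = \<ominus>\<^bsub>X\<^esub> f x"
	using map_add[of "\<ominus>\<^bsub>M\<^esub> x" x] map_zero map_closed
	by (intro X.minus_equality[symmetric]) (auto simp: M.l_neg)

lemma map_minus: "x : carrier M ==> y : carrier M ==> f (x \<ominus>\<^bsub>M\<^esub> y) = f x \<ominus>\<^bsub>X\<^esub> f y"
	by (simp add: M.minus_eq X.minus_eq map_add map_uminus)

end

section \<open>Quotients by spans and free modules\<close>

locale span_quotient = module R M for R (structure) and M (structure) +
	fixes T assumes T_carrier: "T <= carrier M"
begin

abbreviation "N \<equiv> submodule_span R M T"
abbreviation "Q \<equiv> quotient_module M N"
abbreviation "cls x \<equiv> N +>\<^bsub>M\<^esub> x"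

lemma T_sub_N: "T <= N"
	by (auto simp: submodule_span_def)

lemma N_least: "submodule H R M ==> T <= H ==> N <= H"
	by (auto simp: submodule_span_def)

lemma N_submodule: "submodule N R M"
proof (rule submoduleI)
	show "N <= carrier M" by (rule N_least[OF carrier_is_submodule T_carrier])
	show "\<zero>\<^bsub>M\<^esub> : N" unfolding submodule_span_def
		using submodule.axioms(1) subgroup.one_closed by fastforce
qed (use submoduleE in \<open>auto simp: submodule_span_def\<close>)

lemma N_carrier: "N <= carrier M"
	using submoduleE(1)[OF N_submodule] .

lemma N_abelian_subgroup: "abelian_subgroup N M"
	by (intro abelian_subgroupI3 additive_subgroupI submodule.axioms(1)[OF N_submodule] M.abelian_group_axioms)

sublocale NS: abelian_subgroup N M
	by (rule N_abelian_subgroup)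

lemma Q_simps: "carrier Q = a_rcosets\<^bsub>M\<^esub> N" "zero Q = N" "add Q = set_add M"
	"c \<odot>\<^bsub>Q\<^esub> U = (\<Union>x \<in> U. N +>\<^bsub>M\<^esub> (c \<odot>\<^bsub>M\<^esub> x))"
	by (simp_all add: quotient_module_def)

lemma cls_closed: "x : carrier M ==> cls x : carrier Q"
	unfolding Q_simps by (rule M.a_rcosetsI[OF N_carrier])

lemma Q_cases: assumes "U : carrier Q" obtains x where "x : carrier M" "U = cls x"
	using assms unfolding Q_simps by (auto simp: A_RCOSETS_def')

lemma cls_add: "x : carrier M ==> y : carrier M ==> cls (x \<oplus>\<^bsub>M\<^esub> y) = cls x \<oplus>\<^bsub>Q\<^esub> cls y"
	unfolding Q_simps by (simp add: NS.a_rcos_sum)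

lemma cls_eq_iff: "x : carrier M ==> y : carrier M ==> cls x = cls y \<longleftrightarrow> x \<ominus>\<^bsub>M\<^esub> y : N"
	using NS.a_rcos_module[of y x] NS.a_repr_independence'[of x y] NS.a_rcos_self[of x] by (auto simp: M.minus_eq)

lemma mem_cls: "x : carrier M ==> y : cls x ==> y : carrier M & cls y = cls x"
	using NS.a_repr_independence'[of y x] NS.a_elemrcos_carrier[of x y] by auto

lemma cls_zero: "cls \<zero>\<^bsub>M\<^esub> = \<zero>\<^bsub>Q\<^esub>"
	unfolding Q_simps by (rule NS.a_rcos_const) simp

lemma cls_N: "x : N ==> cls x = \<zero>\<^bsub>Q\<^esub>"
	unfolding Q_simps by (rule NS.a_rcos_const)

lemma cls_smult: assumes "c : carrier R" "x : carrier M" shows "cls (c \<odot>\<^bsub>M\<^esub> x) = c \<odot>\<^bsub>Q\<^esub> cls x"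
proof -
	have "cls (c \<odot>\<^bsub>M\<^esub> y) = cls (c \<odot>\<^bsub>M\<^esub> x)" if y: "y : cls x" for y
	proof -
		have yc: "y : carrier M" "cls y = cls x" using mem_cls[OF assms(2) y] by auto
		hence "y \<ominus>\<^bsub>M\<^esub> x : N" using cls_eq_iff assms by auto
		hence "c \<odot>\<^bsub>M\<^esub> (y \<ominus>\<^bsub>M\<^esub> x) : N" using submoduleE(4)[OF N_submodule] assms by auto
		moreover have "c \<odot>\<^bsub>M\<^esub> (y \<ominus>\<^bsub>M\<^esub> x) = c \<odot>\<^bsub>M\<^esub> y \<ominus>\<^bsub>M\<^esub> c \<odot>\<^bsub>M\<^esub> x"
			using assms yc by (simp add: M.minus_eq smult_r_distr smult_r_minus)
		ultimately show ?thesis using cls_eq_iff assms yc by auto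
	qed
	moreover have "x : cls x" using NS.a_rcos_self assms by auto
	ultimately show ?thesis unfolding Q_simps by blast
qed

lemma Q_abelian_group: "abelian_group Q"
proof (rule abelian_groupI)
	show "U \<oplus>\<^bsub>Q\<^esub> V : carrier Q" if "U : carrier Q" "V : carrier Q" for U V
		using that by (metis Q_cases cls_add cls_closed M.a_closed)
	show "\<zero>\<^bsub>Q\<^esub> : carrier Q" using cls_closed[of "\<zero>\<^bsub>M\<^esub>"] cls_zero by simp
	show "U \<oplus>\<^bsub>Q\<^esub> V \<oplus>\<^bsub>Q\<^esub> W = U \<oplus>\<^bsub>Q\<^esub> (V \<oplus>\<^bsub>Q\<^esub> W)" if "U : carrier Q" "V : carrier Q" "W : carrier Q" for U V W
	proof -
		obtain x y z where "x : carrier M" "U = cls x" "y : carrier M" "V = cls y" "z : carrier M" "W = cls z"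
			using \<open>U : carrier Q\<close> \<open>V : carrier Q\<close> \<open>W : carrier Q\<close> by (meson Q_cases)
		thus ?thesis by (metis cls_add M.a_closed M.a_assoc)
	qed
	show "U \<oplus>\<^bsub>Q\<^esub> V = V \<oplus>\<^bsub>Q\<^esub> U" if "U : carrier Q" "V : carrier Q" for U V
		using that by (metis Q_cases cls_add M.a_comm)
	show "\<zero>\<^bsub>Q\<^esub> \<oplus>\<^bsub>Q\<^esub> U = U" if "U : carrier Q" for U
		using that by (metis Q_cases cls_add cls_zero M.l_zero M.zero_closed)
	show "EX V:carrier Q. V \<oplus>\<^bsub>Q\<^esub> U = \<zero>\<^bsub>Q\<^esub>" if "U : carrier Q" for U
		using that by (metis Q_cases cls_add cls_zero cls_closed M.l_neg M.a_inv_closed)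
qed

lemma Q_module: "module R Q"
proof (rule moduleI)
	show "cring R" by (rule R.is_cring)
	show "abelian_group Q" by (rule Q_abelian_group)
	show "c \<odot>\<^bsub>Q\<^esub> U : carrier Q" if "c : carrier R" "U : carrier Q" for c U
		using that by (metis Q_cases cls_smult cls_closed smult_closed)
	show "(c \<oplus> d) \<odot>\<^bsub>Q\<^esub> U = c \<odot>\<^bsub>Q\<^esub> U \<oplus>\<^bsub>Q\<^esub> d \<odot>\<^bsub>Q\<^esub> U" if "c : carrier R" "d : carrier R" "U : carrier Q" for c d U
		using that by (metis Q_cases cls_smult cls_add smult_closed smult_l_distr R.a_closed)
	show "c \<odot>\<^bsub>Q\<^esub> (U \<oplus>\<^bsub>Q\<^esub> V) = c \<odot>\<^bsub>Q\<^esub> U \<oplus>\<^bsub>Q\<^esub> c \<odot>\<^bsub>Q\<^esub> V" if "c : carrier R" "U : carrier Q" "V : carrier Q" for c U V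
	proof -
		obtain x y where "x : carrier M" "U = cls x" "y : carrier M" "V = cls y"
			using \<open>U : carrier Q\<close> \<open>V : carrier Q\<close> by (meson Q_cases)
		thus ?thesis using that(1) by (metis cls_smult cls_add smult_closed smult_r_distr M.a_closed)
	qed
	show "(c \<otimes> d) \<odot>\<^bsub>Q\<^esub> U = c \<odot>\<^bsub>Q\<^esub> (d \<odot>\<^bsub>Q\<^esub> U)" if "c : carrier R" "d : carrier R" "U : carrier Q" for c d U
		using that by (metis Q_cases cls_smult smult_closed smult_assoc1 R.m_closed)
	show "\<one> \<odot>\<^bsub>Q\<^esub> U = U" if "U : carrier Q" for U
		using that by (metis Q_cases cls_smult smult_one R.one_closed)
qed

text \<open>Because \<open>L\<close> is merely additive, vanishing on \<open>T\<close> would not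
  extend to the span; hence all multiples \<open>c t\<close> are required to go to zero. The span
  then lies in the largest submodule \<open>H\<close> of the kernel.\<close>

lemma lift:
	assumes L: "additive_map M X L" and van: "!!c t. c : carrier R ==> t : T ==> L (c \<odot>\<^bsub>M\<^esub> t) = \<zero>\<^bsub>X\<^esub>"
	shows "EX L'. additive_map Q X L' & (ALL x:carrier M. L' (cls x) = L x)"
proof -
	interpret L: additive_map M X L by (rule L)
	define H where "H = {x : carrier M. ALL c:carrier R. L (c \<odot>\<^bsub>M\<^esub> x) = \<zero>\<^bsub>X\<^esub>}"
	have "submodule H R M"
	proof (rule submoduleI)
		show "c \<odot>\<^bsub>M\<^esub> x : H" if "c : carrier R" "x : H" for c x
			using that by (auto simp: H_def smult_assoc1[symmetric])
		show "x \<oplus>\<^bsub>M\<^esub> y : H" if "x : H" "y : H" for x y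
			using that by (auto simp: H_def smult_r_distr L.map_add)
		show "\<ominus>\<^bsub>M\<^esub> x : H" if "x : H" for x
			using that by (auto simp: H_def smult_r_minus L.map_uminus)
	qed (auto simp: H_def L.map_zero)
	moreover have "T <= H" using van T_carrier by (auto simp: H_def)
	ultimately have NH: "N <= H" by (rule N_least)
	have wd: "L x = L y" if "x : carrier M" "y : carrier M" "cls x = cls y" for x y
	proof -
		have "x \<ominus>\<^bsub>M\<^esub> y : H" using that cls_eq_iff NH by auto
		hence "L (\<one> \<odot>\<^bsub>M\<^esub> (x \<ominus>\<^bsub>M\<^esub> y)) = \<zero>\<^bsub>X\<^esub>" unfolding H_def by blast
		hence "L x \<ominus>\<^bsub>X\<^esub> L y = \<zero>\<^bsub>X\<^esub>" using that by (simp add: L.map_minus)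
		hence "\<ominus>\<^bsub>X\<^esub> (\<ominus>\<^bsub>X\<^esub> L y) = L x"
			using that L.map_closed by (intro L.X.minus_equality) (auto simp: L.X.minus_eq)
		thus ?thesis using that L.map_closed by simp
	qed
	define L' where "L' U = L (SOME x. x : carrier M & cls x = U)" for U
	have eq: "L' (cls x) = L x" if x: "x : carrier M" for x
	proof -
		have "(SOME y. y : carrier M & cls y = cls x) : carrier M & cls (SOME y. y : carrier M & cls y = cls x) = cls x"
			by (rule someI[of _ x]) (use x in auto)
		thus ?thesis unfolding L'_def using wd x by blast
	qed
	have "additive_map Q X L'"
	proof (intro additive_map.intro additive_map_axioms.intro Q_abelian_group L.X.abelian_group_axioms)
		show "L' U : carrier X" if "U : carrier Q" for U
			using that by (metis Q_cases eq L.map_closed)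
		show "L' (U \<oplus>\<^bsub>Q\<^esub> V) = L' U \<oplus>\<^bsub>X\<^esub> L' V" if "U : carrier Q" "V : carrier Q" for U V
		proof -
			obtain x y where "x : carrier M" "U = cls x" "y : carrier M" "V = cls y"
				using \<open>U : carrier Q\<close> \<open>V : carrier Q\<close> by (meson Q_cases)
			thus ?thesis by (metis cls_add eq L.map_add M.a_closed)
		qed
	qed
	thus ?thesis using eq by blast
qed

end

context cring
begin

lemma free_module_simps:
	"carrier (free_module R I) = {f. f : I \<rightarrow> carrier R & (ALL x. x ~: I --> f x = \<zero>) & finite {x. f x ~= \<zero>}}"
	"zero (free_module R I) = (%_. \<zero>)" "add (free_module R I) = (%f g x. f x \<oplus> g x)"
	"smult (free_module R I) = (%c f x. c \<otimes> f x)"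
	by (simp_all add: free_module_def)

lemma free_module_value: "f : carrier (free_module R I) ==> f x : carrier R"
	by (cases "x : I") (auto simp: free_module_simps)

lemma free_module_module: "module R (free_module R I)"
proof (rule moduleI)
	let ?F = "free_module R I"
	have fin: "finite {x. h (f x) (g x) ~= \<zero>}" if "finite {x. f x ~= \<zero>}" "finite {x. g x ~= \<zero>}" "h \<zero> \<zero> = \<zero>"
		for f g :: "_ => 'a" and h :: "'a => 'a => 'a"
	proof (rule finite_subset)
		show "{x. h (f x) (g x) ~= \<zero>} <= {x. f x ~= \<zero>} \<union> {x. g x ~= \<zero>}" using that(3) by auto
	qed (use that in auto)
	show "cring R" by (rule cring_axioms)
	show "abelian_group ?F"
	proof (rule abelian_groupI)
		show "f \<oplus>\<^bsub>?F\<^esub> g : carrier ?F" if "f : carrier ?F" "g : carrier ?F" for f g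
			using that fin[of f g "(\<oplus>)"] by (auto simp: free_module_simps)
		show "\<zero>\<^bsub>?F\<^esub> : carrier ?F" by (simp add: free_module_simps)
		show "f \<oplus>\<^bsub>?F\<^esub> g \<oplus>\<^bsub>?F\<^esub> h = f \<oplus>\<^bsub>?F\<^esub> (g \<oplus>\<^bsub>?F\<^esub> h)" if "f : carrier ?F" "g : carrier ?F" "h : carrier ?F" for f g h
			using that[THEN free_module_value] by (auto simp: free_module_simps a_assoc)
		show "f \<oplus>\<^bsub>?F\<^esub> g = g \<oplus>\<^bsub>?F\<^esub> f" if "f : carrier ?F" "g : carrier ?F" for f g
			using that[THEN free_module_value] by (auto simp: free_module_simps a_comm)
		show "\<zero>\<^bsub>?F\<^esub> \<oplus>\<^bsub>?F\<^esub> f = f" if "f : carrier ?F" for f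
			using free_module_value[OF that] by (auto simp: free_module_simps)
		show "EX g:carrier ?F. g \<oplus>\<^bsub>?F\<^esub> f = \<zero>\<^bsub>?F\<^esub>" if f: "f : carrier ?F" for f
		proof
			show "(%x. \<ominus> f x) \<oplus>\<^bsub>?F\<^esub> f = \<zero>\<^bsub>?F\<^esub>" using free_module_value[OF f] by (auto simp: free_module_simps l_neg)
			show "(%x. \<ominus> f x) : carrier ?F"
				using f fin[of f f "%a b. \<ominus> a"] by (auto simp: free_module_simps)
		qed
	qed
	show "c \<odot>\<^bsub>?F\<^esub> f : carrier ?F" if "c : carrier R" "f : carrier ?F" for c f
		using that fin[of f f "%a b. c \<otimes> a"] by (auto simp: free_module_simps)
	show "(c \<oplus> d) \<odot>\<^bsub>?F\<^esub> f = c \<odot>\<^bsub>?F\<^esub> f \<oplus>\<^bsub>?F\<^esub> d \<odot>\<^bsub>?F\<^esub> f" if "c : carrier R" "d : carrier R" "f : carrier ?F" for c d f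
		using that(1,2) free_module_value[OF that(3)] unfolding free_module_simps by (simp add: l_distr)
	show "c \<odot>\<^bsub>?F\<^esub> (f \<oplus>\<^bsub>?F\<^esub> g) = c \<odot>\<^bsub>?F\<^esub> f \<oplus>\<^bsub>?F\<^esub> c \<odot>\<^bsub>?F\<^esub> g" if "c : carrier R" "f : carrier ?F" "g : carrier ?F" for c f g
		using that(1) free_module_value[OF that(2)] free_module_value[OF that(3)] unfolding free_module_simps by (simp add: r_distr)
	show "(c \<otimes> d) \<odot>\<^bsub>?F\<^esub> f = c \<odot>\<^bsub>?F\<^esub> (d \<odot>\<^bsub>?F\<^esub> f)" if "c : carrier R" "d : carrier R" "f : carrier ?F" for c d f
		using that(1,2) free_module_value[OF that(3)] unfolding free_module_simps by (simp add: m_assoc)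
	show "\<one> \<odot>\<^bsub>?F\<^esub> f = f" if "f : carrier ?F" for f
		using free_module_value[OF that] unfolding free_module_simps by simp
qed

lemma free_gen_closed: "x : I ==> free_gen R x : carrier (free_module R I)"
	by (auto simp: free_module_simps free_gen_def)

lemma free_module_induct:
	assumes f: "f : carrier (free_module R I)"
		and add: "!!f g. f : carrier (free_module R I) ==> g : carrier (free_module R I) ==> P f ==> P g ==> P (f \<oplus>\<^bsub>free_module R I\<^esub> g)"
		and zero: "P \<zero>\<^bsub>free_module R I\<^esub>"
		and gen: "!!c x. c : carrier R ==> x : I ==> P (c \<odot>\<^bsub>free_module R I\<^esub> free_gen R x)"
	shows "P f"
proof -
	let ?F = "free_module R I"
	interpret F: module R ?F by (rule free_module_module)
	have "ALL f:carrier ?F. {x. f x ~= \<zero>} <= A --> P f" if "finite A" for A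
		using that
	proof (induction A rule: finite_induct)
		case empty
		have "f = \<zero>\<^bsub>?F\<^esub>" if "{x. f x ~= \<zero>} <= {}" for f using that by (auto simp: free_module_simps fun_eq_iff)
		thus ?case using zero by auto
	next
		case (insert a A)
		show ?case
		proof (intro ballI impI)
			fix f assume f: "f : carrier ?F" "{x. f x ~= \<zero>} <= insert a A"
			show "P f"
			proof (cases "f a = \<zero>")
				case True
				hence "{x. f x ~= \<zero>} <= A" using f by auto
				thus ?thesis using insert f by auto
			next
				case False
				hence a: "a : I" using f by (auto simp: free_module_simps)
				define g where "g = f(a := \<zero>)"
				have "{x. g x ~= \<zero>} <= {x. f x ~= \<zero>}" by (auto simp: g_def)
				hence g: "g : carrier ?F" using f by (auto simp: free_module_simps g_def intro: finite_subset)
				have "{x. g x ~= \<zero>} <= A" using f by (auto simp: g_def)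
				hence Pg: "P g" using insert g by auto
				have fa: "f a : carrier R" using free_module_value[OF f(1)] .
				have "f = g \<oplus>\<^bsub>?F\<^esub> (f a \<odot>\<^bsub>?F\<^esub> free_gen R a)"
					using free_module_value[OF f(1)] by (auto simp: free_module_simps g_def free_gen_def fun_eq_iff)
				thus ?thesis using add[OF g _ Pg gen[OF fa a]] free_gen_closed[OF a] fa by (metis F.smult_closed)
			qed
		qed
	qed
	thus ?thesis using f by (auto simp: free_module_simps)
qed

text \<open>The target is only an abelian group, so the image of each multiple \<open>c\<close> of a
  generator has to be prescribed, additively in \<open>c\<close>.\<close>

lemma free_module_lift:
	fixes \<beta> :: "'a => 'i => 'x" and X (structure)
	assumes X: "abelian_group X" and b: "!!c i. c : carrier R ==> i : I ==> \<beta> c i : carrier X"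
		and badd: "!!c d i. c : carrier R ==> d : carrier R ==> i : I ==> \<beta> (c \<oplus>\<^bsub>R\<^esub> d) i = \<beta> c i \<oplus>\<^bsub>X\<^esub> \<beta> d i"
	shows "EX L. additive_map (free_module R I) X L & (ALL c:carrier R. ALL i:I. L (c \<odot>\<^bsub>free_module R I\<^esub> free_gen R i) = \<beta> c i)"
proof -
	let ?F = "free_module R I"
	interpret X: abelian_group X by fact
	interpret F: module R ?F by (rule free_module_module)
	have b0: "\<beta> \<zero>\<^bsub>R\<^esub> i = \<zero>\<^bsub>X\<^esub>" if i: "i : I" for i
	proof -
		have "\<beta> \<zero>\<^bsub>R\<^esub> i = \<beta> \<zero>\<^bsub>R\<^esub> i \<oplus>\<^bsub>X\<^esub> \<beta> \<zero>\<^bsub>R\<^esub> i" using badd[of "\<zero>\<^bsub>R\<^esub>" "\<zero>\<^bsub>R\<^esub>" i] i by simp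
		thus ?thesis using X.add.l_cancel_one[of "\<beta> \<zero>\<^bsub>R\<^esub> i" "\<beta> \<zero>\<^bsub>R\<^esub> i"] b i by simp
	qed
	define L where "L f = finsum X (%i. \<beta> (f i) i) {i. f i ~= \<zero>\<^bsub>R\<^esub>}" for f
	have supp: "finite {i. f i ~= \<zero>\<^bsub>R\<^esub>}" "{i. f i ~= \<zero>\<^bsub>R\<^esub>} <= I" if "f : carrier ?F" for f
		using that by (auto simp: free_module_simps)
	have bc: "(%i. \<beta> (f i) i) : A \<rightarrow> carrier X" if "f : carrier ?F" "A <= I" for f A
		by (rule funcsetI, rule b[OF free_module_value[OF that(1)]]) (use that(2) in auto)
	have sup: "L f = finsum X (%i. \<beta> (f i) i) A" if f: "f : carrier ?F" and A: "finite A" "{i. f i ~= \<zero>\<^bsub>R\<^esub>} <= A" "A <= I" for f A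
		unfolding L_def using b0 A bc[OF f A(3)]
		by (intro X.add.finprod_mono_neutral_cong_left) auto
	have "additive_map ?F X L"
	proof (intro additive_map.intro additive_map_axioms.intro F.abelian_group_axioms X.abelian_group_axioms)
		show "L f : carrier X" if "f : carrier ?F" for f
			unfolding L_def using bc[OF that supp(2)[OF that]] by (rule X.finsum_closed)
		fix f g assume fg: "f : carrier ?F" "g : carrier ?F"
		let ?A = "{i. f i ~= \<zero>\<^bsub>R\<^esub>} \<union> {i. g i ~= \<zero>\<^bsub>R\<^esub>}"
		have A: "finite ?A" "?A <= I" using supp fg by auto
		have "{i. (f \<oplus>\<^bsub>?F\<^esub> g) i ~= \<zero>\<^bsub>R\<^esub>} <= ?A" by (auto simp: free_module_simps)
		hence "L (f \<oplus>\<^bsub>?F\<^esub> g) = finsum X (%i. \<beta> ((f \<oplus>\<^bsub>?F\<^esub> g) i) i) ?A" using fg A by (intro sup) auto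
		also have "\<dots> = finsum X (%i. \<beta> (f i) i \<oplus>\<^bsub>X\<^esub> \<beta> (g i) i) ?A"
		proof (rule X.finsum_cong')
			fix i assume "i : ?A"
			hence "i : I" using A by auto
			thus "\<beta> ((f \<oplus>\<^bsub>?F\<^esub> g) i) i = \<beta> (f i) i \<oplus>\<^bsub>X\<^esub> \<beta> (g i) i"
				using badd[of "f i" "g i" i] fg[THEN free_module_value] by (simp add: free_module_simps)
		qed (use bc[OF fg(1) A(2)] bc[OF fg(2) A(2)] in auto)
		also have "\<dots> = finsum X (%i. \<beta> (f i) i) ?A \<oplus>\<^bsub>X\<^esub> finsum X (%i. \<beta> (g i) i) ?A"
			by (rule X.finsum_addf[OF bc[OF fg(1) A(2)] bc[OF fg(2) A(2)]])
		also have "finsum X (%i. \<beta> (f i) i) ?A = L f" using fg A by (intro sup[symmetric]) auto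
		also have "finsum X (%i. \<beta> (g i) i) ?A = L g" using fg A by (intro sup[symmetric]) auto
		finally show "L (f \<oplus>\<^bsub>?F\<^esub> g) = L f \<oplus>\<^bsub>X\<^esub> L g" .
	qed
	moreover have "L (c \<odot>\<^bsub>?F\<^esub> free_gen R i) = \<beta> c i" if ci: "c : carrier R" "i : I" for c i
	proof -
		let ?f = "c \<odot>\<^bsub>?F\<^esub> free_gen R i"
		have "?f : carrier ?F" by (rule F.smult_closed[OF ci(1) free_gen_closed[OF ci(2)]])
		note f = this
		have "L ?f = finsum X (%j. \<beta> (?f j) j) {i}"
			using ci by (intro sup[OF f]) (auto simp: free_module_simps free_gen_def)
		also have "\<dots> = \<beta> (?f i) i" using b ci by (simp add: free_module_simps free_gen_def)
		also have "?f i = c" using ci by (simp add: free_module_simps free_gen_def)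
		finally show ?thesis .
	qed
	ultimately show ?thesis by blast
qed

end

lemma module_cong:
	assumes "module R M" "carrier M' = carrier M" "add M' = add M" "zero M' = zero M" "smult M' = smult M"
	shows "module R M'"
proof -
	interpret module R M by fact
	show ?thesis
		by (rule moduleI)
			(use assms(2-) R.is_cring abelian_group_cong[OF M.abelian_group_axioms assms(2-4)] in
				\<open>auto simp: smult_l_distr smult_r_distr smult_assoc1\<close>)
qed

lemma additive_map_cong:
	assumes "additive_map M X f" "carrier M' = carrier M" "add M' = add M" "zero M' = zero M"
	shows "additive_map M' X f"
proof -
	interpret additive_map M X f by fact
	show ?thesis
		by (intro additive_map.intro additive_map_axioms.intro abelian_group_cong[OF M.abelian_group_axioms assms(2-4)]
				X.abelian_group_axioms) (use assms(2-) map_closed map_add in auto)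
qed

section \<open>Tensor products\<close>

locale two_algebras = A: algebra K A + B: algebra K B for K A B
begin

abbreviation "I \<equiv> carrier A \<times> carrier B"
abbreviation "FM \<equiv> free_module K I"
abbreviation "F \<equiv> tensor_free K A B"
abbreviation "R \<equiv> tensor_algebra K A B"
abbreviation "e a b \<equiv> free_gen K (a, b)"
abbreviation "pure \<equiv> pure_tensor K A B"

definition pr where
	"pr p q = (fst p \<otimes>\<^bsub>A\<^esub> fst q, snd p \<otimes>\<^bsub>B\<^esub> snd q)"

lemma F_simps: "carrier F = carrier FM" "add F = add FM" "zero F = zero FM" "smult F = smult FM"
	by (simp_all add: tensor_free_def)

lemma F_module: "module K F"
	by (rule module_cong[OF A.R.free_module_module F_simps])

interpretation F: module K F by (rule F_module)

lemma e_closed: "a : carrier A ==> b : carrier B ==> e a b : carrier F"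
	unfolding F_simps by (rule A.R.free_gen_closed) auto

lemma F_induct [consumes 1]:
	assumes "f : carrier F"
		and "!!f g. f : carrier F ==> g : carrier F ==> P f ==> P g ==> P (f \<oplus>\<^bsub>F\<^esub> g)"
		and "P \<zero>\<^bsub>F\<^esub>"
		and "!!c a b. c : carrier K ==> a : carrier A ==> b : carrier B ==> P (c \<odot>\<^bsub>F\<^esub> e a b)"
	shows "P f"
	using A.R.free_module_induct[of f I P] assms unfolding F_simps by auto

lemma relations_carrier: "tensor_relations K A B <= carrier F"
proof -
	show ?thesis unfolding tensor_relations_def Let_def
		by (auto simp del: A.smult_closed intro!: F.M.minus_closed F.M.add.m_closed F.smult_closed e_closed A.M.add.m_closed B.M.add.m_closed A.smult_closed B.smult_closed)
qed

lemma relations_cases: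
	assumes "t : tensor_relations K A B"
	obtains (add_left) a a' b where "a : carrier A" "a' : carrier A" "b : carrier B"
			"t = e (a \<oplus>\<^bsub>A\<^esub> a') b \<ominus>\<^bsub>F\<^esub> (e a b \<oplus>\<^bsub>F\<^esub> e a' b)"
		| (add_right) a b b' where "a : carrier A" "b : carrier B" "b' : carrier B"
			"t = e a (b \<oplus>\<^bsub>B\<^esub> b') \<ominus>\<^bsub>F\<^esub> (e a b \<oplus>\<^bsub>F\<^esub> e a b')"
		| (smult_left) d a b where "d : carrier K" "a : carrier A" "b : carrier B"
			"t = e (d \<odot>\<^bsub>A\<^esub> a) b \<ominus>\<^bsub>F\<^esub> (d \<odot>\<^bsub>F\<^esub> e a b)"
		| (smult_right) d a b where "d : carrier K" "a : carrier A" "b : carrier B"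
			"t = e a (d \<odot>\<^bsub>B\<^esub> b) \<ominus>\<^bsub>F\<^esub> (d \<odot>\<^bsub>F\<^esub> e a b)"
	using assms unfolding tensor_relations_def Let_def
	by (elim UnE CollectE exE conjE) (iprover intro: that)+

lemma quot: "span_quotient K F (tensor_relations K A B)"
	by (intro span_quotient.intro F_module span_quotient_axioms.intro relations_carrier)

interpretation S: span_quotient K F "tensor_relations K A B" by (rule quot)

lemma R_simps: "carrier R = carrier S.Q" "add R = add S.Q" "zero R = zero S.Q" "smult R = smult S.Q"
	by (simp_all add: tensor_algebra_def tensor_null_def)

lemma R_one: "\<one>\<^bsub>R\<^esub> = pure \<one>\<^bsub>A\<^esub> \<one>\<^bsub>B\<^esub>"
	by (simp add: tensor_algebra_def)

lemma R_module: "module K R"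
	by (rule module_cong[OF S.Q_module R_simps])

interpretation Rm: module K R by (rule R_module)

lemma pure_cls: "pure a b = S.cls (e a b)"
	by (simp add: pure_tensor_def tensor_null_def)

lemma pure_closed: "a : carrier A ==> b : carrier B ==> pure a b : carrier R"
	unfolding R_simps pure_cls by (intro S.cls_closed e_closed)

lemma cls_eqI: "x \<ominus>\<^bsub>F\<^esub> y : tensor_relations K A B ==> x : carrier F ==> y : carrier F ==> S.cls x = S.cls y"
	using S.cls_eq_iff S.T_sub_N by auto

lemma pure_add_left:
	assumes "a : carrier A" "a' : carrier A" "b : carrier B"
	shows "pure (a \<oplus>\<^bsub>A\<^esub> a') b = pure a b \<oplus>\<^bsub>R\<^esub> pure a' b"
proof -
	have "S.cls (e (a \<oplus>\<^bsub>A\<^esub> a') b) = S.cls (e a b \<oplus>\<^bsub>F\<^esub> e a' b)" (is "S.cls ?x = S.cls ?y")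
	proof (rule cls_eqI)
		show "?x \<ominus>\<^bsub>F\<^esub> ?y : tensor_relations K A B" unfolding tensor_relations_def Let_def using assms by blast
	qed (use assms e_closed in auto)
	thus ?thesis using assms e_closed by (simp add: pure_cls R_simps S.cls_add)
qed

lemma pure_add_right:
	assumes "a : carrier A" "b : carrier B" "b' : carrier B"
	shows "pure a (b \<oplus>\<^bsub>B\<^esub> b') = pure a b \<oplus>\<^bsub>R\<^esub> pure a b'"
proof -
	have "S.cls (e a (b \<oplus>\<^bsub>B\<^esub> b')) = S.cls (e a b \<oplus>\<^bsub>F\<^esub> e a b')" (is "S.cls ?x = S.cls ?y")
	proof (rule cls_eqI)
		show "?x \<ominus>\<^bsub>F\<^esub> ?y : tensor_relations K A B" unfolding tensor_relations_def Let_def using assms by blast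
	qed (use assms e_closed in auto)
	thus ?thesis using assms e_closed by (simp add: pure_cls R_simps S.cls_add)
qed

lemma pure_smult_left:
	assumes "c : carrier K" "a : carrier A" "b : carrier B"
	shows "pure (c \<odot>\<^bsub>A\<^esub> a) b = c \<odot>\<^bsub>R\<^esub> pure a b"
proof -
	have "S.cls (e (c \<odot>\<^bsub>A\<^esub> a) b) = S.cls (c \<odot>\<^bsub>F\<^esub> e a b)" (is "S.cls ?x = S.cls ?y")
	proof (rule cls_eqI)
		show "?x \<ominus>\<^bsub>F\<^esub> ?y : tensor_relations K A B" unfolding tensor_relations_def Let_def using assms by blast
	qed (use assms e_closed in auto)
	thus ?thesis using assms e_closed by (simp add: pure_cls R_simps S.cls_smult)
qed

lemma pure_smult_right:
	assumes "c : carrier K" "a : carrier A" "b : carrier B"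
	shows "pure a (c \<odot>\<^bsub>B\<^esub> b) = c \<odot>\<^bsub>R\<^esub> pure a b"
proof -
	have "S.cls (e a (c \<odot>\<^bsub>B\<^esub> b)) = S.cls (c \<odot>\<^bsub>F\<^esub> e a b)" (is "S.cls ?x = S.cls ?y")
	proof (rule cls_eqI)
		show "?x \<ominus>\<^bsub>F\<^esub> ?y : tensor_relations K A B" unfolding tensor_relations_def Let_def using assms by blast
	qed (use assms e_closed in auto)
	thus ?thesis using assms e_closed by (simp add: pure_cls R_simps S.cls_smult)
qed

lemma R_induct [consumes 1]:
	assumes U: "U : carrier R"
		and add: "!!U V. U : carrier R ==> V : carrier R ==> P U ==> P V ==> P (U \<oplus>\<^bsub>R\<^esub> V)"
		and gen: "!!a b. a : carrier A ==> b : carrier B ==> P (pure a b)"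
	shows "P U"
proof -
	have "P (S.cls f)" if "f : carrier F" for f
		using that
	proof (induction f rule: F_induct)
		case (1 f g)
		thus ?case using add[of "S.cls f" "S.cls g"] S.cls_closed by (simp add: S.cls_add R_simps)
	next
		case 2
		have "pure (\<zero>\<^bsub>K\<^esub> \<odot>\<^bsub>A\<^esub> \<one>\<^bsub>A\<^esub>) \<one>\<^bsub>B\<^esub> = \<zero>\<^bsub>K\<^esub> \<odot>\<^bsub>R\<^esub> pure \<one>\<^bsub>A\<^esub> \<one>\<^bsub>B\<^esub>" by (rule pure_smult_left) auto
		also have "\<dots> = \<zero>\<^bsub>R\<^esub>" using pure_closed by simp
		also have "\<dots> = S.cls \<zero>\<^bsub>F\<^esub>" by (simp add: S.cls_zero R_simps)
		finally show ?case using gen[of "\<zero>\<^bsub>K\<^esub> \<odot>\<^bsub>A\<^esub> \<one>\<^bsub>A\<^esub>" "\<one>\<^bsub>B\<^esub>"] by simp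
	next
		case (3 c a b)
		hence "S.cls (c \<odot>\<^bsub>F\<^esub> e a b) = pure (c \<odot>\<^bsub>A\<^esub> a) b"
			using e_closed pure_smult_left by (simp add: S.cls_smult pure_cls R_simps)
		thus ?case using gen 3 by simp
	qed
	thus ?thesis using U S.Q_cases unfolding R_simps by metis
qed

lemma F_value: "f : carrier F ==> f x : carrier K"
	unfolding F_simps by (rule A.R.free_module_value)

text \<open>Supports are not additive in \<open>f\<close> and \<open>g\<close>. Summing over a
  common finite superset of the supports makes distributivity a termwise statement.\<close>

lemma mu_superset:
	assumes f: "f : carrier F" "finite P" "{p. f p ~= \<zero>\<^bsub>K\<^esub>} <= P" and g: "g : carrier F" "finite Q" "{q. g q ~= \<zero>\<^bsub>K\<^esub>} <= Q"
	shows "(f \<otimes>\<^bsub>F\<^esub> g) z = (\<Oplus>\<^bsub>K\<^esub>pq\<in>{(p, q). p : P & q : Q & z = pr p q}. f (fst pq) \<otimes>\<^bsub>K\<^esub> g (snd pq))"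
proof -
	have "{(p, q). p : P & q : Q & z = pr p q} <= P \<times> Q" by auto
	hence fin: "finite {(p, q). p : P & q : Q & z = pr p q}" using f(2) g(2) finite_subset by blast
	have "(f \<otimes>\<^bsub>F\<^esub> g) z = (\<Oplus>\<^bsub>K\<^esub>pq\<in>{(p, q). f p ~= \<zero>\<^bsub>K\<^esub> & g q ~= \<zero>\<^bsub>K\<^esub> & z = pr p q}. f (fst pq) \<otimes>\<^bsub>K\<^esub> g (snd pq))"
		by (simp add: tensor_free_def pr_def)
	also have "\<dots> = (\<Oplus>\<^bsub>K\<^esub>pq\<in>{(p, q). p : P & q : Q & z = pr p q}. f (fst pq) \<otimes>\<^bsub>K\<^esub> g (snd pq))"
		using f(3) g(3) fin F_value[OF f(1)] F_value[OF g(1)]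
		by (intro A.R.add.finprod_mono_neutral_cong_left) auto
	finally show ?thesis .
qed

lemma F_support: "f : carrier F ==> finite {p. f p ~= \<zero>\<^bsub>K\<^esub>}"
	by (auto simp: F_simps A.R.free_module_simps)

lemma F_ext: "(!!z. f z = g z) ==> f = g"
	by (rule ext)

lemma F_add: "(f \<oplus>\<^bsub>F\<^esub> g) z = f z \<oplus>\<^bsub>K\<^esub> g z"
	by (simp add: F_simps A.R.free_module_simps)

lemma mu_add_left:
	assumes f: "f : carrier F" "f' : carrier F" and g: "g : carrier F"
	shows "(f \<oplus>\<^bsub>F\<^esub> f') \<otimes>\<^bsub>F\<^esub> g = f \<otimes>\<^bsub>F\<^esub> g \<oplus>\<^bsub>F\<^esub> f' \<otimes>\<^bsub>F\<^esub> g"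
proof (rule F_ext)
	fix z
	let ?P = "{p. f p ~= \<zero>\<^bsub>K\<^esub>} \<union> {p. f' p ~= \<zero>\<^bsub>K\<^esub>}" and ?Q = "{q. g q ~= \<zero>\<^bsub>K\<^esub>}"
	let ?X = "{(p, q). p : ?P & q : ?Q & z = pr p q}"
	have fin: "finite ?P" "finite ?Q" using F_support f g by auto
	note v = F_value[OF f(1)] F_value[OF f(2)] F_value[OF g]
	have "((f \<oplus>\<^bsub>F\<^esub> f') \<otimes>\<^bsub>F\<^esub> g) z = (\<Oplus>\<^bsub>K\<^esub>pq\<in>?X. (f \<oplus>\<^bsub>F\<^esub> f') (fst pq) \<otimes>\<^bsub>K\<^esub> g (snd pq))"
		by (rule mu_superset) (use f g fin in \<open>auto simp: F_add\<close>)
	also have "\<dots> = (\<Oplus>\<^bsub>K\<^esub>pq\<in>?X. f (fst pq) \<otimes>\<^bsub>K\<^esub> g (snd pq) \<oplus>\<^bsub>K\<^esub> f' (fst pq) \<otimes>\<^bsub>K\<^esub> g (snd pq))"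
		by (rule A.R.finsum_cong') (use v in \<open>auto simp: F_add A.R.l_distr\<close>)
	also have "\<dots> = (\<Oplus>\<^bsub>K\<^esub>pq\<in>?X. f (fst pq) \<otimes>\<^bsub>K\<^esub> g (snd pq)) \<oplus>\<^bsub>K\<^esub> (\<Oplus>\<^bsub>K\<^esub>pq\<in>?X. f' (fst pq) \<otimes>\<^bsub>K\<^esub> g (snd pq))"
		by (rule A.R.finsum_addf) (use v in auto)
	also have "(\<Oplus>\<^bsub>K\<^esub>pq\<in>?X. f (fst pq) \<otimes>\<^bsub>K\<^esub> g (snd pq)) = (f \<otimes>\<^bsub>F\<^esub> g) z"
		by (rule mu_superset[symmetric]) (use f g fin in auto)
	also have "(\<Oplus>\<^bsub>K\<^esub>pq\<in>?X. f' (fst pq) \<otimes>\<^bsub>K\<^esub> g (snd pq)) = (f' \<otimes>\<^bsub>F\<^esub> g) z"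
		by (rule mu_superset[symmetric]) (use f g fin in auto)
	finally show "((f \<oplus>\<^bsub>F\<^esub> f') \<otimes>\<^bsub>F\<^esub> g) z = (f \<otimes>\<^bsub>F\<^esub> g \<oplus>\<^bsub>F\<^esub> f' \<otimes>\<^bsub>F\<^esub> g) z"
		unfolding F_add[of "f \<otimes>\<^bsub>F\<^esub> g" "f' \<otimes>\<^bsub>F\<^esub> g"] .
qed

lemma mu_add_right:
	assumes f: "f : carrier F" and g: "g : carrier F" "g' : carrier F"
	shows "f \<otimes>\<^bsub>F\<^esub> (g \<oplus>\<^bsub>F\<^esub> g') = f \<otimes>\<^bsub>F\<^esub> g \<oplus>\<^bsub>F\<^esub> f \<otimes>\<^bsub>F\<^esub> g'"
proof (rule F_ext)
	fix z
	let ?P = "{p. f p ~= \<zero>\<^bsub>K\<^esub>}" and ?Q = "{q. g q ~= \<zero>\<^bsub>K\<^esub>} \<union> {q. g' q ~= \<zero>\<^bsub>K\<^esub>}"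
	let ?X = "{(p, q). p : ?P & q : ?Q & z = pr p q}"
	have fin: "finite ?P" "finite ?Q" using F_support f g by auto
	note v = F_value[OF f] F_value[OF g(1)] F_value[OF g(2)]
	have "(f \<otimes>\<^bsub>F\<^esub> (g \<oplus>\<^bsub>F\<^esub> g')) z = (\<Oplus>\<^bsub>K\<^esub>pq\<in>?X. f (fst pq) \<otimes>\<^bsub>K\<^esub> (g \<oplus>\<^bsub>F\<^esub> g') (snd pq))"
		by (rule mu_superset) (use f g fin in \<open>auto simp: F_add\<close>)
	also have "\<dots> = (\<Oplus>\<^bsub>K\<^esub>pq\<in>?X. f (fst pq) \<otimes>\<^bsub>K\<^esub> g (snd pq) \<oplus>\<^bsub>K\<^esub> f (fst pq) \<otimes>\<^bsub>K\<^esub> g' (snd pq))"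
		by (rule A.R.finsum_cong') (use v in \<open>auto simp: F_add A.R.r_distr\<close>)
	also have "\<dots> = (\<Oplus>\<^bsub>K\<^esub>pq\<in>?X. f (fst pq) \<otimes>\<^bsub>K\<^esub> g (snd pq)) \<oplus>\<^bsub>K\<^esub> (\<Oplus>\<^bsub>K\<^esub>pq\<in>?X. f (fst pq) \<otimes>\<^bsub>K\<^esub> g' (snd pq))"
		by (rule A.R.finsum_addf) (use v in auto)
	also have "(\<Oplus>\<^bsub>K\<^esub>pq\<in>?X. f (fst pq) \<otimes>\<^bsub>K\<^esub> g (snd pq)) = (f \<otimes>\<^bsub>F\<^esub> g) z"
		by (rule mu_superset[symmetric]) (use f g fin in auto)
	also have "(\<Oplus>\<^bsub>K\<^esub>pq\<in>?X. f (fst pq) \<otimes>\<^bsub>K\<^esub> g' (snd pq)) = (f \<otimes>\<^bsub>F\<^esub> g') z"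
		by (rule mu_superset[symmetric]) (use f g fin in auto)
	finally show "(f \<otimes>\<^bsub>F\<^esub> (g \<oplus>\<^bsub>F\<^esub> g')) z = (f \<otimes>\<^bsub>F\<^esub> g \<oplus>\<^bsub>F\<^esub> f \<otimes>\<^bsub>F\<^esub> g') z"
		unfolding F_add[of "f \<otimes>\<^bsub>F\<^esub> g" "f \<otimes>\<^bsub>F\<^esub> g'"] .
qed

lemma mu_zero: "\<zero>\<^bsub>F\<^esub> \<otimes>\<^bsub>F\<^esub> g = \<zero>\<^bsub>F\<^esub>" "g \<otimes>\<^bsub>F\<^esub> \<zero>\<^bsub>F\<^esub> = \<zero>\<^bsub>F\<^esub>"
	by (simp_all add: tensor_free_def free_module_def)

lemma mu_gen:
	assumes c: "c : carrier K" "a : carrier A" "b : carrier B" and d: "d : carrier K" "x : carrier A" "y : carrier B"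
	shows "(c \<odot>\<^bsub>F\<^esub> e a b) \<otimes>\<^bsub>F\<^esub> (d \<odot>\<^bsub>F\<^esub> e x y) = (c \<otimes>\<^bsub>K\<^esub> d) \<odot>\<^bsub>F\<^esub> e (a \<otimes>\<^bsub>A\<^esub> x) (b \<otimes>\<^bsub>B\<^esub> y)"
proof (rule F_ext)
	fix z
	let ?f = "c \<odot>\<^bsub>F\<^esub> e a b" and ?g = "d \<odot>\<^bsub>F\<^esub> e x y"
	have v: "(c \<odot>\<^bsub>F\<^esub> e a b) p = (if p = (a, b) then c else \<zero>\<^bsub>K\<^esub>)" if "c : carrier K" for c a b p
		using that by (simp add: F_simps A.R.free_module_simps free_gen_def)
	have "(?f \<otimes>\<^bsub>F\<^esub> ?g) z = (\<Oplus>\<^bsub>K\<^esub>pq\<in>{(p, q). p : {(a, b)} & q : {(x, y)} & z = pr p q}. ?f (fst pq) \<otimes>\<^bsub>K\<^esub> ?g (snd pq))"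
		by (rule mu_superset) (use c d e_closed v in \<open>auto split: if_splits\<close>)
	also have "{(p, q). p : {(a, b)} & q : {(x, y)} & z = pr p q} =
			(if z = (a \<otimes>\<^bsub>A\<^esub> x, b \<otimes>\<^bsub>B\<^esub> y) then {((a, b), (x, y))} else {})"
		by (auto simp: pr_def)
	also have "(\<Oplus>\<^bsub>K\<^esub>pq\<in>\<dots>. ?f (fst pq) \<otimes>\<^bsub>K\<^esub> ?g (snd pq)) = (if z = (a \<otimes>\<^bsub>A\<^esub> x, b \<otimes>\<^bsub>B\<^esub> y) then c \<otimes>\<^bsub>K\<^esub> d else \<zero>\<^bsub>K\<^esub>)"
		using c d by (simp add: v)
	also have "\<dots> = ((c \<otimes>\<^bsub>K\<^esub> d) \<odot>\<^bsub>F\<^esub> e (a \<otimes>\<^bsub>A\<^esub> x) (b \<otimes>\<^bsub>B\<^esub> y)) z" using c d by (simp add: v)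
	finally show "(?f \<otimes>\<^bsub>F\<^esub> ?g) z = ((c \<otimes>\<^bsub>K\<^esub> d) \<odot>\<^bsub>F\<^esub> e (a \<otimes>\<^bsub>A\<^esub> x) (b \<otimes>\<^bsub>B\<^esub> y)) z" .
qed

lemma mu_closed:
	assumes f: "f : carrier F" and g: "g : carrier F"
	shows "f \<otimes>\<^bsub>F\<^esub> g : carrier F"
	using f
proof (induction f rule: F_induct)
	case (3 c a b)
	show ?case using g
	proof (induction g rule: F_induct)
		case (1 g g')
		thus ?case using 3 e_closed by (simp add: mu_add_right)
	qed (use 3 e_closed in \<open>auto simp: mu_gen mu_zero\<close>)
qed (use g in \<open>auto simp: mu_add_left mu_zero\<close>)

lemma mu_comm:
	assumes f: "f : carrier F" and g: "g : carrier F"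
	shows "f \<otimes>\<^bsub>F\<^esub> g = g \<otimes>\<^bsub>F\<^esub> f"
	using f
proof (induction f rule: F_induct)
	case (3 c a b)
	show ?case using g
	proof (induction g rule: F_induct)
		case (1 g g')
		thus ?case using 3 e_closed by (simp add: mu_add_right mu_add_left)
	next
		case (3 d x y)
		thus ?case using \<open>c : carrier K\<close> \<open>a : carrier A\<close> \<open>b : carrier B\<close>
			by (simp add: mu_gen A.R.m_comm A.m_comm B.m_comm)
	qed (auto simp: mu_zero)
qed (use g in \<open>auto simp: mu_add_left mu_add_right mu_zero\<close>)

lemma mu_smult:
	assumes c: "c : carrier K" and f: "f : carrier F" and g: "g : carrier F"
	shows "(c \<odot>\<^bsub>F\<^esub> f) \<otimes>\<^bsub>F\<^esub> g = c \<odot>\<^bsub>F\<^esub> (f \<otimes>\<^bsub>F\<^esub> g)"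
	using f
proof (induction f rule: F_induct)
	case (1 f f')
	thus ?case using g c mu_closed by (simp add: F.smult_r_distr mu_add_left)
next
	case (3 d a b)
	show ?case using g
	proof (induction g rule: F_induct)
		case (1 g g')
		thus ?case using 3 c e_closed mu_closed by (simp add: mu_add_right F.smult_r_distr)
	next
		case (3 d' x y)
		thus ?case using \<open>d : carrier K\<close> \<open>a : carrier A\<close> \<open>b : carrier B\<close> c e_closed
			by (simp add: mu_gen A.R.m_assoc F.smult_assoc1[symmetric])
	qed (use 3 c e_closed in \<open>auto simp: mu_zero\<close>)
qed (use g c in \<open>auto simp: mu_zero\<close>)

lemma mu_additive: "g : carrier F ==> additive_map F F (%f. f \<otimes>\<^bsub>F\<^esub> g)"
	by (intro additive_map.intro additive_map_axioms.intro F.M.abelian_group_axioms) (auto simp: mu_closed mu_add_left)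

lemma cls_smult_e:
	"c : carrier K ==> a : carrier A ==> b : carrier B ==> S.cls (c \<odot>\<^bsub>F\<^esub> e a b) = c \<odot>\<^bsub>R\<^esub> pure a b"
	using e_closed by (simp add: S.cls_smult pure_cls R_simps)

lemma null_mu_gen:
	assumes t: "t : tensor_relations K A B" and d: "d : carrier K" "x : carrier A" "y : carrier B"
	shows "S.cls (t \<otimes>\<^bsub>F\<^esub> (d \<odot>\<^bsub>F\<^esub> e x y)) = \<zero>\<^bsub>R\<^esub>"
proof -
	let ?g = "d \<odot>\<^bsub>F\<^esub> e x y"
	have g: "?g : carrier F" using d e_closed by auto
	interpret m: additive_map F F "%f. f \<otimes>\<^bsub>F\<^esub> ?g" by (rule mu_additive[OF g])
	have eg: "e a b \<otimes>\<^bsub>F\<^esub> ?g = d \<odot>\<^bsub>F\<^esub> e (a \<otimes>\<^bsub>A\<^esub> x) (b \<otimes>\<^bsub>B\<^esub> y)" if "a : carrier A" "b : carrier B" for a b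
		using mu_gen[OF A.R.one_closed that d] d that e_closed by simp
	have main: "S.cls ((u \<ominus>\<^bsub>F\<^esub> v) \<otimes>\<^bsub>F\<^esub> ?g) = \<zero>\<^bsub>R\<^esub>"
		if "u : carrier F" "v : carrier F" "S.cls (u \<otimes>\<^bsub>F\<^esub> ?g) = S.cls (v \<otimes>\<^bsub>F\<^esub> ?g)" for u v
	proof -
		have "(u \<ominus>\<^bsub>F\<^esub> v) \<otimes>\<^bsub>F\<^esub> ?g = u \<otimes>\<^bsub>F\<^esub> ?g \<ominus>\<^bsub>F\<^esub> v \<otimes>\<^bsub>F\<^esub> ?g" using that by (simp add: m.map_minus)
		moreover have "u \<otimes>\<^bsub>F\<^esub> ?g \<ominus>\<^bsub>F\<^esub> v \<otimes>\<^bsub>F\<^esub> ?g : S.N"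
			using that(3) S.cls_eq_iff[OF mu_closed[OF that(1) g] mu_closed[OF that(2) g]] by simp
		ultimately show ?thesis using S.cls_N by (simp add: R_simps)
	qed
	from t show ?thesis
	proof (cases rule: relations_cases)
		case add_left
		show ?thesis unfolding add_left(4)
			by (rule main) (use add_left d e_closed pure_closed in
				\<open>auto simp: eg mu_add_left g S.cls_add cls_smult_e A.l_distr pure_add_left Rm.smult_r_distr R_simps(2)[symmetric]\<close>)
	next
		case add_right
		show ?thesis unfolding add_right(4)
			by (rule main) (use add_right d e_closed pure_closed in
				\<open>auto simp: eg mu_add_left g S.cls_add cls_smult_e B.l_distr pure_add_right Rm.smult_r_distr R_simps(2)[symmetric]\<close>)
	next
		case smult_left
		show ?thesis unfolding smult_left(4)
			by (rule main) (use smult_left d e_closed pure_closed in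
				\<open>auto simp: eg mu_smult g F.smult_assoc1[symmetric] cls_smult_e A.smult_assoc2 pure_smult_left Rm.smult_assoc1[symmetric] A.R.m_comm\<close>)
	next
		case smult_right
		show ?thesis unfolding smult_right(4)
			by (rule main) (use smult_right d e_closed pure_closed in
				\<open>auto simp: eg mu_smult g F.smult_assoc1[symmetric] cls_smult_e B.smult_assoc2 pure_smult_right Rm.smult_assoc1[symmetric] A.R.m_comm\<close>)
	qed
qed

lemma cls_zero_N: "x : carrier F ==> S.cls x = \<zero>\<^bsub>R\<^esub> \<longleftrightarrow> x : S.N"
	using S.NS.a_rcos_self[of x] S.cls_N[of x] by (auto simp: R_simps S.Q_simps)

text \<open>The bilinear relations span an ideal of the free algebra, so the product of cosets is
  well defined. Both factors can be reduced to generators, as the claim is preserved by sums and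
  multiples.\<close>

lemma null_mu:
	assumes n: "n : S.N" and g: "g : carrier F"
	shows "n \<otimes>\<^bsub>F\<^esub> g : S.N"
	using g
proof (induction g rule: F_induct)
	case (1 g g')
	thus ?case using n S.N_carrier F.submoduleE(5)[OF S.N_submodule]
		by (auto simp: mu_add_right subset_iff)
next
	case 2
	thus ?case by (simp add: mu_zero)
next
	case (3 d x y)
	define g where "g = d \<odot>\<^bsub>F\<^esub> e x y"
	have g: "g : carrier F" using 3 e_closed by (auto simp: g_def)
	have "submodule {n : carrier F. n \<otimes>\<^bsub>F\<^esub> g : S.N} K F"
	proof (rule F.submoduleI)
		interpret m: additive_map F F "%f. f \<otimes>\<^bsub>F\<^esub> g" by (rule mu_additive[OF g])
		show "\<ominus>\<^bsub>F\<^esub> n : {n : carrier F. n \<otimes>\<^bsub>F\<^esub> g : S.N}" if "n : {n : carrier F. n \<otimes>\<^bsub>F\<^esub> g : S.N}" for n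
			using that F.submoduleE(3)[OF S.N_submodule] by (auto simp: m.map_uminus)
		show "c \<odot>\<^bsub>F\<^esub> n : {n : carrier F. n \<otimes>\<^bsub>F\<^esub> g : S.N}" if "c : carrier K" "n : {n : carrier F. n \<otimes>\<^bsub>F\<^esub> g : S.N}" for c n
			using that F.submoduleE(4)[OF S.N_submodule] g by (auto simp: mu_smult)
		show "n \<oplus>\<^bsub>F\<^esub> m : {n : carrier F. n \<otimes>\<^bsub>F\<^esub> g : S.N}"
			if "n : {n : carrier F. n \<otimes>\<^bsub>F\<^esub> g : S.N}" "m : {n : carrier F. n \<otimes>\<^bsub>F\<^esub> g : S.N}" for n m
			using that F.submoduleE(5)[OF S.N_submodule] g by (auto simp: mu_add_left)
	qed (auto simp: mu_zero)
	moreover have "tensor_relations K A B <= {n : carrier F. n \<otimes>\<^bsub>F\<^esub> g : S.N}"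
	proof
		fix t assume t: "t : tensor_relations K A B"
		have tF: "t : carrier F" using t relations_carrier by auto
		have "S.cls (t \<otimes>\<^bsub>F\<^esub> g) = \<zero>\<^bsub>R\<^esub>" unfolding g_def by (rule null_mu_gen[OF t 3])
		thus "t : {n : carrier F. n \<otimes>\<^bsub>F\<^esub> g : S.N}" using tF cls_zero_N[OF mu_closed[OF tF g]] by simp
	qed
	ultimately show ?case using n S.N_least unfolding g_def by blast
qed

lemma cls_mult:
	assumes x: "x : carrier F" and y: "y : carrier F"
	shows "S.cls x \<otimes>\<^bsub>R\<^esub> S.cls y = S.cls (x \<otimes>\<^bsub>F\<^esub> y)"
proof -
	have one: "S.cls (a \<otimes>\<^bsub>F\<^esub> b) = S.cls (x \<otimes>\<^bsub>F\<^esub> b)" if ab: "a : carrier F" "b : carrier F" "x : carrier F" "S.cls a = S.cls x" for a b x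
	proof -
		interpret m: additive_map F F "%f. f \<otimes>\<^bsub>F\<^esub> b" by (rule mu_additive[OF ab(2)])
		have "a \<ominus>\<^bsub>F\<^esub> x : S.N" using ab S.cls_eq_iff by auto
		hence "(a \<ominus>\<^bsub>F\<^esub> x) \<otimes>\<^bsub>F\<^esub> b : S.N" using null_mu ab by auto
		thus ?thesis using ab mu_closed S.cls_eq_iff by (simp add: m.map_minus)
	qed
	have "S.cls (a \<otimes>\<^bsub>F\<^esub> b) = S.cls (x \<otimes>\<^bsub>F\<^esub> y)" if "a : S.cls x" "b : S.cls y" for a b
	proof -
		have a: "a : carrier F" "S.cls a = S.cls x" and b: "b : carrier F" "S.cls b = S.cls y"
			using S.mem_cls x y that by blast+
		have "S.cls (a \<otimes>\<^bsub>F\<^esub> b) = S.cls (x \<otimes>\<^bsub>F\<^esub> b)" by (rule one[OF a(1) b(1) x a(2)])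
		also have "\<dots> = S.cls (y \<otimes>\<^bsub>F\<^esub> x)" using one[OF b(1) x y b(2)] mu_comm[OF x b(1)] by simp
		also have "\<dots> = S.cls (x \<otimes>\<^bsub>F\<^esub> y)" using mu_comm[OF x y] by simp
		finally show ?thesis .
	qed
	moreover have "x : S.cls x" "y : S.cls y" using S.NS.a_rcos_self x y by auto
	ultimately have "(\<Union>a\<in>S.cls x. \<Union>b\<in>S.cls y. S.cls (a \<otimes>\<^bsub>F\<^esub> b)) = S.cls (x \<otimes>\<^bsub>F\<^esub> y)" by blast
	thus ?thesis by (simp add: tensor_algebra_def rcoset_mult_def tensor_null_def)
qed

lemma R_cases: assumes "U : carrier R" obtains x where "x : carrier F" "U = S.cls x"
	using assms S.Q_cases unfolding R_simps by metis

lemma R_mult_closed: "U : carrier R ==> V : carrier R ==> U \<otimes>\<^bsub>R\<^esub> V : carrier R"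
	by (metis R_cases cls_mult mu_closed S.cls_closed R_simps(1))

lemma R_l_distr:
	assumes "U : carrier R" "V : carrier R" "W : carrier R"
	shows "(U \<oplus>\<^bsub>R\<^esub> V) \<otimes>\<^bsub>R\<^esub> W = U \<otimes>\<^bsub>R\<^esub> W \<oplus>\<^bsub>R\<^esub> V \<otimes>\<^bsub>R\<^esub> W"
proof -
	obtain x y z where h: "x : carrier F" "U = S.cls x" "y : carrier F" "V = S.cls y" "z : carrier F" "W = S.cls z"
		using assms by (meson R_cases)
	have "(U \<oplus>\<^bsub>R\<^esub> V) \<otimes>\<^bsub>R\<^esub> W = S.cls ((x \<oplus>\<^bsub>F\<^esub> y) \<otimes>\<^bsub>F\<^esub> z)"
		unfolding h R_simps(2) using h cls_mult[of "x \<oplus>\<^bsub>F\<^esub> y" z] by (simp add: S.cls_add)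
	also have "\<dots> = U \<otimes>\<^bsub>R\<^esub> W \<oplus>\<^bsub>R\<^esub> V \<otimes>\<^bsub>R\<^esub> W"
		unfolding h R_simps(2) using h mu_closed by (simp add: mu_add_left S.cls_add cls_mult)
	finally show ?thesis .
qed

lemma R_m_comm: "U : carrier R ==> V : carrier R ==> U \<otimes>\<^bsub>R\<^esub> V = V \<otimes>\<^bsub>R\<^esub> U"
	by (metis R_cases cls_mult mu_comm)

lemma pure_mult:
	assumes "a : carrier A" "b : carrier B" "a' : carrier A" "b' : carrier B"
	shows "pure a b \<otimes>\<^bsub>R\<^esub> pure a' b' = pure (a \<otimes>\<^bsub>A\<^esub> a') (b \<otimes>\<^bsub>B\<^esub> b')"
proof -
	have "e a b \<otimes>\<^bsub>F\<^esub> e a' b' = e (a \<otimes>\<^bsub>A\<^esub> a') (b \<otimes>\<^bsub>B\<^esub> b')"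
		using mu_gen[of "\<one>\<^bsub>K\<^esub>" a b "\<one>\<^bsub>K\<^esub>" a' b'] assms e_closed by simp
	thus ?thesis using assms e_closed by (simp add: pure_cls cls_mult)
qed

lemma R_cring: "cring R"
proof (rule cringI)
	show ag: "abelian_group R" by (rule Rm.M.abelian_group_axioms)
	show "(U \<oplus>\<^bsub>R\<^esub> V) \<otimes>\<^bsub>R\<^esub> W = U \<otimes>\<^bsub>R\<^esub> W \<oplus>\<^bsub>R\<^esub> V \<otimes>\<^bsub>R\<^esub> W" if "U : carrier R" "V : carrier R" "W : carrier R" for U V W
		by (rule R_l_distr[OF that])
	have rd: "W \<otimes>\<^bsub>R\<^esub> (U \<oplus>\<^bsub>R\<^esub> V) = W \<otimes>\<^bsub>R\<^esub> U \<oplus>\<^bsub>R\<^esub> W \<otimes>\<^bsub>R\<^esub> V" if "U : carrier R" "V : carrier R" "W : carrier R" for U V W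
		using R_l_distr[OF that] that R_m_comm Rm.M.add.m_closed by metis
	show "comm_monoid R"
	proof (rule comm_monoidI)
		show "\<one>\<^bsub>R\<^esub> : carrier R" unfolding R_one by (rule pure_closed) auto
		show "\<one>\<^bsub>R\<^esub> \<otimes>\<^bsub>R\<^esub> U = U" if "U : carrier R" for U
			using that
		proof (induction U rule: R_induct)
			case (1 U V)
			have "\<one>\<^bsub>R\<^esub> : carrier R" unfolding R_one by (rule pure_closed) auto
			thus ?case using 1 by (simp add: rd)
		next
			case (2 a b)
			thus ?case by (simp add: R_one pure_mult)
		qed
		show "U \<otimes>\<^bsub>R\<^esub> V \<otimes>\<^bsub>R\<^esub> W = U \<otimes>\<^bsub>R\<^esub> (V \<otimes>\<^bsub>R\<^esub> W)" if U: "U : carrier R" and V: "V : carrier R" and W: "W : carrier R" for U V W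
			using U
		proof (induction U rule: R_induct)
			case (1 U U')
			thus ?case using V W R_mult_closed by (simp add: R_l_distr)
		next
			case (2 a b)
			note p = pure_closed[OF 2]
			show ?case using V
			proof (induction V rule: R_induct)
				case (1 V V')
				thus ?case using W p R_mult_closed by (simp add: R_l_distr rd)
			next
				case (2 a' b')
				note p' = pure_closed[OF 2]
				show ?case using W
				proof (induction W rule: R_induct)
					case (1 W W')
					thus ?case using p p' R_mult_closed by (simp add: rd)
				next
					case (2 x y)
					thus ?case using \<open>a : carrier A\<close> \<open>b : carrier B\<close> \<open>a' : carrier A\<close> \<open>b' : carrier B\<close>
						by (simp add: pure_mult A.m_assoc B.m_assoc)
				qed
			qed
		qed
	qed (use R_mult_closed R_m_comm in auto)
qed

text \<open>The universal property for balanced maps into an abelian group. No scalar action on the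
  target is involved, so \<open>A\<close>, \<open>B\<close> and the tensor product itself can all
  serve as targets.\<close>

lemma tensor_lift:
	fixes X (structure)
	assumes X: "abelian_group X" and b: "!!a b. a : carrier A ==> b : carrier B ==> \<beta> a b : carrier X"
		and addl: "!!a a' b. a : carrier A ==> a' : carrier A ==> b : carrier B ==> \<beta> (a \<oplus>\<^bsub>A\<^esub> a') b = \<beta> a b \<oplus>\<^bsub>X\<^esub> \<beta> a' b"
		and addr: "!!a b b'. a : carrier A ==> b : carrier B ==> b' : carrier B ==> \<beta> a (b \<oplus>\<^bsub>B\<^esub> b') = \<beta> a b \<oplus>\<^bsub>X\<^esub> \<beta> a b'"
		and bal: "!!c a b. c : carrier K ==> a : carrier A ==> b : carrier B ==> \<beta> (c \<odot>\<^bsub>A\<^esub> a) b = \<beta> a (c \<odot>\<^bsub>B\<^esub> b)"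
	shows "EX L. additive_map R X L & (ALL a:carrier A. ALL b:carrier B. L (pure a b) = \<beta> a b)"
proof -
	interpret X: abelian_group X by fact
	have "EX L. additive_map FM X L & (ALL c:carrier K. ALL i:I. L (c \<odot>\<^bsub>FM\<^esub> free_gen K i) = \<beta> (c \<odot>\<^bsub>A\<^esub> fst i) (snd i))"
		by (rule A.R.free_module_lift[OF X]) (auto simp: b addl A.smult_l_distr)
	then obtain L where L: "additive_map F X L" "!!c a b. c : carrier K ==> a : carrier A ==> b : carrier B ==> L (c \<odot>\<^bsub>F\<^esub> e a b) = \<beta> (c \<odot>\<^bsub>A\<^esub> a) b"
		using additive_map_cong[OF _ F_simps(1-3)] unfolding F_simps(4) by (metis SigmaI fst_conv snd_conv)
	interpret L: additive_map F X L by (rule L(1))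
	have Le: "L (c \<odot>\<^bsub>F\<^esub> (e u v \<ominus>\<^bsub>F\<^esub> w)) = \<beta> (c \<odot>\<^bsub>A\<^esub> u) v \<ominus>\<^bsub>X\<^esub> L (c \<odot>\<^bsub>F\<^esub> w)"
		if "c : carrier K" "u : carrier A" "v : carrier B" "w : carrier F" for c u v w
	proof -
		have "c \<odot>\<^bsub>F\<^esub> (e u v \<ominus>\<^bsub>F\<^esub> w) = c \<odot>\<^bsub>F\<^esub> e u v \<ominus>\<^bsub>F\<^esub> c \<odot>\<^bsub>F\<^esub> w"
			using that e_closed by (simp add: F.M.minus_eq F.smult_r_distr F.smult_r_minus)
		thus ?thesis using that e_closed by (simp add: L.map_minus L(2))
	qed
	have self: "x \<ominus>\<^bsub>X\<^esub> x = \<zero>\<^bsub>X\<^esub>" if "x : carrier X" for x using that by (simp add: X.minus_eq X.r_neg)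
	have "L (c \<odot>\<^bsub>F\<^esub> t) = \<zero>\<^bsub>X\<^esub>" if c: "c : carrier K" and t: "t : tensor_relations K A B" for c t
	proof -
		from t show ?thesis
		proof (cases rule: relations_cases)
			case add_left
			thus ?thesis using c e_closed b by (simp add: Le F.smult_r_distr L.map_add L(2) A.smult_r_distr addl self)
		next
			case add_right
			thus ?thesis using c e_closed b by (simp add: Le F.smult_r_distr L.map_add L(2) addr self)
		next
			case smult_left
			thus ?thesis using c e_closed b by (simp add: Le F.smult_assoc1[symmetric] A.smult_assoc1[symmetric] L(2) self)
		next
			case (smult_right d a b)
			hence "\<beta> (c \<odot>\<^bsub>A\<^esub> a) (d \<odot>\<^bsub>B\<^esub> b) = \<beta> (d \<odot>\<^bsub>A\<^esub> (c \<odot>\<^bsub>A\<^esub> a)) b" using bal[of d "c \<odot>\<^bsub>A\<^esub> a" b] c by simp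
			also have "\<dots> = \<beta> ((c \<otimes>\<^bsub>K\<^esub> d) \<odot>\<^bsub>A\<^esub> a) b" using smult_right c by (simp add: A.smult_assoc1[symmetric] A.R.m_comm)
			finally show ?thesis using smult_right c e_closed b by (simp add: Le F.smult_assoc1[symmetric] L(2) self)
		qed
	qed
	from S.lift[OF L(1) this] obtain L' where L': "additive_map S.Q X L'" "ALL x:carrier F. L' (S.cls x) = L x" by blast
	have "additive_map R X L'" by (rule additive_map_cong[OF L'(1) R_simps(1-3)])
	moreover have "L' (pure a b) = \<beta> a b" if "a : carrier A" "b : carrier B" for a b
		using that L'(2) e_closed L(2)[of "\<one>\<^bsub>K\<^esub>" a b] by (simp add: pure_cls)
	ultimately show ?thesis by blast
qed

end

section \<open>Kaehler differentials and exterior powers\<close>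

locale kaehler_algebra = S: cring S + A: algebra K S
	for K :: "('k, 'r) ring_scheme" and S :: "('k, 'c, 'm) module_scheme" (structure)
begin

abbreviation "F1 \<equiv> free_module S (carrier S)"
abbreviation "\<Omega> \<equiv> kaehler K S"

definition base :: "'c set" where "base = (%c. c \<odot> \<one>) ` carrier K"

interpretation F1: module S F1 by (rule S.free_module_module)

lemma kaehler_relations_carrier: "kaehler_relations K S <= carrier F1"
proof -
	have g: "free_gen S s : carrier F1" if "s : carrier S" for s using that by (rule S.free_gen_closed)
	show ?thesis unfolding kaehler_relations_def Let_def
		by (auto intro!: F1.M.minus_closed F1.M.add.m_closed F1.smult_closed g S.a_closed S.m_closed A.smult_closed)
qed

interpretation Q1: span_quotient S F1 "kaehler_relations K S"
	by (intro span_quotient.intro S.free_module_module span_quotient_axioms.intro kaehler_relations_carrier)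

lemma \<Omega>_def: "\<Omega> = Q1.Q"
	by (simp add: kaehler_def Let_def)

lemma \<Omega>_module: "module S \<Omega>"
	unfolding \<Omega>_def by (rule Q1.Q_module)

interpretation \<Omega>: module S \<Omega> by (rule \<Omega>_module)

definition dd :: "'c => ('c => 'c) set" where "dd s = Q1.cls (free_gen S s)"

lemma gen1: "s : carrier S ==> free_gen S s : carrier F1"
	by (rule S.free_gen_closed)

lemma dd_closed: "s : carrier S ==> dd s : carrier \<Omega>"
	unfolding dd_def \<Omega>_def by (intro Q1.cls_closed gen1)

lemma dd_add:
	assumes "s : carrier S" "t : carrier S"
	shows "dd (s \<oplus> t) = dd s \<oplus>\<^bsub>\<Omega>\<^esub> dd t"
proof -
	have "free_gen S (s \<oplus> t) \<ominus>\<^bsub>F1\<^esub> (free_gen S s \<oplus>\<^bsub>F1\<^esub> free_gen S t) : kaehler_relations K S"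
		unfolding kaehler_relations_def Let_def using assms by blast
	hence "Q1.cls (free_gen S (s \<oplus> t)) = Q1.cls (free_gen S s \<oplus>\<^bsub>F1\<^esub> free_gen S t)"
		using assms gen1 Q1.T_sub_N by (subst Q1.cls_eq_iff) auto
	thus ?thesis using assms gen1 by (simp add: dd_def \<Omega>_def Q1.cls_add)
qed

lemma dd_mult:
	assumes "s : carrier S" "t : carrier S"
	shows "dd (s \<otimes> t) = s \<odot>\<^bsub>\<Omega>\<^esub> dd t \<oplus>\<^bsub>\<Omega>\<^esub> t \<odot>\<^bsub>\<Omega>\<^esub> dd s"
proof -
	have "free_gen S (s \<otimes> t) \<ominus>\<^bsub>F1\<^esub> ((s \<odot>\<^bsub>F1\<^esub> free_gen S t) \<oplus>\<^bsub>F1\<^esub> (t \<odot>\<^bsub>F1\<^esub> free_gen S s)) : kaehler_relations K S"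
		unfolding kaehler_relations_def Let_def using assms by blast
	hence "Q1.cls (free_gen S (s \<otimes> t)) = Q1.cls ((s \<odot>\<^bsub>F1\<^esub> free_gen S t) \<oplus>\<^bsub>F1\<^esub> (t \<odot>\<^bsub>F1\<^esub> free_gen S s))"
		using assms gen1 Q1.T_sub_N by (subst Q1.cls_eq_iff) auto
	thus ?thesis using assms gen1 by (simp add: dd_def \<Omega>_def Q1.cls_add Q1.cls_smult)
qed

lemma dd_base: "x : base ==> dd x = \<zero>\<^bsub>\<Omega>\<^esub>"
proof -
	assume "x : base"
	hence "free_gen S x : kaehler_relations K S"
		unfolding kaehler_relations_def Let_def base_def by blast
	thus ?thesis using Q1.T_sub_N Q1.cls_N by (auto simp: dd_def \<Omega>_def)
qed

lemma \<Omega>_induct [consumes 1]: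
	assumes "\<omega> : carrier \<Omega>"
		and add: "!!\<omega> \<eta>. \<omega> : carrier \<Omega> ==> \<eta> : carrier \<Omega> ==> P \<omega> ==> P \<eta> ==> P (\<omega> \<oplus>\<^bsub>\<Omega>\<^esub> \<eta>)"
		and zero: "P \<zero>\<^bsub>\<Omega>\<^esub>"
		and gen: "!!c s. c : carrier S ==> s : carrier S ==> P (c \<odot>\<^bsub>\<Omega>\<^esub> dd s)"
	shows "P \<omega>"
proof -
	have "P (Q1.cls f)" if "f : carrier F1" for f
		using that
	proof (induction f rule: S.free_module_induct[consumes 1])
		case (1 f g)
		thus ?case using add[of "Q1.cls f" "Q1.cls g"] Q1.cls_closed by (simp add: Q1.cls_add \<Omega>_def)
	next
		case 2
		thus ?case using zero by (simp add: Q1.cls_zero \<Omega>_def)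
	next
		case (3 c s)
		thus ?case using gen[of c s] gen1 by (simp add: Q1.cls_smult \<Omega>_def dd_def)
	qed
	thus ?thesis using assms(1) Q1.Q_cases unfolding \<Omega>_def by metis
qed

lemma derivation_lift:
	assumes d: "S.derivation_on base (carrier S) \<delta>"
	shows "EX f. f : module_dual S \<Omega> & (ALL s:carrier S. f (dd s) = \<delta> s)"
proof -
	note D = S.derivation_onD[OF d]
	have "EX L. additive_map F1 S L & (ALL c:carrier S. ALL i:carrier S. L (c \<odot>\<^bsub>F1\<^esub> free_gen S i) = c \<otimes> \<delta> i)"
		using D(1) by (intro S.free_module_lift S.abelian_group_axioms) (auto simp: S.l_distr)
	then obtain L where L: "additive_map F1 S L" "!!c i. c : carrier S ==> i : carrier S ==> L (c \<odot>\<^bsub>F1\<^esub> free_gen S i) = c \<otimes> \<delta> i"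
		by blast
	interpret L: additive_map F1 S L by (rule L(1))
	have Lm: "L (c \<odot>\<^bsub>F1\<^esub> (u \<ominus>\<^bsub>F1\<^esub> v)) = L (c \<odot>\<^bsub>F1\<^esub> u) \<ominus> L (c \<odot>\<^bsub>F1\<^esub> v)"
		if "c : carrier S" "u : carrier F1" "v : carrier F1" for c u v
		using that L.map_minus[of "c \<odot>\<^bsub>F1\<^esub> u" "c \<odot>\<^bsub>F1\<^esub> v"] by (simp add: F1.M.minus_eq F1.smult_r_distr F1.smult_r_minus)
	have "L (c \<odot>\<^bsub>F1\<^esub> t) = \<zero>" if c: "c : carrier S" and t: "t : kaehler_relations K S" for c t
	proof -
		from t consider
				(1) x y where "x : carrier S" "y : carrier S" "t = free_gen S (x \<oplus> y) \<ominus>\<^bsub>F1\<^esub> (free_gen S x \<oplus>\<^bsub>F1\<^esub> free_gen S y)"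
			| (2) x y where "x : carrier S" "y : carrier S" "t = free_gen S (x \<otimes> y) \<ominus>\<^bsub>F1\<^esub> ((x \<odot>\<^bsub>F1\<^esub> free_gen S y) \<oplus>\<^bsub>F1\<^esub> (y \<odot>\<^bsub>F1\<^esub> free_gen S x))"
			| (3) d where "d : carrier K" "t = free_gen S (d \<odot> \<one>)"
			unfolding kaehler_relations_def Let_def by (elim UnE CollectE exE conjE) (iprover intro: that)+
		thus ?thesis
		proof cases
			case 1
			hence cl: "\<delta> x : carrier S" "\<delta> y : carrier S" using D(1) by auto
			have "L (c \<odot>\<^bsub>F1\<^esub> t) = c \<otimes> (\<delta> x \<oplus> \<delta> y) \<ominus> (c \<otimes> \<delta> x \<oplus> c \<otimes> \<delta> y)"
				using 1 c gen1 D by (simp add: Lm F1.smult_r_distr L.map_add L(2))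
			thus ?thesis using cl c by (simp add: S.r_distr S.minus_eq S.r_neg)
		next
			case 2
			hence cl: "\<delta> x : carrier S" "\<delta> y : carrier S" using D(1) by auto
			have "L (c \<odot>\<^bsub>F1\<^esub> t) = c \<otimes> (x \<otimes> \<delta> y \<oplus> y \<otimes> \<delta> x) \<ominus> ((c \<otimes> x) \<otimes> \<delta> y \<oplus> (c \<otimes> y) \<otimes> \<delta> x)"
				using 2 c gen1 D by (simp add: Lm F1.smult_r_distr L.map_add L(2) F1.smult_assoc1[symmetric])
			thus ?thesis using cl c 2 by (simp add: S.r_distr S.minus_eq S.r_neg S.m_assoc)
		next
			case 3
			hence "d \<odot> \<one> : base" "d \<odot> \<one> : carrier S" by (auto simp: base_def)
			thus ?thesis using 3 c D(4) by (simp add: L(2))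
		qed
	qed
	from Q1.lift[OF L(1) this] obtain f where f: "additive_map \<Omega> S f" "ALL x:carrier F1. f (Q1.cls x) = L x" unfolding \<Omega>_def by blast
	interpret f: additive_map \<Omega> S f by (rule f(1))
	have fd: "f (c \<odot>\<^bsub>\<Omega>\<^esub> dd s) = c \<otimes> \<delta> s" if "c : carrier S" "s : carrier S" for c s
		using that f(2) gen1 L(2) F1.smult_closed by (simp add: dd_def \<Omega>_def Q1.cls_smult[symmetric])
	have lin: "f (c \<odot>\<^bsub>\<Omega>\<^esub> \<omega>) = c \<otimes> f \<omega>" if c: "c : carrier S" and w: "\<omega> : carrier \<Omega>" for c \<omega>
		using w
	proof (induction \<omega> rule: \<Omega>_induct)
		case (1 \<omega> \<eta>)
		thus ?case using c by (simp add: \<Omega>.smult_r_distr f.map_add f.map_closed S.r_distr)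
	next
		case 2
		thus ?case using c by (simp add: f.map_zero)
	next
		case (3 b s)
		thus ?case using c D(1) by (simp add: \<Omega>.smult_assoc1[symmetric] dd_closed fd S.m_assoc)
	qed
	have "f : module_dual S \<Omega>" unfolding module_dual_def
		using f.map_closed f.map_add lin by auto
	moreover have "f (dd s) = \<delta> s" if "s : carrier S" for s
		using fd[OF S.one_closed that] that dd_closed D(1) by simp
	ultimately show ?thesis by blast
qed

section \<open>Alternating forms on differentials and the trace ideal\<close>

context
	fixes n :: nat
begin

abbreviation "TT \<equiv> tuples n \<Omega>"
abbreviation "F2 \<equiv> free_module S TT"
abbreviation "E \<equiv> exterior_power S n \<Omega>"

interpretation F2: module S F2 by (rule S.free_module_module)

lemma tuple_update: "xs : TT ==> x : carrier \<Omega> ==> xs[j := x] : TT"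
	using set_update_subset_insert[of xs j x] by (auto simp: tuples_def)

lemma gen2: "xs : TT ==> free_gen S xs : carrier F2"
	by (rule S.free_gen_closed)

lemma exterior_relations_carrier: "exterior_relations S n \<Omega> <= carrier F2"
	unfolding exterior_relations_def Let_def
	by (auto intro!: F2.M.minus_closed F2.M.add.m_closed F2.smult_closed gen2 tuple_update \<Omega>.M.add.m_closed \<Omega>.smult_closed)

interpretation Q2: span_quotient S F2 "exterior_relations S n \<Omega>"
	by (intro span_quotient.intro S.free_module_module span_quotient_axioms.intro exterior_relations_carrier)

lemma E_def: "E = Q2.Q"
	by (simp add: exterior_power_def Let_def)

interpretation E: module S E unfolding E_def by (rule Q2.Q_module)

definition wedge :: "('c => 'c) set list => (('c => 'c) set list => 'c) set" where
	"wedge xs = Q2.cls (free_gen S xs)"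

lemma wedge_closed: "xs : TT ==> wedge xs : carrier E"
	unfolding wedge_def E_def by (intro Q2.cls_closed gen2)

lemma wedge_add:
	assumes "xs : TT" "j < n" "x : carrier \<Omega>" "y : carrier \<Omega>"
	shows "wedge (xs[j := x \<oplus>\<^bsub>\<Omega>\<^esub> y]) = wedge (xs[j := x]) \<oplus>\<^bsub>E\<^esub> wedge (xs[j := y])"
proof -
	note t = tuple_update[OF assms(1)]
	have "free_gen S (xs[j := x \<oplus>\<^bsub>\<Omega>\<^esub> y]) \<ominus>\<^bsub>F2\<^esub> (free_gen S (xs[j := x]) \<oplus>\<^bsub>F2\<^esub> free_gen S (xs[j := y])) : exterior_relations S n \<Omega>"
		unfolding exterior_relations_def Let_def using assms by blast
	hence "Q2.cls (free_gen S (xs[j := x \<oplus>\<^bsub>\<Omega>\<^esub> y])) = Q2.cls (free_gen S (xs[j := x]) \<oplus>\<^bsub>F2\<^esub> free_gen S (xs[j := y]))"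
		using assms gen2 t Q2.T_sub_N by (subst Q2.cls_eq_iff) auto
	thus ?thesis using assms gen2 t by (simp add: wedge_def E_def Q2.cls_add)
qed

lemma wedge_smult:
	assumes "xs : TT" "j < n" "s : carrier S" "x : carrier \<Omega>"
	shows "wedge (xs[j := s \<odot>\<^bsub>\<Omega>\<^esub> x]) = s \<odot>\<^bsub>E\<^esub> wedge (xs[j := x])"
proof -
	note t = tuple_update[OF assms(1)]
	have "free_gen S (xs[j := s \<odot>\<^bsub>\<Omega>\<^esub> x]) \<ominus>\<^bsub>F2\<^esub> (s \<odot>\<^bsub>F2\<^esub> free_gen S (xs[j := x])) : exterior_relations S n \<Omega>"
		unfolding exterior_relations_def Let_def using assms by blast
	hence "Q2.cls (free_gen S (xs[j := s \<odot>\<^bsub>\<Omega>\<^esub> x])) = Q2.cls (s \<odot>\<^bsub>F2\<^esub> free_gen S (xs[j := x]))"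
		using assms gen2 t Q2.T_sub_N by (subst Q2.cls_eq_iff) auto
	thus ?thesis using assms gen2 t by (simp add: wedge_def E_def Q2.cls_smult)
qed

lemma wedge_alt:
	assumes "xs : TT" "j < n" "l < n" "j ~= l" "xs ! j = xs ! l"
	shows "wedge xs = \<zero>\<^bsub>E\<^esub>"
proof -
	have "EX j l. j < l & l < n & xs ! j = xs ! l"
		using assms by (metis linorder_neqE_nat)
	hence "free_gen S xs : exterior_relations S n \<Omega>"
		unfolding exterior_relations_def Let_def using assms(1) by blast
	thus ?thesis using Q2.T_sub_N Q2.cls_N by (auto simp: wedge_def E_def)
qed

lemma E_induct [consumes 1]:
	assumes "U : carrier E"
		and add: "!!U V. U : carrier E ==> V : carrier E ==> P U ==> P V ==> P (U \<oplus>\<^bsub>E\<^esub> V)"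
		and zero: "P \<zero>\<^bsub>E\<^esub>"
		and gen: "!!c xs. c : carrier S ==> xs : TT ==> P (c \<odot>\<^bsub>E\<^esub> wedge xs)"
	shows "P U"
proof -
	have "P (Q2.cls f)" if "f : carrier F2" for f
		using that
	proof (induction f rule: S.free_module_induct[consumes 1])
		case (1 f g)
		thus ?case using add[of "Q2.cls f" "Q2.cls g"] Q2.cls_closed by (simp add: Q2.cls_add E_def)
	next
		case 2
		thus ?case using zero by (simp add: Q2.cls_zero E_def)
	next
		case (3 c s)
		thus ?case using gen[of c s] gen2 by (simp add: Q2.cls_smult E_def wedge_def)
	qed
	thus ?thesis using assms(1) Q2.Q_cases unfolding E_def by metis
qed

lemma exterior_lift:
	assumes c: "!!xs. xs : TT ==> \<psi> xs : carrier S"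
		and add: "!!xs j x y. xs : TT ==> j < n ==> x : carrier \<Omega> ==> y : carrier \<Omega> ==>
			 \<psi> (xs[j := x \<oplus>\<^bsub>\<Omega>\<^esub> y]) = \<psi> (xs[j := x]) \<oplus> \<psi> (xs[j := y])"
		and smult: "!!xs j s x. xs : TT ==> j < n ==> s : carrier S ==> x : carrier \<Omega> ==> \<psi> (xs[j := s \<odot>\<^bsub>\<Omega>\<^esub> x]) = s \<otimes> \<psi> (xs[j := x])"
		and alt: "!!xs j l. xs : TT ==> j < l ==> l < n ==> xs ! j = xs ! l ==> \<psi> xs = \<zero>"
	shows "EX f. f : module_dual S E & (ALL xs:TT. f (wedge xs) = \<psi> xs)"
proof -
	have "EX L. additive_map F2 S L & (ALL c:carrier S. ALL i:TT. L (c \<odot>\<^bsub>F2\<^esub> free_gen S i) = c \<otimes> \<psi> i)"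
		using c by (intro S.free_module_lift S.abelian_group_axioms) (auto simp: S.l_distr)
	then obtain L where L: "additive_map F2 S L" "!!c i. c : carrier S ==> i : TT ==> L (c \<odot>\<^bsub>F2\<^esub> free_gen S i) = c \<otimes> \<psi> i"
		by blast
	interpret L: additive_map F2 S L by (rule L(1))
	have Lm: "L (c \<odot>\<^bsub>F2\<^esub> (u \<ominus>\<^bsub>F2\<^esub> v)) = L (c \<odot>\<^bsub>F2\<^esub> u) \<ominus> L (c \<odot>\<^bsub>F2\<^esub> v)"
		if "c : carrier S" "u : carrier F2" "v : carrier F2" for c u v
		using that L.map_minus[of "c \<odot>\<^bsub>F2\<^esub> u" "c \<odot>\<^bsub>F2\<^esub> v"] by (simp add: F2.M.minus_eq F2.smult_r_distr F2.smult_r_minus)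
	have "L (a \<odot>\<^bsub>F2\<^esub> t) = \<zero>" if a: "a : carrier S" and t: "t : exterior_relations S n \<Omega>" for a t
	proof -
		from t consider
				(1) xs j x y where "xs : TT" "j < n" "x : carrier \<Omega>" "y : carrier \<Omega>"
					"t = free_gen S (xs[j := x \<oplus>\<^bsub>\<Omega>\<^esub> y]) \<ominus>\<^bsub>F2\<^esub> (free_gen S (xs[j := x]) \<oplus>\<^bsub>F2\<^esub> free_gen S (xs[j := y]))"
			| (2) xs j s x where "xs : TT" "j < n" "s : carrier S" "x : carrier \<Omega>"
					"t = free_gen S (xs[j := s \<odot>\<^bsub>\<Omega>\<^esub> x]) \<ominus>\<^bsub>F2\<^esub> (s \<odot>\<^bsub>F2\<^esub> free_gen S (xs[j := x]))"
			| (3) xs j l where "xs : TT" "j < l" "l < n" "xs ! j = xs ! l" "t = free_gen S xs"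
			unfolding exterior_relations_def Let_def by (elim UnE CollectE exE conjE) (iprover intro: that)+
		thus ?thesis
		proof cases
			case 1
			note u = tuple_update[OF 1(1)]
			have cl: "\<psi> (xs[j := x]) : carrier S" "\<psi> (xs[j := y]) : carrier S" using c u 1 by auto
			have "L (a \<odot>\<^bsub>F2\<^esub> t) = a \<otimes> (\<psi> (xs[j := x]) \<oplus> \<psi> (xs[j := y])) \<ominus> (a \<otimes> \<psi> (xs[j := x]) \<oplus> a \<otimes> \<psi> (xs[j := y]))"
				using 1 a gen2 u by (simp add: Lm F2.smult_r_distr L.map_add L(2) add)
			thus ?thesis using cl a by (simp add: S.r_distr S.minus_eq S.r_neg)
		next
			case 2
			note u = tuple_update[OF 2(1)]
			have cl: "\<psi> (xs[j := x]) : carrier S" using c u 2 by auto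
			have "L (a \<odot>\<^bsub>F2\<^esub> t) = a \<otimes> (s \<otimes> \<psi> (xs[j := x])) \<ominus> (a \<otimes> s) \<otimes> \<psi> (xs[j := x])"
				using 2 a gen2 u by (simp add: Lm F2.smult_assoc1[symmetric] L(2) smult)
			thus ?thesis using cl a 2 by (simp add: S.minus_eq S.r_neg S.m_assoc)
		next
			case 3
			thus ?thesis using a alt[OF 3(1-4)] by (simp add: L(2))
		qed
	qed
	from Q2.lift[OF L(1) this] obtain f where f: "additive_map E S f" "ALL x:carrier F2. f (Q2.cls x) = L x" unfolding E_def by blast
	interpret f: additive_map E S f by (rule f(1))
	have fd: "f (b \<odot>\<^bsub>E\<^esub> wedge xs) = b \<otimes> \<psi> xs" if "b : carrier S" "xs : TT" for b xs
		using that f(2) gen2 L(2) F2.smult_closed by (simp add: wedge_def E_def Q2.cls_smult[symmetric])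
	have lin: "f (a \<odot>\<^bsub>E\<^esub> U) = a \<otimes> f U" if a: "a : carrier S" and w: "U : carrier E" for a U
		using w
	proof (induction U rule: E_induct)
		case (1 U V)
		thus ?case using a by (simp add: E.smult_r_distr f.map_add f.map_closed S.r_distr)
	next
		case 2
		thus ?case using a by (simp add: f.map_zero)
	next
		case (3 b s)
		thus ?case using a c by (simp add: E.smult_assoc1[symmetric] wedge_closed fd S.m_assoc)
	qed
	have "f : module_dual S E" unfolding module_dual_def
		using f.map_closed f.map_add lin by auto
	moreover have "f (wedge xs) = \<psi> xs" if "xs : TT" for xs
		using fd[OF S.one_closed that] that wedge_closed c by simp
	ultimately show ?thesis by blast
qed

lemma trace_ideal_full:
	assumes ch0: "!!m. S.nmul m \<one> = \<zero> ==> m = 0" and base: "subfield base S"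
		and zs: "set zs <= carrier S" "length zs = n"
		and d: "!!i. i < n ==> S.derivation_on base (carrier S) (\<delta> i)"
		and dual: "!!i j. i < n ==> j < n ==> \<delta> i (zs ! j) = (if i = j then \<one> else \<zero>)"
	shows "carrier S <= trace_ideal S E"
proof -
	interpret C: char0_algebra S base
		by (intro char0_algebra.intro subfield_cring.intro subfield_cring_axioms.intro char0_algebra_axioms.intro
				S.cring_axioms base ch0)
	have "ALL i:{..<n}. EX f. f : module_dual S \<Omega> & (ALL s:carrier S. f (dd s) = \<delta> i s)"
		using derivation_lift[OF d] by auto
	then obtain f where f: "!!i. i < n ==> f i : module_dual S \<Omega>" "!!i s. i < n ==> s : carrier S ==> f i (dd s) = \<delta> i s"
		by (metis lessThan_iff)
	have fl: "f i x : carrier S" "f i (x \<oplus>\<^bsub>\<Omega>\<^esub> y) = f i x \<oplus> f i y" "s : carrier S ==> f i (s \<odot>\<^bsub>\<Omega>\<^esub> x) = s \<otimes> f i x"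
		if "i < n" "x : carrier \<Omega>" "y : carrier \<Omega>" for i x y s
		using f(1)[OF that(1)] that by (auto simp: module_dual_def)
	\<comment> \<open>The matrix is zero outside the block of size \<open>n\<close>, because the
	  determinant lemmas ask for entries in the ring at all indices.\<close>
	define h where "h xs i j = (if i < n & j < n then f i (xs ! j) else \<zero>)" for xs i j
	have tn: "xs ! j : carrier \<Omega>" if "xs : TT" "j < n" for xs j
		using that nth_mem[of j xs] by (auto simp: tuples_def)
	have hc: "h xs i j : carrier S" if "xs : TT" for xs i j
		using fl(1)[OF _ tn[OF that] tn[OF that]] by (auto simp: h_def)
	have len: "length xs = n" if "xs : TT" for xs using that by (simp add: tuples_def)
	have "EX g. g : module_dual S E & (ALL xs:TT. g (wedge xs) = S.detsum n (h xs))"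
	proof (rule exterior_lift)
		show "S.detsum n (h xs) : carrier S" if "xs : TT" for xs
			using hc[OF that] by (rule S.detsum_closed)
		show "S.detsum n (h (xs[j := x \<oplus>\<^bsub>\<Omega>\<^esub> y])) = S.detsum n (h (xs[j := x])) \<oplus> S.detsum n (h (xs[j := y]))"
			if a: "xs : TT" "j < n" "x : carrier \<Omega>" "y : carrier \<Omega>" for xs j x y
		proof (rule S.detsum_add[OF _ _ _ a(2)])
			show "h (xs[j := x \<oplus>\<^bsub>\<Omega>\<^esub> y]) i j = h (xs[j := x]) i j \<oplus> h (xs[j := y]) i j" for i
				using a len[OF a(1)] fl(2)[of i x y] by (auto simp: h_def)
		qed (use a in \<open>simp_all add: hc tuple_update, simp_all add: h_def len\<close>)
		show "S.detsum n (h (xs[j := s \<odot>\<^bsub>\<Omega>\<^esub> x])) = s \<otimes> S.detsum n (h (xs[j := x]))"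
			if a: "xs : TT" "j < n" "s : carrier S" "x : carrier \<Omega>" for xs j s x
		proof (rule S.detsum_smult[OF _ _ a(3) a(2)])
			show "h (xs[j := s \<odot>\<^bsub>\<Omega>\<^esub> x]) i j = s \<otimes> h (xs[j := x]) i j" for i
				using a len[OF a(1)] fl(3)[of i x x s] by (auto simp: h_def)
		qed (use a in \<open>simp_all add: hc tuple_update, simp_all add: h_def len\<close>)
		show "S.detsum n (h xs) = \<zero>" if a: "xs : TT" "j < l" "l < n" "xs ! j = xs ! l" for xs j l
			by (rule C.detsum_alternating[of "h xs" j n l]) (use a hc in \<open>auto simp: h_def\<close>)
	qed
	then obtain g where g: "g : module_dual S E" "!!xs. xs : TT ==> g (wedge xs) = S.detsum n (h xs)" by blast
	let ?xs = "map dd zs"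
	have xs: "?xs : TT" using zs dd_closed by (auto simp: tuples_def)
	have "S.detsum n (h ?xs) = S.detsum n (%i j. if i = j then \<one> else \<zero>)"
		unfolding S.detsum_def
	proof (rule S.finsum_cong')
		fix \<sigma> assume s: "\<sigma> : {\<sigma>. \<sigma> permutes {..<n}}"
		have "(\<Otimes>j\<in>{..<n}. h ?xs (\<sigma> j) j) = (\<Otimes>j\<in>{..<n}. if \<sigma> j = j then \<one> else \<zero>)"
		proof (rule S.finprod_cong')
			fix j assume j: "j : {..<n}"
			have sj: "\<sigma> j < n" using s j permutes_in_image[of \<sigma> "{..<n}" j] by auto
			have zj: "zs ! j : carrier S" using j zs nth_mem[of j zs] by auto
			show "h ?xs (\<sigma> j) j = (if \<sigma> j = j then \<one> else \<zero>)"
				using sj j zs f(2)[OF sj zj] dual[of "\<sigma> j" j] by (simp add: h_def)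
		qed auto
		thus "(if evenperm \<sigma> then \<one> else \<ominus> \<one>) \<otimes> (\<Otimes>j\<in>{..<n}. h ?xs (\<sigma> j) j)
			= (if evenperm \<sigma> then \<one> else \<ominus> \<one>) \<otimes> (\<Otimes>j\<in>{..<n}. if \<sigma> j = j then \<one> else \<zero>)" by simp
	qed auto
	hence g1: "g (wedge ?xs) = \<one>" using g(2)[OF xs] S.detsum_identity by simp
	let ?T = "\<Union>f \<in> module_dual S E. f ` carrier E"
	have T: "?T <= carrier S" by (auto simp: module_dual_def)
	have "\<one> : ?T" using g(1) g1 wedge_closed[OF xs] by (metis UN_I image_eqI)
	hence "\<one> : trace_ideal S E" unfolding trace_ideal_def using S.genideal_self[OF T] by auto
	thus ?thesis using ideal.one_imp_carrier[OF S.genideal_ideal[OF T]] unfolding trace_ideal_def by simp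
qed

text \<open>A form on the exterior power gives a multiderivation; freezing all arguments but one leaves a derivation.\<close>

definition form_at where "form_at f rs = f (wedge (map dd rs))"

lemma tuple_dd: "set rs <= carrier S ==> length rs = n ==> map dd rs : TT"
	using dd_closed by (auto simp: tuples_def)

lemma form_at_derivation:
	assumes f: "f : module_dual S E" and rs: "set rs <= carrier S" "length rs = n" and j: "j < n"
	shows "S.derivation_on base (carrier S) (%s. form_at f (rs[j := s]))"
proof -
	note t = tuple_dd[OF rs]
	have e: "form_at f (rs[j := s]) = f (wedge ((map dd rs)[j := dd s]))" for s
		by (simp add: form_at_def map_update)
	have fl: "f U : carrier S" "f (U \<oplus>\<^bsub>E\<^esub> V) = f U \<oplus> f V" "s : carrier S ==> f (s \<odot>\<^bsub>E\<^esub> U) = s \<otimes> f U"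
		if "U : carrier E" "V : carrier E" for U V s
		using f that by (auto simp: module_dual_def)
	have wc: "wedge ((map dd rs)[j := x]) : carrier E" if "x : carrier \<Omega>" for x
		using wedge_closed tuple_update[OF t that] by auto
	show ?thesis unfolding S.derivation_on_def e
	proof (intro conjI ballI)
		fix x y assume xy: "x : carrier S" "y : carrier S"
		note d = dd_closed[OF xy(1)] dd_closed[OF xy(2)]
		show "f (wedge ((map dd rs)[j := dd (x \<oplus> y)])) = f (wedge ((map dd rs)[j := dd x])) \<oplus> f (wedge ((map dd rs)[j := dd y]))"
			using wedge_add[OF t j d] fl(2)[OF wc[OF d(1)] wc[OF d(2)]] xy by (simp add: dd_add)
		show "f (wedge ((map dd rs)[j := dd (x \<otimes> y)])) = x \<otimes> f (wedge ((map dd rs)[j := dd y])) \<oplus> y \<otimes> f (wedge ((map dd rs)[j := dd x]))"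
		proof -
			have s: "x \<odot>\<^bsub>\<Omega>\<^esub> dd y : carrier \<Omega>" "y \<odot>\<^bsub>\<Omega>\<^esub> dd x : carrier \<Omega>" using xy d by auto
			have "f (wedge ((map dd rs)[j := dd (x \<otimes> y)])) = f (wedge ((map dd rs)[j := x \<odot>\<^bsub>\<Omega>\<^esub> dd y])) \<oplus> f (wedge ((map dd rs)[j := y \<odot>\<^bsub>\<Omega>\<^esub> dd x]))"
				using wedge_add[OF t j s] fl(2)[OF wc[OF s(1)] wc[OF s(2)]] xy by (simp add: dd_mult)
			thus ?thesis
				using wedge_smult[OF t j xy(1) d(2)] wedge_smult[OF t j xy(2) d(1)] fl(3)[OF wc[OF d(2)] wc[OF d(2)] xy(1)]
					fl(3)[OF wc[OF d(1)] wc[OF d(1)] xy(2)] by simp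
		qed
	next
		show "f (wedge ((map dd rs)[j := dd x])) : carrier S" if "x : carrier S" for x
			using fl(1)[OF wc wc] dd_closed[OF that] by auto
		fix c assume c: "c : base"
		\<comment> \<open>A zero argument is its own multiple by \<open>\<zero>\<close>, so linearity in
		  that place makes the form vanish on constants.\<close>
		have z: "\<zero>\<^bsub>\<Omega>\<^esub> = \<zero> \<odot>\<^bsub>\<Omega>\<^esub> \<zero>\<^bsub>\<Omega>\<^esub>" by simp
		have "f (wedge ((map dd rs)[j := \<zero>\<^bsub>\<Omega>\<^esub>])) = \<zero> \<otimes> f (wedge ((map dd rs)[j := \<zero>\<^bsub>\<Omega>\<^esub>]))"
			using wedge_smult[OF t j S.zero_closed \<Omega>.M.zero_closed] fl(3)[OF wc[OF \<Omega>.M.zero_closed] wc[OF \<Omega>.M.zero_closed] S.zero_closed]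
			by (metis z)
		thus "f (wedge ((map dd rs)[j := dd c])) = \<zero>"
			using fl(1)[OF wc wc] dd_base[OF c] by (metis S.l_null \<Omega>.M.zero_closed)
	qed
qed

lemma form_at_closed:
	"f : module_dual S E ==> set rs <= carrier S ==> length rs = n ==> form_at f rs : carrier S"
	using wedge_closed[OF tuple_dd] by (auto simp: form_at_def module_dual_def)

lemma form_at_alternating:
	assumes f: "f : module_dual S E" and rs: "set rs <= carrier S" "length rs = n" and j: "j < n" "l < n" "j ~= l"
	shows "form_at f (rs[j := rs ! l]) = \<zero>"
proof -
	have s: "set (rs[j := rs ! l]) <= carrier S"
		using set_update_subset_insert[of rs j "rs ! l"] nth_mem[of l rs] rs j by blast
	have "wedge (map dd (rs[j := rs ! l])) = \<zero>\<^bsub>E\<^esub>"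
		by (rule wedge_alt[of _ j l]) (use tuple_dd[OF s] rs j in auto)
	moreover have "f \<zero>\<^bsub>E\<^esub> = \<zero>"
	proof -
		have "f (\<zero> \<odot>\<^bsub>E\<^esub> \<zero>\<^bsub>E\<^esub>) = \<zero> \<otimes> f \<zero>\<^bsub>E\<^esub>" "f \<zero>\<^bsub>E\<^esub> : carrier S"
			using f E.M.zero_closed S.zero_closed unfolding module_dual_def by blast+
		thus ?thesis by simp
	qed
	ultimately show ?thesis by (simp add: form_at_def)
qed

text \<open>Membership of the trace in \<open>J\<close> is tested on forms evaluated at
  differentials of elements of \<open>G\<close> only. The hypothesis \<open>gen\<close> is an
  induction principle that expresses that \<open>G\<close> generates \<open>S\<close> under sums and
  products; multilinearity and the Leibniz rule do the rest.\<close>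

lemma trace_ideal_subset:
	assumes J: "ideal J S" and G: "G <= carrier S"
		and gen: "!!P s. s : carrier S ==> (!!g. g : G ==> P g) ==>
			 (!!x y. x : carrier S ==> y : carrier S ==> P x ==> P y ==> P (x \<oplus> y)) ==>
			 (!!x y. x : carrier S ==> y : carrier S ==> P x ==> P y ==> P (x \<otimes> y)) ==> P s"
		and val: "!!f rs. f : module_dual S E ==> set rs <= G ==> length rs = n ==> form_at f rs : J"
	shows "trace_ideal S E <= J"
proof -
	interpret J: ideal J S by (rule J)
	have fJ: "f U : J" if f: "f : module_dual S E" and U: "U : carrier E" for f U
	proof -
		have fl: "f U : carrier S" "f (U \<oplus>\<^bsub>E\<^esub> V) = f U \<oplus> f V" "s : carrier S ==> f (s \<odot>\<^bsub>E\<^esub> U) = s \<otimes> f U"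
			if "U : carrier E" "V : carrier E" for U V s
			using f that by (auto simp: module_dual_def)
		have f0: "f \<zero>\<^bsub>E\<^esub> = \<zero>"
		proof -
			have "f (\<zero> \<odot>\<^bsub>E\<^esub> \<zero>\<^bsub>E\<^esub>) = \<zero> \<otimes> f \<zero>\<^bsub>E\<^esub>" "f \<zero>\<^bsub>E\<^esub> : carrier S"
				using f E.M.zero_closed S.zero_closed unfolding module_dual_def by blast+
			thus ?thesis by simp
		qed
		\<comment> \<open>The entries are reduced one position at a time: the first \<open>m\<close> are
		  arbitrary, the remaining ones are already differentials of elements of \<open>G\<close>.\<close>
		have step: "f (wedge xs) : J" if "xs : TT" "m <= n" "ALL i. m <= i & i < n --> xs ! i : dd ` G" for xs m
			using that
		proof (induction m arbitrary: xs)
			case 0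
			hence "ALL x:set xs. x : dd ` G" by (auto simp: tuples_def in_set_conv_nth)
			hence "EX rs. set rs <= G & map dd rs = xs"
			proof (induction xs)
				case (Cons x xs)
				then obtain rs g where "set rs <= G" "map dd rs = xs" "g : G" "x = dd g" by auto
				thus ?case by (intro exI[of _ "g # rs"]) auto
			qed auto
			then obtain rs where "set rs <= G" "xs = map dd rs" by auto
			moreover have "length rs = n" using 0 calculation by (simp add: tuples_def)
			ultimately show ?case using val[OF f, of rs] by (simp add: form_at_def)
		next
			case (Suc m)
			have m: "m < n" using Suc.prems by simp
			have l: "length xs = n" "set xs <= carrier \<Omega>" using Suc.prems by (auto simp: tuples_def)
			have wc: "wedge (xs[m := x]) : carrier E" if "x : carrier \<Omega>" for x
				using wedge_closed tuple_update[OF Suc.prems(1) that] by auto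
			have sm: "f (wedge (xs[m := s \<odot>\<^bsub>\<Omega>\<^esub> x])) = s \<otimes> f (wedge (xs[m := x]))" if "s : carrier S" "x : carrier \<Omega>" for s x
				using wedge_smult[OF Suc.prems(1) m that] fl(3)[OF wc[OF that(2)] wc[OF that(2)] that(1)] by simp
			have ad: "f (wedge (xs[m := x \<oplus>\<^bsub>\<Omega>\<^esub> y])) = f (wedge (xs[m := x])) \<oplus> f (wedge (xs[m := y]))"
				if "x : carrier \<Omega>" "y : carrier \<Omega>" for x y
				using wedge_add[OF Suc.prems(1) m that] fl(2)[OF wc[OF that(1)] wc[OF that(2)]] by simp
			have dG: "f (wedge (xs[m := dd g])) : J" if g: "g : G" for g
			proof (rule Suc.IH)
				show "xs[m := dd g] : TT" using tuple_update[OF Suc.prems(1)] dd_closed g G by auto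
				show "ALL i. m <= i & i < n --> xs[m := dd g] ! i : dd ` G"
					using Suc.prems(3) g l by (auto simp: nth_list_update)
			qed (use m in simp)
			have dS: "f (wedge (xs[m := dd s])) : J" if s: "s : carrier S" for s
			proof (rule gen[OF s, of "%s. f (wedge (xs[m := dd s])) : J"])
				fix x y assume xy: "x : carrier S" "y : carrier S" "f (wedge (xs[m := dd x])) : J" "f (wedge (xs[m := dd y])) : J"
				note d = dd_closed[OF xy(1)] dd_closed[OF xy(2)]
				show "f (wedge (xs[m := dd (x \<oplus> y)])) : J" using xy d by (simp add: dd_add ad)
				show "f (wedge (xs[m := dd (x \<otimes> y)])) : J" using xy d by (simp add: dd_mult ad sm J.I_l_closed)
			qed (rule dG)
			have all: "f (wedge (xs[m := \<omega>])) : J" if w: "\<omega> : carrier \<Omega>" for \<omega>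
				using w
			proof (induction \<omega> rule: \<Omega>_induct)
				case (1 \<omega> \<eta>)
				thus ?case by (simp add: ad)
			next
				case 2
				have "f (wedge (xs[m := \<zero> \<odot>\<^bsub>\<Omega>\<^esub> \<zero>\<^bsub>\<Omega>\<^esub>])) = \<zero>" using sm[of \<zero> "\<zero>\<^bsub>\<Omega>\<^esub>"] fl(1)[OF wc[OF \<Omega>.M.zero_closed] wc[OF \<Omega>.M.zero_closed]] by simp
				thus ?case by simp
			next
				case (3 c s)
				thus ?case using dS dd_closed by (simp add: sm J.I_l_closed)
			qed
			have "xs ! m : carrier \<Omega>" using l m nth_mem[of m xs] by auto
			from all[OF this] show ?case by simp
		qed
		show ?thesis using U
		proof (induction U rule: E_induct)
			case (1 U V)
			thus ?case by (simp add: fl)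
		next
			case 2
			thus ?case by (simp add: f0)
		next
			case (3 c xs)
			have "f (wedge xs) : J" by (rule step[OF 3(2) order_refl]) auto
			thus ?case using J.I_l_closed[OF _ 3(1)] fl(3)[OF wedge_closed wedge_closed, of xs xs c] 3 by simp
		qed
	qed
	show ?thesis unfolding trace_ideal_def by (rule S.genideal_minimal[OF J]) (use fJ in blast)
qed

end

end

context subfield_cring
begin

text \<open>Over a field the denominator of \<open>free_subfamily\<close> can be inverted.\<close>

lemma independent_subfamily:
	assumes N: "dmod k N" and ys: "set ys <= carrier R"
	shows "EX xs. set xs <= set ys &
		 (ALL cs. length cs = length xs --> set cs <= k --> comb cs xs : N --> set cs <= {\<zero>}) & set ys <= msp k N xs"
proof -
	have "a : {\<zero>} \<or> b : {\<zero>}" if "a : k" "b : k" "a \<otimes> b : {\<zero>}" for a b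
		using subfieldE(5)[OF subfield_k] that by auto
	moreover have "z \<otimes> s : N" if "z : {\<zero>}" "s : carrier R" for z s using that dmodD(2)[OF N] by simp
	ultimately obtain xs e where xs: "set xs <= set ys" "e : k" "e ~= \<zero>"
		"ALL cs. length cs = length xs --> set cs <= k --> comb cs xs : N --> set cs <= {\<zero>}" "ALL y:set ys. e \<otimes> y : msp k N xs"
		using free_subfamily[OF k_subring N, of "{\<zero>}" ys] one_not_zero ys by auto
	obtain d where d: "d : k" "e \<otimes> d = \<one>" using k_inverse[OF xs(2,3)] by blast
	have V: "dmod k (msp k N xs)" using xs(1) ys by (intro msp_dmod[OF k_subring N]) blast
	have "y : msp k N xs" if y: "y : set ys" for y
	proof -
		have c: "y : carrier R" "d : carrier R" "e : carrier R" using y ys d xs(2) k_carrier by auto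
		have "d \<otimes> (e \<otimes> y) : msp k N xs" using dmodD(4)[OF V d(1)] xs(5) y by blast
		moreover have "d \<otimes> (e \<otimes> y) = y" using c d(2) by (simp add: m_assoc[symmetric] m_comm[of d])
		ultimately show ?thesis by simp
	qed
	thus ?thesis using xs(1,4) by blast
qed

lemma indep_distinct: "set xs <= carrier R ==> indep k {\<zero>} xs ==> distinct xs"
proof (induction xs)
	case (Cons x xs)
	have x: "x : carrier R" and xs: "set xs <= carrier R" using Cons.prems by auto
	have "x ~: set xs"
	proof
		assume "x : set xs"
		hence xa: "x : adjs k xs" using adjs_self[OF k_subring xs] by auto
		note sr = subring_adjs[OF k_subring xs]
		have "set [\<ominus> x, \<one>] <= adjs k xs" using subringE(3,5)[OF sr] xa by auto
		moreover have "pev x [\<ominus> x, \<one>] : {\<zero>}" using x by (simp add: l_neg)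
		moreover have "transc (adjs k xs) {\<zero>} x" using Cons.prems(2) by simp
		ultimately have "set [\<ominus> x, \<one>] <= {\<zero>}" unfolding transc_def by blast
		thus False using one_not_zero by simp
	qed
	thus ?case using Cons by simp
qed auto

end

locale field_algebra = kaehler_algebra K S for K :: "('k, 'r) ring_scheme" and S :: "('k, 'c, 'm) module_scheme" (structure) +
	assumes K_field: "field K" and K_char0: "[n] \<cdot>\<^bsub>K\<^esub> \<one>\<^bsub>K\<^esub> = \<zero>\<^bsub>K\<^esub> ==> n = (0::nat)" and one_nonzero: "\<one> ~= \<zero>"
begin

abbreviation "scal c \<equiv> c \<odot> \<one>"

lemma smult_scal: "c : carrier K ==> x : carrier S ==> c \<odot> x = scal c \<otimes> x"
	using A.smult_assoc2[of c \<one> x] by simp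

lemma scal_hom: "ring_hom_ring K S (%c. scal c)"
	by (rule ring_hom_ringI[OF A.R.ring_axioms S.ring_axioms])
		(auto simp: A.smult_l_distr A.smult_assoc1 smult_scal[symmetric])

lemma base_subfield: "subfield base S" and scal_inj: "inj_on (%c. scal c) (carrier K)"
	using ring_hom_ring.img_is_subfield[OF scal_hom field.carrier_is_subfield[OF K_field] one_nonzero]
	unfolding base_def by auto

sublocale C: char0_algebra S base
proof (intro char0_algebra.intro subfield_cring.intro subfield_cring_axioms.intro char0_algebra_axioms.intro
				S.cring_axioms base_subfield)
	fix n assume n: "S.nmul n \<one> = \<zero>"
	have "S.nmul n \<one> = scal ([n] \<cdot>\<^bsub>K\<^esub> \<one>\<^bsub>K\<^esub>)"
		by (induction n) (auto simp: A.smult_l_distr A.R.add.nat_pow_closed)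
	hence "scal ([n] \<cdot>\<^bsub>K\<^esub> \<one>\<^bsub>K\<^esub>) = scal \<zero>\<^bsub>K\<^esub>" using n by simp
	thus "n = 0" using K_char0 inj_onD[OF scal_inj] by auto
qed

lemma dual_derivations:
	assumes xs: "set xs <= carrier S" "S.adjs base xs = carrier S" "S.indep base {\<zero>} xs"
	obtains \<delta> where "!!i. i < length xs ==> S.derivation_on base (carrier S) (\<delta> i)"
		"!!i j. i < length xs ==> j < length xs ==> \<delta> i (xs ! j) = (if i = j then \<one> else \<zero>)"
proof -
	note d = C.indep_distinct[OF xs(1,3)]
	have "EX \<delta>. S.derivation_on base (carrier S) \<delta> & (ALL z:set xs. \<delta> z = (if z = xs ! i then \<one> else \<zero>))" for i
		using S.derivation_exists[OF C.k_subring xs(1,3) d, of "%z. if z = xs ! i then \<one> else \<zero>"] unfolding xs(2) by auto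
	then obtain \<delta> where \<delta>: "!!i. S.derivation_on base (carrier S) (\<delta> i)" "!!i z. z : set xs ==> \<delta> i z = (if z = xs ! i then \<one> else \<zero>)"
		by metis
	show ?thesis
		by (rule that[of \<delta>]) (use \<delta> d in \<open>auto simp: nth_eq_iff_index_eq\<close>)
qed

end

section \<open>Graded algebras over a field\<close>

locale graded_field_algebra = field_algebra K S + GR: connected_graded_algebra K S G
	for K :: "('k, 'r) ring_scheme" and S :: "('k, 'c, 'm) module_scheme" (structure) and G
begin

lemma G_carrier: "x : G i ==> x : carrier S"
	using additive_subgroup.a_Hcarr[OF GR.component_subgroup] .

lemma G_zero: "\<zero> : G i" and G_add: "x : G i ==> y : G i ==> x \<oplus> y : G i"
	using additive_subgroup.zero_closed[OF GR.component_subgroup] additive_subgroup.a_closed[OF GR.component_subgroup] .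

lemma G_base: "G 0 = base"
	using GR.component_zero by (auto simp: bij_betw_def base_def)

lemma graded_induct [consumes 1]:
	assumes x: "x : carrier S"
		and add: "!!x y. x : carrier S ==> y : carrier S ==> P x ==> P y ==> P (x \<oplus> y)"
		and gen: "!!i x. x : G i ==> P x"
	shows "P x"
proof -
	obtain f where f: "!!i. f i : G i" "finite {i. f i ~= \<zero>}" "x = (\<Oplus>i \<in> {i. f i ~= \<zero>}. f i)"
		using GR.component_decomp[OF x] by auto
	have "P (\<Oplus>i \<in> J. f i)" if "finite J" for J
		using that
	proof induction
		case empty
		thus ?case using gen[OF G_zero] by simp
	next
		case (insert j J)
		have c: "f : J \<rightarrow> carrier S" "f j : carrier S" using f(1) G_carrier by auto
		show ?case using insert c gen[OF f(1)] S.finsum_closed[OF c(1)] add by (simp add: S.finsum_insert)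
	qed
	from this[OF f(2)] show ?thesis using f(3) by simp
qed

text \<open>Uniqueness of the homogeneous decomposition lets an additive map be prescribed degree by
  degree. Both the projections to the components and the Euler derivation arise in this way.\<close>

lemma graded_lift:
	fixes X (structure)
	assumes X: "abelian_group X" and c: "!!i x. x : G i ==> \<phi> i x : carrier X"
		and add: "!!i x y. x : G i ==> y : G i ==> \<phi> i (x \<oplus>\<^bsub>S\<^esub> y) = \<phi> i x \<oplus>\<^bsub>X\<^esub> \<phi> i y"
	shows "EX L. additive_map S X L & (ALL i. ALL x:G i. L x = \<phi> i x)"
proof -
	interpret X: abelian_group X by fact
	let ?dec = "%x f. (ALL i. f i : G i) & finite {i. f i ~= \<zero>\<^bsub>S\<^esub>} & x = (\<Oplus>\<^bsub>S\<^esub>i \<in> {i. f i ~= \<zero>\<^bsub>S\<^esub>}. f i)"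
	define d where "d x = (THE f. ?dec x f)" for x
	have d: "?dec x (d x)" if "x : carrier S" for x
		unfolding d_def by (rule theI'[OF GR.component_decomp[OF that]])
	have ext: "(\<Oplus>\<^bsub>S\<^esub>i \<in> {i. f i ~= \<zero>\<^bsub>S\<^esub>}. f i) = (\<Oplus>\<^bsub>S\<^esub>i \<in> J. f i)"
		if "finite J" "{i. f i ~= \<zero>\<^bsub>S\<^esub>} <= J" "ALL i. f i : G i" for f J
		by (rule S.add.finprod_mono_neutral_cong_left) (use that G_carrier in auto)
	have dI: "d x = f" if "x : carrier S" "ALL i. f i : G i" "finite J" "{i. f i ~= \<zero>\<^bsub>S\<^esub>} <= J" "x = (\<Oplus>\<^bsub>S\<^esub>i \<in> J. f i)" for x f J
	proof -
		have "?dec x f" using that ext[OF that(3,4,2)] finite_subset by auto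
		thus ?thesis using GR.component_decomp[OF that(1)] d[OF that(1)] by auto
	qed
	have p0: "\<phi> i \<zero>\<^bsub>S\<^esub> = \<zero>\<^bsub>X\<^esub>" for i
	proof -
		have "\<phi> i \<zero>\<^bsub>S\<^esub> = \<phi> i \<zero>\<^bsub>S\<^esub> \<oplus>\<^bsub>X\<^esub> \<phi> i \<zero>\<^bsub>S\<^esub>" using add[OF G_zero G_zero, of i] by simp
		thus ?thesis using X.add.l_cancel_one[of "\<phi> i \<zero>\<^bsub>S\<^esub>" "\<phi> i \<zero>\<^bsub>S\<^esub>"] c[OF G_zero, of i] by simp
	qed
	define L where "L x = (\<Oplus>\<^bsub>X\<^esub>i \<in> {i. d x i ~= \<zero>\<^bsub>S\<^esub>}. \<phi> i (d x i))" for x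
	have LJ: "L x = (\<Oplus>\<^bsub>X\<^esub>i \<in> J. \<phi> i (d x i))" if "finite J" "{i. d x i ~= \<zero>\<^bsub>S\<^esub>} <= J" "x : carrier S" for x J
		unfolding L_def by (rule X.add.finprod_mono_neutral_cong_left) (use that d c p0 in auto)
	have L1: "additive_map S X L"
	proof (intro additive_map.intro additive_map_axioms.intro X S.abelian_group_axioms)
		show "L x : carrier X" if "x : carrier S" for x
			unfolding L_def by (rule X.finsum_closed) (use d[OF that] c in auto)
		fix x y assume xy: "x : carrier S" "y : carrier S"
		let ?J = "{i. d x i ~= \<zero>\<^bsub>S\<^esub>} \<union> {i. d y i ~= \<zero>\<^bsub>S\<^esub>}"
		have J: "finite ?J" using d[OF xy(1)] d[OF xy(2)] by simp
		have G: "d x i : G i" "d y i : G i" for i using d[OF xy(1)] d[OF xy(2)] by auto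
		have s: "x = (\<Oplus>\<^bsub>S\<^esub>i \<in> ?J. d x i)" "y = (\<Oplus>\<^bsub>S\<^esub>i \<in> ?J. d y i)"
			using ext[OF J, of "d x"] ext[OF J, of "d y"] d[OF xy(1)] d[OF xy(2)] by auto
		have sum: "d (x \<oplus>\<^bsub>S\<^esub> y) = (%i. d x i \<oplus>\<^bsub>S\<^esub> d y i)"
		proof (rule dI[of _ _ ?J])
			have "x \<oplus>\<^bsub>S\<^esub> y = (\<Oplus>\<^bsub>S\<^esub>i \<in> ?J. d x i) \<oplus>\<^bsub>S\<^esub> (\<Oplus>\<^bsub>S\<^esub>i \<in> ?J. d y i)" using s by metis
			also have "\<dots> = (\<Oplus>\<^bsub>S\<^esub>i \<in> ?J. d x i \<oplus>\<^bsub>S\<^esub> d y i)"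
				by (rule S.finsum_addf[symmetric]) (use G G_carrier in auto)
			finally show "x \<oplus>\<^bsub>S\<^esub> y = (\<Oplus>\<^bsub>S\<^esub>i \<in> ?J. d x i \<oplus>\<^bsub>S\<^esub> d y i)" .
		qed (use xy J G G_add in auto)
		have "L (x \<oplus>\<^bsub>S\<^esub> y) = (\<Oplus>\<^bsub>X\<^esub>i \<in> ?J. \<phi> i (d (x \<oplus>\<^bsub>S\<^esub> y) i))" by (rule LJ) (use J xy sum in auto)
		also have "\<dots> = (\<Oplus>\<^bsub>X\<^esub>i \<in> ?J. \<phi> i (d x i) \<oplus>\<^bsub>X\<^esub> \<phi> i (d y i))" using G add sum by simp
		also have "\<dots> = (\<Oplus>\<^bsub>X\<^esub>i \<in> ?J. \<phi> i (d x i)) \<oplus>\<^bsub>X\<^esub> (\<Oplus>\<^bsub>X\<^esub>i \<in> ?J. \<phi> i (d y i))" by (rule X.finsum_addf) (use G c in auto)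
		also have "\<dots> = L x \<oplus>\<^bsub>X\<^esub> L y" using LJ[OF J _ xy(1)] LJ[OF J _ xy(2)] by simp
		finally show "L (x \<oplus>\<^bsub>S\<^esub> y) = L x \<oplus>\<^bsub>X\<^esub> L y" .
	qed
	have "L x = \<phi> i x" if x: "x : G i" for i x
	proof -
		have dx: "d x = (%j. if j = i then x else \<zero>\<^bsub>S\<^esub>)"
			by (rule dI[of _ _ "{i}"]) (use x G_zero G_carrier in \<open>auto simp: S.finsum_insert\<close>)
		have "L x = (\<Oplus>\<^bsub>X\<^esub>i \<in> {i}. \<phi> i (d x i))" by (rule LJ) (use dx G_carrier[OF x] in auto)
		thus ?thesis using dx x c by simp
	qed
	thus ?thesis using L1 by blast
qed

definition cmp where
	"cmp j = (SOME L. additive_map S S L & (ALL i. ALL x:G i. L x = (if i = j then x else \<zero>)))"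

lemma cmp_props: "additive_map S S (cmp j) & (ALL i. ALL x:G i. cmp j x = (if i = j then x else \<zero>))"
proof -
	have "EX L. additive_map S S L & (ALL i. ALL x:G i. L x = (if i = j then x else \<zero>))"
		by (rule graded_lift[OF S.abelian_group_axioms]) (auto intro: G_carrier)
	thus ?thesis unfolding cmp_def by (rule someI_ex)
qed

sublocale cmp: additive_map S S "cmp j" for j
	using cmp_props by blast

lemma cmp_hom: "x : G i ==> cmp j x = (if i = j then x else \<zero>)"
	using cmp_props by blast

lemma cmp_in: "x : carrier S ==> cmp j x : G j"
	by (induction rule: graded_induct) (auto simp: cmp_hom cmp.map_add G_add G_zero)

lemma cmp_mult:
	assumes a: "a : G i" and z: "z : carrier S"
	shows "cmp j (a \<otimes> z) = (if i <= j then a \<otimes> cmp (j - i) z else \<zero>)"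
	using z
proof (induction z rule: graded_induct)
	case (1 x y)
	thus ?case using G_carrier[OF a] by (auto simp: S.r_distr cmp.map_add cmp.map_closed)
next
	case (2 k x)
	thus ?case using G_carrier[OF a] cmp_hom[OF GR.component_mult[OF a 2], of j] by (auto simp: cmp_hom)
qed

lemma cmp_0_mult:
	assumes x: "x : carrier S" and y: "y : carrier S"
	shows "cmp 0 (x \<otimes> y) = cmp 0 x \<otimes> cmp 0 y"
	using x
proof (induction x rule: graded_induct)
	case (1 x z)
	thus ?case using y by (simp add: S.l_distr cmp.map_add cmp.map_closed)
next
	case (2 i x)
	thus ?case using y by (auto simp: cmp_mult cmp_hom cmp.map_closed)
qed

lemma cmp_0_base: "x : base ==> cmp 0 x = x" and cmp_0_in: "x : carrier S ==> cmp 0 x : base"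
	using cmp_hom[of x 0 0] cmp_in[of x 0] G_base by auto

text \<open>The augmentation that forgets all positive degrees. Its values are taken in
  \<open>K\<close> and not in the copy of \<open>K\<close> inside \<open>S\<close>, so that the
  augmentations of two algebras can be compared.\<close>

definition aug where "aug x = (THE c. c : carrier K & scal c = cmp 0 x)"

lemma aug_eqI: "c : carrier K ==> scal c = cmp 0 x ==> aug x = c"
	unfolding aug_def using inj_onD[OF scal_inj] by (intro the_equality) auto

lemma aug: assumes "x : carrier S" shows "aug x : carrier K" "scal (aug x) = cmp 0 x"
proof -
	obtain c where "c : carrier K" "scal c = cmp 0 x" using cmp_0_in[OF assms] by (auto simp: base_def)
	thus "aug x : carrier K" "scal (aug x) = cmp 0 x" using aug_eqI by auto
qed

lemma aug_add: "x : carrier S ==> y : carrier S ==> aug (x \<oplus> y) = aug x \<oplus>\<^bsub>K\<^esub> aug y"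
	by (rule aug_eqI) (auto simp: aug A.smult_l_distr cmp.map_add)

lemma aug_mult: "x : carrier S ==> y : carrier S ==> aug (x \<otimes> y) = aug x \<otimes>\<^bsub>K\<^esub> aug y"
	by (rule aug_eqI) (auto simp: aug cmp_0_mult A.smult_assoc1 smult_scal[of "aug x" "cmp 0 y"] cmp.map_closed)

lemma scal_in_G: "c : carrier K ==> scal c : G 0"
	unfolding G_base base_def by auto

lemma aug_smult: "c : carrier K ==> x : carrier S ==> aug (c \<odot> x) = c \<otimes>\<^bsub>K\<^esub> aug x"
	by (rule aug_eqI)
		(auto simp: aug A.smult_assoc1 smult_scal[of c x] cmp_mult[OF scal_in_G] smult_scal[of c "cmp 0 x"] cmp.map_closed)

lemma aug_one: "aug \<one> = \<one>\<^bsub>K\<^esub>"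
	by (rule aug_eqI) (use scal_in_G[OF A.R.one_closed] cmp_hom[of \<one> 0 0] in auto)

text \<open>The irrelevant maximal ideal, described as the kernel of the multiplicative projection
  to degree 0; this makes primality immediate.\<close>

definition mm where "mm = {x : carrier S. cmp 0 x = \<zero>}"

lemma mm_minus: "x : carrier S ==> x \<ominus> cmp 0 x : mm"
	by (simp add: mm_def cmp.map_minus cmp.map_closed S.r_neg S.minus_eq cmp.map_uminus cmp.map_add
		cmp_0_base[OF cmp_0_in])

lemma mm_hom: "x : G i ==> i > 0 ==> x : mm"
	using G_carrier cmp_hom[of x i 0] by (simp add: mm_def)

lemma mm_prime: "primeideal mm S"
proof (rule primeidealI)
	show "ideal mm S"
		by (rule idealI[OF S.ring_axioms])
			(auto simp: mm_def cmp.map_add cmp_0_mult cmp.map_closed cmp.map_uminus cmp.map_zero a_inv_def[symmetric]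
				intro!: S.add.subgroupI)
	show "cring S" by (rule S.cring_axioms)
	show "carrier S ~= mm" using one_nonzero cmp_0_base[OF subringE(3)[OF C.k_subring]] unfolding mm_def
		by (metis (mono_tags, lifting) S.one_closed mem_Collect_eq)
	fix a b assume ab: "a : carrier S" "b : carrier S" "a \<otimes> b : mm"
	hence "cmp 0 a \<otimes> cmp 0 b = \<zero>" by (simp add: mm_def cmp_0_mult)
	thus "a : mm \<or> b : mm"
		using subfieldE(5)[OF C.subfield_k cmp_0_in cmp_0_in] ab by (auto simp: mm_def)
qed

sublocale mm: primeideal mm S by (rule mm_prime)

lemma mm_carrier: "mm <= carrier S" and mm_cmp: "x : mm ==> cmp 0 x = \<zero>"
	by (auto simp only: mm_def)

lemma mm_induct [consumes 1]:
	assumes x: "x : mm"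
		and add: "!!x y. x : mm ==> y : mm ==> P x ==> P y ==> P (x \<oplus> y)"
		and gen: "!!i x. i > 0 ==> x : G i ==> P x"
	shows "P x"
proof -
	have "P (x \<ominus> cmp 0 x)" if "x : carrier S" for x
		using that
	proof (induction x rule: graded_induct)
		case (1 x y)
		have "x \<oplus> y \<ominus> cmp 0 (x \<oplus> y) = (x \<ominus> cmp 0 x) \<oplus> (y \<ominus> cmp 0 y)"
			using 1 by (simp add: cmp.map_add cmp.map_closed S.minus_eq S.minus_add S.a_ac)
		thus ?case using add[OF mm_minus mm_minus] 1 by simp
	next
		case (2 i x)
		thus ?case using gen[of i x] gen[OF zero_less_one G_zero] G_carrier[OF 2]
			by (cases "i = 0") (auto simp: cmp_hom S.minus_eq S.r_neg)
	qed
	from this[of x] show ?thesis using subsetD[OF mm_carrier x] by (simp add: mm_cmp[OF x] S.minus_eq)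
qed

section \<open>The Euler derivation and homogeneous generators\<close>

definition euler where
	"euler = (SOME L. additive_map S S L & (ALL i. ALL x:G i. L x = S.nmul i x))"

lemma euler_props: "additive_map S S euler & (ALL i. ALL x:G i. euler x = S.nmul i x)"
proof -
	have "EX L. additive_map S S L & (ALL i. ALL x:G i. L x = S.nmul i x)"
		by (rule graded_lift[OF S.abelian_group_axioms]) (auto simp: G_carrier S.nmul_add_pow S.add.nat_pow_distrib)
	thus ?thesis unfolding euler_def by (rule someI_ex)
qed

lemma euler_hom: "x : G i ==> euler x = S.nmul i x"
	using euler_props by blast

lemma nmul_add: "x : carrier S ==> S.nmul (i + j) x = S.nmul i x \<oplus> S.nmul j x"
	by (simp add: S.nmul_add_pow S.add.nat_pow_mult)

lemma nmul_mult: "x : carrier S ==> y : carrier S ==> S.nmul i (x \<otimes> y) = x \<otimes> S.nmul i y"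
	by (induction i) (auto simp: S.r_distr)

lemma euler_derivation: "S.derivation_on base (carrier S) euler"
proof -
	interpret e: additive_map S S euler using euler_props by blast
	show ?thesis unfolding S.derivation_on_def
	proof (intro conjI ballI)
		show "euler x = \<zero>" if "x : base" for x using euler_hom[of x 0] that G_base by simp
		fix x y assume x: "x : carrier S" and y: "y : carrier S"
		show "euler (x \<otimes> y) = x \<otimes> euler y \<oplus> y \<otimes> euler x"
			using x
		proof (induction x rule: graded_induct)
			case (1 x z)
			thus ?case using y by (simp add: S.l_distr e.map_add e.map_closed S.r_distr S.a_ac)
		next
			case (2 i x)
			note xi = 2 G_carrier[OF 2]
			show ?case using y
			proof (induction y rule: graded_induct)
				case (1 y z)
				thus ?case using xi by (simp add: S.l_distr e.map_add e.map_closed S.r_distr S.a_ac)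
			next
				case (2 j y)
				note yj = G_carrier[OF 2]
				have "euler (x \<otimes> y) = S.nmul i (y \<otimes> x) \<oplus> S.nmul j (x \<otimes> y)"
					using euler_hom[OF GR.component_mult[OF xi(1) 2]] xi yj by (simp add: nmul_add S.m_comm[of y x])
				thus ?case using euler_hom[OF xi(1)] euler_hom[OF 2] xi yj
					by (simp add: nmul_mult S.a_comm)
			qed
		qed
	qed (auto simp: e.map_closed e.map_add)
qed

text \<open>Each of the finitely many elements is a finite sum of homogeneous elements of positive
  degree, and these generate an ideal containing it.\<close>

lemma homogeneous_span:
	assumes "finite T" "T <= mm"
	shows "EX H. finite H & (ALL x:H. EX i>0. x : G i) & T <= Idl H"
proof -
	have Hc: "H <= carrier S" if "ALL x:H. EX i>0. x : G i" for H using that G_carrier by blast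
	have mono: "Idl H <= Idl H'" if "H <= H'" "H' <= carrier S" for H H'
		using S.subset_Idl_subset[of H' H] that S.genideal_self by blast
	have 1: "EX H. finite H & (ALL x:H. EX i>0. x : G i) & t : Idl H" if "t : mm" for t
		using that
	proof (induction t rule: mm_induct)
		case (1 x y)
		then obtain H H' where H: "finite H" "ALL x:H. EX i>0. x : G i" "x : Idl H" "finite H'" "ALL x:H'. EX i>0. x : G i" "y : Idl H'" by blast
		have c: "H \<union> H' <= carrier S" using Hc H by blast
		have "x : Idl (H \<union> H')" "y : Idl (H \<union> H')" using mono[OF _ c] H by blast+
		hence "x \<oplus> y : Idl (H \<union> H')" using additive_subgroup.a_closed[OF ideal.axioms(1)[OF S.genideal_ideal[OF c]]] by blast
		thus ?case using H by (intro exI[of _ "H \<union> H'"]) blast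
	next
		case (2 i x)
		thus ?case using S.genideal_self[of "{x}"] G_carrier[OF 2(2)] by (intro exI[of _ "{x}"]) auto
	qed
	show ?thesis using assms
	proof (induction T rule: finite_induct)
		case empty
		thus ?case by (intro exI[of _ "{}"]) auto
	next
		case (insert t T)
		obtain H where H: "finite H" "ALL x:H. EX i>0. x : G i" "T <= Idl H" using insert by blast
		obtain H' where H': "finite H'" "ALL x:H'. EX i>0. x : G i" "t : Idl H'" using 1 insert.prems by blast
		have c: "H \<union> H' <= carrier S" using Hc H H' by blast
		have "insert t T <= Idl (H \<union> H')" using mono[OF _ c] H H' by blast
		thus ?case using H H' by (intro exI[of _ "H \<union> H'"]) blast
	qed
qed

text \<open>Homogeneous elements of \<open>mm\<close> that form a basis modulo \<open>mm\<^sup>2\<close> generate the algebra (graded Nakayama).\<close>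

lemma homogeneous_generators:
	assumes noeth: "noetherian_ring S"
	obtains xs where "!!x. x : set xs ==> EX i>0. x : G i" "S.adjs base xs = carrier S"
		"!!cs. length cs = length xs ==> set cs <= base ==> S.comb cs xs : C.ideal_square mm ==> set cs <= {\<zero>}"
proof -
	obtain T where T: "T <= carrier S" "finite T" "mm = Idl T"
		using noetherian_ring.finetely_gen[OF noeth mm.ideal_axioms] by blast
	have "T <= mm" using S.genideal_self[OF T(1)] T(3) by simp
	from homogeneous_span[OF T(2) this] obtain H where H: "finite H" "ALL x:H. EX i>0. x : G i" "T <= Idl H" by blast
	have Hm: "H <= mm" using H(2) mm_hom by blast
	have Hc: "H <= carrier S" using Hm mm_carrier by blast
	have mH: "mm <= Idl H" unfolding T(3) by (rule S.genideal_minimal[OF S.genideal_ideal[OF Hc] H(3)])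
	obtain ys where ys: "set ys = H" using finite_list[OF H(1)] by blast
	let ?N = "C.ideal_square mm"
	have sq: "S.dmod (carrier S) ?N" by (rule C.ideal_square_dmod[OF mm.ideal_axioms])
	hence N: "S.dmod base ?N" using C.k_carrier by (auto simp: S.dmod_def)
	have Nm: "?N <= mm"
	proof
		fix z assume "z : ?N"
		then obtain as bs where "set as <= mm" "set bs <= mm" "z = S.comb as bs" by (auto simp: C.ideal_square_def)
		thus "z : mm" using S.comb_in_dmod[OF S.ideal_dmod[OF mm.ideal_axioms subset_refl]] mm_carrier by blast
	qed
	obtain xs where xs: "set xs <= H" "!!cs. length cs = length xs ==> set cs <= base ==> S.comb cs xs : ?N ==> set cs <= {\<zero>}"
		"H <= S.msp base ?N xs"
		using C.independent_subfamily[OF N, of ys] Hc unfolding ys by blast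
	have xsc: "set xs <= carrier S" using xs(1) Hc by blast
	define V where "V = S.msp base ?N xs"
	have V: "S.dmod base V" unfolding V_def by (rule S.msp_dmod[OF C.k_subring N xsc])
	have Vm: "V <= mm" unfolding V_def
		using xs(1) Hm by (intro S.msp_least[OF S.ideal_dmod[OF mm.ideal_axioms C.k_carrier] _ Nm]) blast
	have NV: "p : V" if "p : ?N" for p using S.msp_gens(2)[OF C.k_subring N xsc] that unfolding V_def by blast
	\<comment> \<open>The span \<open>V\<close> of \<open>xs\<close> modulo the square of
	  \<open>mm\<close> is an ideal: the constant part of a factor acts by a scalar, and the rest of it
	  sends \<open>V\<close> into the square.\<close>
	have VI: "a \<otimes> z : V" if a: "a : carrier S" and z: "z : V" for a z
	proof -
		have zm: "z : mm" and zc: "z : carrier S" using z Vm mm_carrier by blast+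
		have ac: "a \<ominus> cmp 0 a : carrier S" "cmp 0 a : carrier S" using a cmp.map_closed by auto
		have "S.comb [a \<ominus> cmp 0 a] [z] : ?N" using mm_minus[OF a] zm by (intro C.comb_in_ideal_square) auto
		hence "(a \<ominus> cmp 0 a) \<otimes> z : V" using NV ac zc by simp
		moreover have "a \<otimes> z = cmp 0 a \<otimes> z \<oplus> (a \<ominus> cmp 0 a) \<otimes> z"
			using a ac zc by (simp add: S.l_distr[symmetric]) (simp add: S.minus_eq S.a_lcomm S.r_neg)
		ultimately show ?thesis using S.dmodD(3)[OF V S.dmodD(4)[OF V cmp_0_in[OF a] z]] by simp
	qed
	have "ideal V S"
	proof (rule idealI[OF S.ring_axioms])
		show "subgroup V (add_monoid S)"
			using S.dmodD[OF V] S.dmod_uminus[OF V C.k_subring]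
			by (intro S.add.subgroupI) (auto simp: a_inv_def[symmetric])
		fix a x assume h: "a : V" "x : carrier S"
		show "x \<otimes> a : V" by (rule VI[OF h(2,1)])
		thus "a \<otimes> x : V" using S.m_comm[of a x] h S.dmodD(1)[OF V] by auto
	qed
	hence mV: "mm <= V" using S.genideal_minimal[of V H] xs(3) mH unfolding V_def[symmetric] by blast
	define D where "D = S.adjs base xs"
	have D: "subring D S" unfolding D_def by (rule S.subring_adjs[OF C.k_subring xsc])
	have kD: "base <= D" and xD: "set xs <= D" unfolding D_def
		using S.adjs_incl[OF C.k_subring xsc] S.adjs_self[OF C.k_subring xsc] by auto
	\<comment> \<open>In degree \<open>n\<close> an element is a linear combination of the
	  \<open>xs\<close> plus degree \<open>n\<close> parts of products of elements of
	  \<open>mm\<close>. Homogeneous factors that contribute to such a part both have degree below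
	  \<open>n\<close>, so the induction hypothesis applies.\<close>
	have GD: "G n <= D" for n
	proof (induction n rule: less_induct)
		case (less n)
		show ?case
		proof (cases "n = 0")
			case True
			thus ?thesis using kD G_base by simp
		next
			case False
			have comb1: "cmp n (S.comb cs vs) : D" if "set cs <= base" "set vs <= set xs" for cs vs
				using that
			proof (induction cs vs rule: S.comb.induct)
				case (1 c cs v vs)
				obtain i where i: "v : G i" using 1(3) xs(1) H(2) by (auto dest!: subsetD)
				have cv: "c \<otimes> v : G i" using GR.component_mult[of c 0 v i] i 1(2) G_base by auto
				have "c \<otimes> v : D" using subringE(6)[OF D] 1 kD xD by auto
				hence "cmp n (c \<otimes> v) : D" using cmp_hom[OF cv] subringE(2)[OF D] by simp
				moreover have "S.comb cs vs : carrier S" using 1(2,3) C.k_carrier xsc by (intro S.comb_closed) auto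
				ultimately show ?case using 1 G_carrier[OF cv] subringE(7)[OF D] by (simp add: cmp.map_add)
			qed (use subringE(2)[OF D] in \<open>auto simp: cmp.map_zero\<close>)
			have prod: "cmp n (p \<otimes> q) : D" if p: "p : mm" and q: "q : mm" for p q
				using p
			proof (induction p rule: mm_induct)
				case (1 x y)
				hence "x : carrier S" "y : carrier S" "q : carrier S" using q mm_carrier by blast+
				thus ?case using 1 subringE(7)[OF D] by (simp add: S.l_distr cmp.map_add)
			next
				case (2 i x)
				have xc: "x : carrier S" by (rule G_carrier[OF 2(2)])
				show ?case using q
				proof (induction q rule: mm_induct)
					case (1 y z)
					hence "y : carrier S" "z : carrier S" using mm_carrier by blast+
					thus ?case using 1 xc subringE(7)[OF D] by (simp add: S.r_distr cmp.map_add)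
				next
					case (2 j y)
					have "x \<otimes> y : D" if "i + j = n"
						using subringE(6)[OF D] less[of i] less[of j] \<open>0 < i\<close> \<open>x : G i\<close> 2 that by auto
					thus ?case using cmp_hom[OF GR.component_mult[OF \<open>x : G i\<close> 2(2)]] subringE(2)[OF D] by simp
				qed
			qed
			have comb2: "cmp n (S.comb as bs) : D" if "set as <= mm" "set bs <= mm" for as bs
				using that
			proof (induction as bs rule: S.comb.induct)
				case (1 a as b bs)
				have "a : carrier S" "b : carrier S" "S.comb as bs : carrier S"
					using 1(2,3) mm_carrier by (auto intro!: S.comb_closed)
				thus ?case using 1 prod subringE(7)[OF D] by (simp add: cmp.map_add)
			qed (use subringE(2)[OF D] in \<open>auto simp: cmp.map_zero\<close>)
			show ?thesis
			proof
				fix x assume x: "x : G n"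
				hence "x : V" using mV mm_hom False by blast
				then obtain cs as bs where h: "set cs <= base" "x = S.comb cs xs \<oplus> S.comb as bs" "set as <= mm" "set bs <= mm"
					by (auto simp: V_def S.msp_def S.lin_def C.ideal_square_def)
				have "S.comb cs xs : carrier S" "S.comb as bs : carrier S"
					using h C.k_carrier mm_carrier xsc by (auto intro!: S.comb_closed)
				hence "cmp n x = cmp n (S.comb cs xs) \<oplus> cmp n (S.comb as bs)" using h(2) by (simp add: cmp.map_add)
				hence "cmp n x : D" using comb1[OF h(1) subset_refl] comb2[OF h(3,4)] subringE(7)[OF D] by simp
				thus "x : D" using cmp_hom[OF x] by simp
			qed
		qed
	qed
	have "x : D" if "x : carrier S" for x
		using that by (induction rule: graded_induct) (use GD subringE(7)[OF D] in auto)
	hence "S.adjs base xs = carrier S" using subringE(1)[OF D] unfolding D_def by blast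
	moreover have "EX i>0. x : G i" if "x : set xs" for x using that xs(1) H(2) by blast
	ultimately show ?thesis using that xs(2) by blast
qed

lemma nmul_in_G: "x : G i ==> S.nmul n x : G i"
	by (induction n) (auto simp: G_zero G_add)

text \<open>If all positive degrees vanished, the algebra would be the base field, with no
  generators and dimension \<open>0\<close>.\<close>

lemma positive_degree_element:
	assumes "krull_dim S > 0"
	obtains j y where "j > 0" "y : G j" "y ~= \<zero>"
proof (rule ccontr)
	assume "\<not> thesis"
	hence z: "y = \<zero>" if "j > 0" "y : G j" for j y using that \<open>!!j y. j > 0 ==> y : G j ==> y ~= \<zero> ==> thesis\<close> by blast
	have "x : base" if "x : carrier S" for x
		using that
	proof (induction rule: graded_induct)
		case (1 x y)
		thus ?case using subringE(7)[OF C.k_subring] by simp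
	next
		case (2 i x)
		thus ?case using z[of i x] subringE(2)[OF C.k_subring] G_base by (cases "i = 0") auto
	qed
	hence "S.adjs base [] = carrier S" using C.k_carrier by (auto simp: S.adjs_def)
	hence "krull_dim S <= enat 0" using C.krull_dim_le_gens[of "[]"] by simp
	thus False using assms by (simp add: zero_enat_def[symmetric])
qed

lemma regular_generators:
	assumes noeth: "noetherian_ring S" and reg: "regular_ring S"
	shows "EX xs. set xs <= carrier S & S.adjs base xs = carrier S & S.indep base {\<zero>} xs"
proof -
	obtain xs where xs: "!!x. x : set xs ==> EX i>0. x : G i" "S.adjs base xs = carrier S"
		"!!cs. length cs = length xs ==> set cs <= base ==> S.comb cs xs : C.ideal_square mm ==> set cs <= {\<zero>}"
		using homogeneous_generators[OF noeth] by blast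
	have xm: "set xs <= mm" using xs(1) mm_hom by blast
	have "S.indep base {\<zero>} xs"
	proof (rule C.regular_local_indep[OF mm_prime _ xm xs(2,3)])
		show "EX c:base. f \<ominus> c : mm" if "f : carrier S" for f
			using mm_minus[OF that] cmp_0_in[OF that] by blast
		show "regular_local_ring (localization S mm)" using reg mm_prime by (simp add: regular_ring_def)
	qed
	thus ?thesis using xm mm_carrier xs(2) by blast
qed

end

context cring
begin

lemma derivation_smult:
	assumes d: "derivation_on k (carrier R) \<delta>" and c: "c : carrier R"
	shows "derivation_on k (carrier R) (%x. c \<otimes> \<delta> x)"
	using derivation_onD[OF d] c by (auto simp: derivation_on_def r_distr m_lcomm)

lemma derivation_minus:
	assumes d: "derivation_on k (carrier R) \<delta>" and e: "derivation_on k (carrier R) \<epsilon>"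
	shows "derivation_on k (carrier R) (%x. \<delta> x \<ominus> \<epsilon> x)"
	using derivation_onD[OF d] derivation_onD[OF e]
	by (auto simp: derivation_on_def r_distr minus_eq minus_add r_minus a_ac)

end

section \<open>Transport along homomorphisms, and linear functionals\<close>

lemma (in ring) subring_preimage:
	assumes h: "h : ring_hom R T" and T: "ring T" and E: "subring E T"
	shows "subring {a : carrier R. h a : E} R"
proof (rule subringI)
	interpret h: ring_hom_ring R T h by (rule ring_hom_ringI2[OF ring_axioms T h])
	show "\<ominus> a : {a : carrier R. h a : E}" if "a : {a : carrier R. h a : E}" for a
		using that subringE(5)[OF E] by (auto simp: h.hom_a_inv)
	show "\<one> : {a : carrier R. h a : E}" using subringE(3)[OF E] by simp
qed (use subringE(6,7)[OF E] ring_hom_mult[OF h] ring_hom_add[OF h] in auto)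

lemma (in ring) hom_pev:
	assumes h: "h : ring_hom R T" and T: "ring T" and x: "x : carrier R"
	shows "set ds <= carrier R ==> pev x ds : carrier R & h (pev x ds) = ring.pev T (h x) (map h ds)"
proof -
	interpret h: ring_hom_ring R T h by (rule ring_hom_ringI2[OF ring_axioms T h])
	show "set ds <= carrier R ==> pev x ds : carrier R & h (pev x ds) = ring.pev T (h x) (map h ds)"
		using x by (induction ds) auto
qed

lemma (in cring) hom_adjs:
	assumes h: "h : ring_hom R T" and T: "cring T" and D: "D <= carrier R" and xs: "set xs <= carrier R"
		and E: "subring E T" "h ` D <= E" "h ` set xs <= E"
	shows "h ` adjs D xs <= E"
proof -
	have "adjs D xs <= {a : carrier R. h a : E}"
		using D xs E cring.axioms(1)[OF T] by (intro adjs_least subring_preimage[OF h]) auto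
	thus ?thesis by auto
qed

lemma (in cring) indep_hom:
	assumes h: "h : ring_hom R T" "inj_on h (carrier R)" and T: "cring T" and D: "subring D R" and hD: "subring (h ` D) T"
	shows "set xs <= carrier R ==> ring.indep T (h ` D) {\<zero>\<^bsub>T\<^esub>} (map h xs) ==> indep D {\<zero>} xs"
proof -
	interpret T: cring T by (rule T)
	interpret h: ring_hom_ring R T h by (rule ring_hom_ringI2[OF ring_axioms T.ring_axioms h(1)])
	note Dc = subringE(1)[OF D]
	show "set xs <= carrier R ==> T.indep (h ` D) {\<zero>\<^bsub>T\<^esub>} (map h xs) ==> indep D {\<zero>} xs"
	proof (induction xs)
		case (Cons x xs)
		have x: "x : carrier R" and xs: "set xs <= carrier R" using Cons.prems by auto
		have hxs: "set (map h xs) <= carrier T" using xs by auto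
		have t: "T.transc (T.adjs (h ` D) (map h xs)) {\<zero>\<^bsub>T\<^esub>} (h x)" using Cons.prems by simp
		have sub: "h ` adjs D xs <= T.adjs (h ` D) (map h xs)"
			using T.adjs_incl[OF hD hxs] T.adjs_self[OF hD hxs] T.subring_adjs[OF hD hxs]
			by (intro hom_adjs[OF h(1) T Dc xs]) auto
		have "transc (adjs D xs) {\<zero>} x" unfolding transc_def
		proof (intro allI impI, elim conjE)
			fix ds assume ds: "set ds <= adjs D xs" "pev x ds : {\<zero>}"
			have dsc: "set ds <= carrier R" using ds(1) subringE(1)[OF subring_adjs[OF D xs]] by blast
			have "T.pev (h x) (map h ds) : {\<zero>\<^bsub>T\<^esub>}" using hom_pev[OF h(1) T.ring_axioms x dsc] ds(2) by auto
			moreover have "set (map h ds) <= T.adjs (h ` D) (map h xs)" using ds(1) sub by auto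
			ultimately have z: "set (map h ds) <= {\<zero>\<^bsub>T\<^esub>}" using t unfolding T.transc_def by blast
			show "set ds <= {\<zero>}"
			proof
				fix d assume d: "d : set ds"
				hence "h d = h \<zero>" using z by auto
				thus "d : {\<zero>}" using inj_onD[OF h(2)] d dsc by auto
			qed
		qed
		thus ?case using Cons by simp
	qed auto
qed

lemma (in cring) hom_comb:
	assumes h: "h : ring_hom R T" and T: "cring T"
	shows "set cs <= carrier R ==> set vs <= carrier R ==> h (comb cs vs) = ring.comb T (map h cs) (map h vs)"
proof -
	interpret T: cring T by (rule T)
	interpret h: ring_hom_ring R T h by (rule ring_hom_ringI2[OF ring_axioms T.ring_axioms h])
	show "set cs <= carrier R ==> set vs <= carrier R ==> h (comb cs vs) = T.comb (map h cs) (map h vs)"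
		by (induction cs vs rule: comb.induct) auto
qed

text \<open>A maximal subspace avoiding \<open>v\<close> is a hyperplane.\<close>

lemma linear_functional_exists:
	fixes M (structure)
	assumes K: "field K" and M: "module K M" and v: "v : carrier M" "v ~= \<zero>"
	shows "EX l. additive_map M K l & (ALL c:carrier K. ALL x:carrier M. l (c \<odot> x) = c \<otimes>\<^bsub>K\<^esub> l x) & l v = \<one>\<^bsub>K\<^esub>"
proof -
	interpret K: field K by (rule K)
	interpret M: module K M by (rule M)
	define \<A> where "\<A> = {W. submodule W K M & v ~: W}"
	have "EX W:\<A>. ALL X:\<A>. W <= X --> X = W"
	proof (rule subset_Zorn_nonempty)
		have "submodule {\<zero>} K M" by (rule M.submoduleI) auto
		thus "\<A> ~= {}" using v unfolding \<A>_def by blast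
		fix \<C> assume C: "\<C> ~= {}" "subset.chain \<A> \<C>"
		hence sub: "!!W. W : \<C> ==> submodule W K M & v ~: W" by (auto simp: \<A>_def subset.chain_def)
		have "submodule (\<Union>\<C>) K M"
		proof (rule M.submoduleI)
			show "\<Union>\<C> <= carrier M" using sub M.submoduleE(1) by blast
			show "\<zero> : \<Union>\<C>"
				using C(1) sub M.submoduleE(2) subgroup.one_closed[of _ "add_monoid M"] submodule.axioms(1) by fastforce
			show "\<ominus> x : \<Union>\<C>" if "x : \<Union>\<C>" for x using that sub M.submoduleE(3) by blast
			show "c \<odot> x : \<Union>\<C>" if "c : carrier K" "x : \<Union>\<C>" for c x using that sub M.submoduleE(4) by blast
			fix x y assume "x : \<Union>\<C>" "y : \<Union>\<C>"
			then obtain X Y where XY: "X : \<C>" "Y : \<C>" "x : X" "y : Y" by blast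
			hence "X <= Y \<or> Y <= X" using C(2) by (auto simp: subset.chain_def)
			then obtain Z where "Z : \<C>" "x : Z" "y : Z" using XY by blast
			thus "x \<oplus> y : \<Union>\<C>" using sub M.submoduleE(5) by blast
		qed
		thus "\<Union>\<C> \<in> \<A>" using sub by (auto simp: \<A>_def)
	qed
	then obtain W where W: "submodule W K M" "v ~: W" and max: "!!X. submodule X K M ==> v ~: X ==> W <= X ==> X = W"
		by (auto simp: \<A>_def)
	note Wc = M.submoduleE(1)[OF W(1)] and Ws = M.submoduleE(4)[OF W(1)] and Wa = M.submoduleE(5)[OF W(1)]
		and Wm = M.submoduleE(3)[OF W(1)]
	have W0: "\<zero> : W" using subgroup.one_closed[OF submodule.axioms(1)[OF W(1)]] by simp
	\<comment> \<open>By maximality, adding any \<open>x\<close> outside \<open>W\<close> brings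
	  \<open>v\<close> into the span, so \<open>x\<close> is a multiple of \<open>v\<close> modulo
	  \<open>W\<close>. That multiple is unique because \<open>v\<close> is not in \<open>W\<close>; it
	  is the value of the functional.\<close>
	have ex: "EX c:carrier K. x \<ominus> c \<odot> v : W" if x: "x : carrier M" for x
	proof (cases "x : W")
		case True
		thus ?thesis using x v Wa[OF True Wm[OF W0]] by (intro bexI[of _ "\<zero>\<^bsub>K\<^esub>"]) (auto simp: M.M.minus_eq)
	next
		case False
		define X where "X = {w \<oplus> c \<odot> x | w c. w : W & c : carrier K}"
		have XI: "w \<oplus> c \<odot> x : X" if "w : W" "c : carrier K" for w c using that X_def by blast
		have "submodule X K M"
		proof (rule M.submoduleI)
			show "X <= carrier M" unfolding X_def using Wc x by auto
			show "\<zero> : X" using XI[OF W0 K.zero_closed] x by simp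
			show "\<ominus> y : X" if "y : X" for y
			proof -
				obtain w c where y: "w : W" "c : carrier K" "y = w \<oplus> c \<odot> x" using \<open>y : X\<close> X_def by auto
				hence "\<ominus> y = \<ominus> w \<oplus> (\<ominus>\<^bsub>K\<^esub> c) \<odot> x"
					using x Wc by (auto simp: M.M.minus_add M.smult_l_minus)
				thus ?thesis using XI[of "\<ominus> w" "\<ominus>\<^bsub>K\<^esub> c"] y Wm by simp
			qed
			show "a \<odot> y : X" if a: "a : carrier K" and "y : X" for a y
			proof -
				obtain w c where y: "w : W" "c : carrier K" "y = w \<oplus> c \<odot> x" using \<open>y : X\<close> X_def by auto
				hence "a \<odot> y = a \<odot> w \<oplus> (a \<otimes>\<^bsub>K\<^esub> c) \<odot> x"
					using x a Wc by (auto simp: M.smult_r_distr M.smult_assoc1)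
				thus ?thesis using XI[of "a \<odot> w" "a \<otimes>\<^bsub>K\<^esub> c"] y Ws a by simp
			qed
			show "y \<oplus> z : X" if "y : X" and "z : X" for y z
			proof -
				obtain w c where y: "w : W" "c : carrier K" "y = w \<oplus> c \<odot> x" using \<open>y : X\<close> X_def by auto
				obtain w' c' where z: "w' : W" "c' : carrier K" "z = w' \<oplus> c' \<odot> x" using \<open>z : X\<close> X_def by auto
				have "w : carrier M" "w' : carrier M" using y z Wc by auto
				hence "y \<oplus> z = (w \<oplus> w') \<oplus> (c \<oplus>\<^bsub>K\<^esub> c') \<odot> x"
					using x y z by (simp add: M.smult_l_distr M.M.a_ac)
				thus ?thesis using XI[of "w \<oplus> w'" "c \<oplus>\<^bsub>K\<^esub> c'"] y z Wa by simp
			qed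
		qed
		moreover have WX: "W <= X"
		proof
			fix w assume w: "w : W"
			thus "w : X" using XI[OF w K.zero_closed] x Wc by auto
		qed
		moreover have "x : X" using XI[OF W0 K.one_closed] x by simp
		ultimately have "v : X" using max False by blast
		then obtain w c where vx: "w : W" "c : carrier K" "v = w \<oplus> c \<odot> x" using X_def by auto
		have wc: "w : carrier M" using vx Wc by auto
		have "c ~= \<zero>\<^bsub>K\<^esub>" using vx W(2) wc x by auto
		then obtain e where e: "e : carrier K" "e \<otimes>\<^bsub>K\<^esub> c = \<one>\<^bsub>K\<^esub>"
			using K.field_Units vx(2) K.Units_l_inv_ex by blast
		have "e \<odot> v = e \<odot> w \<oplus> x"
			using vx e wc x by (simp add: M.smult_r_distr M.smult_assoc1[symmetric])
		hence "x \<ominus> e \<odot> v = \<ominus> (e \<odot> w)"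
			using e wc x by (simp add: M.M.minus_eq M.M.minus_add
				M.M.a_lcomm[of x "\<ominus> (e \<odot> w)"] M.M.r_neg)
		thus ?thesis using Wm[OF Ws[OF e(1) vx(1)]] e(1) by (intro bexI[of _ e]) simp_all
	qed
	have uniq: "c = c'" if c: "c : carrier K" "c' : carrier K" "x : carrier M" "x \<ominus> c \<odot> v : W" "x \<ominus> c' \<odot> v : W" for c c' x
	proof (rule ccontr)
		assume n: "c ~= c'"
		have "(x \<ominus> c' \<odot> v) \<oplus> \<ominus> (x \<ominus> c \<odot> v) : W" by (intro Wa Wm c)
		moreover have "(x \<ominus> c' \<odot> v) \<oplus> \<ominus> (x \<ominus> c \<odot> v) = (c \<ominus>\<^bsub>K\<^esub> c') \<odot> v"
			using c v by (simp add: M.M.minus_eq M.M.minus_add K.minus_eq M.smult_l_distr M.smult_l_minus M.M.a_ac M.M.r_neg)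
				(simp add: M.M.a_ac M.M.r_neg1 M.M.r_neg2)
		ultimately have d: "(c \<ominus>\<^bsub>K\<^esub> c') \<odot> v : W" by simp
		have "c \<ominus>\<^bsub>K\<^esub> c' ~= \<zero>\<^bsub>K\<^esub>" using n c by simp
		then obtain e where e: "e : carrier K" "e \<otimes>\<^bsub>K\<^esub> (c \<ominus>\<^bsub>K\<^esub> c') = \<one>\<^bsub>K\<^esub>"
			using K.field_Units K.Units_l_inv_ex c by (metis K.minus_closed Diff_iff singletonD)
		have "e \<odot> ((c \<ominus>\<^bsub>K\<^esub> c') \<odot> v) = v" using e c v by (simp add: M.smult_assoc1[symmetric])
		thus False using Ws[OF e(1) d] W(2) by simp
	qed
	define l where "l x = (THE c. c : carrier K & x \<ominus> c \<odot> v : W)" for x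
	have lI: "l x = c" if "c : carrier K" "x : carrier M" "x \<ominus> c \<odot> v : W" for x c
		unfolding l_def using that uniq by (intro the_equality) auto
	have l: "l x : carrier K" "x \<ominus> l x \<odot> v : W" if "x : carrier M" for x
		using ex[OF that] lI[OF _ that] by auto
	have "additive_map M K l"
	proof (intro additive_map.intro additive_map_axioms.intro M.M.abelian_group_axioms K.abelian_group_axioms l(1))
		fix x y assume xy: "x : carrier M" "y : carrier M"
		have "(x \<ominus> l x \<odot> v) \<oplus> (y \<ominus> l y \<odot> v) = (x \<oplus> y) \<ominus> (l x \<oplus>\<^bsub>K\<^esub> l y) \<odot> v"
			using xy l(1) v by (simp add: M.M.minus_eq M.smult_l_distr M.M.minus_add M.M.a_ac)
		thus "l (x \<oplus> y) = l x \<oplus>\<^bsub>K\<^esub> l y"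
			using xy l(1) Wa[OF l(2)[OF xy(1)] l(2)[OF xy(2)]] by (intro lI) auto
	qed
	moreover have "l (c \<odot> x) = c \<otimes>\<^bsub>K\<^esub> l x" if c: "c : carrier K" and x: "x : carrier M" for c x
	proof -
		have "c \<odot> (x \<ominus> l x \<odot> v) = c \<odot> x \<ominus> (c \<otimes>\<^bsub>K\<^esub> l x) \<odot> v"
			using c x l(1) v by (simp add: M.M.minus_eq M.smult_r_distr M.smult_r_minus M.smult_assoc1)
		thus ?thesis using c x l(1) Ws[OF c l(2)[OF x]] by (intro lI) auto
	qed
	moreover have "l v = \<one>\<^bsub>K\<^esub>" using v W0 by (intro lI) (auto simp: M.M.minus_eq M.M.r_neg)
	ultimately show ?thesis by blast
qed

section \<open>Tensor products of graded algebras\<close>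

text \<open>The target \<open>X\<close> is a parameter because its type cannot be quantified inside
  a locale assumption. The three targets that occur, namely both factors and the tensor product, are
  assumed one by one.\<close>

definition tensor_universal ::
	"('k, 'r) ring_scheme => ('k, 'a, 'm) module_scheme => ('k, 'b, 'n) module_scheme => ('k, 't, 'u) module_scheme =>
		('a => 't) => ('b => 't) => ('x, 'y) ring_scheme => bool" where
	"tensor_universal K A B R p q X \<longleftrightarrow> (ALL \<beta>.
		 (ALL a:carrier A. ALL b:carrier B. \<beta> a b : carrier X) -->
		 (ALL a:carrier A. ALL a':carrier A. ALL b:carrier B. \<beta> (a \<oplus>\<^bsub>A\<^esub> a') b = \<beta> a b \<oplus>\<^bsub>X\<^esub> \<beta> a' b) -->
		 (ALL a:carrier A. ALL b:carrier B. ALL b':carrier B. \<beta> a (b \<oplus>\<^bsub>B\<^esub> b') = \<beta> a b \<oplus>\<^bsub>X\<^esub> \<beta> a b') -->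
		 (ALL c:carrier K. ALL a:carrier A. ALL b:carrier B. \<beta> (c \<odot>\<^bsub>A\<^esub> a) b = \<beta> a (c \<odot>\<^bsub>B\<^esub> b)) -->
		 (EX L. additive_map R X L & (ALL a:carrier A. ALL b:carrier B. L (p a \<otimes>\<^bsub>R\<^esub> q b) = \<beta> a b)))"

lemma tensor_universalD:
	assumes "tensor_universal K A B R p q X"
		and "!!a b. a : carrier A ==> b : carrier B ==> \<beta> a b : carrier X"
		and "!!a a' b. a : carrier A ==> a' : carrier A ==> b : carrier B ==> \<beta> (a \<oplus>\<^bsub>A\<^esub> a') b = \<beta> a b \<oplus>\<^bsub>X\<^esub> \<beta> a' b"
		and "!!a b b'. a : carrier A ==> b : carrier B ==> b' : carrier B ==> \<beta> a (b \<oplus>\<^bsub>B\<^esub> b') = \<beta> a b \<oplus>\<^bsub>X\<^esub> \<beta> a b'"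
		and "!!c a b. c : carrier K ==> a : carrier A ==> b : carrier B ==> \<beta> (c \<odot>\<^bsub>A\<^esub> a) b = \<beta> a (c \<odot>\<^bsub>B\<^esub> b)"
	obtains L where "additive_map R X L" "!!a b. a : carrier A ==> b : carrier B ==> L (p a \<otimes>\<^bsub>R\<^esub> q b) = \<beta> a b"
proof -
	have "EX L. additive_map R X L & (ALL a:carrier A. ALL b:carrier B. L (p a \<otimes>\<^bsub>R\<^esub> q b) = \<beta> a b)"
		using assms(1)[unfolded tensor_universal_def, rule_format, of \<beta>] assms(2-5) by blast
	thus ?thesis using that by blast
qed

text \<open>The tensor product enters only through its universal property, which is symmetric in both factors:
	statements about \<open>A\<close> then transfer to \<open>B\<close>.\<close>

locale graded_tensor =
	A: graded_field_algebra K A GA + B: graded_field_algebra K B GB + R: field_algebra K R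
	for K :: "('k, 'r) ring_scheme" and A :: "('k, 'a, 'm) module_scheme" and GA
		and B :: "('k, 'b, 'n) module_scheme" and GB and R :: "('k, 't, 'u) module_scheme" (structure) +
	fixes p q
	assumes p_hom: "p : ring_hom A R" and q_hom: "q : ring_hom B R"
		and p_smult: "c : carrier K ==> a : carrier A ==> p (c \<odot>\<^bsub>A\<^esub> a) = c \<odot> p a"
		and q_smult: "c : carrier K ==> b : carrier B ==> q (c \<odot>\<^bsub>B\<^esub> b) = c \<odot> q b"
		and tensor_induct: "!!U P. U : carrier R ==> (!!U V. U : carrier R ==> V : carrier R ==> P U ==> P V ==> P (U \<oplus> V)) ==>
			 (!!a b. a : carrier A ==> b : carrier B ==> P (p a \<otimes> q b)) ==> P U"
		and univ_A: "tensor_universal K A B R p q A" and univ_B: "tensor_universal K A B R p q B"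
		and univ_R: "tensor_universal K A B R p q R"
		and noeth_A: "noetherian_ring A" and noeth_B: "noetherian_ring B"
		and red_A: "reduced_ring A" and red_B: "reduced_ring B" and red_R: "reduced_ring R"
begin

sublocale p: ring_hom_ring A R p by (rule ring_hom_ringI2[OF A.S.ring_axioms R.S.ring_axioms p_hom])
sublocale q: ring_hom_ring B R q by (rule ring_hom_ringI2[OF B.S.ring_axioms R.S.ring_axioms q_hom])

lemma mult4:
	"a : carrier R ==> b : carrier R ==> c : carrier R ==> d : carrier R ==>
		(a \<otimes> b) \<otimes> (c \<otimes> d) = (a \<otimes> c) \<otimes> (b \<otimes> d)"
	by (simp add: R.S.m_ac)

lemma swap: "graded_tensor K B GB A GA R q p"
proof -
	have u: "tensor_universal K B A R q p X" if uX: "tensor_universal K A B R p q X" for X :: "('x, 'y) ring_scheme"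
		unfolding tensor_universal_def
	proof (intro allI impI)
		fix \<beta>
		assume h: "ALL b:carrier B. ALL a:carrier A. \<beta> b a : carrier X"
			"ALL b:carrier B. ALL b':carrier B. ALL a:carrier A. \<beta> (b \<oplus>\<^bsub>B\<^esub> b') a = \<beta> b a \<oplus>\<^bsub>X\<^esub> \<beta> b' a"
			"ALL b:carrier B. ALL a:carrier A. ALL a':carrier A. \<beta> b (a \<oplus>\<^bsub>A\<^esub> a') = \<beta> b a \<oplus>\<^bsub>X\<^esub> \<beta> b a'"
			"ALL c:carrier K. ALL b:carrier B. ALL a:carrier A. \<beta> (c \<odot>\<^bsub>B\<^esub> b) a = \<beta> b (c \<odot>\<^bsub>A\<^esub> a)"
		obtain L where L: "additive_map R X L" "!!a b. a : carrier A ==> b : carrier B ==> L (p a \<otimes> q b) = \<beta> b a"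
			by (rule tensor_universalD[OF uX, of "%a b. \<beta> b a"]) (use h in auto)
		show "EX L. additive_map R X L & (ALL b:carrier B. ALL a:carrier A. L (q b \<otimes> p a) = \<beta> b a)"
		proof (intro exI[of _ L] conjI ballI L(1))
			show "L (q b \<otimes> p a) = \<beta> b a" if "b : carrier B" "a : carrier A" for a b
				using L(2)[OF that(2,1)] R.S.m_comm[OF p.hom_closed[OF that(2)] q.hom_closed[OF that(1)]] by simp
		qed
	qed
	have ind: "P U" if "U : carrier R" "!!U V. U : carrier R ==> V : carrier R ==> P U ==> P V ==> P (U \<oplus> V)"
		"!!b a. b : carrier B ==> a : carrier A ==> P (q b \<otimes> p a)" for U P
	proof (rule tensor_induct[of U P])
		show "P (p a \<otimes> q b)" if h: "a : carrier A" "b : carrier B" for a b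
			using \<open>!!b a. b : carrier B ==> a : carrier A ==> P (q b \<otimes> p a)\<close>[OF h(2,1)]
				R.S.m_comm[OF p.hom_closed[OF h(1)] q.hom_closed[OF h(2)]] by simp
	qed (rule that(1), rule that(2))
	show ?thesis
	proof (rule graded_tensor.intro[OF B.graded_field_algebra_axioms A.graded_field_algebra_axioms R.field_algebra_axioms], rule graded_tensor_axioms.intro)
		show "P U" if "U : carrier R" "!!U V. U : carrier R ==> V : carrier R ==> P U ==> P V ==> P (U \<oplus> V)"
			"!!b a. b : carrier B ==> a : carrier A ==> P (q b \<otimes> p a)" for U P using that by (rule ind)
	qed (assumption | rule q_hom p_hom q_smult p_smult u[OF univ_A] u[OF univ_B] u[OF univ_R] noeth_A noeth_B red_A red_B red_R)+
qed

lemma scal_p: "c : carrier K ==> R.scal c = p (A.scal c)"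
	using p_smult[of c "\<one>\<^bsub>A\<^esub>"] by simp

lemma p_base: "p ` A.base = R.base"
	unfolding A.base_def R.base_def by (force simp: scal_p image_iff)

text \<open>The map \<open>id \<otimes> \<epsilon>\<close> for the augmentation
  \<open>\<epsilon>\<close> of \<open>B\<close>: it sets the positive part of \<open>B\<close> to
  zero and is a retraction of \<open>p\<close>. Its mirror image \<open>sw.prA\<close> is the map
  from \<open>R\<close> to \<open>B\<close>.\<close>

definition prA where
	"prA = (SOME L. additive_map R A L & (ALL a:carrier A. ALL b:carrier B. L (p a \<otimes> q b) = B.aug b \<odot>\<^bsub>A\<^esub> a))"

lemma prA_props: "additive_map R A prA & (ALL a:carrier A. ALL b:carrier B. prA (p a \<otimes> q b) = B.aug b \<odot>\<^bsub>A\<^esub> a)"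
proof -
	obtain L where "additive_map R A L" "!!a b. a : carrier A ==> b : carrier B ==> L (p a \<otimes> q b) = B.aug b \<odot>\<^bsub>A\<^esub> a"
		by (rule tensor_universalD[OF univ_A, of "%a b. B.aug b \<odot>\<^bsub>A\<^esub> a"])
			(auto simp: B.aug B.aug_add B.aug_smult A.A.smult_r_distr A.A.smult_l_distr A.A.smult_assoc1[symmetric] A.A.R.m_comm)
	hence "EX L. additive_map R A L & (ALL a:carrier A. ALL b:carrier B. L (p a \<otimes> q b) = B.aug b \<odot>\<^bsub>A\<^esub> a)" by blast
	thus ?thesis unfolding prA_def by (rule someI_ex)
qed

sublocale prA: additive_map R A prA using prA_props by blast

lemma prA_pure: "a : carrier A ==> b : carrier B ==> prA (p a \<otimes> q b) = B.aug b \<odot>\<^bsub>A\<^esub> a"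
	using prA_props by blast

lemma prA_p: "a : carrier A ==> prA (p a) = a"
	using prA_pure[of a "\<one>\<^bsub>B\<^esub>"] by (simp add: B.aug_one)

lemma prA_q: "b : carrier B ==> prA (q b) = A.scal (B.aug b)"
	using prA_pure[of "\<one>\<^bsub>A\<^esub>" b] by simp

lemma p_inj: "inj_on p (carrier A)"
	by (rule inj_on_inverseI[of _ prA]) (rule prA_p)

lemma prA_hom: "prA : ring_hom R A"
proof (rule ring_hom_memI)
	show "prA \<one> = \<one>\<^bsub>A\<^esub>" using prA_p[of "\<one>\<^bsub>A\<^esub>"] by simp
	fix U V assume U: "U : carrier R" and V: "V : carrier R"
	show "prA (U \<otimes> V) = prA U \<otimes>\<^bsub>A\<^esub> prA V"
	proof (rule tensor_induct[OF U])
		fix a b assume a: "a : carrier A" and b: "b : carrier B"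
		show "prA (p a \<otimes> q b \<otimes> V) = prA (p a \<otimes> q b) \<otimes>\<^bsub>A\<^esub> prA V"
		proof (rule tensor_induct[OF V])
			fix x y assume x: "x : carrier A" and y: "y : carrier B"
			have "p a \<otimes> q b \<otimes> (p x \<otimes> q y) = p (a \<otimes>\<^bsub>A\<^esub> x) \<otimes> q (b \<otimes>\<^bsub>B\<^esub> y)"
				using a b x y by (simp add: mult4)
			hence "prA (p a \<otimes> q b \<otimes> (p x \<otimes> q y)) = B.aug (b \<otimes>\<^bsub>B\<^esub> y) \<odot>\<^bsub>A\<^esub> (a \<otimes>\<^bsub>A\<^esub> x)"
				using a b x y prA_pure[of "a \<otimes>\<^bsub>A\<^esub> x" "b \<otimes>\<^bsub>B\<^esub> y"] by (simp only: A.S.m_closed B.S.m_closed)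
			thus "prA (p a \<otimes> q b \<otimes> (p x \<otimes> q y)) = prA (p a \<otimes> q b) \<otimes>\<^bsub>A\<^esub> prA (p x \<otimes> q y)"
				unfolding prA_pure[OF a b] prA_pure[OF x y] using a b x y B.aug(1) by (simp add: prA_pure B.aug_mult A.A.smult_assoc1 A.A.smult_assoc2 A.S.m_comm[of a])
		qed (use a b in \<open>simp add: R.S.r_distr prA.map_add prA.map_closed A.S.r_distr\<close>)
	qed (use V in \<open>simp add: R.S.l_distr prA.map_add prA.map_closed A.S.l_distr\<close>)
qed (auto simp: prA.map_closed prA.map_add)

sublocale prA: ring_hom_ring R A prA by (rule ring_hom_ringI2[OF R.S.ring_axioms A.S.ring_axioms prA_hom])

lemma prA_base: assumes "c : R.base" shows "prA c : A.base" "p (prA c) = c"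
proof -
	obtain a where "a : A.base" "c = p a" using assms unfolding p_base[symmetric] by auto
	thus "prA c : A.base" "p (prA c) = c" using prA_p A.C.k_carrier by auto
qed

text \<open>The derivation \<open>\<delta> \<otimes> id\<close>. The map to be lifted is balanced
  since \<open>\<delta>\<close> kills constants and is therefore linear over
  \<open>K\<close>.\<close>

lemma derivation_extend:
	assumes d: "A.S.derivation_on A.base (carrier A) \<delta>"
	obtains D where "R.S.derivation_on R.base (carrier R) D"
		"!!a b. a : carrier A ==> b : carrier B ==> D (p a \<otimes> q b) = p (\<delta> a) \<otimes> q b"
		"!!a. a : carrier A ==> D (p a) = p (\<delta> a)" "!!b. b : carrier B ==> D (q b) = \<zero>"
proof -
	note D = A.S.derivation_onD[OF d]
	have sm: "\<delta> (c \<odot>\<^bsub>A\<^esub> a) = c \<odot>\<^bsub>A\<^esub> \<delta> a" if "c : carrier K" "a : carrier A" for c a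
	proof -
		have "A.scal c : A.base" using that A.base_def by auto
		thus ?thesis using that D by (simp add: A.smult_scal[of c a] A.smult_scal[of c "\<delta> a"])
	qed
	obtain L where L: "additive_map R R L" "!!a b. a : carrier A ==> b : carrier B ==> L (p a \<otimes> q b) = p (\<delta> a) \<otimes> q b"
		by (rule tensor_universalD[OF univ_R, of "%a b. p (\<delta> a) \<otimes> q b"])
			(auto simp: D sm R.S.l_distr R.S.r_distr p_smult q_smult R.smult_scal[of _ "p _"] R.smult_scal[of _ "q _"] R.S.m_ac)
	interpret L: additive_map R R L by (rule L(1))
	have Lp: "L (p a) = p (\<delta> a)" if "a : carrier A" for a
		using L(2)[OF that B.S.one_closed] that D(1) by simp
	have d1: "\<delta> c = \<zero>\<^bsub>A\<^esub>" if "c : A.base" for c using D(4) that .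
	have Lq: "L (q b) = \<zero>" if "b : carrier B" for b
		using L(2)[OF A.S.one_closed that] that d1[OF subringE(3)[OF A.C.k_subring]] by simp
	have "R.S.derivation_on R.base (carrier R) L" unfolding R.S.derivation_on_def
	proof (intro conjI ballI)
		show "L c = \<zero>" if c: "c : R.base" for c
		proof -
			obtain a where "a : A.base" "c = p a" using c unfolding p_base[symmetric] by auto
			thus ?thesis using Lp[of a] d1 A.C.k_carrier by auto
		qed
		fix U V assume U: "U : carrier R" and V: "V : carrier R"
		show "L (U \<otimes> V) = U \<otimes> L V \<oplus> V \<otimes> L U"
		proof (rule tensor_induct[OF U])
			fix a b assume a: "a : carrier A" and b: "b : carrier B"
			let ?U = "p a \<otimes> q b"
			show "L (?U \<otimes> V) = ?U \<otimes> L V \<oplus> V \<otimes> L ?U"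
			proof (rule tensor_induct[OF V])
				fix x y assume x: "x : carrier A" and y: "y : carrier B"
				have "p a \<otimes> q b \<otimes> (p x \<otimes> q y) = p (a \<otimes>\<^bsub>A\<^esub> x) \<otimes> q (b \<otimes>\<^bsub>B\<^esub> y)"
					using a b x y by (simp add: mult4)
				hence "L (?U \<otimes> (p x \<otimes> q y)) = p (\<delta> (a \<otimes>\<^bsub>A\<^esub> x)) \<otimes> q (b \<otimes>\<^bsub>B\<^esub> y)"
					using L(2)[of "a \<otimes>\<^bsub>A\<^esub> x" "b \<otimes>\<^bsub>B\<^esub> y"] a b x y by (simp only: A.S.m_closed B.S.m_closed)
				also have "\<dots> = (p a \<otimes> p (\<delta> x) \<oplus> p x \<otimes> p (\<delta> a)) \<otimes> (q b \<otimes> q y)"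
					using a b x y D by simp
				finally show "L (?U \<otimes> (p x \<otimes> q y)) = ?U \<otimes> L (p x \<otimes> q y) \<oplus> (p x \<otimes> q y) \<otimes> L ?U"
					using a b x y D(1) by (simp add: L(2) R.S.l_distr mult4[of "p _" "q _" "p _" "q _"] R.S.m_comm[of "q y" "q b"])
			next
				fix V W assume "V : carrier R" "W : carrier R" "L (?U \<otimes> V) = ?U \<otimes> L V \<oplus> V \<otimes> L ?U"
					"L (?U \<otimes> W) = ?U \<otimes> L W \<oplus> W \<otimes> L ?U"
				moreover have "?U : carrier R" using a b by simp
				ultimately show "L (?U \<otimes> (V \<oplus> W)) = ?U \<otimes> L (V \<oplus> W) \<oplus> (V \<oplus> W) \<otimes> L ?U"
					using L.map_closed by (simp del: L(2) add: R.S.r_distr R.S.l_distr L.map_add R.S.a_ac)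
			qed
		qed (use V in \<open>simp add: R.S.l_distr R.S.r_distr L.map_add L.map_closed R.S.a_ac\<close>)
	qed (auto simp: L.map_closed L.map_add)
	thus ?thesis by (rule that[OF _ L(2) Lp Lq])
qed

lemma gens_subset:
	assumes xs: "set xs <= carrier A" "A.S.adjs A.base xs = carrier A" and E: "subring E R" "R.base <= E" "p ` set xs <= E"
	shows "p ` carrier A <= E"
	using A.S.hom_adjs[OF p_hom R.S.cring_axioms A.C.k_carrier xs(1) E(1) _ E(3)] E(2) unfolding xs(2) p_base .

end

context graded_tensor
begin

interpretation sw: graded_tensor K B GB A GA R q p by (rule swap)

lemma tensor_gens:
	assumes xs: "set xs <= carrier A" "A.S.adjs A.base xs = carrier A" and ys: "set ys <= carrier B" "B.S.adjs B.base ys = carrier B"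
	shows "set (map p xs @ map q ys) <= carrier R" "R.S.adjs R.base (map p xs @ map q ys) = carrier R"
proof -
	show c: "set (map p xs @ map q ys) <= carrier R" using xs(1) ys(1) by auto
	let ?E = "R.S.adjs R.base (map p xs @ map q ys)"
	note E = R.S.subring_adjs[OF R.C.k_subring c] R.S.adjs_incl[OF R.C.k_subring c] R.S.adjs_self[OF R.C.k_subring c]
	have pq: "p ` carrier A <= ?E" "q ` carrier B <= ?E"
		using gens_subset[OF xs E(1,2)] sw.gens_subset[OF ys E(1,2)] E(3) by auto
	have "U : ?E" if "U : carrier R" for U
		using that by (rule tensor_induct) (use pq subringE(6,7)[OF E(1)] in auto)
	thus "?E = carrier R" using subringE(1)[OF E(1)] by blast
qed

text \<open>The maximal ideal at the origin, as the kernel of the composite from \<open>R\<close>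
  through \<open>A\<close> to \<open>K\<close>, so that no grading of \<open>R\<close> has to be
  constructed. The route through \<open>B\<close> gives the same map.\<close>

definition mR where "mR = {U : carrier R. A.aug (prA U) = \<zero>\<^bsub>K\<^esub>}"

lemma aug_pr: "U : carrier R ==> A.aug (prA U) = B.aug (sw.prA U)"
proof (rule tensor_induct)
	fix a b assume a: "a : carrier A" and b: "b : carrier B"
	have "p a \<otimes> q b = q b \<otimes> p a" using R.S.m_comm[OF p.hom_closed[OF a] q.hom_closed[OF b]] .
	hence "sw.prA (p a \<otimes> q b) = A.aug a \<odot>\<^bsub>B\<^esub> b" using sw.prA_pure[OF b a] by simp
	thus "A.aug (prA (p a \<otimes> q b)) = B.aug (sw.prA (p a \<otimes> q b))"
		unfolding prA_pure[OF a b] using a b by (simp add: A.aug_smult B.aug_smult A.aug B.aug A.A.R.m_comm)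
qed (auto simp: prA.map_add sw.prA.map_add prA.map_closed sw.prA.map_closed A.aug_add B.aug_add)

lemma prA_mR: "U : carrier R ==> U : mR \<longleftrightarrow> prA U : A.mm"
proof -
	assume U: "U : carrier R"
	note c = prA.map_closed[OF U]
	have "A.aug (prA U) = \<zero>\<^bsub>K\<^esub> \<longleftrightarrow> A.cmp 0 (prA U) = \<zero>\<^bsub>A\<^esub>"
		using A.aug(2)[OF c] A.aug_eqI[of "\<zero>\<^bsub>K\<^esub>" "prA U"] by auto
	thus ?thesis using U c unfolding mR_def A.mm_def mem_Collect_eq by blast
qed

lemma mR_prime: "primeideal mR R"
proof -
	have "mR = {U : carrier R. prA U : A.mm}" using prA_mR by (auto simp: mR_def)
	thus ?thesis using prA.primeideal_vimage[OF R.S.cring_axioms A.mm_prime] by simp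
qed

text \<open>Under \<open>prA\<close> the part coming from \<open>B\<close> vanishes, as the
  \<open>ys\<close> have augmentation zero, and the square of \<open>mR\<close> goes into the square
  of \<open>A.mm\<close>. What remains is a linear relation between the \<open>xs\<close> in
  \<open>A\<close>.\<close>

lemma comb_mR:
	assumes xs: "set xs <= carrier A" and ys: "set ys <= carrier B" "!!y. y : set ys ==> B.aug y = \<zero>\<^bsub>K\<^esub>"
		and li: "!!cs. length cs = length xs ==> set cs <= A.base ==> A.S.comb cs xs : A.C.ideal_square A.mm ==> set cs <= {\<zero>\<^bsub>A\<^esub>}"
		and cs: "length cs = length xs" "set cs <= R.base" "set ds <= R.base"
		and sq: "R.S.comb cs (map p xs) \<oplus> R.S.comb ds (map q ys) : R.C.ideal_square mR"
	shows "set cs <= {\<zero>}"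
proof -
	have csc: "set cs <= carrier R" "set ds <= carrier R" using cs R.C.k_carrier by auto
	have pc: "set (map p xs) <= carrier R" "set (map q ys) <= carrier R" using xs ys by auto
	have id: "map prA (map p xs) = xs" using xs by (auto simp: prA_p intro!: map_idI)
	have z: "prA (R.S.comb ds (map q ys)) = \<zero>\<^bsub>A\<^esub>"
		using csc(2) ys
	proof (induction ds ys rule: list_induct2')
		case (4 d ds y ys)
		have "R.S.comb ds (map q ys) : carrier R" using 4 by (intro R.S.comb_closed) auto
		thus ?case using 4 by (auto simp: prA.map_add prA.map_closed prA_q)
	qed auto
	obtain as bs where ab: "set as <= mR" "set bs <= mR"
		"R.S.comb cs (map p xs) \<oplus> R.S.comb ds (map q ys) = R.S.comb as bs"
		using sq by (auto simp: R.C.ideal_square_def)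
	have abc: "set as <= carrier R" "set bs <= carrier R" using ab(1,2) by (auto simp: mR_def)
	have "A.S.comb (map prA cs) xs = prA (R.S.comb as bs)"
		using prA.map_add[OF R.S.comb_closed[OF csc(1) pc(1)] R.S.comb_closed[OF csc(2) pc(2)]]
			R.S.hom_comb[OF prA_hom A.S.cring_axioms csc(1) pc(1)] prA.map_closed[OF R.S.comb_closed[OF csc(1) pc(1)]]
		unfolding id z ab(3) by simp
	also have "\<dots> = A.S.comb (map prA as) (map prA bs)" by (rule R.S.hom_comb[OF prA_hom A.S.cring_axioms abc])
	also have "\<dots> : A.C.ideal_square A.mm"
		using prA_mR abc ab(1,2) by (intro A.C.comb_in_ideal_square) (auto simp: subset_iff)
	finally have "set (map prA cs) <= {\<zero>\<^bsub>A\<^esub>}"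
		using cs prA_base(1) by (intro li) auto
	thus ?thesis using prA_base(2) cs(2) p.hom_zero by (force simp: subset_iff)
qed

end

context graded_tensor
begin

interpretation sw: graded_tensor K B GB A GA R q p by (rule swap)

text \<open>Minimal homogeneous generators of both factors together stay linearly independent modulo
  the square of \<open>mR\<close>, so regularity makes the joint list independent. In this list the
  \<open>ys\<close> form the tail, that is, they are adjoined first; their independence over the
  base is thus part of that of the whole list. The other factor is reached by swapping.\<close>

lemma regular_generators_right:
	assumes reg: "regular_ring R"
	shows "EX ys. set ys <= carrier B & B.S.adjs B.base ys = carrier B & B.S.indep B.base {\<zero>\<^bsub>B\<^esub>} ys"
proof -
	obtain xs where xs: "!!x. x : set xs ==> EX i>0. x : GA i" "A.S.adjs A.base xs = carrier A"
		"!!cs. length cs = length xs ==> set cs <= A.base ==> A.S.comb cs xs : A.C.ideal_square A.mm ==> set cs <= {\<zero>\<^bsub>A\<^esub>}"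
		using A.homogeneous_generators[OF noeth_A] by blast
	obtain ys where ys: "!!x. x : set ys ==> EX i>0. x : GB i" "B.S.adjs B.base ys = carrier B"
		"!!cs. length cs = length ys ==> set cs <= B.base ==> B.S.comb cs ys : B.C.ideal_square B.mm ==> set cs <= {\<zero>\<^bsub>B\<^esub>}"
		using B.homogeneous_generators[OF noeth_B] by blast
	have xm: "set xs <= A.mm" and ym: "set ys <= B.mm" using xs(1) ys(1) A.mm_hom B.mm_hom by blast+
	have xc: "set xs <= carrier A" and yc: "set ys <= carrier B" using xm ym A.mm_carrier B.mm_carrier by auto
	have xa: "A.aug x = \<zero>\<^bsub>K\<^esub>" if "x : set xs" for x
		using that xm A.mm_cmp[of x] by (intro A.aug_eqI) auto
	have ya: "B.aug y = \<zero>\<^bsub>K\<^esub>" if "y : set ys" for y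
		using that ym B.mm_cmp[of y] by (intro B.aug_eqI) auto
	let ?zs = "map p xs @ map q ys"
	note gens = tensor_gens[OF xc xs(2) yc ys(2)]
	have sw_mR: "sw.mR = mR" unfolding mR_def sw.mR_def by (rule Collect_cong) (metis aug_pr)
	have "R.S.indep R.base {\<zero>} ?zs"
	proof (rule R.C.regular_local_indep[OF mR_prime _ _ gens(2)])
		show "EX c:R.base. f \<ominus> c : mR" if f: "f : carrier R" for f
		proof (rule bexI)
			let ?c = "A.cmp 0 (prA f)"
			have c: "prA f : carrier A" "?c : A.base" "?c : carrier A"
				using prA.map_closed[OF f] A.cmp_0_in[of "prA f"] A.C.k_carrier by auto
			show pc: "p ?c : R.base" using p_base c(2) by blast
			have "prA (f \<ominus> p ?c) = prA f \<ominus>\<^bsub>A\<^esub> ?c" using f c by (simp add: prA.map_minus prA_p)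
			thus "f \<ominus> p ?c : mR"
				using prA_mR[of "f \<ominus> p ?c"] A.mm_minus[OF c(1)] f c by simp
		qed
		show "set ?zs <= mR"
		proof -
			have "p x : mR" if "x : set xs" for x using prA_mR[of "p x"] prA_p[of x] that xm xc by auto
			moreover have "q y : mR" if "y : set ys" for y
				using sw.prA_mR[of "q y"] sw.prA_p[of y] that ym yc sw_mR by auto
			ultimately show ?thesis by auto
		qed
		show "regular_local_ring (localization R mR)" using reg mR_prime by (simp add: regular_ring_def)
		fix cs assume cs: "length cs = length ?zs" "set cs <= R.base" "R.S.comb cs ?zs : R.C.ideal_square mR"
		define c1 where "c1 = take (length xs) cs"
		define c2 where "c2 = drop (length xs) cs"
		have c: "cs = c1 @ c2" "length c1 = length xs" "length c2 = length ys" using cs(1) by (auto simp: c1_def c2_def)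
		have cb: "set c1 <= R.base" "set c2 <= R.base" using cs(2) c(1) by auto
		hence cc: "set c1 <= carrier R" "set c2 <= carrier R" using R.C.k_carrier by auto
		have pc: "set (map p xs) <= carrier R" "set (map q ys) <= carrier R" using xc yc by auto
		have sq: "R.S.comb c1 (map p xs) \<oplus> R.S.comb c2 (map q ys) : R.C.ideal_square mR"
			using cs(3) R.S.comb_append[OF _ cc(1) pc(1) cc(2) pc(2)] c by simp
		have "set c1 <= {\<zero>}"
			by (rule comb_mR[OF xc yc ya xs(3) c(2) cb sq])
		moreover have "set c2 <= {\<zero>}"
		proof (rule sw.comb_mR[OF yc xc xa ys(3) c(3) cb(2,1)])
			show "R.S.comb c2 (map q ys) \<oplus> R.S.comb c1 (map p xs) : R.C.ideal_square sw.mR"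
				using sq R.S.a_comm[OF R.S.comb_closed[OF cc(1) pc(1)] R.S.comb_closed[OF cc(2) pc(2)]] sw_mR by simp
		qed
		ultimately show "set cs <= {\<zero>}" using c(1) by auto
	qed
	hence "R.S.indep (q ` B.base) {\<zero>} (map q ys)" unfolding sw.p_base R.S.indep_append by simp
	hence "B.S.indep B.base {\<zero>\<^bsub>B\<^esub>} ys"
		using B.S.indep_hom[OF q_hom sw.p_inj R.S.cring_axioms B.C.k_subring _ yc] R.C.k_subring by (simp add: sw.p_base)
	thus ?thesis using yc ys(2) by blast
qed

lemma tensor_dual_derivations:
	assumes xs: "set xs <= carrier A" "A.S.adjs A.base xs = carrier A" "A.S.indep A.base {\<zero>\<^bsub>A\<^esub>} xs"
		and ys: "set ys <= carrier B" "B.S.adjs B.base ys = carrier B" "B.S.indep B.base {\<zero>\<^bsub>B\<^esub>} ys"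
	defines "zs \<equiv> map p xs @ map q ys"
	shows "EX D. ALL i<length zs. R.S.derivation_on R.base (carrier R) (D i) &
		 (ALL j<length zs. D i (zs ! j) = (if i = j then \<one> else \<zero>))"
proof -
	obtain \<delta> where \<delta>: "!!i. i < length xs ==> A.S.derivation_on A.base (carrier A) (\<delta> i)"
		"!!i j. i < length xs ==> j < length xs ==> \<delta> i (xs ! j) = (if i = j then \<one>\<^bsub>A\<^esub> else \<zero>\<^bsub>A\<^esub>)"
		using A.dual_derivations[OF xs] by blast
	obtain \<epsilon> where \<epsilon>: "!!i. i < length ys ==> B.S.derivation_on B.base (carrier B) (\<epsilon> i)"
		"!!i j. i < length ys ==> j < length ys ==> \<epsilon> i (ys ! j) = (if i = j then \<one>\<^bsub>B\<^esub> else \<zero>\<^bsub>B\<^esub>)"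
		using B.dual_derivations[OF ys] by blast
	have n: "length zs = length xs + length ys" by (simp add: zs_def)
	have xj: "xs ! j : carrier A" if "j < length xs" for j using that xs(1) nth_mem by blast
	have yj: "ys ! j : carrier B" if "j < length ys" for j using that ys(1) nth_mem by blast
	have "EX D. R.S.derivation_on R.base (carrier R) D & (ALL j<length zs. D (zs ! j) = (if i = j then \<one> else \<zero>))"
		if i: "i < length zs" for i
	proof (cases "i < length xs")
		case True
		obtain D where D: "R.S.derivation_on R.base (carrier R) D" "!!a. a : carrier A ==> D (p a) = p (\<delta> i a)"
			"!!b. b : carrier B ==> D (q b) = \<zero>" using derivation_extend[OF \<delta>(1)[OF True]] by metis
		have "D (zs ! j) = (if i = j then \<one> else \<zero>)" if "j < length zs" for j
			using that True \<delta>(2)[OF True] D xj yj[of "j - length xs"] by (auto simp: zs_def nth_append)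
		thus ?thesis using D(1) by blast
	next
		case False
		have k: "i - length xs < length ys" using i False n by simp
		obtain D where D: "R.S.derivation_on R.base (carrier R) D" "!!b. b : carrier B ==> D (q b) = q (\<epsilon> (i - length xs) b)"
			"!!a. a : carrier A ==> D (p a) = \<zero>" using sw.derivation_extend[OF \<epsilon>(1)[OF k]] by metis
		have "D (zs ! j) = (if i = j then \<one> else \<zero>)" if "j < length zs" for j
			using that False \<epsilon>(2)[OF k, of "j - length xs"] D xj yj[of "j - length xs"] by (auto simp: zs_def nth_append)
		thus ?thesis using D(1) by blast
	qed
	thus ?thesis by metis
qed

lemma derivations_indep:
	assumes g: "g : carrier R" "g ~= \<zero>" and ys: "set ys <= carrier R"
		and D: "!!i. i < length ys ==> R.S.derivation_on R.base (carrier R) (D i)"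
		and z: "!!i j. i < j ==> j < length ys ==> D i (ys ! j) = \<zero>"
		and nz: "!!i f. i < length ys ==> f : carrier R ==> (g \<otimes> f) \<otimes> D i (ys ! i) = \<zero> ==> g \<otimes> f = \<zero>"
	shows "R.S.indep R.base {\<zero>} ys"
proof -
	have "R.S.indep R.base {f : carrier R. g \<otimes> f = \<zero>} ys"
	proof (rule R.C.triangular_derivations_indep[OF red_R g ys, of "map D [0..<length ys]"])
		show "R.S.derivation_on R.base (carrier R) \<delta>" if "\<delta> : set (map D [0..<length ys])" for \<delta>
			using that D by auto
	qed (use z nz in auto)
	thus ?thesis by (rule R.S.indep_mono) (use g in auto)
qed

lemma polynomial_tensor:
	assumes xs: "set xs <= carrier A" "A.S.adjs A.base xs = carrier A" "A.S.indep A.base {\<zero>\<^bsub>A\<^esub>} xs"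
		and ys: "set ys <= carrier B" "B.S.adjs B.base ys = carrier B" "B.S.indep B.base {\<zero>\<^bsub>B\<^esub>} ys"
	shows "regular_ring R" "carrier R <= trace_ideal R (exterior_power R (the_enat (krull_dim R)) (kaehler K R))"
proof -
	define zs where "zs = map p xs @ map q ys"
	obtain D where D0: "ALL i<length zs. R.S.derivation_on R.base (carrier R) (D i) &
		 (ALL j<length zs. D i (zs ! j) = (if i = j then \<one> else \<zero>))"
		using tensor_dual_derivations[OF xs ys, folded zs_def] by (rule exE)
	have D: "!!i. i < length zs ==> R.S.derivation_on R.base (carrier R) (D i)"
		"!!i j. i < length zs ==> j < length zs ==> D i (zs ! j) = (if i = j then \<one> else \<zero>)"
		using D0 by (iprover, iprover)
	note gens = tensor_gens[OF xs(1,2) ys(1,2), folded zs_def]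
	\<comment> \<open>Independence in the tensor product comes from the Jacobian criterion with
	  \<open>g = \<one>\<close> and the dual derivations.\<close>
	have ind: "R.S.indep R.base {\<zero>} zs"
		by (rule derivations_indep[OF R.S.one_closed R.one_nonzero gens(1) D(1)]) (use D(2) in auto)
	show "regular_ring R" by (rule R.C.regular_ring_polynomial[OF gens ind])
	have "krull_dim R = enat (length zs)"
		using R.C.krull_dim_ge_indep[OF gens gens(1) ind] R.C.krull_dim_le_gens[OF gens] by (rule antisym[rotated])
	thus "carrier R <= trace_ideal R (exterior_power R (the_enat (krull_dim R)) (kaehler K R))"
		using R.trace_ideal_full[OF R.C.char0 R.base_subfield gens(1) refl D] by simp
qed

lemma form_outside_kernel:
	assumes y: "y : carrier B" "y ~= \<zero>\<^bsub>B\<^esub>" and tr: "q y : trace_ideal R (exterior_power R n (kaehler K R))"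
	obtains f rs where "f : module_dual R (exterior_power R n (kaehler K R))" "length rs = n"
		"!!r. r : set rs ==> (EX i a. a : GA i & r = p a) \<or> (EX b:carrier B. r = q b)" "sw.prA (R.form_at n f rs) ~= \<zero>\<^bsub>B\<^esub>"
proof -
	define J where "J = {U : carrier R. sw.prA U = \<zero>\<^bsub>B\<^esub>}"
	have J: "ideal J R" using sw.prA.kernel_is_ideal unfolding J_def a_kernel_def' .
	\<comment> \<open>Elements of \<open>B\<close> may enter without being homogeneous, as the Euler
	  derivation of \<open>A\<close> kills all of them.\<close>
	define H where "H = {r. (EX i a. a : GA i & r = p a) \<or> (EX b:carrier B. r = q b)}"
	have H: "H <= carrier R" using A.G_carrier by (auto simp: H_def)
	have "\<not> trace_ideal R (exterior_power R n (kaehler K R)) <= J"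
		using tr y sw.prA_p[of y] by (auto simp: J_def)
	hence "EX f rs. f : module_dual R (exterior_power R n (kaehler K R)) & set rs <= H & length rs = n & R.form_at n f rs ~: J"
	proof (rule contrapos_np)
		assume no: "\<nexists>f rs. f : module_dual R (exterior_power R n (kaehler K R)) & set rs <= H & length rs = n & R.form_at n f rs ~: J"
		show "trace_ideal R (exterior_power R n (kaehler K R)) <= J"
		proof (rule R.trace_ideal_subset[OF J H])
			fix P s assume s: "s : carrier R" and PH: "!!g. g : H ==> P g"
				and Pa: "!!x y. x : carrier R ==> y : carrier R ==> P x ==> P y ==> P (x \<oplus> y)"
				and Pm: "!!x y. x : carrier R ==> y : carrier R ==> P x ==> P y ==> P (x \<otimes> y)"
			have "P (p a)" if "a : carrier A" for a
				using that
			proof (induction a rule: A.graded_induct)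
				case (2 i x)
				thus ?case by (intro PH) (unfold H_def, blast)
			next
				case (1 x y)
				thus ?case using Pa[of "p x" "p y"] by simp
			qed
			moreover have "P (q b)" if "b : carrier B" for b using that by (intro PH) (unfold H_def, blast)
			ultimately show "P s" using Pa Pm by (intro tensor_induct[OF s, of P]) simp_all
		qed (use no in blast)
	qed
	then obtain f rs where f: "f : module_dual R (exterior_power R n (kaehler K R))" "set rs <= H" "length rs = n"
		"R.form_at n f rs ~: J" by blast
	have "R.form_at n f rs : carrier R" using R.form_at_closed[OF f(1) _ f(3)] f(2) H by blast
	thus ?thesis using that[OF f(1,3)] f(2,4) by (auto simp: H_def J_def)
qed

text \<open>The map \<open>1 \<otimes> l\<close> for a functional \<open>l\<close> on \<open>B\<close> that detects the nonzero element \<open>v\<close>.\<close>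

lemma slice_exists:
	assumes v: "v : carrier B" "v ~= \<zero>\<^bsub>B\<^esub>"
	obtains \<Lambda> where "additive_map R A \<Lambda>" "!!a U. a : carrier A ==> U : carrier R ==> \<Lambda> (p a \<otimes> U) = a \<otimes>\<^bsub>A\<^esub> \<Lambda> U"
		"!!U. U : carrier R ==> sw.prA U = v ==> A.aug (\<Lambda> U) = \<one>\<^bsub>K\<^esub>"
proof -
	obtain l where l: "additive_map B K l" "ALL c:carrier K. ALL x:carrier B. l (c \<odot>\<^bsub>B\<^esub> x) = c \<otimes>\<^bsub>K\<^esub> l x" "l v = \<one>\<^bsub>K\<^esub>"
		using linear_functional_exists[OF A.K_field B.A.module_axioms v] by blast
	interpret l: additive_map B K l by (rule l(1))
	obtain L where L: "additive_map R A L" "!!a b. a : carrier A ==> b : carrier B ==> L (p a \<otimes> q b) = l b \<odot>\<^bsub>A\<^esub> a"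
		by (rule tensor_universalD[OF univ_A, of "%a b. l b \<odot>\<^bsub>A\<^esub> a"])
			(auto simp: l(2) l.map_closed l.map_add A.A.smult_r_distr A.A.smult_l_distr A.A.smult_assoc1[symmetric] A.A.R.m_comm)
	interpret L: additive_map R A L by (rule L(1))
	have "L (p a \<otimes> U) = a \<otimes>\<^bsub>A\<^esub> L U" if a: "a : carrier A" and U: "U : carrier R" for a U
		using U
	proof (rule tensor_induct)
		fix x y assume x: "x : carrier A" and y: "y : carrier B"
		have "p a \<otimes> (p x \<otimes> q y) = p (a \<otimes>\<^bsub>A\<^esub> x) \<otimes> q y" using a x y by (simp add: R.S.m_assoc)
		hence "L (p a \<otimes> (p x \<otimes> q y)) = l y \<odot>\<^bsub>A\<^esub> (a \<otimes>\<^bsub>A\<^esub> x)"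
			using L(2)[of "a \<otimes>\<^bsub>A\<^esub> x" y] a x y by (simp only: A.S.m_closed)
		thus "L (p a \<otimes> (p x \<otimes> q y)) = a \<otimes>\<^bsub>A\<^esub> L (p x \<otimes> q y)"
			unfolding L(2)[OF x y] using a x l.map_closed[OF y] A.A.smult_assoc2[of "l y" x a] by (simp add: A.S.m_comm[of a])
	qed (use a in \<open>simp add: R.S.r_distr L.map_add L.map_closed A.S.r_distr\<close>)
	moreover have "A.aug (L U) = l (sw.prA U)" if U: "U : carrier R" for U
		using U
	proof (rule tensor_induct)
		fix a b assume a: "a : carrier A" and b: "b : carrier B"
		have "p a \<otimes> q b = q b \<otimes> p a" using R.S.m_comm[OF p.hom_closed[OF a] q.hom_closed[OF b]] .
		hence "sw.prA (p a \<otimes> q b) = A.aug a \<odot>\<^bsub>B\<^esub> b" using sw.prA_pure[OF b a] by simp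
		thus "A.aug (L (p a \<otimes> q b)) = l (sw.prA (p a \<otimes> q b))"
			unfolding L(2)[OF a b] using a b l(2) l.map_closed[OF b] by (simp add: A.aug_smult A.aug A.A.R.m_comm)
	qed (simp add: L.map_add L.map_closed sw.prA.map_add sw.prA.map_closed l.map_add A.aug_add)
	ultimately show ?thesis using that[OF L(1)] l(3) by simp
qed

lemma reduced_square: "x : carrier R ==> x \<otimes> x = \<zero> ==> x = \<zero>"
	using red_R[unfolded reduced_ring_def, rule_format, of x 2] by (simp add: numeral_2_eq_2)

text \<open>With \<open>g = f (d r\<^sub>1, \<dots>, d r\<^sub>d)\<close> and \<open>\<Delta>\<^sub>i\<close> the derivation that replaces \<open>r\<^sub>i\<close>, the combination
	\<open>g \<theta> - \<Sum> \<theta>(r\<^sub>i) \<Delta>\<^sub>i\<close> of the Euler derivation \<open>\<theta>\<close> of \<open>A\<close> kills all \<open>r\<^sub>i\<close>; as these are a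
	transcendence basis wherever \<open>g\<close> does not vanish, \<open>g\<close> kills this derivation.
	The degree \<open>w\<close> part of the resulting identity expresses \<open>w x\<close> by elements of smaller degree.\<close>

lemma nearly_regular_generators_left:
	assumes f: "f : module_dual R (exterior_power R n (kaehler K R))" and n: "length rs = n"
		and rs: "!!r. r : set rs ==> (EX i a. a : GA i & r = p a) \<or> (EX b:carrier B. r = q b)"
		and nz: "sw.prA (R.form_at n f rs) ~= \<zero>\<^bsub>B\<^esub>"
		and maxlen: "!!ys. set ys <= carrier R ==> R.S.indep R.base {\<zero>} ys ==> length ys <= n"
	shows "EX xs. set xs <= carrier A & A.S.adjs A.base xs = carrier A & A.S.indep A.base {\<zero>\<^bsub>A\<^esub>} xs"
proof -
	define g where "g = R.form_at n f rs"
	define \<Delta> where "\<Delta> i s = R.form_at n f (rs[i := s])" for i s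
	have rsc: "set rs <= carrier R" using rs A.G_carrier by fastforce
	have rc: "rs ! i : carrier R" if "i < n" for i using rsc nth_mem[of i rs] that n by auto
	have gc: "g : carrier R" unfolding g_def by (rule R.form_at_closed[OF f rsc n])
	have g0: "g ~= \<zero>" using nz sw.prA.map_zero by (auto simp: g_def)
	have Dd: "R.S.derivation_on R.base (carrier R) (\<Delta> i)" if "i < n" for i
		unfolding \<Delta>_def by (rule R.form_at_derivation[OF f rsc n that])
	have Dr: "\<Delta> i (rs ! j) = (if i = j then g else \<zero>)" if "i < n" "j < n" for i j
		using R.form_at_alternating[OF f rsc n that] by (auto simp: \<Delta>_def g_def)
	have gcancel: "g \<otimes> u = \<zero>" if "u : carrier R" "(g \<otimes> u) \<otimes> g = \<zero>" for u
	proof (rule reduced_square)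
		have "(g \<otimes> u) \<otimes> (g \<otimes> u) = u \<otimes> ((g \<otimes> u) \<otimes> g)" using that(1) gc by (simp add: R.S.m_ac)
		thus "(g \<otimes> u) \<otimes> (g \<otimes> u) = \<zero>" using that by simp
	qed (use that gc in simp)
	obtain \<theta> where th: "R.S.derivation_on R.base (carrier R) \<theta>" "!!a. a : carrier A ==> \<theta> (p a) = p (A.euler a)"
		"!!b. b : carrier B ==> \<theta> (q b) = \<zero>"
		using derivation_extend[OF A.euler_derivation] by metis
	note thc = R.S.derivation_onD(1)[OF th(1)]
	\<comment> \<open>\<open>D m\<close> is the partial sum
	  \<open>g \<theta> - \<Sum> \<theta>(r\<^sub>i) \<Delta>\<^sub>i\<close> over
	  \<open>i < m\<close>; it kills the first \<open>m\<close> of the \<open>r\<^sub>i\<close> and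
	  agrees with \<open>g \<theta>\<close> on the others.\<close>
	define D where "D = rec_nat (%s. g \<otimes> \<theta> s) (%m \<delta> s. \<delta> s \<ominus> \<theta> (rs ! m) \<otimes> \<Delta> m s)"
	have D0: "D 0 = (%s. g \<otimes> \<theta> s)" and DS: "D (Suc m) = (%s. D m s \<ominus> \<theta> (rs ! m) \<otimes> \<Delta> m s)" for m
		by (simp_all add: D_def)
	have DD: "R.S.derivation_on R.base (carrier R) (D m)" if "m <= n" for m
		using that
	proof (induction m)
		case 0
		show ?case unfolding D0 by (rule R.S.derivation_smult[OF th(1) gc])
	next
		case (Suc m)
		show ?case unfolding DS
			by (rule R.S.derivation_minus[OF Suc.IH R.S.derivation_smult[OF Dd]]) (use Suc.prems thc rc in auto)
	qed
	have Dkill: "D m (rs ! j) = (if j < m then \<zero> else g \<otimes> \<theta> (rs ! j))" if "m <= n" "j < n" for m j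
		using that
	proof (induction m)
		case (Suc m)
		have c: "\<theta> (rs ! m) : carrier R" "\<theta> (rs ! j) : carrier R" using thc rc Suc.prems by auto
		show ?case
			using Suc c gc Dr[of m j] by (cases "m = j") (auto simp: DS R.S.minus_eq R.S.r_neg R.S.m_comm[of g])
	qed (simp add: D0)
	have kill: "g \<otimes> D n s = \<zero>" if s: "s : carrier R" for s
	proof (rule ccontr)
		define e where "e = D n s"
		have ec: "e : carrier R" unfolding e_def by (rule R.S.derivation_onD(1)[OF DD[OF order_refl] s])
		assume "g \<otimes> D n s ~= \<zero>"
		hence h: "g \<otimes> e ~= \<zero>" by (simp add: e_def)
		have c: "g \<otimes> e \<otimes> u = \<zero>" if u: "u : carrier R" and z: "g \<otimes> e \<otimes> u \<otimes> t = \<zero>" and t: "t = e \<or> t = g" for u t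
		proof (rule reduced_square)
			have "(g \<otimes> e \<otimes> u) \<otimes> (g \<otimes> e \<otimes> u) = (g \<otimes> e \<otimes> u \<otimes> e) \<otimes> (g \<otimes> u)"
				"(g \<otimes> e \<otimes> u) \<otimes> (g \<otimes> e \<otimes> u) = (g \<otimes> e \<otimes> u \<otimes> g) \<otimes> (e \<otimes> u)"
				using gc ec u by (simp_all add: R.S.m_ac)
			moreover have "g \<otimes> u : carrier R" "e \<otimes> u : carrier R" using gc ec u by auto
			ultimately show "(g \<otimes> e \<otimes> u) \<otimes> (g \<otimes> e \<otimes> u) = \<zero>"
				using z t by (metis R.S.l_null)
		qed (use gc ec u in simp)
		\<comment> \<open>The criterion is applied with multiplier \<open>g e\<close>, using
		  \<open>D n\<close> for \<open>s\<close> and the \<open>\<Delta>\<^sub>i\<close> for the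
		  \<open>r\<^sub>i\<close>. The element \<open>s\<close> comes first because the
		  \<open>\<Delta>\<^sub>i\<close> need not kill it, while \<open>D n\<close> kills all
		  \<open>r\<^sub>i\<close>. This list has one element too many.\<close>
		have "R.S.indep R.base {\<zero>} (s # rs)"
		proof (rule derivations_indep[OF _ h, where D = "%i. if i = 0 then D n else \<Delta> (i - 1)"])
			show "R.S.derivation_on R.base (carrier R) (if i = 0 then D n else \<Delta> (i - 1))" if "i < length (s # rs)" for i
				using that DD[OF order_refl] Dd[of "i - 1"] n by auto
			show "(if i = 0 then D n else \<Delta> (i - 1)) ((s # rs) ! j) = \<zero>" if "i < j" "j < length (s # rs)" for i j
				using that Dkill[OF order_refl, of "j - 1"] Dr[of "i - 1" "j - 1"] n by (cases j) auto
			show "g \<otimes> e \<otimes> u = \<zero>" if "i < length (s # rs)" "u : carrier R"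
				"g \<otimes> e \<otimes> u \<otimes> (if i = 0 then D n else \<Delta> (i - 1)) ((s # rs) ! i) = \<zero>" for i u
				using that c[OF that(2), of "if i = 0 then e else g"] Dr[of "i - 1" "i - 1"] n by (cases i) (auto simp: e_def)
		qed (use gc ec s rsc in auto)
		from maxlen[OF _ this] show False using s rsc n by simp
	qed
	\<comment> \<open>The functional is normalised at \<open>g g\<close>, since the final identity
	  carries two factors \<open>g\<close>: one inside \<open>D n\<close>, one from
	  \<open>kill\<close>. The image of \<open>g g\<close> is nonzero because \<open>B\<close> is
	  reduced.\<close>
	have "sw.prA (g \<otimes> g) ~= \<zero>\<^bsub>B\<^esub>"
		using red_B[unfolded reduced_ring_def, rule_format, of "sw.prA g" 2] nz gc sw.prA.map_closed[OF gc]
		by (auto simp: numeral_2_eq_2 g_def)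
	from slice_exists[OF sw.prA.map_closed[OF R.S.m_closed[OF gc gc]] this]
	obtain \<Lambda> where \<Lambda>: "additive_map R A \<Lambda>" "!!a U. a : carrier A ==> U : carrier R ==> \<Lambda> (p a \<otimes> U) = a \<otimes>\<^bsub>A\<^esub> \<Lambda> U"
		"A.aug (\<Lambda> (g \<otimes> g)) = \<one>\<^bsub>K\<^esub>" using gc by (metis R.S.m_closed)
	interpret \<Lambda>: additive_map R A \<Lambda> by (rule \<Lambda>(1))
	\<comment> \<open>Exactly the \<open>r\<^sub>i\<close> that come from \<open>A\<close> in positive
	  degree are kept; all others are constants or elements of \<open>B\<close> and are killed by
	  \<open>\<theta>\<close>.\<close>
	define idx where "idx = filter (%i. EX w>0. EX a:GA w. rs ! i = p a) [0..<n]"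
	have "ALL i. EX a. i : set idx --> (EX w>0. a : GA w & rs ! i = p a)" by (auto simp: idx_def)
	then obtain \<alpha> where \<alpha>: "!!i. i : set idx ==> EX w>0. \<alpha> i : GA w & rs ! i = p (\<alpha> i)" by metis
	define xs where "xs = map \<alpha> idx"
	have xsc: "set xs <= carrier A" using \<alpha> A.G_carrier by (fastforce simp: xs_def)
	have idxn: "i < n" if "i : set idx" for i using that by (simp add: idx_def)
	have px: "map p xs = map ((!) rs) idx" unfolding xs_def map_map by (intro map_cong refl) (metis \<alpha> comp_apply)
	have "R.S.indep (p ` A.base) {\<zero>} (map p xs)" unfolding p_base
	proof (rule derivations_indep[OF gc g0, where D = "%i. \<Delta> (idx ! i)"])
		have l: "length (map p xs) = length idx" by (simp add: xs_def)
		have nth: "map p xs ! j = rs ! (idx ! j)" "idx ! j < n" if "j < length idx" for j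
			using that px idxn[OF nth_mem[OF that]] by auto
		show "set (map p xs) <= carrier R" using xsc by auto
		show "R.S.derivation_on R.base (carrier R) (\<Delta> (idx ! i))" if "i < length (map p xs)" for i
			using that nth(2) Dd l by simp
		show "\<Delta> (idx ! i) (map p xs ! j) = \<zero>" if "i < j" "j < length (map p xs)" for i j
		proof -
			have ij: "i < length idx" "j < length idx" using that l by auto
			have "distinct idx" by (simp add: idx_def)
			hence "idx ! i ~= idx ! j" using ij that(1) by (simp add: nth_eq_iff_index_eq)
			thus ?thesis unfolding nth(1)[OF ij(2)] using Dr[OF nth(2)[OF ij(1)] nth(2)[OF ij(2)]] by simp
		qed
		show "g \<otimes> u = \<zero>" if "i < length (map p xs)" "u : carrier R" "g \<otimes> u \<otimes> \<Delta> (idx ! i) (map p xs ! i) = \<zero>" for i u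
		proof -
			have i: "i < length idx" using that l by simp
			show ?thesis using gcancel[OF that(2)] that(3) Dr[OF nth(2)[OF i] nth(2)[OF i]] unfolding nth(1)[OF i] by simp
		qed
	qed
	hence ind: "A.S.indep A.base {\<zero>\<^bsub>A\<^esub>} xs"
		using A.S.indep_hom[OF p_hom p_inj R.S.cring_axioms A.C.k_subring _ xsc] R.C.k_subring by (simp add: p_base)
	define C where "C = A.S.adjs A.base xs"
	have C: "subring C A" unfolding C_def by (rule A.S.subring_adjs[OF A.C.k_subring xsc])
	have bC: "A.base <= C" and xC: "set xs <= C"
		unfolding C_def using A.S.adjs_incl[OF A.C.k_subring xsc] A.S.adjs_self[OF A.C.k_subring xsc] by auto
	\<comment> \<open>Nonzero constants can be cancelled inside the subalgebra
	  \<open>C\<close>.\<close>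
	have divC: "x : C" if x: "x : carrier A" and c: "c : A.base" "c ~= \<zero>\<^bsub>A\<^esub>" and xc: "x \<otimes>\<^bsub>A\<^esub> c : C" for x c
	proof -
		obtain c' where c': "c' : A.base" "c \<otimes>\<^bsub>A\<^esub> c' = \<one>\<^bsub>A\<^esub>" using A.C.k_inverse[OF c] by blast
		have "(x \<otimes>\<^bsub>A\<^esub> c) \<otimes>\<^bsub>A\<^esub> c' = x" using c c' x A.C.k_carrier by (simp add: A.S.m_assoc subset_iff)
		thus ?thesis using subringE(6)[OF C xc, of c'] bC c'(1) by auto
	qed
	have GC: "GA w <= C" for w
	proof (induction w rule: less_induct)
		case (less w)
		show ?case
		proof (cases "w = 0")
			case True
			thus ?thesis using bC A.G_base by simp
		next
			case False
			show ?thesis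
			proof
				fix x assume x: "x : GA w"
				note xc = A.G_carrier[OF x]
				define y where "y = A.S.nmul w x"
				define u where "u = \<Lambda> (g \<otimes> g)"
				have yG: "y : GA w" unfolding y_def by (rule A.nmul_in_G[OF x])
				have yc: "y : carrier A" and uc: "u : carrier A" using A.G_carrier[OF yG] gc \<Lambda>.map_closed by (auto simp: u_def)
				\<comment> \<open>Each step of the recursion changes the expression by the image of
				  \<open>\<theta>(r\<^sub>m) t\<close>. If \<open>r\<^sub>m\<close> has degree
				  \<open>v > 0\<close> in \<open>A\<close>, this is an element of \<open>C\<close> of degree
				  \<open>v\<close> times \<open>\<Lambda> t\<close>, so its degree \<open>w\<close> part
				  involves only degree \<open>w - v\<close> of \<open>\<Lambda> t\<close>, which lies in
				  \<open>C\<close> by induction.\<close>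
				have rel: "A.cmp w (y \<otimes>\<^bsub>A\<^esub> u \<ominus>\<^bsub>A\<^esub> \<Lambda> (g \<otimes> D m (p x))) : C" if "m <= n" for m
					using that
				proof (induction m)
					case 0
					have "g \<otimes> D 0 (p x) = p y \<otimes> (g \<otimes> g)"
						using gc yc th(2)[OF xc] A.euler_hom[OF x] by (simp add: D0 y_def[symmetric] R.S.m_ac)
					hence "\<Lambda> (g \<otimes> D 0 (p x)) = y \<otimes>\<^bsub>A\<^esub> u" using \<Lambda>(2)[OF yc] gc by (simp add: u_def)
					thus ?case using yc uc subringE(2)[OF C] by (simp add: A.S.minus_eq A.S.r_neg A.cmp.map_zero)
				next
					case (Suc m)
					have m: "m < n" using Suc.prems by simp
					define t where "t = g \<otimes> \<Delta> m (p x)"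
					have dc: "\<Delta> m (p x) : carrier R" "D m (p x) : carrier R" "\<theta> (rs ! m) : carrier R"
						using R.S.derivation_onD(1)[OF Dd[OF m]] R.S.derivation_onD(1)[OF DD, of m] thc rc m xc by auto
					have tc: "t : carrier R" using gc dc by (simp add: t_def)
					have "g \<otimes> D (Suc m) (p x) = g \<otimes> D m (p x) \<ominus> \<theta> (rs ! m) \<otimes> t"
						using dc gc by (simp add: DS t_def R.S.minus_eq R.S.r_distr R.S.r_minus R.S.m_lcomm)
					hence e1: "\<Lambda> (g \<otimes> D (Suc m) (p x)) = \<Lambda> (g \<otimes> D m (p x)) \<ominus>\<^bsub>A\<^esub> \<Lambda> (\<theta> (rs ! m) \<otimes> t)"
						using dc gc tc by (simp add: \<Lambda>.map_minus)
					have lc: "\<Lambda> (g \<otimes> D m (p x)) : carrier A" "\<Lambda> (\<theta> (rs ! m) \<otimes> t) : carrier A"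
						using dc gc tc \<Lambda>.map_closed by auto
					have e2: "y \<otimes>\<^bsub>A\<^esub> u \<ominus>\<^bsub>A\<^esub> \<Lambda> (g \<otimes> D (Suc m) (p x)) = (y \<otimes>\<^bsub>A\<^esub> u \<ominus>\<^bsub>A\<^esub> \<Lambda> (g \<otimes> D m (p x))) \<oplus>\<^bsub>A\<^esub> \<Lambda> (\<theta> (rs ! m) \<otimes> t)"
						unfolding e1 using lc yc uc by (simp add: A.S.minus_eq A.S.minus_add A.S.a_assoc)
					have zC: "A.cmp w (\<Lambda> (\<zero> \<otimes> t)) : C" using tc subringE(2)[OF C] by (simp add: \<Lambda>.map_zero A.cmp.map_zero)
					have "A.cmp w (\<Lambda> (\<theta> (rs ! m) \<otimes> t)) : C"
					proof (cases "m : set idx")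
						case True
						obtain v where v: "v > 0" "\<alpha> m : GA v" "rs ! m = p (\<alpha> m)" using \<alpha>[OF True] by blast
						define z where "z = A.S.nmul v (\<alpha> m)"
						have ac: "\<alpha> m : C" using xC True by (auto simp: xs_def)
						have zG: "z : GA v" unfolding z_def by (rule A.nmul_in_G[OF v(2)])
						have zCC: "z : C" unfolding z_def by (rule A.S.nmul_subring[OF C ac])
						have "\<theta> (rs ! m) = p z" using th(2)[OF A.G_carrier[OF v(2)]] A.euler_hom[OF v(2)] v(3) by (simp add: z_def)
						hence "A.cmp w (\<Lambda> (\<theta> (rs ! m) \<otimes> t)) = A.cmp w (z \<otimes>\<^bsub>A\<^esub> \<Lambda> t)" using \<Lambda>(2)[OF A.G_carrier[OF zG] tc] by simp
						also have "\<dots> = (if v <= w then z \<otimes>\<^bsub>A\<^esub> A.cmp (w - v) (\<Lambda> t) else \<zero>\<^bsub>A\<^esub>)" by (rule A.cmp_mult[OF zG \<Lambda>.map_closed[OF tc]])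
						also have "\<dots> : C"
							using less[of "w - v"] False v(1) A.cmp_in[OF \<Lambda>.map_closed[OF tc], of "w - v"] zCC subringE(2,6)[OF C] by auto
						finally show ?thesis .
					next
						case False
						have "rs ! m : set rs" using m n by simp
						from rs[OF this] have "\<theta> (rs ! m) = \<zero>"
						proof
							assume "EX i a. a : GA i & rs ! m = p a"
							then obtain i a where a: "a : GA i" "rs ! m = p a" by blast
							have "i = 0" using False a m by (force simp: idx_def)
							thus ?thesis using th(2)[OF A.G_carrier[OF a(1)]] A.euler_hom[OF a(1)] a(2) by simp
						qed (use th(3) in auto)
						thus ?thesis using zC by simp
					qed
					thus ?case unfolding e2 using Suc lc yc uc subringE(7)[OF C] by (simp add: A.cmp.map_add)
				qed
				have "A.cmp w (y \<otimes>\<^bsub>A\<^esub> u) : C"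
					using rel[OF order_refl] kill[of "p x"] xc yc uc by (simp add: \<Lambda>.map_zero A.S.minus_eq)
				\<comment> \<open>As \<open>y\<close> is homogeneous of degree \<open>w\<close>, only the
				  constant term of \<open>u\<close> reaches degree \<open>w\<close>, and the normalisation makes
				  that term equal to one.\<close>
				hence "y \<otimes>\<^bsub>A\<^esub> A.cmp 0 u : C" using A.cmp_mult[OF yG uc, of w] by simp
				moreover have "A.cmp 0 u = \<one>\<^bsub>A\<^esub>" using A.aug(2)[OF uc] \<Lambda>(3) by (simp add: u_def)
				ultimately have "x \<otimes>\<^bsub>A\<^esub> A.S.nmul w \<one>\<^bsub>A\<^esub> : C"
					using yc xc A.S.nmul_one[OF xc, of w] by (simp add: y_def A.S.m_comm)
				\<comment> \<open>The positive degree \<open>w\<close> is invertible in characteristic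
				  0.\<close>
				thus "x : C"
					using A.S.nmul_subring[OF A.C.k_subring subringE(3)[OF A.C.k_subring]] A.C.char0 False by (intro divC[OF xc]) auto
			qed
		qed
	qed
	have "x : C" if "x : carrier A" for x
		using that by (induction rule: A.graded_induct) (use GC subringE(7)[OF C] in auto)
	hence "A.S.adjs A.base xs = carrier A" using subringE(1)[OF C] unfolding C_def by blast
	thus ?thesis using xsc ind by blast
qed

abbreviation "poly_A \<equiv> EX xs. set xs <= carrier A & A.S.adjs A.base xs = carrier A & A.S.indep A.base {\<zero>\<^bsub>A\<^esub>} xs"
abbreviation "poly_B \<equiv> EX xs. set xs <= carrier B & B.S.adjs B.base xs = carrier B & B.S.indep B.base {\<zero>\<^bsub>B\<^esub>} xs"

text \<open>Positive dimension of \<open>B\<close> provides the nonzero element of positive degree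
  at which the trace is tested. Finite generation makes the dimension \<open>d\<close> finite, and
  \<open>d\<close> bounds the length of independent lists, as required for comparing
  derivations.\<close>

lemma poly_left:
	assumes dim: "krull_dim B > 0"
		and tr: "!!j y. j > 0 ==> y : GB j ==> q y : trace_ideal R (exterior_power R (the_enat (krull_dim R)) (kaehler K R))"
	shows poly_A
proof -
	obtain xs where xs: "!!x. x : set xs ==> EX i>0. x : GA i" "A.S.adjs A.base xs = carrier A"
		using A.homogeneous_generators[OF noeth_A] by metis
	obtain ys where ys: "!!x. x : set ys ==> EX i>0. x : GB i" "B.S.adjs B.base ys = carrier B"
		using B.homogeneous_generators[OF noeth_B] by metis
	have "set xs <= carrier A" "set ys <= carrier B" using xs(1) ys(1) A.G_carrier B.G_carrier by blast+
	note gens = tensor_gens[OF this(1) xs(2) this(2) ys(2)]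
	obtain d where d: "krull_dim R = enat d"
		using R.C.krull_dim_le_gens[OF gens] by (cases "krull_dim R") auto
	obtain j y where y: "j > 0" "y : GB j" "y ~= \<zero>\<^bsub>B\<^esub>" by (rule B.positive_degree_element[OF dim])
	have "q y : trace_ideal R (exterior_power R d (kaehler K R))" using tr[OF y(1,2)] d by simp
	from form_outside_kernel[OF B.G_carrier[OF y(2)] y(3) this]
	obtain f rs where f: "f : module_dual R (exterior_power R d (kaehler K R))" "length rs = d"
		"!!r. r : set rs ==> (EX i a. a : GA i & r = p a) \<or> (EX b:carrier B. r = q b)" "sw.prA (R.form_at d f rs) ~= \<zero>\<^bsub>B\<^esub>"
		by metis
	show ?thesis
	proof (rule nearly_regular_generators_left[OF f])
		show "length ys <= d" if "set ys <= carrier R" "R.S.indep R.base {\<zero>} ys" for ys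
			using R.C.krull_dim_ge_indep[OF gens that] d by simp
	qed
qed

end

context graded_tensor
begin

interpretation sw: graded_tensor K B GB A GA R q p by (rule swap)

text \<open>The set \<open>I\<close> stands for the irrelevant ideal. It only has to contain the
  positive degree elements of both factors: these suffice to make both factors polynomial, and in
  the polynomial case the trace ideal is the whole ring.\<close>

lemma regular_equivalence:
	assumes dims: "krull_dim A > 0" "krull_dim B > 0" and I: "I <= carrier R"
		and pI: "!!i x. i > 0 ==> x : GA i ==> p x : I" and qI: "!!j y. j > 0 ==> y : GB j ==> q y : I"
	shows "(I <= trace_ideal R (exterior_power R (the_enat (krull_dim R)) (kaehler K R)) \<longleftrightarrow> regular_ring R) &
		(regular_ring R \<longleftrightarrow> regular_ring A & regular_ring B)"
proof -
	let ?T = "trace_ideal R (exterior_power R (the_enat (krull_dim R)) (kaehler K R))"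
	have 1: "poly_A & poly_B" if "I <= ?T"
		using poly_left[OF dims(2)] sw.poly_left[OF dims(1)] that pI qI by blast
	have 2: "poly_A & poly_B" if "regular_ring R"
		using regular_generators_right[OF that] sw.regular_generators_right[OF that] by blast
	have 3: "poly_A & poly_B" if "regular_ring A" "regular_ring B"
		using A.regular_generators[OF noeth_A that(1)] B.regular_generators[OF noeth_B that(2)] by blast
	have 4: "regular_ring R & I <= ?T & regular_ring A & regular_ring B" if h: "poly_A & poly_B"
	proof -
		from h obtain xs ys where xs: "set xs <= carrier A" "A.S.adjs A.base xs = carrier A" "A.S.indep A.base {\<zero>\<^bsub>A\<^esub>} xs"
			and ys: "set ys <= carrier B" "B.S.adjs B.base ys = carrier B" "B.S.indep B.base {\<zero>\<^bsub>B\<^esub>} ys" by blast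
		show ?thesis
			using polynomial_tensor[OF xs ys] A.C.regular_ring_polynomial[OF xs] B.C.regular_ring_polynomial[OF ys] I by blast
	qed
	show ?thesis using 1 2 3 4 by blast
qed

end

section \<open>The constructed tensor product as an instance of the universal property\<close>

lemma graded_field_algebraI:
	assumes "field K" "!!n::nat. [n] \<cdot>\<^bsub>K\<^esub> \<one>\<^bsub>K\<^esub> = \<zero>\<^bsub>K\<^esub> ==> n = 0" "connected_graded_algebra K S G"
	shows "graded_field_algebra K S G"
proof -
	interpret K: field K by fact
	interpret connected_graded_algebra K S G by fact
	have "\<one>\<^bsub>S\<^esub> ~= \<zero>\<^bsub>S\<^esub>"
	proof
		assume h: "\<one>\<^bsub>S\<^esub> = \<zero>\<^bsub>S\<^esub>"
		hence "\<one>\<^bsub>K\<^esub> \<odot>\<^bsub>S\<^esub> \<one>\<^bsub>S\<^esub> = \<zero>\<^bsub>K\<^esub> \<odot>\<^bsub>S\<^esub> \<one>\<^bsub>S\<^esub>" by simp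
		from inj_onD[OF bij_betw_imp_inj_on[OF component_zero] this] show False using K.one_not_zero by simp
	qed
	thus ?thesis
		by (intro graded_field_algebra.intro field_algebra.intro field_algebra_axioms.intro kaehler_algebra.intro
				M_cring algebra_axioms assms)
qed

context two_algebras
begin

lemma R_algebra: "algebra K R"
proof -
	interpret Rm: module K R by (rule R_module)
	interpret R: cring R by (rule R_cring)
	show ?thesis
	proof (rule algebra.intro[OF R_module R_cring algebra_axioms.intro])
		fix c U V assume c: "c : carrier K" and U: "U : carrier R" and V: "V : carrier R"
		show "(c \<odot>\<^bsub>R\<^esub> U) \<otimes>\<^bsub>R\<^esub> V = c \<odot>\<^bsub>R\<^esub> (U \<otimes>\<^bsub>R\<^esub> V)"
			using U
		proof (induction U rule: R_induct)
			case (1 U U')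
			thus ?case using c V by (simp add: Rm.smult_r_distr R.l_distr)
		next
			case (2 a b)
			note ab = 2
			show ?case using V
			proof (induction V rule: R_induct)
				case (1 U U')
				thus ?case using c pure_closed[OF ab] by (simp add: Rm.smult_r_distr R.r_distr)
			next
				case (2 x y)
				thus ?case using c ab
					by (simp add: pure_smult_left[symmetric] pure_mult A.smult_assoc2)
			qed
		qed
	qed
qed

end

theorem corollary5p10:
  fixes K :: "'k ring"
    and A :: "('k, 'a) module" and GA :: "nat \<Rightarrow> 'a set"
    and B :: "('k, 'b) module" and GB :: "nat \<Rightarrow> 'b set"
  defines "R \<equiv> tensor_algebra K A B"
    and "GR \<equiv> total_grading K A GA B GB"
  assumes "field K"
    and char_0: "\<And>n::nat. [n] \<cdot>\<^bsub>K\<^esub> \<one>\<^bsub>K\<^esub> = \<zero>\<^bsub>K\<^esub> \<Longrightarrow> n = 0"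
    and "connected_graded_algebra K A GA" and "connected_graded_algebra K B GB"
    and "noetherian_ring A" and "noetherian_ring B"
    and "reduced_ring A" and "reduced_ring B"
    and "equidimensional A" and "equidimensional B"
    and "krull_dim A > 0" and "krull_dim B > 0"
    and "reduced_ring R"
  shows "(nearly_regular K R GR \<longleftrightarrow> regular_ring R) \<and>
         (regular_ring R \<longleftrightarrow> regular_ring A \<and> regular_ring B)"
proof -
	interpret A: graded_field_algebra K A GA by (rule graded_field_algebraI) fact+
	interpret B: graded_field_algebra K B GB by (rule graded_field_algebraI) fact+
	interpret T: two_algebras K A B by (rule two_algebras.intro[OF A.A.algebra_axioms B.A.algebra_axioms])
	interpret RR: cring R unfolding R_def by (rule T.R_cring)
	interpret RA: algebra K R unfolding R_def by (rule T.R_algebra)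
	let ?p = "%a. pure_tensor K A B a \<one>\<^bsub>B\<^esub>" and ?q = "%b. pure_tensor K A B \<one>\<^bsub>A\<^esub> b"
	have pq: "?p a \<otimes>\<^bsub>R\<^esub> ?q b = pure_tensor K A B a b" if "a : carrier A" "b : carrier B" for a b
		using that by (simp add: R_def T.pure_mult)
	have univ: "tensor_universal K A B R ?p ?q X" if X: "abelian_group X" for X :: "('x, 'y) ring_scheme"
		unfolding tensor_universal_def
	proof (intro allI impI)
		fix \<beta>
		assume h: "ALL a:carrier A. ALL b:carrier B. \<beta> a b : carrier X"
			"ALL a:carrier A. ALL a':carrier A. ALL b:carrier B. \<beta> (a \<oplus>\<^bsub>A\<^esub> a') b = \<beta> a b \<oplus>\<^bsub>X\<^esub> \<beta> a' b"
			"ALL a:carrier A. ALL b:carrier B. ALL b':carrier B. \<beta> a (b \<oplus>\<^bsub>B\<^esub> b') = \<beta> a b \<oplus>\<^bsub>X\<^esub> \<beta> a b'"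
			"ALL c:carrier K. ALL a:carrier A. ALL b:carrier B. \<beta> (c \<odot>\<^bsub>A\<^esub> a) b = \<beta> a (c \<odot>\<^bsub>B\<^esub> b)"
		have "EX L. additive_map R X L & (ALL a:carrier A. ALL b:carrier B. L (pure_tensor K A B a b) = \<beta> a b)"
			unfolding R_def by (rule T.tensor_lift[OF X]) (use h in auto)
		thus "EX L. additive_map R X L & (ALL a:carrier A. ALL b:carrier B. L (?p a \<otimes>\<^bsub>R\<^esub> ?q b) = \<beta> a b)"
			by (simp add: pq)
	qed
	have ind: "P U" if U: "U : carrier R" and "!!U V. U : carrier R ==> V : carrier R ==> P U ==> P V ==> P (U \<oplus>\<^bsub>R\<^esub> V)"
		and g: "!!a b. a : carrier A ==> b : carrier B ==> P (?p a \<otimes>\<^bsub>R\<^esub> ?q b)" for U P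
	proof (rule T.R_induct[of U P])
		show "P (pure_tensor K A B a b)" if "a : carrier A" "b : carrier B" for a b using g[OF that] pq[OF that] by simp
	qed (use that(1,2) R_def in auto)
	have one: "\<one>\<^bsub>R\<^esub> = pure_tensor K A B \<one>\<^bsub>A\<^esub> \<one>\<^bsub>B\<^esub>" by (simp add: R_def T.R_one)
	have nontriv: "\<one>\<^bsub>R\<^esub> ~= \<zero>\<^bsub>R\<^esub>"
	proof -
		\<comment> \<open>The augmentation of \<open>B\<close> gives an additive map to \<open>A\<close>
		  with \<open>\<one>\<close> going to \<open>\<one>\<close>, so the tensor product is not the zero
		  ring.\<close>
		obtain L where L: "additive_map R A L" "!!a b. a : carrier A ==> b : carrier B ==> L (?p a \<otimes>\<^bsub>R\<^esub> ?q b) = B.aug b \<odot>\<^bsub>A\<^esub> a"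
			by (rule tensor_universalD[OF univ[OF A.S.abelian_group_axioms], of "%a b. B.aug b \<odot>\<^bsub>A\<^esub> a"])
				(auto simp: B.aug B.aug_add B.aug_smult A.A.smult_r_distr A.A.smult_l_distr A.A.smult_assoc1[symmetric] A.A.R.m_comm)
		interpret L: additive_map R A L by (rule L(1))
		have "L \<one>\<^bsub>R\<^esub> = \<one>\<^bsub>A\<^esub>" using L(2)[of "\<one>\<^bsub>A\<^esub>" "\<one>\<^bsub>B\<^esub>"] pq one by (simp add: B.aug_one)
		thus ?thesis using L.map_zero A.one_nonzero by auto
	qed
	have ph: "?p : ring_hom A R"
		by (rule ring_hom_memI) (simp_all add: R_def T.pure_closed T.pure_mult T.pure_add_left T.R_one)
	have qh: "?q : ring_hom B R"
		by (rule ring_hom_memI) (simp_all add: R_def T.pure_closed T.pure_mult T.pure_add_right T.R_one)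
	interpret G: graded_tensor K A GA B GB R ?p ?q
	proof (rule graded_tensor.intro[OF A.graded_field_algebra_axioms B.graded_field_algebra_axioms], goal_cases)
		case 1
		show ?case
			by (intro field_algebra.intro field_algebra_axioms.intro kaehler_algebra.intro RR.cring_axioms RA.algebra_axioms
					A.K_field char_0 nontriv)
	next
		case 2
		show ?case
		proof (rule graded_tensor_axioms.intro)
			show "P U" if "U : carrier R" "!!U V. U : carrier R ==> V : carrier R ==> P U ==> P V ==> P (U \<oplus>\<^bsub>R\<^esub> V)"
				"!!a b. a : carrier A ==> b : carrier B ==> P (?p a \<otimes>\<^bsub>R\<^esub> ?q b)" for U P using that by (rule ind)
			show "?p (c \<odot>\<^bsub>A\<^esub> a) = c \<odot>\<^bsub>R\<^esub> ?p a" if "c : carrier K" "a : carrier A" for c a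
				unfolding R_def by (rule T.pure_smult_left) (use that in auto)
			show "?q (c \<odot>\<^bsub>B\<^esub> b) = c \<odot>\<^bsub>R\<^esub> ?q b" if "c : carrier K" "b : carrier B" for c b
				unfolding R_def by (rule T.pure_smult_right) (use that in auto)
		qed (rule ph qh univ[OF A.S.abelian_group_axioms] univ[OF B.S.abelian_group_axioms] univ[OF RR.abelian_group_axioms] assms)+
	qed
	have sub: "EX N. submodule N K R & N <= carrier R" by (rule exI[of _ "carrier R"]) (auto intro: RA.carrier_is_submodule)
	have GRc: "GR n <= carrier R" for n
	proof -
		have "submodule (carrier R) K R" by (rule RA.carrier_is_submodule)
		moreover have "{pure_tensor K A B a b | a b i j. a : GA i & b : GB j & i + j = n} <= carrier R"
			using T.pure_closed A.G_carrier B.G_carrier by (auto simp: R_def)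
		ultimately show ?thesis unfolding GR_def total_grading_def submodule_span_def R_def by blast
	qed
	have GRI: "pure_tensor K A B a b : GR (i + j)" if "a : GA i" "b : GB j" for a b i j
		using that unfolding GR_def total_grading_def submodule_span_def by blast
	have II: "x : irrelevant_ideal R GR" if "x : GR n" "n > 0" for x n
		using that unfolding irrelevant_ideal_def by (intro generate.incl) auto
	have one0: "\<one>\<^bsub>A\<^esub> : GA 0" "\<one>\<^bsub>B\<^esub> : GB 0"
		unfolding A.G_base B.G_base using subringE(3)[OF A.C.k_subring] subringE(3)[OF B.C.k_subring] .
	show ?thesis unfolding nearly_regular_def
	proof (rule G.regular_equivalence)
		show "irrelevant_ideal R GR <= carrier R"
			unfolding irrelevant_ideal_def using group.generate_incl[OF RR.add.is_group, of "\<Union>i\<in>{0<..}. GR i"] GRc by auto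
		show "?p x : irrelevant_ideal R GR" if "i > 0" "x : GA i" for i x
			using II[OF GRI[OF that(2) one0(2)]] that(1) by simp
		show "?q y : irrelevant_ideal R GR" if "j > 0" "y : GB j" for j y
			using II[OF GRI[OF one0(1) that(2)]] that(1) by simp
	qed fact+
qed

end
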